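(* Let $\mathfrak g$ be a simple simply-laced Lie algebra of rank $r$. For every $p\in\mathcal A_+$ and every $\boldsymbol\ell=(\ell_1,\dots,\ell_r)\in\mathbb Z_+^r$, $$\mu_{\boldsymbol\ell}(p)=\langle0,\dots,0|\,p\,|\ell_1,\dots,\ell_r\rangle .$$
   Context: $\mathbb Z_+=\{0,1,2,\dots\}$, $I_r=\{1,\dots,r\}$; $C$ is the Cartan matrix of $\mathfrak g$, $\delta=\det C$, $\lambda=\delta C^{-1}$, $A_{i,j}=\min(i,j)$, $q=t^{-\delta}$ ($t$ an indeterminate). Quantum $Q$-system: $\widehat Q_{\alpha,0},\widehat Q_{\alpha,1}$ ($\alpha\in I_r$) are invertible variables with $\widehat Q_{\alpha,n}\widehat Q_{\beta,m}=t^{\lambda_{\alpha,\beta}(m-n)}\widehat Q_{\beta,m}\widehat Q_{\alpha,n}$ for $m,n\in\{0,1\}$, and $\widehat Q_{\alpha,n}$, $n\in\mathbb Z$, are defined by $t^{\lambda_{\alpha,\alpha}}\widehat Q_{\alpha,n+1}\widehat Q_{\alpha,n-1}=\widehat Q_{\alpha,n}^2-\prod_{\beta\ne\alpha}\widehat Q_{\beta,n}^{-C_{\alpha,\beta}}$; they lie in the quantum torus over $\mathbb Z[t^{\pm1}]$ generated by the $\widehat Q_{\alpha,0}^{\pm1},\widehat Q_{\alpha,1}^{\pm1}$. $\mathcal A_+$ is the $\mathbb Z[t^{\pm1}]$-algebra generated by all $\widehat Q_{\alpha,0}^{\pm1}$ and $\widehat Q_{\alpha,m}$, $m\ge1$,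 viewed inside this quantum torus. Products of non-commuting factors are ordered with indices increasing from left to right (in $\prod_i\prod_\alpha$, first by $i$, then by $\alpha$). Definition of $\mu_{\boldsymbol\ell}$: inverses and infinite products are expanded as formal Laurent series in the $\widehat Q_{\alpha,1}^{-1}$ with coefficients Laurent polynomials in the $\widehat Q_{\alpha,0}$; concretely, as finite sums of Laurent monomials times formal power series in $x_\beta=\prod_\alpha\widehat Q_{\alpha,1}^{-C_{\alpha,\beta}}$, $\beta\in I_r$. For a series in normal-ordered form $f=\sum f_{a;b}\prod_\alpha\widehat Q_{\alpha,0}^{a_\alpha}\prod_\beta\widehat Q_{\beta,1}^{b_\beta}$ let $\mathrm{CT}_{\widehat{\mathbf Q}_1}(f)|_{\widehat{\mathbf Q}_0=1}=\sum_{a}f_{a;0}$. Put $z_\beta=\lim_{k\to\infty}\widehat Q_{\beta,k}\widehat Q_{\beta,k+1}^{-1}=\widehat Q_{\beta,0}\widehat Q_{\beta,1}^{-1}\prod_{k=1}^\infty\big(1-\prod_{\alpha=1}^r\widehat Q_{\alpha,k}^{-C_{\alpha,\beta}}\big)^{-1}$ and $$\mu_{\boldsymbol\ell}(p)=\mathrm{CT}_{\widehat{\mathbf Q}_1}\Big(\prod_{\alpha=1}^r\widehat Q_{\alpha,1}\widehat Q_{\alpha,0}^{-1}\cdot p\cdot\prod_{\beta=1}^rz_\beta^{\ell_\beta+1}\Big)\Big|_{\widehat{\mathbf Q}_0=1}.$$ Graded multiplicities: for $a\in\mathbb Z_+$, $b\in\mathbb Z$, $\left[\begin{matrix}a+b\\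 a\end{matrix}\right]_q$ is the coefficient of $x^a$ in $\prod_{i=0}^{b}(1-q^ix)^{-1}$ if $b\ge0$, and in $\prod_{i=0}^{-b-1}(1-q^{i+b+1}x)$ if $b<0$. For $K\ge1$, with indices $\alpha\in I_r$, $1\le i\le K$, put $\mathbf p=(I\otimes A)\mathbf n-(C\otimes A)\mathbf m$, $q_{\alpha,0}=\ell_\alpha-p_{\alpha,K}$, $Q(\mathbf m,\mathbf n)=-\frac12\mathbf m\cdot(\mathbf p+(I\otimes A)\mathbf n)$ and $M^{(K)}_{\boldsymbol\ell;\mathbf n}(q^{-1})=\sum q^{Q(\mathbf m,\mathbf n)}\prod_{\alpha,i}\left[\begin{matrix}m_{\alpha,i}+p_{\alpha,i}\\ m_{\alpha,i}\end{matrix}\right]_q$, the sum being over all $m_{\alpha,i}\in\mathbb Z_+$ with all $q_{\alpha,0}=0$ and all $p_{\alpha,i}\ge0$; $M_{\boldsymbol\ell;\mathbf n}(q^{-1})$ is its value for $K$ sufficiently large with respect to $\mathbf n$. Definition of the representation: a cyclic representation of $\mathcal A_+$ (acting from the right) with cyclic vector $\langle0,\dots,0|$ such that $\langle0,\dots,0|\widehat Q_{\alpha,0}=t^{-\sum_\beta\lambda_{\alpha,\beta}}\langle0,\dots,0|$ for all $\alpha$, and with $\mathbb Z[t^{\pm1}]$-basis $\langle p_1,\dots,p_r|$, $\mathbf p\in\mathbb Z_+^r$, determined by the following equations, one for each $(m_1,\dots,m_r)\in\mathbb Z_+^r$, with $n_{\alpha,i}=\delta_{i,m_\alpha}$ ($i\ge1$):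 $$\langle0,\dots,0|\prod_{i\ge1}\prod_{\alpha=1}^r\widehat Q_{\alpha,i}^{\,n_{\alpha,i}}=\sum_{\mathbf p\in\mathbb Z_+^r}t^{-\sum_{\alpha,\beta,i}n_{\alpha,i}\lambda_{\alpha,\beta}-\frac12\left(\sum_\alpha p_\alpha\lambda_{\alpha,\alpha}+\sum_{\alpha,\beta}\min(m_\alpha,m_\beta)\lambda_{\alpha,\beta}\right)}M_{\mathbf p;\mathbf n}(q^{-1})\,\langle p_1,\dots,p_r|.$$ $|\ell_1,\dots,\ell_r\rangle$ denotes the dual basis: $\langle m_1,\dots,m_r|\ell_1,\dots,\ell_r\rangle=\prod_\alpha\delta_{m_\alpha,\ell_\alpha}$. *)

theory Defs
  imports
    "HOL-Analysis.Analysis"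
    "HOL-Algebra.Generated_Rings"
    "HOL-Library.Poly_Mapping"
    "HOL-Computational_Algebra.Formal_Power_Series"
begin

section \<open>Cartan data\<close>

text \<open>
  The set \<open>I_r\<close> is a finite linearly ordered type \<open>'r\<close>, so that \<open>r = CARD('r) \<ge> 1\<close>.  The simple
  simply-laced Lie algebra enters only through its Cartan matrix, that is, through an indecomposable
  symmetric Cartan matrix of finite type; no numbering of the simple roots is preferred.
\<close>

definition real_matrix :: "int^'n^'m \<Rightarrow> real^'n^'m" where
  "real_matrix C = (\<chi> i j. real_of_int (C $ i $ j))"

definition simply_laced_cartan :: "int^'r::finite^'r \<Rightarrow> bool" where
  "simply_laced_cartan C \<longleftrightarrow>
     (\<forall>i. C $ i $ i = 2) \<and>
     (\<forall>i j. i \<noteq> j \<longrightarrow> C $ i $ j \<in> {0, -1}) \<and>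
     (\<forall>i j. C $ i $ j = C $ j $ i) \<and>
     (\<forall>x. x \<noteq> 0 \<longrightarrow> x \<bullet> (real_matrix C *v x) > 0) \<and>
     (\<forall>S. S \<noteq> {} \<and> S \<noteq> UNIV \<longrightarrow> (\<exists>i\<in>S. \<exists>j\<in>- S. C $ i $ j \<noteq> 0))"

text \<open>
  \<open>\<lambda> = \<delta> C\<^sup>-\<^sup>1\<close> with \<open>\<delta> = det C\<close>.  The floor only transports the integer entries from \<^typ>\<open>real\<close> to
  \<^typ>\<open>int\<close>, see \<open>lam_exact\<close> below.
\<close>

definition lam :: "int^'r::finite^'r \<Rightarrow> int^'r^'r" where
  "lam C = (\<chi> i j. \<lfloor>real_of_int (det C) * matrix_inv (real_matrix C) $ i $ j\<rfloor>)"

lemma det_real_matrix: "det (real_matrix C) = real_of_int (det C)"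
  by (simp add: det_def real_matrix_def)

lemma real_matrix_inv:
  assumes "det C \<noteq> 0"
  shows "real_matrix C ** matrix_inv (real_matrix C) = mat 1"
proof -
  have "invertible (real_matrix C)"
    using assms by (simp add: invertible_det_nz det_real_matrix)
  then obtain B where "real_matrix C ** B = mat 1 \<and> B ** real_matrix C = mat 1"
    unfolding invertible_def by blast
  then show ?thesis
    unfolding matrix_inv_def by (rule someI2) blast
qed

lemma lam_exact:
  fixes C :: "int^'r::finite^'r"
  assumes "det C \<noteq> 0"
  shows "real_of_int (lam C $ i $ j) = real_of_int (det C) * matrix_inv (real_matrix C) $ i $ j"
proof -
  let ?A = "real_matrix C"
  let ?D = "\<chi> k l. if l = i then (axis j 1 :: int^'r) $ k else C $ k $ l"
  define x where "x = matrix_inv ?A *v axis j 1"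
  have Ax: "?A *v x = axis j 1"
    by (simp add: x_def matrix_vector_mul_assoc real_matrix_inv[OF assms])
  have "x $ i * det ?A = det (\<chi> k l. if l = i then (?A *v x) $ k else ?A $ k $ l)"
    by (rule cramer_lemma[symmetric])
  also have "(\<chi> k l. if l = i then (?A *v x) $ k else ?A $ k $ l) = real_matrix ?D"
    unfolding Ax by (simp add: real_matrix_def vec_eq_iff axis_def)
  finally have *: "real_of_int (det C) * x $ i = real_of_int (det ?D)"
    unfolding det_real_matrix by (simp only: mult.commute)
  have xi: "x $ i = matrix_inv ?A $ i $ j"
    unfolding x_def matrix_vector_mult_basis column_def by (rule vec_lambda_beta)
  show ?thesis
    unfolding lam_def vec_lambda_beta *[unfolded xi] floor_of_int by (rule refl)
qed

lemma det_cartan_nonzero: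
  assumes "simply_laced_cartan C"
  shows "det C \<noteq> 0"
proof -
  have "x = 0" if "real_matrix C *v x = 0" for x
    using assms that unfolding simply_laced_cartan_def by (metis inner_zero_right less_irrefl)
  then have "invertible (real_matrix C)"
    by (simp add: invertible_left_inverse matrix_left_invertible_ker)
  then show ?thesis
    by (simp add: invertible_det_nz det_real_matrix)
qed

lemma cartan_lam:
  fixes C :: "int^'r::finite^'r"
  assumes "simply_laced_cartan C"
  shows "(\<Sum>\<gamma>\<in>UNIV. C $ \<alpha> $ \<gamma> * lam C $ \<gamma> $ \<beta>) = (if \<alpha> = \<beta> then det C else 0)"
proof -
  have "(real_matrix C ** matrix_inv (real_matrix C)) $ \<alpha> $ \<beta> = mat 1 $ \<alpha> $ \<beta>"
    by (simp add: real_matrix_inv[OF det_cartan_nonzero[OF assms]])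
  then have "(\<Sum>\<gamma>\<in>UNIV. real_of_int (C $ \<alpha> $ \<gamma>) * matrix_inv (real_matrix C) $ \<gamma> $ \<beta>)
      = (if \<alpha> = \<beta> then 1 else 0)"
    by (simp add: matrix_matrix_mult_def mat_def real_matrix_def)
  then have "real_of_int (det C) * (\<Sum>\<gamma>\<in>UNIV. real_of_int (C $ \<alpha> $ \<gamma>) * matrix_inv (real_matrix C) $ \<gamma> $ \<beta>)
      = real_of_int (if \<alpha> = \<beta> then det C else 0)"
    by simp
  moreover have "real_of_int (\<Sum>\<gamma>\<in>UNIV. C $ \<alpha> $ \<gamma> * lam C $ \<gamma> $ \<beta>)
      = real_of_int (det C) * (\<Sum>\<gamma>\<in>UNIV. real_of_int (C $ \<alpha> $ \<gamma>) * matrix_inv (real_matrix C) $ \<gamma> $ \<beta>)"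
    by (simp add: lam_exact[OF det_cartan_nonzero[OF assms]] sum_distrib_left mult_ac)
  ultimately have "real_of_int (\<Sum>\<gamma>\<in>UNIV. C $ \<alpha> $ \<gamma> * lam C $ \<gamma> $ \<beta>)
      = real_of_int (if \<alpha> = \<beta> then det C else 0)"
    by (simp only:)
  then show ?thesis
    by (rule of_int_eq_iff[THEN iffD1])
qed

lemma lam_sym:
  assumes "simply_laced_cartan C"
  shows "lam C $ \<alpha> $ \<beta> = lam C $ \<beta> $ \<alpha>"
proof -
  have sym: "C $ i $ j = C $ j $ i" for i j
    using assms by (simp add: simply_laced_cartan_def)
  let ?S = "\<Sum>\<gamma>\<in>UNIV. \<Sum>\<epsilon>\<in>UNIV. lam C $ \<gamma> $ \<alpha> * C $ \<gamma> $ \<epsilon> * lam C $ \<epsilon> $ \<beta>"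
  have "?S = (\<Sum>\<gamma>\<in>UNIV. lam C $ \<gamma> $ \<alpha> * (\<Sum>\<epsilon>\<in>UNIV. C $ \<gamma> $ \<epsilon> * lam C $ \<epsilon> $ \<beta>))"
    by (simp add: sum_distrib_left mult_ac)
  also have "\<dots> = lam C $ \<beta> $ \<alpha> * det C"
    by (simp add: cartan_lam[OF assms] if_distrib cong: if_cong)
  finally have 1: "?S = lam C $ \<beta> $ \<alpha> * det C" .
  have "?S = (\<Sum>\<epsilon>\<in>UNIV. \<Sum>\<gamma>\<in>UNIV. lam C $ \<gamma> $ \<alpha> * C $ \<gamma> $ \<epsilon> * lam C $ \<epsilon> $ \<beta>)"
    by (rule sum.swap)
  also have "\<dots> = (\<Sum>\<epsilon>\<in>UNIV. (\<Sum>\<gamma>\<in>UNIV. C $ \<epsilon> $ \<gamma> * lam C $ \<gamma> $ \<alpha>) * lam C $ \<epsilon> $ \<beta>)"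
    unfolding sum_distrib_right
    by (intro sum.cong refl) (metis sym mult.commute)
  also have "\<dots> = det C * lam C $ \<alpha> $ \<beta>"
    by (simp add: cartan_lam[OF assms] if_distrib if_distribR cong: if_cong)
  finally show ?thesis
    using 1 det_cartan_nonzero[OF assms] by simp
qed

lemma symmetric_sum_parity:
  fixes B :: "'a \<Rightarrow> 'a \<Rightarrow> int"
  assumes "finite S" and "\<And>x y. B x y = B y x"
  shows "even ((\<Sum>x\<in>S. \<Sum>y\<in>S. B x y) - (\<Sum>x\<in>S. B x x))"
  using assms(1)
proof (induction S rule: finite_induct)
  case (insert z S)
  have "(\<Sum>x\<in>insert z S. \<Sum>y\<in>insert z S. B x y) - (\<Sum>x\<in>insert z S. B x x)
      = 2 * (\<Sum>y\<in>S. B z y) + ((\<Sum>x\<in>S. \<Sum>y\<in>S. B x y) - (\<Sum>x\<in>S. B x x))"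
  proof -
    have "(\<Sum>x\<in>S. B x z) = (\<Sum>y\<in>S. B z y)"
      by (rule sum.cong) (auto intro: assms(2))
    then show ?thesis
      using insert.hyps by (simp add: sum.distrib)
  qed
  then show ?case
    using insert.IH by (simp only: dvd_add dvd_triv_left)
qed simp

section \<open>The quantum torus and its completion\<close>

text \<open>\<open>\<int>[t\<^sup>\<plusminus>\<^sup>1]\<close> as the group ring of \<open>\<int>\<close>, and \<open>t\<^sup>k\<close>.\<close>

type_synonym laurent = "int \<Rightarrow>\<^sub>0 int"

definition tpow :: "int \<Rightarrow> laurent" where
  "tpow k = Poly_Mapping.single k 1"

text \<open>
  A series \<open>f\<close> is given by its normal-ordered coefficients:
  \<open>f a b\<close> is the coefficient of \<open>\<Prod>\<^sub>\<alpha> Q\<^sub>\<alpha>\<^sub>,\<^sub>0^(a\<^sub>\<alpha>) \<Prod>\<^sub>\<beta> Q\<^sub>\<beta>\<^sub>,\<^sub>1^(b\<^sub>\<beta>)\<close>.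
\<close>

type_synonym 'r qseries = "int^'r \<Rightarrow> int^'r \<Rightarrow> laurent"

text \<open>
  The ring of formal Laurent series in the \<open>Q\<^sub>\<alpha>\<^sub>,\<^sub>1\<^sup>-\<^sup>1\<close> in which all inverses are taken.
  A series belongs to it if the occurring exponents \<open>b\<close> lie in finitely many translates of the cone
  spanned by the exponents \<open>- C e\<^sub>\<beta>\<close> of the \<open>x\<^sub>\<beta> = \<Prod>\<^sub>\<alpha> Q\<^sub>\<alpha>\<^sub>,\<^sub>1^(- C\<^sub>\<alpha>\<^sub>\<beta>)\<close>, and if each \<open>b\<close> occurs with a Laurent
  polynomial in the \<open>Q\<^sub>\<alpha>\<^sub>,\<^sub>0\<close> as its coefficient; that is, it is a finite sum of Laurent monomials times
  power series in the \<open>x\<^sub>\<beta>\<close> with coefficients Laurent polynomials in the \<open>Q\<^sub>\<alpha>\<^sub>,\<^sub>0\<close>.  The quantum torus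
  is the subring of the series with finite support.
  The commutation rule \<open>Q\<^sub>\<alpha>\<^sub>,\<^sub>1 Q\<^sub>\<beta>\<^sub>,\<^sub>0 = t^(- \<lambda>\<^sub>\<alpha>\<^sub>\<beta>) Q\<^sub>\<beta>\<^sub>,\<^sub>0 Q\<^sub>\<alpha>\<^sub>,\<^sub>1\<close> gives the power of \<open>t\<close> in the product.  The
  sum defining a product has finite support for factors in the carrier.
\<close>

definition qseries_carrier :: "int^'r::finite^'r \<Rightarrow> 'r qseries set" where
  "qseries_carrier C =
     {f. (\<exists>B. finite B \<and>
            (\<forall>a b. f a b \<noteq> 0 \<longrightarrow> (\<exists>b0\<in>B. \<exists>k::nat^'r. b = b0 - C *v (\<chi> \<beta>. int (k $ \<beta>))))) \<and>
         (\<forall>b. finite {a. f a b \<noteq> 0})}"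

definition qmult :: "int^'r::finite^'r \<Rightarrow> 'r qseries \<Rightarrow> 'r qseries \<Rightarrow> 'r qseries" where
  "qmult C f g = (\<lambda>a b. Sum_any (\<lambda>(a1, b1).
      tpow (- (\<Sum>\<alpha>\<in>UNIV. \<Sum>\<beta>\<in>UNIV. b1 $ \<alpha> * lam C $ \<alpha> $ \<beta> * (a - a1) $ \<beta>))
      * f a1 b1 * g (a - a1) (b - b1)))"

text \<open>\<open>c\<close> times the monomial with exponents \<open>a\<close>, \<open>b\<close>; scalars are the case \<open>a = b = 0\<close>.\<close>

definition qmonom :: "laurent \<Rightarrow> int^'r \<Rightarrow> int^'r \<Rightarrow> 'r::finite qseries" where
  "qmonom c a b = (\<lambda>a' b'. if a' = a \<and> b' = b then c else 0)"

definition qring :: "int^'r::finite^'r \<Rightarrow> 'r qseries ring" where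
  "qring C = \<lparr> carrier = qseries_carrier C, mult = qmult C, one = qmonom 1 0 0,
     zero = (\<lambda>_ _. 0), add = (\<lambda>f g a b. f a b + g a b) \<rparr>"

definition ordprod :: "('a, 'b) monoid_scheme \<Rightarrow> ('i \<Rightarrow> 'a) \<Rightarrow> 'i list \<Rightarrow> 'a" where
  "ordprod G f is = foldr (\<lambda>i y. f i \<otimes>\<^bsub>G\<^esub> y) is \<one>\<^bsub>G\<^esub>"

definition idx :: "'r::{finite,linorder} list" where
  "idx = sorted_list_of_set UNIV"

section \<open>The quantum Q-system\<close>

text \<open>
  \<open>qQ C \<alpha> n\<close> for \<open>n \<ge> 0\<close>; only these occur in \<open>Aplus\<close> and \<open>mu\<close>.  The recursion is solved for
  \<open>Q\<^sub>\<alpha>\<^sub>,\<^sub>n\<^sub>+\<^sub>1\<close> by dividing by \<open>Q\<^sub>\<alpha>\<^sub>,\<^sub>n\<^sub>-\<^sub>1\<close> from the right in the completed ring, where \<open>Q\<^sub>\<alpha>\<^sub>,\<^sub>n\<^sub>-\<^sub>1\<close> is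
  invertible because its term of highest degree is a single monomial with coefficient a power of \<open>t\<close>.
\<close>

fun qQ :: "int^'r::{finite,linorder}^'r::{finite,linorder} \<Rightarrow> 'r \<Rightarrow> nat \<Rightarrow> 'r qseries" where
  "qQ C \<alpha> 0 = qmonom 1 (axis \<alpha> 1) 0"
| "qQ C \<alpha> (Suc 0) = qmonom 1 0 (axis \<alpha> 1)"
| "qQ C \<alpha> (Suc (Suc n)) =
     qmonom (tpow (- lam C $ \<alpha> $ \<alpha>)) 0 0 \<otimes>\<^bsub>qring C\<^esub>
     (qQ C \<alpha> (Suc n) [^]\<^bsub>qring C\<^esub> (2::nat)
        \<ominus>\<^bsub>qring C\<^esub> ordprod (qring C) (\<lambda>\<beta>. qQ C \<beta> (Suc n) [^]\<^bsub>qring C\<^esub> (- C $ \<alpha> $ \<beta>))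
                     (filter (\<lambda>\<beta>. \<beta> \<noteq> \<alpha>) idx))
     \<otimes>\<^bsub>qring C\<^esub> inv\<^bsub>qring C\<^esub> (qQ C \<alpha> n)"

text \<open>A \<open>\<int>[t\<^sup>\<plusminus>\<^sup>1]\<close>-subalgebra is a subring containing the scalars.\<close>

definition Aplus :: "int^'r::{finite,linorder}^'r::{finite,linorder} \<Rightarrow> 'r qseries set" where
  "Aplus C = generate_ring (qring C)
     (range (\<lambda>c. qmonom c 0 0)
      \<union> range (\<lambda>\<alpha>. qQ C \<alpha> 0) \<union> range (\<lambda>\<alpha>. inv\<^bsub>qring C\<^esub> (qQ C \<alpha> 0))
      \<union> {qQ C \<alpha> m | \<alpha> m. m \<ge> 1})"

section \<open>The functionals \<open>\<mu>\<^sub>\<ell>\<close>\<close>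

text \<open>
  The limit \<open>z\<^sub>\<beta>\<close> of the \<open>Q\<^sub>\<beta>\<^sub>,\<^sub>k Q\<^sub>\<beta>\<^sub>,\<^sub>k\<^sub>+\<^sub>1\<^sup>-\<^sup>1\<close> as formal series: the coefficient (a Laurent polynomial in the
  \<open>Q\<^sub>\<alpha>\<^sub>,\<^sub>0\<close>) of each monomial in the \<open>Q\<^sub>\<alpha>\<^sub>,\<^sub>1\<close> is eventually constant in \<open>k\<close>.
\<close>

definition zlim :: "int^'r::{finite,linorder}^'r::{finite,linorder} \<Rightarrow> 'r \<Rightarrow> 'r qseries" where
  "zlim C \<beta> = (THE z. z \<in> carrier (qring C) \<and>
     (\<forall>b. \<forall>\<^sub>F k in sequentially. \<forall>a.
        (qQ C \<beta> k \<otimes>\<^bsub>qring C\<^esub> inv\<^bsub>qring C\<^esub> (qQ C \<beta> (k + 1))) a b = z a b))"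

definition CT1 :: "'r::finite qseries \<Rightarrow> laurent" where
  "CT1 f = Sum_any (\<lambda>a. f a 0)"

definition mu :: "int^'r::{finite,linorder}^'r::{finite,linorder} \<Rightarrow> nat^'r::{finite,linorder} \<Rightarrow> 'r qseries \<Rightarrow> laurent" where
  "mu C l p = CT1
     (ordprod (qring C) (\<lambda>\<alpha>. qQ C \<alpha> 1 \<otimes>\<^bsub>qring C\<^esub> inv\<^bsub>qring C\<^esub> (qQ C \<alpha> 0)) idx
      \<otimes>\<^bsub>qring C\<^esub> p
      \<otimes>\<^bsub>qring C\<^esub> ordprod (qring C) (\<lambda>\<beta>. zlim C \<beta> [^]\<^bsub>qring C\<^esub> (l $ \<beta> + 1)) idx)"

section \<open>Graded multiplicities\<close>

definition qpow :: "int^'r::finite^'r \<Rightarrow> int \<Rightarrow> laurent" where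
  "qpow C k = tpow (- det C * k)"

text \<open>
  The \<open>q\<close>-binomial coefficient \<open>[a + b, a]\<^sub>q\<close>.  For \<open>b \<ge> 0\<close> the factor \<open>(1 - q\<^sup>i x)\<^sup>-\<^sup>1\<close> is written as
  the geometric series it denotes.
\<close>

definition qbinom :: "int^'r::finite^'r \<Rightarrow> nat \<Rightarrow> int \<Rightarrow> laurent" where
  "qbinom C a b = fps_nth
     (if b \<ge> 0 then \<Prod>i\<in>{0..b}. Abs_fps (\<lambda>k. qpow C (i * int k))
      else \<Prod>i\<in>{0..- b - 1}. 1 - fps_const (qpow C (i + b + 1)) * fps_X) a"

text \<open>In the following, only the values \<open>m \<alpha> i\<close>, \<open>n \<alpha> i\<close> with \<open>1 \<le> i \<le> K\<close> matter.\<close>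

definition An :: "nat \<Rightarrow> ('r \<Rightarrow> nat \<Rightarrow> nat) \<Rightarrow> 'r \<Rightarrow> nat \<Rightarrow> int" where
  "An K n \<alpha> i = (\<Sum>j=1..K. int (min i j) * int (n \<alpha> j))"

definition pvec :: "int^'r::finite^'r \<Rightarrow> nat \<Rightarrow> ('r \<Rightarrow> nat \<Rightarrow> nat) \<Rightarrow> ('r \<Rightarrow> nat \<Rightarrow> nat) \<Rightarrow> 'r \<Rightarrow> nat \<Rightarrow> int" where
  "pvec C K n m \<alpha> i = An K n \<alpha> i - (\<Sum>\<beta>\<in>UNIV. C $ \<alpha> $ \<beta> * An K m \<beta> i)"

text \<open>The division by 2 is exact, see \<open>Qform_exact\<close> below.\<close>

definition Qform :: "int^'r::finite^'r \<Rightarrow> nat \<Rightarrow> ('r \<Rightarrow> nat \<Rightarrow> nat) \<Rightarrow> ('r \<Rightarrow> nat \<Rightarrow> nat) \<Rightarrow> int" where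
  "Qform C K n m =
     - ((\<Sum>\<alpha>\<in>UNIV. \<Sum>i=1..K. int (m \<alpha> i) * (pvec C K n m \<alpha> i + An K n \<alpha> i)) div 2)"

lemma Qform_exact:
  assumes "simply_laced_cartan C"
  shows "2 * Qform C K n m =
    - (\<Sum>\<alpha>\<in>UNIV. \<Sum>i=1..K. int (m \<alpha> i) * (pvec C K n m \<alpha> i + An K n \<alpha> i))"
proof -
  define B where "B x y = int (m (fst x) (snd x)) * C $ fst x $ fst y * int (min (snd x) (snd y))
    * int (m (fst y) (snd y))" for x y
  have sym: "B x y = B y x" for x y
  proof -
    have "C $ fst x $ fst y = C $ fst y $ fst x"
      using assms unfolding simply_laced_cartan_def by blast
    moreover have "min (snd x) (snd y) = min (snd y) (snd x)"
      by (rule min.commute)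
    ultimately show ?thesis
      unfolding B_def by (simp only: mult_ac)
  qed
  have diag: "even (B x x)" for x
    using assms by (simp add: B_def simply_laced_cartan_def)
  have ev: "even (\<Sum>x\<in>UNIV \<times> {1..K}. \<Sum>y\<in>UNIV \<times> {1..K}. B x y)"
  proof -
    have "even (\<Sum>x\<in>UNIV \<times> {1..K}. B x x)"
      by (intro dvd_sum diag)
    moreover have "even ((\<Sum>x\<in>UNIV \<times> {1..K}. \<Sum>y\<in>UNIV \<times> {1..K}. B x y)
        - (\<Sum>x\<in>UNIV \<times> {1..K}. B x x))"
      by (rule symmetric_sum_parity) (simp, rule sym)
    ultimately show ?thesis
      using dvd_add by fastforce
  qed
  have "(\<Sum>\<alpha>\<in>UNIV. \<Sum>i=1..K. int (m \<alpha> i) * (pvec C K n m \<alpha> i + An K n \<alpha> i))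
      = 2 * (\<Sum>\<alpha>\<in>UNIV. \<Sum>i=1..K. int (m \<alpha> i) * An K n \<alpha> i)
        - (\<Sum>x\<in>UNIV \<times> {1..K}. \<Sum>y\<in>UNIV \<times> {1..K}. B x y)"
    by (simp add: B_def pvec_def An_def sum.cartesian_product' algebra_simps sum.distrib
        sum_subtractf sum_distrib_left sum_distrib_right)
  then have "even (\<Sum>\<alpha>\<in>UNIV. \<Sum>i=1..K. int (m \<alpha> i) * (pvec C K n m \<alpha> i + An K n \<alpha> i))"
    using ev by simp
  then show ?thesis
    by (simp add: Qform_def)
qed

text \<open>
  The set of admissible \<open>m\<close>; it is finite, since \<open>p\<^sub>\<alpha>\<^sub>,\<^sub>K = \<ell>\<^sub>\<alpha>\<close> fixes all \<open>\<Sum>\<^sub>j j m\<^sub>\<alpha>\<^sub>,\<^sub>j\<close>.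
\<close>

definition admissible :: "int^'r::finite^'r \<Rightarrow> nat \<Rightarrow> nat^'r \<Rightarrow> ('r \<Rightarrow> nat \<Rightarrow> nat) \<Rightarrow> ('r \<Rightarrow> nat \<Rightarrow> nat) set" where
  "admissible C K l n =
     {m. (\<forall>\<alpha> i. i \<notin> {1..K} \<longrightarrow> m \<alpha> i = 0) \<and>
         (\<forall>\<alpha>. int (l $ \<alpha>) - pvec C K n m \<alpha> K = 0) \<and>
         (\<forall>\<alpha>. \<forall>i\<in>{1..K}. pvec C K n m \<alpha> i \<ge> 0)}"

definition MultK :: "int^'r::finite^'r \<Rightarrow> nat \<Rightarrow> nat^'r \<Rightarrow> ('r \<Rightarrow> nat \<Rightarrow> nat) \<Rightarrow> laurent" where
  "MultK C K l n = (\<Sum>m\<in>admissible C K l n.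
     qpow C (Qform C K n m) * (\<Prod>\<alpha>\<in>UNIV. \<Prod>i=1..K. qbinom C (m \<alpha> i) (pvec C K n m \<alpha> i)))"

text \<open>\<open>M\<^sub>\<ell>\<^sub>;\<^sub>n(q\<^sup>-\<^sup>1)\<close>: the value for all sufficiently large \<open>K\<close>.\<close>

definition Mult :: "int^'r::finite^'r \<Rightarrow> nat^'r \<Rightarrow> ('r \<Rightarrow> nat \<Rightarrow> nat) \<Rightarrow> laurent" where
  "Mult C l n = (THE c. \<forall>\<^sub>F K in sequentially. MultK C K l n = c)"

section \<open>The cyclic representation\<close>

definition delta_n :: "nat^'r \<Rightarrow> 'r \<Rightarrow> nat \<Rightarrow> nat" where
  "delta_n m \<alpha> i = (if i = m $ \<alpha> \<and> i \<ge> 1 then 1 else 0)"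

text \<open>
  The exponent of \<open>t\<close> in the defining equations.  The division by 2 is exact whenever the
  accompanying multiplicity is nonzero, see \<open>rep_exponent_exact\<close> below.
\<close>

definition rep_exponent :: "int^'r::finite^'r \<Rightarrow> nat^'r \<Rightarrow> nat^'r \<Rightarrow> int" where
  "rep_exponent C m p =
     - (\<Sum>\<alpha>\<in>UNIV. \<Sum>\<beta>\<in>UNIV. \<Sum>i=1..m $ \<alpha>. int (delta_n m \<alpha> i) * lam C $ \<alpha> $ \<beta>)
     - ((\<Sum>\<alpha>\<in>UNIV. int (p $ \<alpha>) * lam C $ \<alpha> $ \<alpha>)
        + (\<Sum>\<alpha>\<in>UNIV. \<Sum>\<beta>\<in>UNIV. int (min (m $ \<alpha>) (m $ \<beta>)) * lam C $ \<alpha> $ \<beta>)) div 2"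

lemma rep_exponent_exact:
  fixes C :: "int^'r::finite^'r"
  assumes C: "simply_laced_cartan C" and K: "\<And>\<alpha>. m $ \<alpha> \<le> K" and nz: "MultK C K p (delta_n m) \<noteq> 0"
  shows "even ((\<Sum>\<alpha>\<in>UNIV. int (p $ \<alpha>) * lam C $ \<alpha> $ \<alpha>)
        + (\<Sum>\<alpha>\<in>UNIV. \<Sum>\<beta>\<in>UNIV. int (min (m $ \<alpha>) (m $ \<beta>)) * lam C $ \<alpha> $ \<beta>))"
proof -
  have sym: "C $ i $ j = C $ j $ i" for i j
    using C by (simp add: simply_laced_cartan_def)
  have col: "even (\<Sum>\<alpha>\<in>UNIV. lam C $ \<alpha> $ \<alpha> * C $ \<alpha> $ \<beta>)" for \<beta>
  proof -
    define B where "B = (\<lambda>\<alpha> \<gamma>. C $ \<alpha> $ \<beta> * (lam C $ \<alpha> $ \<gamma> * C $ \<gamma> $ \<beta>))"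
    have "(\<Sum>\<alpha>\<in>UNIV. \<Sum>\<gamma>\<in>UNIV. B \<alpha> \<gamma>) = (\<Sum>\<alpha>\<in>UNIV. C $ \<alpha> $ \<beta> * (\<Sum>\<gamma>\<in>UNIV. C $ \<beta> $ \<gamma> * lam C $ \<gamma> $ \<alpha>))"
      unfolding B_def sum_distrib_left
      by (intro sum.cong refl) (metis (no_types, lifting) lam_sym[OF C] sym mult.commute)
    also have "\<dots> = C $ \<beta> $ \<beta> * det C"
      by (simp add: cartan_lam[OF C] if_distrib cong: if_cong)
    finally have "even (\<Sum>\<alpha>\<in>UNIV. \<Sum>\<gamma>\<in>UNIV. B \<alpha> \<gamma>)"
      using C by (simp add: simply_laced_cartan_def)
    moreover have "B \<alpha> \<gamma> = B \<gamma> \<alpha>" for \<alpha> \<gamma>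
      by (simp add: B_def lam_sym[OF C, of \<alpha> \<gamma>] mult_ac)
    ultimately have "even (\<Sum>\<alpha>\<in>UNIV. B \<alpha> \<alpha>)"
      using symmetric_sum_parity[of UNIV B] by auto
    moreover have "even (B \<alpha> \<alpha> - lam C $ \<alpha> $ \<alpha> * C $ \<alpha> $ \<beta>)" for \<alpha>
      by (auto simp: B_def)
    then have "even (\<Sum>\<alpha>\<in>UNIV. B \<alpha> \<alpha> - lam C $ \<alpha> $ \<alpha> * C $ \<alpha> $ \<beta>)"
      by (intro dvd_sum)
    ultimately show ?thesis
      by (simp add: sum_subtractf)
  qed
  have "admissible C K p (delta_n m) \<noteq> {}"
    using nz by (auto simp: MultK_def)
  then obtain k where "k \<in> admissible C K p (delta_n m)"
    by blast
  then have "int (p $ \<alpha>) = An K (delta_n m) \<alpha> K - (\<Sum>\<beta>\<in>UNIV. C $ \<alpha> $ \<beta> * An K k \<beta> K)" for \<alpha>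
    by (simp add: admissible_def pvec_def)
  moreover have "An K (delta_n m) \<alpha> K = int (m $ \<alpha>)" for \<alpha>
  proof -
    have "An K (delta_n m) \<alpha> K = (\<Sum>j=1..K. if j = m $ \<alpha> then int j else 0)"
      unfolding An_def by (intro sum.cong) (auto simp: delta_n_def)
    then show ?thesis
      using K[of \<alpha>] by (cases "m $ \<alpha> = 0") auto
  qed
  ultimately have p: "int (p $ \<alpha>) = int (m $ \<alpha>) - (\<Sum>\<beta>\<in>UNIV. C $ \<alpha> $ \<beta> * An K k \<beta> K)" for \<alpha>
    by simp
  have "(\<Sum>\<alpha>\<in>UNIV. (\<Sum>\<beta>\<in>UNIV. C $ \<alpha> $ \<beta> * An K k \<beta> K) * lam C $ \<alpha> $ \<alpha>)
      = (\<Sum>\<beta>\<in>UNIV. An K k \<beta> K * (\<Sum>\<alpha>\<in>UNIV. lam C $ \<alpha> $ \<alpha> * C $ \<alpha> $ \<beta>))"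
    unfolding sum_distrib_left sum_distrib_right by (subst sum.swap) (simp add: mult_ac)
  moreover have "even \<dots>"
    by (intro dvd_sum dvd_mult col)
  ultimately have "even ((\<Sum>\<alpha>\<in>UNIV. int (m $ \<alpha>) * lam C $ \<alpha> $ \<alpha>) - (\<Sum>\<alpha>\<in>UNIV. int (p $ \<alpha>) * lam C $ \<alpha> $ \<alpha>))"
    by (simp add: p left_diff_distrib sum_subtractf)
  moreover have "even ((\<Sum>\<alpha>\<in>UNIV. \<Sum>\<beta>\<in>UNIV. int (min (m $ \<alpha>) (m $ \<beta>)) * lam C $ \<alpha> $ \<beta>)
      - (\<Sum>\<alpha>\<in>UNIV. int (m $ \<alpha>) * lam C $ \<alpha> $ \<alpha>))"
  proof -
    define D where "D \<alpha> \<beta> = int (min (m $ \<alpha>) (m $ \<beta>)) * lam C $ \<alpha> $ \<beta>" for \<alpha> \<beta>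
    have "D \<alpha> \<beta> = D \<beta> \<alpha>" for \<alpha> \<beta>
      unfolding D_def lam_sym[OF C, of \<alpha> \<beta>] by (simp only: min.commute)
    then have "even ((\<Sum>\<alpha>\<in>UNIV. \<Sum>\<beta>\<in>UNIV. D \<alpha> \<beta>) - (\<Sum>\<alpha>\<in>UNIV. D \<alpha> \<alpha>))"
      by (intro symmetric_sum_parity) simp_all
    then show ?thesis
      by (simp add: D_def)
  qed
  ultimately show ?thesis
    by presburger
qed

text \<open>
  \<open>act v x\<close> is \<open>v\<close> acted upon by \<open>x\<close> from the right and \<open>bra p\<close> is \<open>\<langle>p\<^sub>1, \<dots>, p\<^sub>r|\<close>.  The values
  \<open>act v x\<close> for \<open>x\<close> outside of \<open>Aplus C\<close> are irrelevant.  The sum over \<open>p\<close> has finite support.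
\<close>

locale cyclic_rep = Modules.module smul
  for smul :: "laurent \<Rightarrow> 'v::ab_group_add \<Rightarrow> 'v" +
  fixes C :: "int^'r::{finite,linorder}^'r::{finite,linorder}"
    and act :: "'v \<Rightarrow> 'r qseries \<Rightarrow> 'v"
    and bra :: "nat^'r::{finite,linorder} \<Rightarrow> 'v"
  assumes act_add_left: "x \<in> Aplus C \<Longrightarrow> act (v + w) x = act v x + act w x"
    and act_scale_left: "x \<in> Aplus C \<Longrightarrow> act (smul c v) x = smul c (act v x)"
    and act_add: "x \<in> Aplus C \<Longrightarrow> y \<in> Aplus C \<Longrightarrow> act v (x \<oplus>\<^bsub>qring C\<^esub> y) = act v x + act v y"
    and act_mult: "x \<in> Aplus C \<Longrightarrow> y \<in> Aplus C \<Longrightarrow> act v (x \<otimes>\<^bsub>qring C\<^esub> y) = act (act v x) y"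
    and act_scalar: "act v (qmonom c 0 0) = smul c v"
    and bra_inj: "inj bra"
    and bra_independent: "independent (range bra)"
    and bra_span: "span (range bra) = UNIV"
    and bra_cyclic: "\<exists>x\<in>Aplus C. v = act (bra 0) x"
    and bra_Q0: "act (bra 0) (qQ C \<alpha> 0) = smul (tpow (- (\<Sum>\<beta>\<in>UNIV. lam C $ \<alpha> $ \<beta>))) (bra 0)"
    and bra_Q:
      "act (bra 0) (ordprod (qring C)
           (\<lambda>i. ordprod (qring C) (\<lambda>\<alpha>. qQ C \<alpha> i [^]\<^bsub>qring C\<^esub> delta_n m \<alpha> i) idx)
           [1..<Suc (MAX \<alpha>. m $ \<alpha>)])
       = Sum_any (\<lambda>p. smul (tpow (rep_exponent C m p) * Mult C p (delta_n m)) (bra p))"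

definition dual_basis ::
  "(laurent \<Rightarrow> 'v::ab_group_add \<Rightarrow> 'v) \<Rightarrow> (nat^'r::finite \<Rightarrow> 'v) \<Rightarrow> (nat^'r \<Rightarrow> 'v \<Rightarrow> laurent) \<Rightarrow> bool" where
  "dual_basis smul bra ket \<longleftrightarrow>
     (\<forall>l. Modules.module_hom smul (*) (ket l)) \<and>
     (\<forall>m l. ket l (bra m) = (\<Prod>\<alpha>\<in>UNIV. if m $ \<alpha> = l $ \<alpha> then 1 else 0))"

end

theory Submission
  imports Defs
begin

text \<open>
  Consecutive seeds \<open>(Q\<^sub>i, Q\<^sub>i\<^sub>+\<^sub>1)\<close> satisfy the same commutation relations, and in the completed torus a series
  with monomial leading term is invertible, so one may compute with the monomials
  \<open>Q\<^sub>i\<^sup>a Q\<^sub>i\<^sub>+\<^sub>1\<^sup>b\<close> of any seed.  Let \<open>\<Lambda>(x)\<close> be the constant term of \<open>Q\<^sub>1 Q\<^sub>0\<^sup>-\<^sup>1 x\<close> at \<open>Q\<^sub>0 = 1\<close>; it evaluates the coefficient of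
  \<open>Q\<^sub>1\<^sup>-\<^sup>1\<close> in \<open>x\<close> at one point.  All \<open>Q\<^sub>\<alpha>\<^sub>,\<^sub>n\<close> are Laurent polynomials in which the coefficient of \<open>Q\<^sub>1\<^sup>b\<close> with
  \<open>b\<^sub>\<alpha> < 0\<close> is divisible by \<open>\<Prod>\<^sub>j (1 - t^(- j \<delta>) \<Prod>\<^sub>\<beta> Q\<^sub>\<beta>\<^sub>,\<^sub>0^(- C\<^sub>\<alpha>\<^sub>\<beta>))\<close>, \<open>1 \<le> j \<le> - b\<^sub>\<alpha>\<close>, and the factor \<open>j = 1\<close> vanishes at
  that point.  Hence \<open>\<Lambda>\<close> kills everything with this divisibility.

  Modulo terms of arbitrarily low degree, \<open>\<Prod> z^(\<ell>+1)\<close> is a monomial of a late seed \<open>K\<close>.  Expanding its negative powers of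
  \<open>Q\<^sub>K\<^sub>+\<^sub>1\<close> in the seed \<open>K - 1\<close>, and so on down to the seed \<open>0\<close>, turns \<open>\<mu>\<^sub>\<ell>\<close> of an ordered product of the
  \<open>Q\<^sub>\<alpha>\<^sub>,\<^sub>i\<close> into a sum over \<open>m\<close>; the vanishing discards the terms with some \<open>p\<^sub>\<alpha>\<^sub>,\<^sub>i < 0\<close>, and the rest is
  \<open>M\<^sub>\<ell>\<^sub>;\<^sub>n\<close>.  This proves the claim for the products in the defining equations of the representation, whose
  images of \<open>\<langle>0|\<close> span the module since the \<open>M\<^sub>\<ell>\<^sub>;\<^sub>n\<close> are unitriangular.

  It remains to see that \<open>\<langle>0| y = 0\<close> implies \<open>\<mu>\<^sub>\<ell>(y) = 0\<close>.  For large \<open>s\<close> only nonnegative powers of \<open>Q\<^sub>1\<close> occur in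
  \<open>y Q\<^sub>1\<^sup>s\<close>.  The vectors \<open>\<langle>0| Q\<^sub>1\<^sup>b\<close>, \<open>b \<ge> 0\<close>, have distinct weights under the \<open>Q\<^sub>\<alpha>\<^sub>,\<^sub>0\<close>, and they are nonzero: the term of
  some \<open>Q\<^sub>\<alpha>\<^sub>,\<^sub>n\<close> with \<open>Q\<^sub>1\<close>-exponent \<open>- e\<^sub>\<gamma>\<close> lies, up to a scalar, in \<open>\<A>\<^sub>+\<close> and lowers \<open>b + e\<^sub>\<gamma>\<close> to \<open>b\<close>.  So all
  coefficients of \<open>y\<close> vanish at the point where \<open>\<Lambda>\<close> evaluates.
\<close>

section \<open>Powers of \<open>t\<close> and Laurent polynomials in the \<open>Q\<^sub>\<alpha>\<^sub>,\<^sub>0\<close>\<close>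

text \<open>Why the functional and the representation can be compared at all: the prefactor Q_1
  Q_0^-1 moves the specialisation Q_0 = 1 to the character Q_0^a -> t^(- \<open>kap\<close> . a),
  where \<open>kap\<close> = \<lambda>(1,...,1), and this is the character by which the Q_0 act on
  <0|. Three obstacles shape the rest. The completed torus depends on the Cartan matrix, so
  computations are made in a plain ring type whose exponents are recorded as \<lambda>b: since
  \<lambda>C = \<delta>, the cone of expansion becomes the negative orthant. Substituting a later
  seed keeps a Laurent polynomial Laurent only because of the divisibilities, yet a shift by one
  seed does not return them; they are recovered from a shift by two seeds, after cancelling the
  Q_{\<beta>,2}. Finally, an element lowering each single Q_1-exponent must be found in some
  Q_{\<alpha>,n}. Here finite type enters: the exponents of lowest monomials are Chebyshev
  polynomials in the adjacency matrix of the diagram, and these reach zero at the Coxeter number,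
  where the two terms of the Q-system relation have the same lowest Q_1-degree.\<close>

abbreviation lookup :: "('a \<Rightarrow>\<^sub>0 'b::zero) \<Rightarrow> 'a \<Rightarrow> 'b" where
  "lookup \<equiv> Poly_Mapping.lookup"

abbreviation keys :: "('a \<Rightarrow>\<^sub>0 'b::zero) \<Rightarrow> 'a set" where
  "keys \<equiv> Poly_Mapping.keys"

lemma tpow_0 [simp]: "tpow 0 = 1"
  by (simp add: tpow_def)

lemma tpow_add: "tpow (k + l) = tpow k * tpow l"
  by (simp add: tpow_def mult_single)

lemma tpow_diff: "tpow (k - l) = tpow k * tpow (- l)"
  by (simp flip: tpow_add)

lemma tpow_eq_iff [simp]: "tpow k = tpow l \<longleftrightarrow> k = l"
  by (metis lookup_single_eq lookup_single_not_eq tpow_def zero_neq_one)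

lemma tpow_nonzero [simp]: "tpow k \<noteq> 0"
  by (metis lookup_single_eq lookup_zero tpow_def zero_neq_one)

definition idot :: "int^'r::finite \<Rightarrow> int^'r \<Rightarrow> int" where
  "idot m a = (\<Sum>i\<in>UNIV. m $ i * a $ i)"

lemma idot_add_left: "idot (m + n) a = idot m a + idot n a"
  by (simp add: idot_def ring_distribs sum.distrib)

lemma idot_add_right: "idot m (a + b) = idot m a + idot m b"
  by (simp add: idot_def ring_distribs sum.distrib)

lemma idot_minus_left [simp]: "idot (- m) a = - idot m a"
  by (simp add: idot_def sum_negf)

lemma idot_minus_right [simp]: "idot m (- a) = - idot m a"
  by (simp add: idot_def sum_negf)

lemma idot_diff_left: "idot (m - n) a = idot m a - idot n a"
  by (simp add: idot_def ring_distribs sum_subtractf)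

lemma idot_diff_right: "idot m (a - b) = idot m a - idot m b"
  by (simp add: idot_def ring_distribs sum_subtractf)

lemma idot_0_left [simp]: "idot 0 a = 0"
  by (simp add: idot_def)

lemma idot_0_right [simp]: "idot m 0 = 0"
  by (simp add: idot_def)

lemma idot_commute: "idot m a = idot a m"
  by (simp add: idot_def mult.commute)

lemma idot_scale_left [simp]: "idot (k *s m) a = k * idot m a"
  by (simp add: idot_def sum_distrib_left mult_ac)

lemma idot_scale_right [simp]: "idot m (k *s a) = k * idot m a"
  by (simp add: idot_def sum_distrib_left mult_ac)

lemma idot_axis_left [simp]: "idot (axis i k) a = k * a $ i"
proof -
  have "axis i k $ j * a $ j = (if j = i then k * a $ j else 0)" for j
    by (simp add: axis_def)
  then show ?thesis by (simp add: idot_def)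
qed

lemma idot_axis_right [simp]: "idot a (axis i k) = k * a $ i"
  by (simp add: idot_commute[of a])

lemma idot_sum_left: "idot (\<Sum>x\<in>A. f x) a = (\<Sum>x\<in>A. idot (f x) a)"
  by (induction A rule: infinite_finite_induct) (simp_all add: idot_add_left)

lemma idot_sum_right: "idot a (\<Sum>x\<in>A. f x) = (\<Sum>x\<in>A. idot a (f x))"
  by (simp add: idot_commute[of a] idot_sum_left)

type_synonym 'r lpoly = "int^'r \<Rightarrow>\<^sub>0 laurent"

lemma lpoly_sum_single:
  fixes d :: "'r::finite lpoly"
  shows "d = (\<Sum>a\<in>keys d. Poly_Mapping.single a (lookup d a))"
proof (rule poly_mapping_eqI)
  fix k
  have "lookup (\<Sum>a\<in>keys d. Poly_Mapping.single a (lookup d a)) k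
      = (\<Sum>a\<in>keys d. if a = k then lookup d k else 0)"
    unfolding lookup_sum by (intro sum.cong refl) (auto simp: lookup_single)
  also have "\<dots> = lookup d k" by (auto simp: sum.delta in_keys_iff)
  finally show "lookup d k = lookup (\<Sum>a\<in>keys d. Poly_Mapping.single a (lookup d a)) k" ..
qed

lemma lpoly_induct [case_names zero single add]:
  fixes d :: "'r::finite lpoly"
  assumes "P 0" and "\<And>a c. P (Poly_Mapping.single a c)" and "\<And>x y. P x \<Longrightarrow> P y \<Longrightarrow> P (x + y)"
  shows "P d"
proof -
  have "P (\<Sum>a\<in>A. Poly_Mapping.single a (f a))" if "finite A" for A f
    using that by (induction A rule: finite_induct) (auto intro: assms)
  then show ?thesis using lpoly_sum_single[of d] by (metis finite_keys)
qed

text \<open>Commuting \<open>Q\<^sub>0\<^sup>a\<close> past \<open>Q\<^sub>1\<^sup>b\<close>; the exponent \<open>b\<close> is given here by \<open>\<lambda>b\<close>.\<close>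

lift_definition tw :: "int^'r::finite \<Rightarrow> 'r lpoly \<Rightarrow> 'r lpoly" is
  "\<lambda>b d a. tpow (- idot b a) * d a"
  by (rule finite_subset) auto

lemma lookup_tw: "lookup (tw b d) a = tpow (- idot b a) * lookup d a"
  by transfer simp

lemma tw_single [simp]:
  "tw b (Poly_Mapping.single a c) = Poly_Mapping.single a (tpow (- idot b a) * c)"
  by (rule poly_mapping_eqI) (auto simp: lookup_tw lookup_single when_def)

lemma tw_add [simp]: "tw b (x + y) = tw b x + tw b y"
  by (rule poly_mapping_eqI) (simp add: lookup_tw lookup_add ring_distribs)

lemma tw_0 [simp]: "tw b 0 = 0"
  by (rule poly_mapping_eqI) (simp add: lookup_tw)

lemma tw_diff [simp]: "tw b (x - y) = tw b x - tw b y"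
  by (rule poly_mapping_eqI) (simp add: lookup_tw lookup_minus ring_distribs)

lemma tw_sum: "tw b (sum f A) = (\<Sum>x\<in>A. tw b (f x))"
  by (induction A rule: infinite_finite_induct) simp_all

lemma tw_zero_left [simp]: "tw 0 x = x"
  by (rule poly_mapping_eqI) (simp add: lookup_tw)

lemma tw_tw: "tw b (tw c x) = tw (b + c) x"
  by (rule poly_mapping_eqI) (simp add: lookup_tw idot_add_left mult.assoc flip: tpow_add)

lemma tw_mult [simp]: "tw b (x * y) = tw b x * tw b y"
proof (induction x rule: lpoly_induct)
  case (single a c)
  show ?case
    by (induction y rule: lpoly_induct)
      (simp_all add: mult_single ring_distribs idot_add_right tpow_add tpow_diff mult_ac)
qed (simp_all add: ring_distribs)

lemma tw_1 [simp]: "tw b 1 = 1"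
  by (rule poly_mapping_eqI) (simp add: lookup_tw lookup_one when_def)

abbreviation q0 :: "int^'r \<Rightarrow> 'r::finite lpoly" where
  "q0 a \<equiv> Poly_Mapping.single a 1"

abbreviation sD :: "laurent \<Rightarrow> 'r::finite lpoly" where
  "sD c \<equiv> Poly_Mapping.single 0 c"

lemma lookup_sD_mult [simp]: "lookup (sD c * d) a = c * lookup d a"
  by (induction d rule: lpoly_induct) (auto simp: mult_single lookup_single when_def lookup_add ring_distribs)

text \<open>Evaluation of \<open>Q\<^sub>0\<^sup>a\<close> at \<open>t^(- m \<cdot> a)\<close>.\<close>

definition ev :: "int^'r::finite \<Rightarrow> 'r lpoly \<Rightarrow> laurent" where
  "ev m d = (\<Sum>a\<in>keys d. tpow (- idot m a) * lookup d a)"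

lemma ev_superset:
  assumes "finite A" "keys d \<subseteq> A"
  shows "ev m d = (\<Sum>a\<in>A. tpow (- idot m a) * lookup d a)"
  unfolding ev_def using assms by (intro sum.mono_neutral_left) (auto simp: in_keys_iff)

lemma ev_add [simp]: "ev m (x + y) = ev m x + ev m y"
proof -
  let ?A = "keys x \<union> keys y"
  have "ev m (x + y) = (\<Sum>a\<in>?A. tpow (- idot m a) * lookup (x + y) a)"
    by (rule ev_superset) (auto simp: keys_add)
  then show ?thesis
    by (simp add: ev_superset[of ?A x] ev_superset[of ?A y] lookup_add ring_distribs sum.distrib)
qed

lemma ev_0 [simp]: "ev m 0 = 0"
  by (simp add: ev_def)

lemma ev_single [simp]: "ev m (Poly_Mapping.single a c) = tpow (- idot m a) * c"
  by (cases "c = 0") (simp_all add: ev_def)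

lemma ev_minus [simp]: "ev m (- x) = - ev m x"
  by (metis add.left_inverse add_eq_0_iff ev_0 ev_add)

lemma ev_diff [simp]: "ev m (x - y) = ev m x - ev m y"
  using ev_add[of m x "- y"] by simp

lemma ev_sum: "ev m (sum f A) = (\<Sum>x\<in>A. ev m (f x))"
  by (induction A rule: infinite_finite_induct) simp_all

lemma ev_mult [simp]: "ev m (x * y) = ev m x * ev m y"
proof (induction x rule: lpoly_induct)
  case (single a c)
  show ?case
    by (induction y rule: lpoly_induct)
      (simp_all add: mult_single ring_distribs idot_add_right tpow_add tpow_diff mult_ac)
qed (simp_all add: ring_distribs)

text \<open>Moving a coefficient past Q_1^b translates the evaluation point by b, in
  \<lambda>-coordinates. This turns Q_0 = 1 into the point \<open>kap\<close> in
  \<open>mu_Lam0\<close> and shifts that point again in \<open>wv_nonzero\<close>.\<close>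

lemma ev_tw: "ev m (tw b d) = ev (m + b) d"
  by (induction d rule: lpoly_induct) (simp_all add: idot_add_left tpow_diff tpow_add mult_ac)

section \<open>Twisted Laurent series\<close>

lemma finite_int_box: "finite {b :: int^'r::finite. lo \<le> b \<and> b \<le> hi}"
proof -
  have "{b. lo \<le> b \<and> b \<le> hi} \<subseteq> (\<lambda>f. \<chi> i. f i) ` (PiE UNIV (\<lambda>i. {lo $ i..hi $ i}))"
  proof
    fix b assume "b \<in> {b. lo \<le> b \<and> b \<le> hi}"
    then have "(\<lambda>i. b $ i) \<in> PiE UNIV (\<lambda>i. {lo $ i..hi $ i})"
      by (auto simp: less_eq_vec_def)
    moreover have "b = (\<chi> i. b $ i)" by simp
    ultimately show "b \<in> (\<lambda>f. \<chi> i. f i) ` (PiE UNIV (\<lambda>i. {lo $ i..hi $ i}))"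
      by (metis (no_types, lifting) imageI)
  qed
  then show ?thesis by (rule finite_subset) (intro finite_imageI finite_PiE; simp)
qed

lemma vec_ub: "\<exists>u :: int^'r::finite. b \<le> u \<and> c \<le> u"
  by (rule exI[of _ "\<chi> i. max (b $ i) (c $ i)"]) (simp add: less_eq_vec_def)

text \<open>The index is \<lambda>b instead of b. The variables x_\<beta> then have exponent
  -\<delta> e_\<beta>, so expansions stay below a bound in the coordinatewise order and products are
  finite sums. The type does not mention the Cartan matrix and becomes an instance of
  \<open>ring_1\<close>; the ring of the statement is identified with a subring of it through
  \<open>Ph\<close>.\<close>

typedef (overloaded) 'r qtser =
  "{x :: int^'r \<Rightarrow> 'r::finite lpoly. \<exists>u. \<forall>b. x b \<noteq> 0 \<longrightarrow> b \<le> u}" morphisms cf mkser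
  by (rule exI[of _ "\<lambda>_. 0"]) simp

setup_lifting type_definition_qtser

lemma cf_bounded: obtains u where "\<And>b. cf x b \<noteq> 0 \<Longrightarrow> b \<le> u"
  using cf[of x] by auto

lemma qtser_eqI: "(\<And>b. cf x b = cf y b) \<Longrightarrow> x = y"
  by (metis cf_inject ext)

lemma cf_mkser: "(\<And>b. x b \<noteq> 0 \<Longrightarrow> b \<le> u) \<Longrightarrow> cf (mkser x) = x"
  by (rule mkser_inverse) blast

instantiation qtser :: (finite) ab_group_add
begin

lift_definition zero_qtser :: "'a qtser" is "\<lambda>_. 0" by simp

lift_definition plus_qtser :: "'a qtser \<Rightarrow> 'a qtser \<Rightarrow> 'a qtser" is "\<lambda>x y b. x b + y b"
proof -
  fix x y :: "int^'a \<Rightarrow> 'a lpoly"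
  assume "\<exists>u. \<forall>b. x b \<noteq> 0 \<longrightarrow> b \<le> u" "\<exists>u. \<forall>b. y b \<noteq> 0 \<longrightarrow> b \<le> u"
  then obtain u v where "\<forall>b. x b \<noteq> 0 \<longrightarrow> b \<le> u" "\<forall>b. y b \<noteq> 0 \<longrightarrow> b \<le> v" by blast
  moreover obtain w where "u \<le> w" "v \<le> w" using vec_ub by blast
  ultimately have "b \<le> w" if "x b + y b \<noteq> 0" for b
    using that by (cases "x b = 0") (auto intro: order_trans)
  then show "\<exists>u. \<forall>b. x b + y b \<noteq> 0 \<longrightarrow> b \<le> u" by blast
qed

lift_definition uminus_qtser :: "'a qtser \<Rightarrow> 'a qtser" is "\<lambda>x b. - x b" by simp

definition minus_qtser :: "'a qtser \<Rightarrow> 'a qtser \<Rightarrow> 'a qtser" where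
  "minus_qtser x y = x + - y"

instance
  by standard (transfer; simp add: add_ac minus_qtser_def ext)+

end

lemma cf_0 [simp]: "cf 0 b = 0" by transfer simp
lemma cf_add [simp]: "cf (x + y) b = cf x b + cf y b" by transfer simp
lemma cf_minus [simp]: "cf (- x) b = - cf x b" by transfer simp
lemma cf_diff [simp]: "cf (x - y) b = cf x b - cf y b"
  unfolding minus_qtser_def by (simp only: cf_add cf_minus diff_conv_add_uminus)
lemma cf_sum: "cf (sum f A) b = (\<Sum>x\<in>A. cf (f x) b)"
  by (induction A rule: infinite_finite_induct) simp_all

lemma finite_conv_support:
  "finite {b1. cf x b1 \<noteq> 0 \<and> cf y (b - b1) \<noteq> 0}"
proof -
  obtain u where u: "\<And>b. cf x b \<noteq> 0 \<Longrightarrow> b \<le> u" using cf_bounded by blast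
  obtain v where v: "\<And>b. cf y b \<noteq> 0 \<Longrightarrow> b \<le> v" using cf_bounded by blast
  have "{b1. cf x b1 \<noteq> 0 \<and> cf y (b - b1) \<noteq> 0} \<subseteq> {b1. b - v \<le> b1 \<and> b1 \<le> u}"
  proof safe
    fix b1 assume "cf x b1 \<noteq> 0" "cf y (b - b1) \<noteq> 0"
    then have "b1 \<le> u" "b - b1 \<le> v" using u v by blast+
    then show "b - v \<le> b1" "b1 \<le> u" by (auto simp: less_eq_vec_def algebra_simps)
  qed
  then show ?thesis using finite_int_box finite_subset by blast
qed

instantiation qtser :: (finite) ring_1
begin

lift_definition one_qtser :: "'a qtser" is "\<lambda>b. if b = 0 then 1 else 0"
  by (rule exI[of _ 0]) simp

definition times_qtser :: "'a qtser \<Rightarrow> 'a qtser \<Rightarrow> 'a qtser" where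
  "times_qtser x y = mkser (\<lambda>b. \<Sum>b1 | cf x b1 \<noteq> 0 \<and> cf y (b - b1) \<noteq> 0. cf x b1 * tw b1 (cf y (b - b1)))"

lemma cf_mult_raw:
  fixes x y :: "'a qtser"
  shows "cf (x * y) b = (\<Sum>b1 | cf x b1 \<noteq> 0 \<and> cf y (b - b1) \<noteq> 0. cf x b1 * tw b1 (cf y (b - b1)))"
proof -
  obtain u where u: "\<And>b. cf x b \<noteq> 0 \<Longrightarrow> b \<le> u" using cf_bounded by blast
  obtain v where v: "\<And>b. cf y b \<noteq> 0 \<Longrightarrow> b \<le> v" using cf_bounded by blast
  have "cf (x * y) = (\<lambda>b. \<Sum>b1 | cf x b1 \<noteq> 0 \<and> cf y (b - b1) \<noteq> 0. cf x b1 * tw b1 (cf y (b - b1)))"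
    unfolding times_qtser_def
  proof (rule cf_mkser)
    fix b
    assume "(\<Sum>b1 | cf x b1 \<noteq> 0 \<and> cf y (b - b1) \<noteq> 0. cf x b1 * tw b1 (cf y (b - b1))) \<noteq> 0"
    then obtain b1 where "cf x b1 \<noteq> 0" "cf y (b - b1) \<noteq> 0" by (auto elim: sum.not_neutral_contains_not_neutral)
    then have "b1 \<le> u" "b - b1 \<le> v" using u v by blast+
    then have "b1 $ i \<le> u $ i" "b $ i - b1 $ i \<le> v $ i" for i by (auto simp: less_eq_vec_def)
    then show "b \<le> u + v"
      unfolding less_eq_vec_def vector_add_component by (smt (verit, best))
  qed
  then show ?thesis by simp
qed

lemma cf_mult_superset:
  fixes x y :: "'a qtser"
  assumes "finite B" "\<And>b1. cf x b1 \<noteq> 0 \<Longrightarrow> cf y (b - b1) \<noteq> 0 \<Longrightarrow> b1 \<in> B"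
  shows "cf (x * y) b = (\<Sum>b1\<in>B. cf x b1 * tw b1 (cf y (b - b1)))"
  unfolding cf_mult_raw using assms by (intro sum.mono_neutral_left) auto

instance
proof
  fix x y z :: "'a qtser"
  show "x * y * z = x * (y * z)"
  proof (rule qtser_eqI)
    fix b
    obtain u where u: "\<And>b. cf x b \<noteq> 0 \<Longrightarrow> b \<le> u" using cf_bounded by blast
    obtain v where v: "\<And>b. cf y b \<noteq> 0 \<Longrightarrow> b \<le> v" using cf_bounded by blast
    obtain w where w: "\<And>b. cf z b \<noteq> 0 \<Longrightarrow> b \<le> w" using cf_bounded by blast
    \<comment> \<open>For fixed b the upper bounds of the three supports confine the exponents of x,
      of y and of the partial product to finite boxes, so associativity becomes an exchange of
      finite sums.\<close>
    define X where "X = {c. b - v - w \<le> c \<and> c \<le> u}"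
    define Y where "Y = {c. b - u - w \<le> c \<and> c \<le> v}"
    define Z where "Z = {c. b - w \<le> c \<and> c \<le> u + v}"
    have fin: "finite X" "finite Y" "finite Z"
      by (simp_all add: X_def Y_def Z_def finite_int_box)
    have key: "b1 \<in> X \<and> b2 \<in> Y \<and> b1 + b2 \<in> Z"
      if "cf x b1 \<noteq> 0" "cf y b2 \<noteq> 0" "cf z (b - b1 - b2) \<noteq> 0" for b1 b2
    proof -
      have "b1 \<le> u" "b2 \<le> v" "b - b1 - b2 \<le> w" using that u v w by blast+
      then have "b1 $ i \<le> u $ i" "b2 $ i \<le> v $ i" "b $ i - b1 $ i - b2 $ i \<le> w $ i" for i
        by (auto simp: less_eq_vec_def)
      then show ?thesis
        unfolding X_def Y_def Z_def less_eq_vec_def mem_Collect_eq vector_add_component vector_minus_component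
        by (smt (verit, best))
    qed
    have "cf (x * y * z) b = (\<Sum>c\<in>Z. cf (x * y) c * tw c (cf z (b - c)))"
    proof (rule cf_mult_superset[OF fin(3)])
      fix c assume "cf (x * y) c \<noteq> 0" "cf z (b - c) \<noteq> 0"
      then obtain b1 where "cf x b1 \<noteq> 0" "cf y (c - b1) \<noteq> 0"
        unfolding cf_mult_raw by (auto elim: sum.not_neutral_contains_not_neutral)
      then show "c \<in> Z" using key[of b1 "c - b1"] \<open>cf z (b - c) \<noteq> 0\<close> by simp
    qed
    also have "\<dots> = (\<Sum>c\<in>Z. \<Sum>b1\<in>X. cf x b1 * tw b1 (cf y (c - b1)) * tw c (cf z (b - c)))"
    proof (rule sum.cong[OF refl])
      fix c
      show "cf (x * y) c * tw c (cf z (b - c)) = (\<Sum>b1\<in>X. cf x b1 * tw b1 (cf y (c - b1)) * tw c (cf z (b - c)))"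
      proof (cases "cf z (b - c) = 0")
        case False
        have "cf (x * y) c = (\<Sum>b1\<in>X. cf x b1 * tw b1 (cf y (c - b1)))"
          by (rule cf_mult_superset[OF fin(1)]) (use key[of _ "c - _"] False in simp)
        then show ?thesis by (simp add: sum_distrib_right)
      qed simp
    qed
    also have "\<dots> = (\<Sum>b1\<in>X. \<Sum>c\<in>Z. cf x b1 * tw b1 (cf y (c - b1)) * tw c (cf z (b - c)))"
      by (rule sum.swap)
    also have "\<dots> = (\<Sum>b1\<in>X. \<Sum>b2\<in>Y. cf x b1 * tw b1 (cf y b2 * tw b2 (cf z (b - b1 - b2))))"
    proof (rule sum.cong[OF refl])
      fix b1
      have "(\<Sum>c\<in>Z. cf x b1 * tw b1 (cf y (c - b1)) * tw c (cf z (b - c)))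
        = (\<Sum>c\<in>(\<lambda>b2. b1 + b2) ` Y. cf x b1 * tw b1 (cf y (c - b1)) * tw c (cf z (b - c)))"
      proof (rule sum.mono_neutral_cong)
        show "cf x b1 * tw b1 (cf y (c - b1)) * tw c (cf z (b - c)) = 0" if "c \<in> Z - (+) b1 ` Y" for c
        proof (rule ccontr)
          assume "\<not> ?thesis"
          then have "cf x b1 \<noteq> 0" "cf y (c - b1) \<noteq> 0" "cf z (b - b1 - (c - b1)) \<noteq> 0" by auto
          then have "c - b1 \<in> Y" using key by blast
          then show False using that by (metis DiffD2 add_diff_cancel_left' diff_add_cancel add.commute imageI)
        qed
        show "cf x b1 * tw b1 (cf y (c - b1)) * tw c (cf z (b - c)) = 0" if "c \<in> (+) b1 ` Y - Z" for c
        proof (rule ccontr)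
          assume "\<not> ?thesis"
          then have "cf x b1 \<noteq> 0" "cf y (c - b1) \<noteq> 0" "cf z (b - b1 - (c - b1)) \<noteq> 0" by auto
          then have "b1 + (c - b1) \<in> Z" using key by blast
          then show False using that by simp
        qed
      qed (use fin in auto)
      also have "\<dots> = (\<Sum>b2\<in>Y. cf x b1 * tw b1 (cf y b2 * tw b2 (cf z (b - b1 - b2))))"
        by (subst sum.reindex) (auto simp: o_def tw_tw mult.assoc algebra_simps intro!: sum.cong inj_onI)
      finally show "(\<Sum>c\<in>Z. cf x b1 * tw b1 (cf y (c - b1)) * tw c (cf z (b - c)))
          = (\<Sum>b2\<in>Y. cf x b1 * tw b1 (cf y b2 * tw b2 (cf z (b - b1 - b2))))" .
    qed
    also have "\<dots> = (\<Sum>b1\<in>X. cf x b1 * tw b1 (cf (y * z) (b - b1)))"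
    proof (rule sum.cong[OF refl])
      fix b1
      show "(\<Sum>b2\<in>Y. cf x b1 * tw b1 (cf y b2 * tw b2 (cf z (b - b1 - b2))))
          = cf x b1 * tw b1 (cf (y * z) (b - b1))"
      proof (cases "cf x b1 = 0")
        case False
        have "cf (y * z) (b - b1) = (\<Sum>b2\<in>Y. cf y b2 * tw b2 (cf z (b - b1 - b2)))"
          by (rule cf_mult_superset[OF fin(2)]) (use key[of b1] False in blast)
        then show ?thesis by (simp add: tw_sum sum_distrib_left)
      qed simp
    qed
    also have "\<dots> = cf (x * (y * z)) b"
    proof (rule cf_mult_superset[OF fin(1), symmetric])
      fix b1 assume "cf x b1 \<noteq> 0" "cf (y * z) (b - b1) \<noteq> 0"
      then obtain b2 where "cf y b2 \<noteq> 0" "cf z (b - b1 - b2) \<noteq> 0"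
        unfolding cf_mult_raw by (auto elim: sum.not_neutral_contains_not_neutral)
      then show "b1 \<in> X" using key \<open>cf x b1 \<noteq> 0\<close> by blast
    qed
    finally show "cf (x * y * z) b = cf (x * (y * z)) b" .
  qed
  show "(x + y) * z = x * z + y * z"
  proof (rule qtser_eqI)
    fix b
    let ?B = "{b1. cf x b1 \<noteq> 0 \<and> cf z (b - b1) \<noteq> 0} \<union> {b1. cf y b1 \<noteq> 0 \<and> cf z (b - b1) \<noteq> 0}"
    have f: "finite ?B" by (simp add: finite_conv_support)
    have "cf ((x + y) * z) b = (\<Sum>b1\<in>?B. cf (x + y) b1 * tw b1 (cf z (b - b1)))"
      by (rule cf_mult_superset[OF f]) auto
    moreover have "cf (x * z) b = (\<Sum>b1\<in>?B. cf x b1 * tw b1 (cf z (b - b1)))"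
      by (rule cf_mult_superset[OF f]) auto
    moreover have "cf (y * z) b = (\<Sum>b1\<in>?B. cf y b1 * tw b1 (cf z (b - b1)))"
      by (rule cf_mult_superset[OF f]) auto
    ultimately show "cf ((x + y) * z) b = cf (x * z + y * z) b"
      by (simp add: ring_distribs sum.distrib)
  qed
  show "x * (y + z) = x * y + x * z"
  proof (rule qtser_eqI)
    fix b
    let ?B = "{b1. cf x b1 \<noteq> 0 \<and> cf y (b - b1) \<noteq> 0} \<union> {b1. cf x b1 \<noteq> 0 \<and> cf z (b - b1) \<noteq> 0}"
    have f: "finite ?B" by (simp add: finite_conv_support)
    have "cf (x * (y + z)) b = (\<Sum>b1\<in>?B. cf x b1 * tw b1 (cf (y + z) (b - b1)))"
      by (rule cf_mult_superset[OF f]) auto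
    moreover have "cf (x * y) b = (\<Sum>b1\<in>?B. cf x b1 * tw b1 (cf y (b - b1)))"
      by (rule cf_mult_superset[OF f]) auto
    moreover have "cf (x * z) b = (\<Sum>b1\<in>?B. cf x b1 * tw b1 (cf z (b - b1)))"
      by (rule cf_mult_superset[OF f]) auto
    ultimately show "cf (x * (y + z)) b = cf (x * y + x * z) b"
      by (simp add: ring_distribs sum.distrib)
  qed
  have one: "cf 1 b = (if b = 0 then 1 else 0)" for b :: "int^'a" by transfer simp
  show "1 * x = x"
  proof (rule qtser_eqI)
    fix b
    have "cf (1 * x) b = (\<Sum>b1\<in>{0}. cf 1 b1 * tw b1 (cf x (b - b1)))"
      by (rule cf_mult_superset) (auto simp: one split: if_splits)
    then show "cf (1 * x) b = cf x b" by (simp add: one)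
  qed
  show "x * 1 = x"
  proof (rule qtser_eqI)
    fix b
    have "cf (x * 1) b = (\<Sum>b1\<in>{b}. cf x b1 * tw b1 (cf 1 (b - b1)))"
      by (rule cf_mult_superset) (auto simp: one split: if_splits)
    then show "cf (x * 1) b = cf x b" by (simp add: one)
  qed
  show "(0 :: 'a qtser) \<noteq> 1" by (metis cf_0 one zero_neq_one)
qed

end

lemma cf_1: "cf 1 b = (if b = 0 then 1 else 0)"
  by transfer simp

definition qmon :: "'r::finite lpoly \<Rightarrow> int^'r \<Rightarrow> 'r qtser" where
  "qmon d b = mkser (\<lambda>b'. if b' = b then d else 0)"

lemma cf_qmon: "cf (qmon d b) b' = (if b' = b then d else 0)"
proof -
  have "cf (qmon d b) = (\<lambda>b'. if b' = b then d else 0)"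
    unfolding qmon_def by (rule cf_mkser[of _ b]) (simp split: if_splits)
  then show ?thesis by simp
qed

lemma cf_qmon_mult: "cf (qmon d b * x) b' = d * tw b (cf x (b' - b))"
proof -
  have "cf (qmon d b * x) b' = (\<Sum>b1\<in>{b}. cf (qmon d b) b1 * tw b1 (cf x (b' - b1)))"
    by (rule cf_mult_superset) (simp_all add: cf_qmon split: if_splits)
  then show ?thesis by (simp add: cf_qmon)
qed

lemma cf_mult_qmon: "cf (x * qmon d b) b' = cf x (b' - b) * tw (b' - b) d"
proof -
  have "b1 = b' - b" if "cf (qmon d b) (b' - b1) \<noteq> 0" for b1
    using that by (auto simp: cf_qmon split: if_splits)
  then have "cf (x * qmon d b) b' = (\<Sum>b1\<in>{b' - b}. cf x b1 * tw b1 (cf (qmon d b) (b' - b1)))"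
    by (intro cf_mult_superset) auto
  then show ?thesis by (simp add: cf_qmon)
qed

lemma qmon_mult: "qmon d b * qmon d' b' = qmon (d * tw b d') (b + b')"
proof (rule qtser_eqI)
  fix x
  have "x - b = b' \<longleftrightarrow> x = b + b'" by (metis add.commute diff_eq_eq)
  then show "cf (qmon d b * qmon d' b') x = cf (qmon (d * tw b d') (b + b')) x"
    by (simp add: cf_qmon_mult cf_qmon)
qed

lemma qmon_0 [simp]: "qmon 0 b = 0"
  by (rule qtser_eqI) (simp add: cf_qmon)

lemma qmon_add: "qmon (d + d') b = qmon d b + qmon d' b"
  by (rule qtser_eqI) (simp add: cf_qmon)

lemma qmon_diff: "qmon (d - d') b = qmon d b - qmon d' b"
  by (rule qtser_eqI) (simp add: cf_qmon)

lemma qmon_one: "qmon 1 0 = 1"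
  by (rule qtser_eqI) (simp add: cf_qmon cf_1)

definition scl :: "laurent \<Rightarrow> 'r::finite qtser \<Rightarrow> 'r qtser" (infixr \<open>\<star>\<close> 75) where
  "c \<star> x = qmon (sD c) 0 * x"

lemma cf_scl [simp]: "cf (c \<star> x) b = sD c * cf x b"
  by (simp add: scl_def cf_qmon_mult)

lemma scl_mult [simp]: "(c \<star> x) * y = c \<star> (x * y)"
  by (simp add: scl_def mult.assoc)

lemma mult_scl [simp]: "x * (c \<star> y) = c \<star> (x * y)"
proof -
  have "x * qmon (sD c) 0 = qmon (sD c) 0 * x"
    by (rule qtser_eqI) (simp add: cf_qmon_mult cf_mult_qmon mult.commute)
  then show ?thesis by (metis scl_def mult.assoc)
qed

lemma scl_scl [simp]: "c \<star> (d \<star> x) = (c * d) \<star> x"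
  by (rule qtser_eqI) (simp add: mult_single flip: mult.assoc)

lemma scl_1 [simp]: "1 \<star> x = x"
  by (simp add: scl_def qmon_one)

lemma scl_0 [simp]: "0 \<star> x = 0" "c \<star> 0 = 0"
  by (simp_all add: scl_def)

lemma scl_add_left: "(c + d) \<star> x = c \<star> x + d \<star> x"
  by (simp add: scl_def single_add qmon_add ring_distribs)

lemma scl_diff_left: "(c - d) \<star> x = c \<star> x - d \<star> x"
  by (simp add: scl_def single_diff qmon_diff ring_distribs)

lemma scl_add_right: "c \<star> (x + y) = c \<star> x + c \<star> y"
  by (simp add: scl_def ring_distribs)

lemma scl_diff_right: "c \<star> (x - y) = c \<star> x - c \<star> y"
  by (simp add: scl_def ring_distribs)

lemma scl_minus [simp]: "c \<star> (- x) = - (c \<star> x)"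
  by (simp add: scl_def)

lemma scl_minus_left [simp]: "(- c) \<star> x = - (c \<star> x)"
  using scl_diff_left[of 0 c x] by simp

lemma scl_qmon [simp]: "c \<star> qmon d b = qmon (sD c * d) b"
  by (simp add: scl_def qmon_mult)

section \<open>Inverses, powers and q-commuting elements\<close>

definition is_inv :: "'a::ring_1 \<Rightarrow> 'a \<Rightarrow> bool" where
  "is_inv x y \<longleftrightarrow> x * y = 1 \<and> y * x = 1"

definition uinv :: "'a::ring_1 \<Rightarrow> 'a" where
  "uinv x = (SOME y. is_inv x y)"

definition isu :: "'a::ring_1 \<Rightarrow> bool" where
  "isu x \<longleftrightarrow> (\<exists>y. is_inv x y)"

lemma isu_inv: "isu x \<Longrightarrow> is_inv x (uinv x)"
  unfolding isu_def uinv_def by (rule someI_ex)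

lemma is_inv_unique: "is_inv x y \<Longrightarrow> is_inv x z \<Longrightarrow> y = z"
  unfolding is_inv_def by (metis mult.assoc mult_1_left mult_1_right)

lemma uinvI: "is_inv x y \<Longrightarrow> uinv x = y"
  by (metis is_inv_unique isu_def isu_inv)

lemma uinv_left [simp]: "isu x \<Longrightarrow> uinv x * x = 1"
  and uinv_right [simp]: "isu x \<Longrightarrow> x * uinv x = 1"
  using isu_inv by (auto simp: is_inv_def)

lemma uinv_left' [simp]: "isu x \<Longrightarrow> uinv x * (x * z) = z"
  and uinv_right' [simp]: "isu x \<Longrightarrow> x * (uinv x * z) = z"
  by (simp_all flip: mult.assoc)

lemma isu_cancel_right: "isu x \<Longrightarrow> y * x = z * x \<longleftrightarrow> y = z"
  by (metis mult.assoc mult_1_right uinv_right)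

definition pw :: "'a::ring_1 \<Rightarrow> int \<Rightarrow> 'a" where
  "pw x k = (if k \<ge> 0 then x ^ nat k else uinv x ^ nat (- k))"

lemma pw_0 [simp]: "pw x 0 = 1"
  by (simp add: pw_def)

lemma pw_1 [simp]: "pw x 1 = x"
  by (simp add: pw_def)

lemma pw_Suc:
  assumes "isu x"
  shows "pw x (k + 1) = pw x k * x"
proof (cases "k \<ge> 0")
  case True
  then have "nat (k + 1) = Suc (nat k)" by simp
  then show ?thesis using True by (simp add: pw_def power_commutes del: power_Suc) (simp add: power_commutes)
next
  case False
  then have "nat (- k) = Suc (nat (- (k + 1)))" by simp
  then have "uinv x ^ nat (- k) * x = uinv x ^ nat (- (k + 1))"
    by (simp only: power_Suc2 mult.assoc) (simp add: assms)
  then show ?thesis using False by (auto simp: pw_def)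
qed

lemma pw_add:
  assumes "isu x"
  shows "pw x (k + l) = pw x k * pw x l"
proof (induction l rule: int_induct[where k = 0])
  case base show ?case by simp
next
  case (step1 i)
  then show ?case using pw_Suc[OF assms, of "k + i"] pw_Suc[OF assms, of i]
    by (metis add.assoc mult.assoc)
next
  case (step2 i)
  have "pw x (k + (i - 1)) * x = pw x k * pw x (i - 1) * x"
    using pw_Suc[OF assms, of "k + (i - 1)"] pw_Suc[OF assms, of "i - 1"] step2.IH
    by (simp add: mult.assoc add.assoc)
  then show ?case using assms by (simp only: isu_cancel_right)
qed

definition qcomm :: "int \<Rightarrow> 'r::finite qtser \<Rightarrow> 'r qtser \<Rightarrow> bool" where
  "qcomm k x y \<longleftrightarrow> x * y = tpow k \<star> (y * x)"

lemma qcomm_1 [simp]: "qcomm 0 x 1" "qcomm 0 1 x"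
  by (simp_all add: qcomm_def)

lemma qcomm_sym: "qcomm k x y \<Longrightarrow> qcomm (- k) y x"
  by (simp add: qcomm_def flip: tpow_add)

lemma qcomm_mult_right: "qcomm k x y \<Longrightarrow> qcomm l x z \<Longrightarrow> qcomm (k + l) x (y * z)"
proof -
  assume a: "qcomm k x y" "qcomm l x z"
  have "x * (y * z) = tpow k \<star> (y * (x * z))"
    by (simp only: mult.assoc[symmetric] a(1)[unfolded qcomm_def] scl_mult)
  also have "\<dots> = tpow (k + l) \<star> (y * z * x)"
    using a(2)[unfolded qcomm_def] by (simp only: mult_scl scl_scl tpow_add mult.assoc)
  finally show ?thesis by (simp only: qcomm_def)
qed

lemma qcomm_uinv:
  assumes "qcomm k x y" "isu y"
  shows "qcomm (- k) x (uinv y)"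
proof -
  have "uinv y * (x * y) * uinv y = uinv y * (tpow k \<star> (y * x)) * uinv y"
    using assms(1) by (simp add: qcomm_def)
  then have "uinv y * x = tpow k \<star> (x * uinv y)"
    using assms(2) by (simp add: mult.assoc)
  then show ?thesis by (simp add: qcomm_def flip: tpow_add)
qed

lemma qcomm_power: "qcomm k x y \<Longrightarrow> qcomm (int n * k) x (y ^ n)"
proof (induction n)
  case (Suc n)
  then show ?case using qcomm_mult_right[of k x y "int n * k" "y ^ n"] by (simp add: ring_distribs)
qed simp

lemma qcomm_pw:
  assumes "qcomm k x y" "isu y"
  shows "qcomm (l * k) x (pw y l)"
proof (cases "l \<ge> 0")
  case True
  then show ?thesis using qcomm_power[OF assms(1), of "nat l"] by (simp add: pw_def)
next
  case False
  then show ?thesis using qcomm_power[OF qcomm_uinv[OF assms], of "nat (- l)"] by (simp add: pw_def)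
qed

lemma qcomm_prod_list:
  assumes "\<And>i. i \<in> set is \<Longrightarrow> qcomm (k i) x (f i)"
  shows "qcomm (sum_list (map k is)) x (prod_list (map f is))"
  using assms by (induction "is") (simp_all add: qcomm_mult_right)

lemma prod_list_mult_qcomm:
  fixes f g :: "'i \<Rightarrow> 'r::finite qtser"
  assumes "\<And>i j. qcomm 0 (f i) (g j)"
  shows "prod_list (map (\<lambda>i. f i * g i) is) = prod_list (map f is) * prod_list (map g is)"
proof (induction "is")
  case (Cons i "is")
  have "qcomm (sum_list (map (\<lambda>_. 0) is)) (g i) (prod_list (map f is))"
    by (rule qcomm_prod_list) (use qcomm_sym[OF assms] in simp)
  then have "g i * prod_list (map f is) = prod_list (map f is) * g i"
    by (simp add: qcomm_def)
  then have "f i * g i * (prod_list (map f is) * prod_list (map g is))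
      = f i * (prod_list (map f is) * g i) * prod_list (map g is)"
    by (metis mult.assoc)
  then show ?case using Cons by (simp add: mult.assoc)
qed simp

section \<open>The degree filtration and geometric series\<close>

definition tot :: "int^'r::finite \<Rightarrow> int" where
  "tot b = (\<Sum>i\<in>UNIV. b $ i)"

lemma tot_add [simp]: "tot (a + b) = tot a + tot b"
  by (simp add: tot_def sum.distrib)

lemma tot_minus [simp]: "tot (- a) = - tot a"
  by (simp add: tot_def sum_negf)

lemma tot_diff [simp]: "tot (a - b) = tot a - tot b"
  by (simp add: tot_def sum_subtractf)

lemma tot_0 [simp]: "tot 0 = 0"
  by (simp add: tot_def)

lemma tot_mono: "a \<le> b \<Longrightarrow> tot a \<le> tot b"
  by (simp add: tot_def less_eq_vec_def sum_mono)

text \<open>In \<lambda>-coordinates \<open>tot\<close> becomes the grading b -> \<open>kap\<close>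
  . b (\<open>tot_Lm\<close>), in which every Q_{\<alpha>,1} has positive degree. A larger N means
  deeper terms.\<close>

definition fl :: "int \<Rightarrow> 'r::finite qtser \<Rightarrow> bool" where
  "fl N x \<longleftrightarrow> (\<forall>b. cf x b \<noteq> 0 \<longrightarrow> tot b \<le> - N)"

lemma cf_mult_nonzero:
  assumes "cf (x * y) b \<noteq> 0"
  obtains b1 b2 where "cf x b1 \<noteq> 0" "cf y b2 \<noteq> 0" "b = b1 + b2"
proof -
  obtain b1 where "cf x b1 \<noteq> 0" "cf y (b - b1) \<noteq> 0"
    using assms unfolding cf_mult_raw by (auto elim: sum.not_neutral_contains_not_neutral)
  then show thesis using that[of b1 "b - b1"] by simp
qed

lemma fl_mult: "fl M x \<Longrightarrow> fl N y \<Longrightarrow> fl (M + N) (x * y)"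
  unfolding fl_def by (smt (verit) cf_mult_nonzero tot_add)

lemma fl_add: "fl N x \<Longrightarrow> fl N y \<Longrightarrow> fl N (x + y)"
  unfolding fl_def by (metis add.right_neutral cf_add)

lemma fl_mono: "fl N x \<Longrightarrow> M \<le> N \<Longrightarrow> fl M x"
  by (auto simp: fl_def)

lemma fl_ex: "\<exists>N. fl N x"
proof -
  obtain u where "\<And>b. cf x b \<noteq> 0 \<Longrightarrow> b \<le> u" using cf_bounded by blast
  then have "fl (- tot u) x" unfolding fl_def using tot_mono by fastforce
  then show ?thesis ..
qed

text \<open>Each factor \<open>h\<close> lowers the total degree by at least one, so every
  coefficient of the series is already that of a partial sum. The second conclusion is what later
  carries properties from \<open>h\<close> to the inverse.\<close>

lemma geometric_series:
  fixes h :: "'r::finite qtser"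
  assumes h: "\<And>b. cf h b \<noteq> 0 \<Longrightarrow> b \<le> 0 \<and> b \<noteq> 0"
  shows "\<exists>g. is_inv (1 - h) g \<and> (\<forall>b. \<exists>N. cf g b = cf (\<Sum>n\<le>N. h ^ n) b)"
proof -
  have hn: "b \<le> 0 \<and> tot b \<le> - int n" if "cf (h ^ n) b \<noteq> 0" for n b
    using that
  proof (induction n arbitrary: b)
    case 0
    then show ?case by (auto simp: cf_1 split: if_splits)
  next
    case (Suc n)
    then obtain b1 b2 where b: "cf h b1 \<noteq> 0" "cf (h ^ n) b2 \<noteq> 0" "b = b1 + b2"
      by (auto elim: cf_mult_nonzero)
    have b1: "b1 $ i \<le> 0" for i using h[OF b(1)] by (simp add: less_eq_vec_def)
    have "\<exists>i. b1 $ i < 0" using h[OF b(1)] b1 by (metis order.not_eq_order_implies_strict vec_eq_iff zero_index)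
    then have "tot b1 < 0" unfolding tot_def using b1
      by (intro sum_strict_mono_ex1[of UNIV "\<lambda>i. b1 $ i" "\<lambda>_. 0", simplified]) auto
    moreover have "b2 \<le> 0" "tot b2 \<le> - int n" using Suc.IH[OF b(2)] by auto
    ultimately show ?case using b1 b(3) by (auto simp: less_eq_vec_def add_nonpos_nonpos)
  qed
  define gN where "gN N = (\<Sum>n\<le>N. h ^ n)" for N
  \<comment> \<open>\<open>h ^ n\<close> lives in degrees at most -n, so powers beyond
    -\<open>tot b\<close> do not reach the coefficient at b.\<close>
  define g where "g = mkser (\<lambda>b. cf (gN (nat (- tot b))) b)"
  have "cf g = (\<lambda>b. cf (gN (nat (- tot b))) b)"
    unfolding g_def
  proof (rule cf_mkser)
    fix b assume "cf (gN (nat (- tot b))) b \<noteq> 0"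
    then obtain n where "cf (h ^ n) b \<noteq> 0"
      unfolding gN_def cf_sum by (auto elim: sum.not_neutral_contains_not_neutral)
    then show "b \<le> 0" using hn by blast
  qed
  then have cfg: "cf g b = cf (gN (nat (- tot b))) b" for b by simp
  have gN: "cf g b = cf (gN N) b" if "nat (- tot b) \<le> N" for b N
  proof -
    have "cf (gN N) b = cf (gN (nat (- tot b))) b"
      unfolding gN_def cf_sum
    proof (rule sum.mono_neutral_right)
      show "\<forall>i\<in>{..N} - {..nat (- tot b)}. cf (h ^ i) b = 0"
        using hn by fastforce
    qed (use that in auto)
    then show ?thesis by (simp add: cfg)
  qed
  have one: "(1 - h) * gN N = 1 - h ^ Suc N \<and> gN N * (1 - h) = 1 - h ^ Suc N" for N
  proof (induction N)
    case (Suc N)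
    have "gN (Suc N) = gN N + h ^ Suc N" by (simp add: gN_def)
    then show ?case using Suc by (simp only: distrib_left distrib_right)
        (simp add: left_diff_distrib right_diff_distrib power_commutes mult.assoc)
  qed (simp add: gN_def)
  have hle: "b \<le> 0" if "cf (1 - h) b \<noteq> 0" for b
    using that h[of b] by (auto simp: cf_1 split: if_splits)
  have sh: "nat (- tot (b - b1)) \<le> nat (- tot b)" if "cf (1 - h) b1 \<noteq> 0" for b b1
    using tot_mono[OF hle[OF that]] by simp
  have hz: "cf (h ^ Suc (nat (- tot b))) b = 0" for b
  proof (rule ccontr)
    assume "\<not> ?thesis"
    then have "tot b \<le> - int (Suc (nat (- tot b)))" using hn by blast
    then show False by linarith
  qed
  have "(1 - h) * g = 1"
  proof (rule qtser_eqI)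
    fix b :: "int^'r"
    let ?N = "nat (- tot b)"
    let ?B = "{b1. cf (1 - h) b1 \<noteq> 0 \<and> cf g (b - b1) \<noteq> 0}"
    have g': "cf g (b - b1) = cf (gN ?N) (b - b1)" if "cf (1 - h) b1 \<noteq> 0" for b1
      by (rule gN) (rule sh[OF that])
    have "cf ((1 - h) * g) b = (\<Sum>b1\<in>?B. cf (1 - h) b1 * tw b1 (cf (gN ?N) (b - b1)))"
      unfolding cf_mult_raw[of _ g] by (intro sum.cong refl) (simp add: g' del: cf_diff)
    also have "\<dots> = cf ((1 - h) * gN ?N) b"
      by (rule cf_mult_superset[symmetric]) (simp_all add: finite_conv_support g' del: cf_diff)
    finally show "cf ((1 - h) * g) b = cf 1 b" by (simp add: one hz del: power_Suc)
  qed
  moreover have "g * (1 - h) = 1"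
  proof (rule qtser_eqI)
    fix b :: "int^'r"
    let ?N = "nat (- tot b)"
    let ?B = "{b1. cf g b1 \<noteq> 0 \<and> cf (1 - h) (b - b1) \<noteq> 0}"
    have g': "cf g b1 = cf (gN ?N) b1" if "cf (1 - h) (b - b1) \<noteq> 0" for b1
      using gN[of b1 ?N] sh[OF that, of b] by simp
    have "cf (g * (1 - h)) b = (\<Sum>b1\<in>?B. cf (gN ?N) b1 * tw b1 (cf (1 - h) (b - b1)))"
      unfolding cf_mult_raw[of g] by (intro sum.cong refl) (simp add: g' del: cf_diff)
    also have "\<dots> = cf (gN ?N * (1 - h)) b"
      by (rule cf_mult_superset[symmetric])
        (simp_all add: finite_conv_support[of g "1 - h" b] g' del: cf_diff)
    finally show "cf (g * (1 - h)) b = cf 1 b" by (simp add: one hz del: power_Suc)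
  qed
  ultimately show ?thesis using cfg unfolding is_inv_def gN_def by blast
qed

section \<open>Positivity of the Cartan matrix\<close>

lemma matvec_int_nth: "(A *v x) $ i = (\<Sum>j\<in>UNIV. A $ i $ j * x $ j)" for A :: "int^'n::finite^'m::finite"
  by (simp add: matrix_vector_mult_def)

lemma matvec_int_add: "(A::int^'n::finite^'m::finite) *v (x + y) = A *v x + A *v y"
  by (simp add: vec_eq_iff matvec_int_nth ring_distribs sum.distrib)

lemma matvec_int_diff: "(A::int^'n::finite^'m::finite) *v (x - y) = A *v x - A *v y"
  by (simp add: vec_eq_iff matvec_int_nth ring_distribs sum_subtractf)

lemma matvec_int_minus: "(A::int^'n::finite^'m::finite) *v (- x) = - (A *v x)"
  by (simp add: vec_eq_iff matvec_int_nth sum_negf)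

lemma matvec_int_scale: "(A::int^'n::finite^'m::finite) *v (k *s x) = k *s (A *v x)"
  by (simp add: vec_eq_iff matvec_int_nth sum_distrib_left mult_ac)

lemma matvec_int_axis: "((A::int^'n::finite^'m::finite) *v axis j k) $ i = k * A $ i $ j"
proof -
  have "A $ i $ l * axis j k $ l = (if l = j then k * A $ i $ j else 0)" for l
    by (simp add: axis_def)
  then show ?thesis by (simp add: matvec_int_nth)
qed

lemma idot_matvec: "idot a ((A::int^'n::finite^'m::finite) *v b) = (\<Sum>i\<in>UNIV. \<Sum>j\<in>UNIV. a $ i * A $ i $ j * b $ j)"
  by (simp add: idot_def matvec_int_nth sum_distrib_left mult.assoc)

lemma idot_matvec_sym:
  fixes A :: "int^'n::finite^'n"
  assumes "\<And>i j. A $ i $ j = A $ j $ i"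
  shows "idot a (A *v b) = idot (A *v a) b"
proof -
  have "idot a (A *v b) = (\<Sum>j\<in>UNIV. \<Sum>i\<in>UNIV. a $ i * A $ i $ j * b $ j)"
    unfolding idot_matvec by (rule sum.swap)
  also have "\<dots> = (\<Sum>j\<in>UNIV. (\<Sum>i\<in>UNIV. A $ j $ i * a $ i) * b $ j)"
    unfolding sum_distrib_right by (intro sum.cong refl) (metis assms mult.commute)
  finally show ?thesis by (simp add: idot_def matvec_int_nth)
qed

locale simply_laced =
  fixes C :: "int^'r::{finite,linorder}^'r::{finite,linorder}"
  assumes slc: "simply_laced_cartan C"
begin

lemma C_sym: "C $ i $ j = C $ j $ i"
  using slc unfolding simply_laced_cartan_def by blast

lemma C_diag [simp]: "C $ i $ i = 2"
proof -
  have "\<forall>i. C $ i $ i = 2" using slc unfolding simply_laced_cartan_def by (rule conjunct1)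
  then show ?thesis ..
qed

lemma C_offdiag: "i \<noteq> j \<Longrightarrow> C $ i $ j = 0 \<or> C $ i $ j = - 1"
proof -
  assume "i \<noteq> j"
  moreover have "\<forall>i j. i \<noteq> j \<longrightarrow> C $ i $ j \<in> {0, - 1}"
    using slc unfolding simply_laced_cartan_def by (elim conjE)
  ultimately have "C $ i $ j \<in> {0, - 1}" by simp
  then show ?thesis by simp
qed

lemma C_offdiag_le: "i \<noteq> j \<Longrightarrow> C $ i $ j \<le> 0"
  using C_offdiag[of i j] by linarith

lemma C_connected: "S \<noteq> {} \<Longrightarrow> S \<noteq> UNIV \<Longrightarrow> \<exists>i\<in>S. \<exists>j\<in>- S. C $ i $ j \<noteq> 0"
  using slc unfolding simply_laced_cartan_def by (elim conjE) simp

lemma C_posdef_real: "x \<noteq> 0 \<Longrightarrow> x \<bullet> (real_matrix C *v x) > 0"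
  using slc unfolding simply_laced_cartan_def by (elim conjE) simp

lemma C_posdef:
  assumes "u \<noteq> 0"
  shows "idot u (C *v u) > 0"
proof -
  define x :: "(real, 'r) vec" where "x = (\<chi> i. real_of_int (u $ i))"
  have "x \<noteq> 0" using assms by (auto simp: x_def vec_eq_iff)
  then have "x \<bullet> (real_matrix C *v x) > 0" by (rule C_posdef_real)
  moreover have "x \<bullet> (real_matrix C *v x) = real_of_int (idot u (C *v u))"
    by (simp add: inner_vec_def matrix_vector_mult_def x_def real_matrix_def idot_def)
  ultimately show ?thesis by simp
qed

lemma C_nonneg: "idot u (C *v u) \<ge> 0"
  using C_posdef[of u] by (cases "u = 0") auto

text \<open>The segment from the identity to C consists of positive definite, hence invertible,
  matrices; the determinant starts at 1 and cannot cross zero.\<close>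

lemma det_pos: "det C > 0"
proof -
  define B where "B s = s *\<^sub>R real_matrix C + (1 - s) *\<^sub>R mat 1" for s :: real
  have nz: "det (B s) \<noteq> 0" if "0 \<le> s" "s \<le> 1" for s
  proof -
    have "x = 0" if x: "B s *v x = 0" for x
    proof (rule ccontr)
      assume "x \<noteq> 0"
      have "x \<bullet> (B s *v x) = s * (x \<bullet> (real_matrix C *v x)) + (1 - s) * (x \<bullet> x)"
        unfolding B_def by (simp add: matrix_vector_mult_add_rdistrib inner_add_right
            flip: scaleR_matrix_vector_assoc)
      moreover have "s * (x \<bullet> (real_matrix C *v x)) + (1 - s) * (x \<bullet> x) > 0"
      proof (cases "s = 0")
        case False
        then have "s * (x \<bullet> (real_matrix C *v x)) > 0"
          using C_posdef_real[OF \<open>x \<noteq> 0\<close>] \<open>0 \<le> s\<close> by simp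
        moreover have "(1 - s) * (x \<bullet> x) \<ge> 0" using \<open>s \<le> 1\<close> by simp
        ultimately show ?thesis by linarith
      qed (use \<open>x \<noteq> 0\<close> in simp)
      ultimately show False using x by simp
    qed
    then have "invertible (B s)"
      by (simp add: invertible_left_inverse matrix_left_invertible_ker)
    then show ?thesis by (simp add: invertible_det_nz)
  qed
  have cont: "continuous_on {0..1} (\<lambda>s. det (B s))"
    unfolding det_def B_def by (simp, intro continuous_intros)
  have "det (B 0) = 1" by (simp add: B_def)
  have "det (B 1) > 0"
  proof (rule ccontr)
    assume "\<not> det (B 1) > 0"
    then obtain s where "0 \<le> s" "s \<le> 1" "det (B s) = 0"
      using IVT2'[of "\<lambda>s. det (B s)" 1 0 0] cont \<open>det (B 0) = 1\<close> by fastforce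
    then show False using nz by blast
  qed
  then show ?thesis by (simp add: B_def det_real_matrix)
qed

abbreviation dl :: int where "dl \<equiv> det C"

text \<open>The M-matrix argument: pairing C u with the negative part w of u, the off-diagonal
  entries being nonpositive, gives w . C w \<le> 0, so w = 0.\<close>

lemma C_inv_nonneg:
  assumes "\<And>i. (C *v u) $ i \<ge> 0"
  shows "u $ i \<ge> 0"
proof -
  define w where "w = (\<chi> i. max 0 (- u $ i))"
  define p where "p = (\<chi> i. max 0 (u $ i))"
  have u: "u = p - w" by (simp add: vec_eq_iff p_def w_def max_def)
  have "idot w (C *v u) \<ge> 0"
    unfolding idot_def by (intro sum_nonneg mult_nonneg_nonneg assms) (simp add: w_def)
  moreover have "idot w (C *v p) \<le> 0"
    unfolding idot_matvec
  proof (intro sum_nonpos)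
    fix i j
    show "w $ i * C $ i $ j * p $ j \<le> 0"
    proof (cases "i = j")
      case True
      then show ?thesis by (auto simp: w_def p_def max_def)
    next
      case False
      have "w $ i \<ge> 0" "p $ j \<ge> 0" by (simp_all add: w_def p_def)
      then show ?thesis using C_offdiag_le[OF False]
        by (simp add: mult_nonneg_nonpos mult_nonpos_nonneg)
    qed
  qed
  ultimately have "idot w (C *v w) \<le> 0"
    by (simp add: u matvec_int_diff idot_diff_right)
  then have "w = 0" using C_posdef[of w] by fastforce
  then have "w $ i = 0" by simp
  then show ?thesis by (simp add: w_def max_def split: if_splits)
qed

lemma C_inj: "C *v u = C *v u' \<Longrightarrow> u = u'"
proof -
  assume "C *v u = C *v u'"
  then have "idot (u - u') (C *v (u - u')) = 0" by (simp add: matvec_int_diff)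
  then show "u = u'" using C_posdef[of "u - u'"] by fastforce
qed

definition Lm :: "(int, 'r) vec \<Rightarrow> (int, 'r) vec" where "Lm b = lam C *v b"

lemma Lm_add: "Lm (a + b) = Lm a + Lm b" by (simp add: Lm_def matvec_int_add)
lemma Lm_diff: "Lm (a - b) = Lm a - Lm b" by (simp add: Lm_def matvec_int_diff)
lemma Lm_minus: "Lm (- a) = - Lm a" by (simp add: Lm_def matvec_int_minus)
lemma Lm_0 [simp]: "Lm 0 = 0" by (simp add: Lm_def)
lemma Lm_scale: "Lm (k *s a) = k *s Lm a" by (simp add: Lm_def matvec_int_scale)
lemma Lm_axis: "Lm (axis i k) $ j = k * lam C $ i $ j"
  by (simp add: Lm_def matvec_int_axis lam_sym[OF slc, of j i])

lemma Lm_sym: "idot (Lm a) b = idot (Lm b) a"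
  unfolding Lm_def by (metis idot_commute idot_matvec_sym lam_sym[OF slc])

lemma C_Lm: "C *v Lm b = dl *s b"
proof -
  have "(C *v Lm b) $ i = dl * b $ i" for i
  proof -
    have "(C *v Lm b) $ i = (\<Sum>j\<in>UNIV. \<Sum>k\<in>UNIV. C $ i $ j * lam C $ j $ k * b $ k)"
      by (simp add: matvec_int_nth Lm_def sum_distrib_left mult.assoc)
    also have "\<dots> = (\<Sum>k\<in>UNIV. (\<Sum>j\<in>UNIV. C $ i $ j * lam C $ j $ k) * b $ k)"
      by (subst sum.swap) (simp add: sum_distrib_right)
    also have "\<dots> = dl * b $ i"
      by (simp add: cartan_lam[OF slc] if_distrib if_distribR cong: if_cong)
    finally show ?thesis .
  qed
  then show ?thesis by (simp add: vec_eq_iff)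
qed

lemma scale_cancel_int: "k \<noteq> 0 \<Longrightarrow> k *s a = k *s b \<Longrightarrow> a = b" for a b :: "(int, 'r) vec"
  by (simp add: vec_eq_iff)

lemma Lm_C: "Lm (C *v b) = dl *s b"
proof -
  have "C *v Lm (C *v b) = C *v (dl *s b)" by (simp add: C_Lm matvec_int_scale)
  then show ?thesis by (rule C_inj)
qed

lemma Lm_inj: "Lm a = Lm b \<longleftrightarrow> a = b"
proof
  assume "Lm a = Lm b"
  then have "dl *s a = dl *s b" by (simp flip: C_Lm)
  then show "a = b" using det_pos scale_cancel_int[of dl a b] by simp
qed simp

abbreviation ax :: "'r \<Rightarrow> (int, 'r) vec" where "ax i \<equiv> axis i 1"

definition vc :: "'r \<Rightarrow> (int, 'r) vec" where "vc i = C *v ax i"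

lemma vc_nth: "vc i $ j = C $ i $ j"
  by (simp add: vc_def matvec_int_axis C_sym)

lemma Lm_vc: "Lm (vc i) = dl *s ax i"
  by (simp add: vc_def Lm_C)

lemma idot_Lm_vc [simp]: "idot (Lm b) (vc i) = dl * b $ i"
  by (simp add: Lm_sym[of b] Lm_vc)

lemma vc_indep: "i \<noteq> j \<Longrightarrow> k *s vc i \<noteq> l *s vc j \<or> (k = 0 \<and> l = 0)"
proof (rule disjCI)
  assume "i \<noteq> j" and n: "\<not> (k = 0 \<and> l = 0)"
  show "k *s vc i \<noteq> l *s vc j"
  proof
    assume "k *s vc i = l *s vc j"
    then have "C *v (k *s ax i) = C *v (l *s ax j)" by (simp add: vc_def matvec_int_scale)
    then have "k *s ax i = l *s ax j" by (rule C_inj)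
    then have "(k *s ax i) $ i = (l *s ax j) $ i" "(k *s ax i) $ j = (l *s ax j) $ j" by simp_all
    then show False using \<open>i \<noteq> j\<close> n by (simp add: axis_def split: if_splits)
  qed
qed

definition pc :: "'r \<Rightarrow> (int, 'r) vec" where "pc i = 2 *s ax i - vc i"

lemma pc_nth: "pc i $ j = (if i = j then 0 else - C $ i $ j)"
  by (simp add: pc_def vc_nth axis_def)

lemma Lm_pc: "Lm (pc i) = 2 *s Lm (ax i) - dl *s ax i"
  by (simp add: pc_def Lm_diff Lm_scale Lm_vc)

text \<open>The row sums of \<lambda>, that is, the exponents by which the Q_{\<alpha>,0} scale <0|.
  At the same time it is the grading vector and, negated, the index of the coefficient of
  Q_1^-1.\<close>

definition kap :: "(int, 'r) vec" where "kap = Lm 1"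

text \<open>A minimum principle: at a zero of the nonnegative vector \<open>kap\<close> the
  corresponding entry of C \<open>kap\<close> would be nonpositive, but it equals \<delta>.\<close>

lemma kap_pos: "kap $ i > 0"
proof -
  have c: "(C *v kap) $ j = dl" for j by (simp add: kap_def C_Lm)
  have nn: "kap $ j \<ge> 0" for j
    by (rule C_inv_nonneg) (use c det_pos in simp)
  have "kap $ i \<noteq> 0"
  proof
    assume "kap $ i = 0"
    have "(C *v kap) $ i \<le> 0" unfolding matvec_int_nth
    proof (rule sum_nonpos)
      fix j show "C $ i $ j * kap $ j \<le> 0"
        using C_offdiag_le[of i j] nn[of j] \<open>kap $ i = 0\<close>
        by (cases "i = j") (auto simp: mult_nonpos_nonneg)
    qed
    then show False using c[of i] det_pos by simp
  qed
  then show ?thesis using nn[of i] by simp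
qed

lemma tot_Lm: "tot (Lm b) = idot kap b"
proof -
  have "tot (Lm b) = idot (Lm b) 1" by (simp add: tot_def idot_def)
  then show ?thesis by (simp add: kap_def Lm_sym[of b])
qed

lemma kap_vc [simp]: "idot kap (vc i) = dl"
  by (simp add: kap_def)

end

section \<open>Seeds of the quantum Q-system\<close>

declare vector_smult_lzero [simp]

lemma prod_list_map_one [simp]: "prod_list (map (\<lambda>_. 1) l) = (1 :: 'a::monoid_mult)"
  by (induction l) simp_all

lemma qcomm_diff_left: "qcomm k x z \<Longrightarrow> qcomm k y z \<Longrightarrow> qcomm k (x - y) z"
  by (simp add: qcomm_def left_diff_distrib right_diff_distrib scl_diff_right)

lemma qcomm_scl_left: "qcomm k x z \<Longrightarrow> qcomm k (c \<star> x) z"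
  by (simp add: qcomm_def mult.commute)

text \<open>The closure conditions under which a property passes from a series to its inverse. The
  last one is a limit condition, coefficient by coefficient: the approximating element may change
  with the coefficient.\<close>

definition limclosed :: "('r::finite qtser \<Rightarrow> bool) \<Rightarrow> bool" where
  "limclosed P \<longleftrightarrow> P 1 \<and> (\<forall>u v. P u \<longrightarrow> P v \<longrightarrow> P (u * v)) \<and> (\<forall>u v. P u \<longrightarrow> P v \<longrightarrow> P (u + v))
     \<and> (\<forall>c u. P u \<longrightarrow> P (c \<star> u)) \<and> (\<forall>u. (\<forall>d. \<exists>v. P v \<and> cf u d = cf v d) \<longrightarrow> P u)"

context simply_laced
begin

section \<open>Monomials, cones of exponents, leading terms and inverses\<close>

definition X :: "(int, 'r) vec \<Rightarrow> (int, 'r) vec \<Rightarrow> 'r qtser" where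
  "X a b = qmon (q0 a) (Lm b)"

lemma X_mult: "X a b * X a' b' = tpow (- idot (Lm b) a') \<star> X (a + a') (b + b')"
  by (simp add: X_def qmon_mult mult_single Lm_add)

lemma X_00 [simp]: "X 0 0 = 1"
  by (simp add: X_def qmon_one)

text \<open>The exponents of Q_1^b0 times a power series in the x_\<beta>, written in
  \<lambda>-coordinates, where the cone -C N^r is -\<delta> N^r.\<close>

definition incone :: "(int, 'r) vec \<Rightarrow> (int, 'r) vec \<Rightarrow> bool" where
  "incone b0 b \<longleftrightarrow> (\<exists>n :: 'r \<Rightarrow> nat. b = Lm b0 - dl *s (\<chi> i. int (n i)))"

lemma incone_refl: "incone b0 (Lm b0)"
  unfolding incone_def by (rule exI[of _ "\<lambda>_. 0"]) (simp add: vec_eq_iff)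

lemma incone_add: "incone b0 b \<Longrightarrow> incone c0 c \<Longrightarrow> incone (b0 + c0) (b + c)"
  unfolding incone_def
proof (elim exE)
  fix n m :: "'r \<Rightarrow> nat"
  assume "b = Lm b0 - dl *s (\<chi> i. int (n i))" "c = Lm c0 - dl *s (\<chi> i. int (m i))"
  then show "\<exists>n :: 'r \<Rightarrow> nat. b + c = Lm (b0 + c0) - dl *s (\<chi> i. int (n i))"
    by (intro exI[of _ "\<lambda>i. n i + m i"]) (simp add: vec_eq_iff Lm_add right_diff_distrib ring_distribs)
qed

lemma incone_antisym:
  assumes "incone b0 b" "incone c0 c" "b + c = Lm (b0 + c0)"
  shows "b = Lm b0" "c = Lm c0"
proof -
  obtain n m :: "'r \<Rightarrow> nat" where nm: "b = Lm b0 - dl *s (\<chi> i. int (n i))" "c = Lm c0 - dl *s (\<chi> i. int (m i))"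
    using assms(1,2) unfolding incone_def by blast
  have "n i = 0 \<and> m i = 0" for i
  proof -
    have "(b + c) $ i = Lm b0 $ i + Lm c0 $ i" using assms(3) by (simp add: Lm_add)
    then have "dl * (int (n i) + int (m i)) = 0" by (simp add: nm algebra_simps)
    then show ?thesis using det_pos by simp
  qed
  then show "b = Lm b0" "c = Lm c0" using nm by (simp_all add: vec_eq_iff)
qed

lemma incone_shift:
  assumes "incone (b0 - C *v k) b" "\<And>i. k $ i \<ge> 0"
  shows "incone b0 b"
proof -
  obtain n :: "'r \<Rightarrow> nat" where "b = Lm (b0 - C *v k) - dl *s (\<chi> i. int (n i))"
    using assms(1) unfolding incone_def by blast
  then have "b = Lm b0 - dl *s (\<chi> i. int (n i + nat (k $ i)))"
    using assms(2) by (simp add: vec_eq_iff Lm_diff Lm_C algebra_simps)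
  then show ?thesis unfolding incone_def by (rule exI[of _ "\<lambda>i. n i + nat (k $ i)"])
qed

lemma incone_le: "incone b0 b \<Longrightarrow> b \<le> Lm b0"
  using det_pos by (auto simp: incone_def less_eq_vec_def)

lemma incone_lattice: "incone b0 b \<Longrightarrow> \<exists>c. b = Lm c"
proof -
  assume "incone b0 b"
  then obtain n :: "'r \<Rightarrow> nat" where "b = Lm b0 - dl *s (\<chi> i. int (n i))" unfolding incone_def by blast
  then have "b = Lm (b0 - C *v (\<chi> i. int (n i)))" by (simp add: Lm_diff Lm_C)
  then show ?thesis by blast
qed

text \<open>The shape of everything that is ever inverted: the top coefficient is one monomial in
  Q_0 with a power of t, a unit, and all other terms lie in the cone below it.\<close>

definition led :: "'r qtser \<Rightarrow> (int, 'r) vec \<Rightarrow> bool" where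
  "led x b0 \<longleftrightarrow> (\<exists>k a. cf x (Lm b0) = Poly_Mapping.single a (tpow k)) \<and> (\<forall>b. cf x b \<noteq> 0 \<longrightarrow> incone b0 b)"

lemma led_incone: "led x b0 \<Longrightarrow> cf x b \<noteq> 0 \<Longrightarrow> incone b0 b"
  by (auto simp: led_def)

lemma led_X: "led (X a b) b"
  unfolding led_def X_def by (auto simp: cf_qmon incone_refl intro!: exI[of _ a] exI[of _ "0 :: int"])

lemma led_1: "led 1 0"
  using led_X[of 0 0] by simp

lemma led_scl: "led x b \<Longrightarrow> led (tpow k \<star> x) b"
  unfolding led_def
proof (elim conjE exE, intro conjI)
  fix l a assume "cf x (Lm b) = Poly_Mapping.single a (tpow l)"
  then show "\<exists>l a. cf (tpow k \<star> x) (Lm b) = Poly_Mapping.single a (tpow l)"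
    by (intro exI[of _ "k + l"] exI[of _ a]) (simp add: mult_single tpow_add)
  assume "\<forall>b'. cf x b' \<noteq> 0 \<longrightarrow> incone b b'"
  then show "\<forall>b'. cf (tpow k \<star> x) b' \<noteq> 0 \<longrightarrow> incone b b'" by (metis cf_scl mult_zero_right)
qed

lemma led_mult:
  assumes "led x b" "led y c"
  shows "led (x * y) (b + c)"
proof -
  obtain k a l a' where k: "cf x (Lm b) = Poly_Mapping.single a (tpow k)"
    "cf y (Lm c) = Poly_Mapping.single a' (tpow l)"
    using assms unfolding led_def by blast
  have "cf (x * y) (Lm (b + c)) = (\<Sum>b1\<in>{Lm b}. cf x b1 * tw b1 (cf y (Lm (b + c) - b1)))"
  proof (rule cf_mult_superset)
    fix b1 assume "cf x b1 \<noteq> 0" "cf y (Lm (b + c) - b1) \<noteq> 0"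
    then have "incone b b1" "incone c (Lm (b + c) - b1)" using assms by (auto simp: led_def)
    then show "b1 \<in> {Lm b}" using incone_antisym(1)[of b b1 c "Lm (b + c) - b1"] by simp
  qed simp
  also have "\<dots> = Poly_Mapping.single (a + a') (tpow (k + (l - idot (Lm b) a')))"
    by (simp add: Lm_add k mult_single tpow_add tpow_diff mult_ac)
  finally have "cf (x * y) (Lm (b + c)) = Poly_Mapping.single (a + a') (tpow (k + (l - idot (Lm b) a')))" .
  moreover have "incone (b + c) d" if "cf (x * y) d \<noteq> 0" for d
    using that assms by (auto elim!: cf_mult_nonzero intro!: incone_add simp: led_def)
  ultimately show ?thesis unfolding led_def by blast
qed

lemma led_power: "led x b \<Longrightarrow> led (x ^ n) (int n *s b)"
proof (induction n)
  case 0
  show ?case by (simp add: led_1)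
next
  case (Suc n)
  have "int (Suc n) *s b = b + int n *s b" by (simp add: vec_eq_iff algebra_simps)
  then show ?case using led_mult[of x b "x ^ n"] Suc by simp
qed

lemma led_diff_lower:
  assumes "led x b" "led y (b - C *v k)" "\<And>i. k $ i \<ge> 0" "k \<noteq> 0"
  shows "led (x - c \<star> y) b"
proof -
  have y: "incone (b - C *v k) d" if "cf y d \<noteq> 0" for d using that assms(2) by (auto simp: led_def)
  have "cf y (Lm b) = 0"
  proof (rule ccontr)
    assume "cf y (Lm b) \<noteq> 0"
    then have "Lm b \<le> Lm (b - C *v k)" using y incone_le by blast
    then have "dl * k $ i \<le> 0" for i by (simp add: less_eq_vec_def Lm_diff Lm_C)
    then have "k $ i = 0" for i using det_pos assms(3)[of i] by (smt (verit) mult_pos_pos)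
    then show False using assms(4) by (simp add: vec_eq_iff)
  qed
  moreover have "incone b d" if "cf (x - c \<star> y) d \<noteq> 0" for d
  proof (cases "cf y d = 0")
    case True
    then show ?thesis using that assms(1) by (simp add: led_def)
  next
    case False
    then show ?thesis using y incone_shift assms(3) by blast
  qed
  ultimately show ?thesis using assms(1) by (simp add: led_def)
qed

text \<open>Dividing by the top monomial leaves 1 - h with h strictly below 0, to which
  \<open>geometric_series\<close> applies. The last clause records that the inverse is built from x
  and the monomials with exponent -b by operations under which a \<open>limclosed\<close> property
  is stable.\<close>

lemma led_inverse:
  assumes "led x b"
  shows "\<exists>y. is_inv x y \<and> led y (- b) \<and> (\<forall>P. limclosed P \<longrightarrow> (\<forall>a. P (X a (- b))) \<longrightarrow> P x \<longrightarrow> P y)"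
proof -
  obtain k a where k: "cf x (Lm b) = Poly_Mapping.single a (tpow k)" using assms by (auto simp: led_def)
  define w where "w = tpow (- k - idot (Lm b) a) \<star> X (- a) (- b)"
  have cw: "cf (w * x) d = sD (tpow (- k - idot (Lm b) a)) * (q0 (- a) * tw (Lm (- b)) (cf x (d + Lm b)))" for d
    by (simp add: w_def X_def cf_qmon_mult Lm_minus mult.assoc)
  define h where "h = 1 - w * x"
  have wi: "is_inv (tpow k \<star> X a b) w"
    by (simp add: is_inv_def w_def X_mult Lm_minus flip: tpow_add)
  have hcone: "incone 0 d" if "cf (w * x) d \<noteq> 0" for d
  proof -
    have "cf x (d + Lm b) \<noteq> 0" using that cw by (metis mult_zero_right tw_0)
    then have "incone b (d + Lm b)" using assms by (auto simp: led_def)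
    then obtain n :: "'r \<Rightarrow> nat" where n: "d + Lm b = Lm b - dl *s (\<chi> i. int (n i))"
      unfolding incone_def by blast
    have "d = (d + Lm b) - Lm b" by simp
    then have "d = Lm 0 - dl *s (\<chi> i. int (n i))" unfolding n by simp
    then show ?thesis unfolding incone_def by blast
  qed
  have wx0: "cf (w * x) 0 = 1"
    by (simp add: cw k Lm_minus mult_single flip: tpow_add)
  have hc: "incone 0 d \<and> d \<noteq> 0" if "cf h d \<noteq> 0" for d
  proof -
    have "d \<noteq> 0" using that wx0 by (auto simp: h_def cf_1)
    then have "cf (w * x) d \<noteq> 0" using that by (auto simp: h_def cf_1)
    then show ?thesis using hcone \<open>d \<noteq> 0\<close> by blast
  qed
  have "\<And>d. cf h d \<noteq> 0 \<Longrightarrow> d \<le> 0 \<and> d \<noteq> 0" using hc incone_le by fastforce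
  then obtain g where g: "is_inv (1 - h) g" "\<And>d. \<exists>N. cf g d = cf (\<Sum>n\<le>N. h ^ n) d"
    using geometric_series by blast
  have wx: "1 - h = w * x" by (simp add: h_def)
  define y where "y = g * w"
  have "is_inv x y"
  proof -
    let ?u = "tpow k \<star> X a b"
    have "y * x = 1" using g(1) wx by (simp add: is_inv_def y_def mult.assoc)
    moreover have "x = ?u * (1 - h)" using wi by (simp add: wx is_inv_def flip: mult.assoc)
    then have "x * y = ?u * ((1 - h) * g) * w" by (simp add: y_def mult.assoc)
    then have "x * y = 1" using g(1) wi by (simp add: is_inv_def)
    ultimately show ?thesis by (simp add: is_inv_def)
  qed
  moreover have "led y (- b)"
  proof -
    have hn: "incone 0 d \<and> (n > 0 \<longrightarrow> d \<noteq> 0)" if "cf (h ^ n) d \<noteq> 0" for n d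
      using that
    proof (induction n arbitrary: d)
      case 0
      then show ?case using incone_refl[of 0] by (auto simp: cf_1 split: if_splits)
    next
      case (Suc n)
      then obtain b1 b2 where b: "cf h b1 \<noteq> 0" "cf (h ^ n) b2 \<noteq> 0" "d = b1 + b2"
        by (auto elim: cf_mult_nonzero)
      have 1: "incone 0 b1" "b1 \<noteq> 0" "incone 0 b2" using hc[OF b(1)] Suc.IH[OF b(2)] by auto
      then have "incone 0 d" using incone_add[of 0 b1 0 b2] b(3) by simp
      moreover have "d \<noteq> 0" using incone_antisym(1)[OF 1(1,3)] 1(2) b(3) by auto
      ultimately show ?case by simp
    qed
    have "incone 0 d" if "cf g d \<noteq> 0" for d
    proof -
      obtain N where "cf g d = cf (\<Sum>n\<le>N. h ^ n) d" using g(2) by blast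
      then have "cf (\<Sum>n\<le>N. h ^ n) d \<noteq> 0" using that by simp
      then obtain n where "cf (h ^ n) d \<noteq> 0"
        unfolding cf_sum by (auto elim: sum.not_neutral_contains_not_neutral)
      then show ?thesis using hn by blast
    qed
    moreover have "cf g 0 = 1"
    proof -
      obtain N where N: "cf g 0 = cf (\<Sum>n\<le>N. h ^ n) 0" using g(2) by blast
      have "cf (h ^ n) 0 = (if n = 0 then 1 else 0)" for n
        using hn[of n 0] by (cases "n = 0") (auto simp: cf_1)
      then show ?thesis unfolding N cf_sum by simp
    qed
    then have "cf g (Lm 0) = Poly_Mapping.single 0 (tpow 0)" by simp
    ultimately have "led g 0" unfolding led_def by blast
    then show ?thesis
      using led_mult[of g 0 w "- b"] by (simp add: y_def w_def led_scl led_X)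
  qed
  moreover have "P y" if P: "limclosed P" "\<forall>a. P (X a (- b))" "P x" for P
  proof -
    have P1: "P 1" and Pm: "\<And>u v. P u \<Longrightarrow> P v \<Longrightarrow> P (u * v)" and Pa: "\<And>u v. P u \<Longrightarrow> P v \<Longrightarrow> P (u + v)"
      and Ps: "\<And>c u. P u \<Longrightarrow> P (c \<star> u)" and Pl: "\<And>u. (\<And>d. \<exists>v. P v \<and> cf u d = cf v d) \<Longrightarrow> P u"
      using P(1) unfolding limclosed_def by blast+
    have "P w" unfolding w_def using P(2) by (intro Ps) blast
    then have "P ((- 1) \<star> (w * x))" using P(3) by (intro Ps Pm)
    then have "P (1 + (- 1) \<star> (w * x))" by (rule Pa[OF P1])
    then have Ph: "P h" by (simp add: h_def)
    have "P (h ^ n)" for n by (induction n) (simp_all add: P1 Pm Ph)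
    then have "P (\<Sum>n\<le>N. h ^ n)" for N by (induction N) (simp_all add: P1 Pa Pm Ph)
    then have "P g" using Pl g(2) by blast
    then show ?thesis unfolding y_def using Pm \<open>P w\<close> by blast
  qed
  ultimately show ?thesis by blast
qed

lemma led_isu: "led x b \<Longrightarrow> isu x"
  using led_inverse unfolding isu_def by blast

lemma led_uinv: "led x b \<Longrightarrow> led (uinv x) (- b)"
  using led_inverse[of x b] uinvI[of x] by auto

lemma led_uinv_closed:
  assumes "led x b" "limclosed P" "\<And>a. P (X a (- b))" "P x"
  shows "P (uinv x)"
  using led_inverse[OF assms(1)] uinvI[of x] assms(2-4) by auto

lemma led_pw:
  assumes "led x b"
  shows "led (pw x k) (k *s b)"
proof (cases "k \<ge> 0")
  case True
  then show ?thesis using led_power[OF assms, of "nat k"] by (simp add: pw_def)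
next
  case False
  have "int (nat (- k)) *s (- b) = k *s b" using False by (simp add: vec_eq_iff)
  then show ?thesis using led_power[OF led_uinv[OF assms], of "nat (- k)"] False by (simp add: pw_def)
qed

lemma led_prod_list:
  assumes "\<And>i. i \<in> set is \<Longrightarrow> led (f i) (g i)"
  shows "led (prod_list (map f is)) (sum_list (map g is))"
  using assms by (induction "is") (simp_all add: led_1 led_mult)

lemma set_idx [simp]: "set idx = (UNIV :: 'r set)" and distinct_idx [simp]: "distinct (idx :: 'r list)"
  by (simp_all add: idx_def)

lemma sum_list_idx: "sum_list (map f idx) = (\<Sum>i\<in>(UNIV :: 'r set). f i)"
  by (subst sum_list_distinct_conv_sum_set) simp_all

lemma vec_expand: "(\<Sum>i\<in>UNIV. b $ i *s ax i) = b"
proof -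
  have "(\<Sum>i\<in>UNIV. b $ i * ax i $ j) = b $ j" for j
  proof -
    have "b $ i * ax i $ j = (if i = j then b $ j else 0)" for i by (simp add: axis_def)
    then show ?thesis by simp
  qed
  then show ?thesis by (simp add: vec_eq_iff)
qed

lemma vec_expand_scale: "(\<Sum>i\<in>UNIV. b $ i *s (k *s ax i)) = k *s b"
proof -
  have "(\<Sum>i\<in>UNIV. b $ i *s (k *s ax i)) $ j = k * (\<Sum>i\<in>UNIV. b $ i *s ax i) $ j" for j
    by (simp add: sum_distrib_left mult_ac)
  then show ?thesis unfolding vec_expand by (simp add: vec_eq_iff del: sum_component)
qed

text \<open>\<open>Xi i a b\<close> is \<open>\<Prod>\<^sub>\<alpha> Q\<^sub>\<alpha>\<^sub>,\<^sub>i^(a\<^sub>\<alpha>) \<Prod>\<^sub>\<alpha> Q\<^sub>\<alpha>\<^sub>,\<^sub>i\<^sub>+\<^sub>1^(b\<^sub>\<alpha>)\<close>.\<close>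

fun Xi :: "nat \<Rightarrow> (int, 'r) vec \<Rightarrow> (int, 'r) vec \<Rightarrow> 'r qtser" where
  "Xi 0 a b = X a b"
| "Xi (Suc i) a b = Xi i 0 a * prod_list (map (\<lambda>\<alpha>. pw (tpow (lam C $ \<alpha> $ \<alpha>) \<star>
      (Xi i (- ax \<alpha>) (2 *s ax \<alpha>) - tpow (- dl) \<star> Xi i (- ax \<alpha>) (pc \<alpha>))) (b $ \<alpha>)) idx)"

text \<open>The Q-system relation solved for Q_{\<alpha>,i+2}, with the inverse of Q_{\<alpha>,i}
  moved to the left. Passing Q_{i+1}^(2 e_\<alpha>) costs t^(2 \<lambda>_\<alpha>\<alpha>), passing
  the product term costs t^(2 \<lambda>_\<alpha>\<alpha> - \<delta>); hence the relative factor
  t^(-\<delta>).\<close>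

definition Pn :: "nat \<Rightarrow> 'r \<Rightarrow> 'r qtser" where
  "Pn i \<alpha> = tpow (lam C $ \<alpha> $ \<alpha>) \<star>
      (Xi i (- ax \<alpha>) (2 *s ax \<alpha>) - tpow (- dl) \<star> Xi i (- ax \<alpha>) (pc \<alpha>))"

lemma Xi_Suc: "Xi (Suc i) a b = Xi i 0 a * prod_list (map (\<lambda>\<alpha>. pw (Pn i \<alpha>) (b $ \<alpha>)) idx)"
  by (simp add: Pn_def)

declare Xi.simps(2) [simp del]

definition seed_ok :: "nat \<Rightarrow> bool" where
  "seed_ok i \<longleftrightarrow> (\<forall>a b a' b'. Xi i a b * Xi i a' b' = tpow (- idot (Lm b) a') \<star> Xi i (a + a') (b + b'))
     \<and> Xi i 0 0 = 1 \<and> (\<forall>a b. led (Xi i a b) (int i *s a + int (Suc i) *s b))"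

lemma led_Pn:
  assumes "seed_ok i"
  shows "led (Pn i \<alpha>) (int (i + 2) *s ax \<alpha>)"
proof -
  have 1: "led (Xi i (- ax \<alpha>) (2 *s ax \<alpha>)) (int (i + 2) *s ax \<alpha>)"
  proof -
    have "int i *s (- ax \<alpha>) + int (Suc i) *s (2 *s ax \<alpha>) = int (i + 2) *s ax \<alpha>"
      by (simp add: vec_eq_iff axis_def algebra_simps)
    then show ?thesis using assms unfolding seed_ok_def by metis
  qed
  have 2: "led (Xi i (- ax \<alpha>) (pc \<alpha>)) (int (i + 2) *s ax \<alpha> - C *v (int (Suc i) *s ax \<alpha>))"
  proof -
    have "int i *s (- ax \<alpha>) + int (Suc i) *s pc \<alpha> = int (i + 2) *s ax \<alpha> - C *v (int (Suc i) *s ax \<alpha>)"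
      by (simp add: pc_def vc_def matvec_int_scale vec_eq_iff algebra_simps)
    then show ?thesis using assms unfolding seed_ok_def by metis
  qed
  have "int (Suc i) *s ax \<alpha> \<noteq> 0"
  proof
    assume "int (Suc i) *s ax \<alpha> = 0"
    then have "(int (Suc i) *s ax \<alpha>) $ \<alpha> = 0" by simp
    then show False by simp
  qed
  then show ?thesis unfolding Pn_def
    by (intro led_scl led_diff_lower[OF 1 2]) (simp_all add: axis_def)
qed

lemma seed_qcomm:
  assumes "seed_ok i"
  shows "qcomm (idot (Lm b') a - idot (Lm b) a') (Xi i a b) (Xi i a' b')"
  using assms by (simp add: seed_ok_def qcomm_def add.commute flip: tpow_add)

text \<open>Commutation rule and leading terms are proved in one induction, because the next seed is
  made of powers, possibly negative, of \<open>Pn i \<alpha>\<close>, and these exist only once the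
  leading term is known. The leading exponent of Q_{\<alpha>,n} is n e_\<alpha>.\<close>

lemma seed_ok_Xi: "seed_ok i"
proof (induction i)
  case 0
  show ?case unfolding seed_ok_def using led_X by (simp add: X_mult)
next
  case (Suc i)
  let ?P = "Pn i"
  note law = Suc[unfolded seed_ok_def, THEN conjunct1, rule_format]
  have one: "Xi i 0 0 = 1" using Suc by (simp add: seed_ok_def)
  have uP: "isu (?P \<alpha>)" for \<alpha> using led_Pn[OF Suc] led_isu by blast
  have com: "?P \<alpha> * ?P \<beta> = ?P \<beta> * ?P \<alpha>" for \<alpha> \<beta>
  proof (cases "\<alpha> = \<beta>")
    case False
    \<comment> \<open>The two exponents occurring in \<open>Pn i \<gamma>\<close> differ by
      \<open>vc \<gamma>\<close>, whose image under \<lambda> is \<delta> e_\<gamma>. Away from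
      \<gamma> they are therefore indistinguishable, and the symmetry of \<lambda> makes all four
      pairs of terms commute.\<close>
    have L: "Lm c $ \<delta> = 2 * lam C $ \<gamma> $ \<delta>" if "c = 2 *s ax \<gamma> \<or> c = pc \<gamma>" "\<gamma> \<noteq> \<delta>" for c \<gamma> \<delta>
    proof -
      have "ax \<gamma> $ \<delta> = 0" using that(2) by (simp add: axis_def)
      then show ?thesis using that(1) by (auto simp: Lm_scale Lm_pc Lm_axis)
    qed
    have m: "qcomm 0 (Xi i (- ax \<alpha>) c) (Xi i (- ax \<beta>) d)"
      if "c = 2 *s ax \<alpha> \<or> c = pc \<alpha>" "d = 2 *s ax \<beta> \<or> d = pc \<beta>" for c d
    proof -
      have "Lm d $ \<alpha> = Lm c $ \<beta>"
        using L[OF that(1)] L[OF that(2)] False lam_sym[OF slc, of \<alpha> \<beta>] by metis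
      then show ?thesis using seed_qcomm[OF Suc, of d "- ax \<alpha>" c "- ax \<beta>"] by simp
    qed
    have 1: "qcomm 0 (?P \<alpha>) (Xi i (- ax \<beta>) d)" if "d = 2 *s ax \<beta> \<or> d = pc \<beta>" for d
      unfolding Pn_def using that by (intro qcomm_scl_left qcomm_diff_left m) auto
    have "qcomm 0 (?P \<beta>) (?P \<alpha>)"
      unfolding Pn_def[of i \<beta>] using qcomm_sym[OF 1]
      by (intro qcomm_scl_left qcomm_diff_left) auto
    then show ?thesis by (simp add: qcomm_def)
  qed simp
  have comX: "qcomm (- Lm a $ \<alpha>) (?P \<alpha>) (Xi i 0 a)" for \<alpha> a
  proof -
    have "qcomm (- Lm a $ \<alpha>) (Xi i (- ax \<alpha>) c) (Xi i 0 a)" for c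
      using seed_qcomm[OF Suc, of a "- ax \<alpha>" c 0] by simp
    then show ?thesis unfolding Pn_def by (intro qcomm_scl_left qcomm_diff_left)
  qed
  define W where "W b = prod_list (map (\<lambda>\<alpha>. pw (?P \<alpha>) (b $ \<alpha>)) idx)" for b
  have Wcom: "qcomm (- idot (Lm b) a) (W b) (Xi i 0 a)" for a b
  proof -
    have "qcomm (b $ \<alpha> * Lm a $ \<alpha>) (Xi i 0 a) (pw (?P \<alpha>) (b $ \<alpha>))" for \<alpha>
      using qcomm_pw[OF qcomm_sym[OF comX] uP] by simp
    then have "qcomm (sum_list (map (\<lambda>\<alpha>. b $ \<alpha> * Lm a $ \<alpha>) idx)) (Xi i 0 a) (W b)"
      unfolding W_def by (rule qcomm_prod_list)
    moreover have "sum_list (map (\<lambda>\<alpha>. b $ \<alpha> * Lm a $ \<alpha>) idx) = idot (Lm b) a"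
      by (simp add: sum_list_idx Lm_sym[of b] idot_commute[of _ b]) (simp add: idot_def)
    ultimately show ?thesis using qcomm_sym by metis
  qed
  have Wadd: "W (b + b') = W b * W b'" for b b'
  proof -
    have c: "qcomm 0 (pw (?P \<alpha>) k) (pw (?P \<beta>) l)" for \<alpha> \<beta> k l
    proof -
      have "qcomm 0 (?P \<alpha>) (?P \<beta>)" using com by (simp add: qcomm_def)
      then have "qcomm 0 (?P \<alpha>) (pw (?P \<beta>) l)" using qcomm_pw[OF _ uP, of 0] by simp
      then have "qcomm 0 (pw (?P \<beta>) l) (?P \<alpha>)" using qcomm_sym by fastforce
      then have "qcomm 0 (pw (?P \<beta>) l) (pw (?P \<alpha>) k)" using qcomm_pw[OF _ uP, of 0] by simp
      then show ?thesis using qcomm_sym by fastforce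
    qed
    show ?thesis unfolding W_def
      by (subst prod_list_mult_qcomm[symmetric]) (simp_all add: c pw_add[OF uP])
  qed
  have W0: "W 0 = 1" unfolding W_def by simp
  have XW: "Xi (Suc i) a b = Xi i 0 a * W b" for a b by (simp add: Xi_Suc W_def)
  have "Xi (Suc i) a b * Xi (Suc i) a' b' = tpow (- idot (Lm b) a') \<star> Xi (Suc i) (a + a') (b + b')" for a b a' b'
  proof -
    have "Xi (Suc i) a b * Xi (Suc i) a' b' = Xi i 0 a * (W b * Xi i 0 a') * W b'"
      by (simp add: XW mult.assoc)
    also have "\<dots> = tpow (- idot (Lm b) a') \<star> (Xi i 0 a * Xi i 0 a' * (W b * W b'))"
      using Wcom[of b a'] by (simp add: qcomm_def mult.assoc)
    finally show ?thesis by (simp add: law XW Wadd)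
  qed
  moreover have "led (Xi (Suc i) a b) (int (Suc i) *s a + int (Suc (Suc i)) *s b)" for a b
  proof -
    have "led (W b) (sum_list (map (\<lambda>\<alpha>. b $ \<alpha> *s (int (i + 2) *s ax \<alpha>)) idx))"
      unfolding W_def by (intro led_prod_list led_pw led_Pn Suc)
    moreover have "sum_list (map (\<lambda>\<alpha>. b $ \<alpha> *s (int (i + 2) *s ax \<alpha>)) idx) = int (Suc (Suc i)) *s b"
      unfolding sum_list_idx vec_expand_scale by simp
    moreover have "led (Xi i 0 a) (int (Suc i) *s a)"
      using Suc unfolding seed_ok_def by (metis add_0 vector_smult_rzero)
    ultimately show ?thesis unfolding XW using led_mult by metis
  qed
  ultimately show ?case unfolding seed_ok_def by (simp add: XW one W0)
qed

lemma Xi_mult: "Xi i a b * Xi i a' b' = tpow (- idot (Lm b) a') \<star> Xi i (a + a') (b + b')"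
  using seed_ok_Xi[of i] by (simp add: seed_ok_def)

lemma Xi_00 [simp]: "Xi i 0 0 = 1"
  using seed_ok_Xi[of i] by (simp add: seed_ok_def)

lemma led_Xi: "led (Xi i a b) (int i *s a + int (Suc i) *s b)"
  using seed_ok_Xi[of i] unfolding seed_ok_def by blast

lemma Xi_Suc_0: "Xi (Suc i) a 0 = Xi i 0 a"
  by (simp add: Xi_Suc)

lemma Xi_Suc_ax: "Xi (Suc i) 0 (ax \<alpha>) = Pn i \<alpha>"
proof -
  have "prod_list (map (\<lambda>\<beta>. pw (Pn i \<beta>) (ax \<alpha> $ \<beta>)) l) = (if \<alpha> \<in> set l then Pn i \<alpha> else 1)"
    if "distinct l" for l :: "'r list"
    using that by (induction l) (auto simp: axis_def)
  then show ?thesis by (simp add: Xi_Suc)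
qed

end

section \<open>Divisibility of Laurent polynomials\<close>

lemma lookup_single_mult: "lookup (Poly_Mapping.single w s * d) a = s * lookup d (a - w)"
  for d :: "'r::finite lpoly"
proof (induction d rule: lpoly_induct)
  case (single b c)
  have "w + b = a \<longleftrightarrow> b = a - w" by (metis add_diff_cancel_left' diff_add_cancel add.commute)
  then show ?case by (auto simp: mult_single lookup_single when_def)
qed (simp_all add: lookup_add ring_distribs)

text \<open>The value of \<open>d\<close> on the coset of \<open>a\<close> in the quotient by \<open>1 = t^k Q\<^sub>0^(- v)\<close>.\<close>

definition Es :: "int \<Rightarrow> int^'r::finite \<Rightarrow> 'r lpoly \<Rightarrow> int^'r \<Rightarrow> laurent" where
  "Es k v d a = (\<Sum>n | lookup d (a + n *s v) \<noteq> 0. tpow (k * n) * lookup d (a + n *s v))"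

lemma scale_inj: "v \<noteq> 0 \<Longrightarrow> inj (\<lambda>n :: int. (a :: int^'r::finite) + n *s v)"
  by (rule injI) (auto simp: vec_eq_iff)

lemma finite_Es: "v \<noteq> 0 \<Longrightarrow> finite {n :: int. lookup d (a + n *s v) \<noteq> 0}" for d :: "'r::finite lpoly"
  using finite_vimageI[OF finite_keys[of d] scale_inj[of v a]] by (simp add: vimage_def in_keys_iff)

lemma Es_superset:
  fixes d :: "'r::finite lpoly"
  assumes "finite N" "\<And>n. lookup d (a + n *s v) \<noteq> 0 \<Longrightarrow> n \<in> N"
  shows "Es k v d a = (\<Sum>n\<in>N. tpow (k * n) * lookup d (a + n *s v))"
  unfolding Es_def using assms by (intro sum.mono_neutral_left) auto

lemma Es_add:
  assumes "v \<noteq> 0"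
  shows "Es k v (x + y) a = Es k v x a + Es k v y a"
proof -
  let ?N = "{n. lookup x (a + n *s v) \<noteq> 0} \<union> {n. lookup y (a + n *s v) \<noteq> 0}"
  have f: "finite ?N" using finite_Es[OF assms] by blast
  show ?thesis
    by (subst (1 2 3) Es_superset[OF f]) (auto simp: lookup_add sum.distrib ring_distribs)
qed

lemma Es_single_mult:
  assumes "v \<noteq> 0"
  shows "Es k v (Poly_Mapping.single w s * d) a = s * Es k v d (a - w)"
proof -
  have e: "a + n *s v - w = a - w + n *s v" for n by simp
  have l: "lookup (Poly_Mapping.single w s * d) (a + n *s v) = s * lookup d (a - w + n *s v)" for n
    unfolding lookup_single_mult e ..
  have "Es k v (Poly_Mapping.single w s * d) a
      = (\<Sum>n | lookup d (a - w + n *s v) \<noteq> 0. tpow (k * n) * (s * lookup d (a - w + n *s v)))"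
    by (subst Es_superset[OF finite_Es[OF assms, of d "a - w"]]) (auto simp: l)
  also have "\<dots> = s * Es k v d (a - w)"
    unfolding Es_def sum_distrib_left by (intro sum.cong refl) (rule mult.left_commute)
  finally show ?thesis .
qed

lemma Es_shift:
  assumes "v \<noteq> 0"
  shows "Es k v d (a + m *s v) = tpow (- k * m) * Es k v d a"
proof -
  have e: "a + m *s v + n *s v = a + (n + m) *s v" for n by (simp add: vec_eq_iff algebra_simps)
  have "Es k v d (a + m *s v) = (\<Sum>n\<in>(\<lambda>n. n - m) ` {n. lookup d (a + n *s v) \<noteq> 0}.
      tpow (k * n) * lookup d (a + (n + m) *s v))"
    by (subst Es_superset[of "(\<lambda>n. n - m) ` {n. lookup d (a + n *s v) \<noteq> 0}"])
      (auto simp: e finite_Es[OF assms] image_iff intro!: exI[of _ "_ + m"])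
  also have "\<dots> = (\<Sum>n | lookup d (a + n *s v) \<noteq> 0. tpow (k * (n - m)) * lookup d (a + n *s v))"
    by (subst sum.reindex) (auto simp: inj_on_def)
  also have "\<dots> = tpow (- k * m) * Es k v d a"
    unfolding Es_def sum_distrib_left
    by (intro sum.cong refl) (simp add: right_diff_distrib mult.assoc[symmetric] flip: tpow_add)
  finally show ?thesis .
qed

definition pb :: "int \<Rightarrow> int^'r::finite \<Rightarrow> 'r lpoly" where
  "pb k v = 1 - Poly_Mapping.single (- v) (tpow k)"

lemma Es_pb_mult:
  assumes "u \<noteq> 0"
  shows "Es l u (pb k v * d) a = Es l u d a - tpow k * Es l u d (a + v)"
proof -
  have "pb k v * d = d + Poly_Mapping.single (- v) (- tpow k) * d"
    by (simp add: pb_def single_uminus algebra_simps)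
  then show ?thesis by (simp add: Es_add[OF assms] Es_single_mult[OF assms])
qed

text \<open>On a coset of Z v, multiplication by \<open>pb k v\<close> is a weighted difference
  operator. A finitely supported sequence is a difference of a finitely supported one exactly when
  its weighted total sum is zero.\<close>

lemma pb_dvd_iff:
  assumes "v \<noteq> 0"
  shows "pb k v dvd d \<longleftrightarrow> (\<forall>a. Es k v d a = 0)"
proof
  assume "pb k v dvd d"
  then obtain c where c: "d = pb k v * c" by (auto simp: dvd_def)
  have "Es k v c (a + v) = tpow (- k) * Es k v c a" for a
    using Es_shift[OF assms, of k c a 1] by simp
  then show "\<forall>a. Es k v d a = 0"
    by (simp add: c Es_pb_mult[OF assms] flip: mult.assoc tpow_add)
next
  assume E: "\<forall>a. Es k v d a = 0"
  obtain i where i: "v $ i \<noteq> 0" using assms by (auto simp: vec_eq_iff)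
  define g where "g a n = tpow (k * n) * lookup d (a + n *s v)" for a and n :: int
  define S where "S a = {n. lookup d (a + n *s v) \<noteq> 0}" for a
  have fS: "finite (S a)" for a unfolding S_def by (rule finite_Es[OF assms])
  \<comment> \<open>The quotient as a summation: the weighted sum of d over the ray from a in
    direction v solves c(a) - t^k c(a + v) = d(a).\<close>
  define c where "c a = (\<Sum>n\<in>S a \<inter> {0..}. g a n)" for a
  define M where "M = (\<Sum>a\<in>keys d. \<bar>a $ i\<bar>)"
  have M: "\<bar>a $ i\<bar> \<le> M" if "lookup d a \<noteq> 0" for a
    unfolding M_def using that by (intro member_le_sum) (auto simp: in_keys_iff)
  \<comment> \<open>Since the full coset sum is zero, a nonzero half sum at a forces support points
    of d on both sides of a. Along a coordinate where v is nonzero this bounds the distance from a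
    to the support.\<close>
  have fin: "finite {a. c a \<noteq> 0}"
  proof -
    have "{a. c a \<noteq> 0} \<subseteq> (\<lambda>(x, n). x - n *s v) ` (keys d \<times> {0..2 * M})"
    proof
      fix a assume "a \<in> {a. c a \<noteq> 0}"
      then have ca: "c a \<noteq> 0" by simp
      then obtain n where n: "n \<in> S a" "n \<ge> 0" unfolding c_def
        by (auto elim: sum.not_neutral_contains_not_neutral)
      have "Es k v d a = c a + (\<Sum>n\<in>S a \<inter> {..<0}. g a n)"
        unfolding Es_def c_def g_def
        by (subst sum.union_disjoint[symmetric]) (use fS[of a] in \<open>auto simp: S_def intro!: sum.cong\<close>)
      then have "(\<Sum>n\<in>S a \<inter> {..<0}. g a n) \<noteq> 0" using E ca by auto
      then obtain m where m: "m \<in> S a" "m < 0" by (auto elim: sum.not_neutral_contains_not_neutral)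
      have "\<bar>a $ i + n * v $ i\<bar> \<le> M" "\<bar>a $ i + m * v $ i\<bar> \<le> M"
        using M[of "a + n *s v"] M[of "a + m *s v"] n m by (auto simp: S_def)
      then have "\<bar>(n - m) * v $ i\<bar> \<le> 2 * M" unfolding left_diff_distrib by linarith
      moreover have "\<bar>(n - m) * v $ i\<bar> \<ge> \<bar>n - m\<bar>" 
      proof -
        have "1 \<le> \<bar>v $ i\<bar>" using i by linarith
        then have "\<bar>n - m\<bar> * 1 \<le> \<bar>n - m\<bar> * \<bar>v $ i\<bar>" by (intro mult_left_mono) simp_all
        then show ?thesis by (simp add: abs_mult)
      qed
      ultimately have "n \<le> 2 * M" using m n by linarith
      then have "(a + n *s v, n) \<in> keys d \<times> {0..2 * M}" using n by (auto simp: S_def in_keys_iff)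
      moreover have "a = (\<lambda>(x, n). x - n *s v) (a + n *s v, n)" by simp
      ultimately show "a \<in> (\<lambda>(x, n). x - n *s v) ` (keys d \<times> {0..2 * M})" by (rule rev_image_eqI)
    qed
    then show ?thesis by (rule finite_subset) auto
  qed
  define c' where "c' = Abs_poly_mapping c"
  have lc: "lookup c' = c" unfolding c'_def using fin by (rule lookup_Abs_poly_mapping)
  have "lookup d a = lookup (pb k v * c') a" for a
  proof -
    have "lookup (pb k v * c') a = c a - tpow k * c (a + v)"
      unfolding pb_def left_diff_distrib lookup_minus by (simp add: lookup_single_mult lc)
    also have "tpow k * c (a + v) = (\<Sum>n\<in>S a \<inter> {1..}. g a n)"
    proof -
      have e: "a + v + n *s v = a + (n + 1) *s v" for n by (simp add: vec_eq_iff algebra_simps)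
      have "tpow k * c (a + v) = (\<Sum>n\<in>S (a + v) \<inter> {0..}. g a (n + 1))"
        unfolding c_def sum_distrib_left g_def e
        by (intro sum.cong refl) (simp add: distrib_left tpow_add mult_ac)
      also have "\<dots> = (\<Sum>n\<in>S a \<inter> {1..}. g a n)"
        by (rule sum.reindex_bij_witness[of _ "\<lambda>n. n - 1" "\<lambda>n. n + 1"]) (auto simp: S_def e)
      finally show ?thesis .
    qed
    also have "c a = (\<Sum>n\<in>S a \<inter> {1..}. g a n) + lookup d a"
    proof -
      have "c a = (\<Sum>n\<in>(S a \<inter> {1..}) \<union> (S a \<inter> {0}). g a n)"
        unfolding c_def by (rule sum.cong) auto
      also have "\<dots> = (\<Sum>n\<in>S a \<inter> {1..}. g a n) + (\<Sum>n\<in>S a \<inter> {0}. g a n)"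
        by (rule sum.union_disjoint) (use fS in auto)
      also have "(\<Sum>n\<in>S a \<inter> {0}. g a n) = lookup d a"
        by (cases "0 \<in> S a") (auto simp: S_def g_def)
      finally show ?thesis .
    qed
    finally show ?thesis by simp
  qed
  then have "d = pb k v * c'" by (rule poly_mapping_eqI)
  then show "pb k v dvd d" by simp
qed

lemma pb_dvd_scalar:
  assumes "v \<noteq> 0" "pb k v dvd sD z * d" "z \<noteq> 0"
  shows "pb k v dvd d"
  using assms(2,3) unfolding pb_dvd_iff[OF assms(1)] by (simp add: Es_single_mult[OF assms(1)])

text \<open>The two binomials differ by a nonzero scalar times a unit, and scalars can be cancelled
  by \<open>pb_dvd_scalar\<close>. This replaces an argument with coprime elements.\<close>

lemma pb_dvd_pb_same:
  assumes "v \<noteq> 0" "pb k v dvd pb l v * d" "k \<noteq> l"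
  shows "pb k v dvd d"
proof -
  have "sD (tpow k - tpow l) * q0 (- v) = Poly_Mapping.single (- v) (tpow k) - Poly_Mapping.single (- v) (tpow l)"
    unfolding mult_single by (simp add: single_diff)
  then have "pb l v = pb k v + sD (tpow k - tpow l) * q0 (- v)"
    by (simp add: pb_def)
  then have "pb l v * d = pb k v * d + sD (tpow k - tpow l) * (q0 (- v) * d)"
    by (simp only: distrib_right mult.assoc)
  then have "pb k v dvd sD (tpow k - tpow l) * (q0 (- v) * d)"
    using assms(2) by (simp add: dvd_add_right_iff)
  then have "pb k v dvd q0 (- v) * d" by (rule pb_dvd_scalar[OF assms(1)]) (use assms(3) in simp)
  then have "pb k v dvd q0 v * (q0 (- v) * d)" by (rule dvd_mult)
  moreover have "q0 v * (q0 (- v) * d) = d"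
    unfolding mult.assoc[symmetric] mult_single by simp
  ultimately show ?thesis by simp
qed

text \<open>Divisibility of the product makes the coset sums of d invariant, up to a power of t,
  under the shift by w. The cosets reached from one point are pairwise different, so a nonzero sum
  would need infinite support.\<close>

lemma pb_dvd_pb_indep:
  assumes "v \<noteq> 0" "pb k v dvd pb l w * d" and indep: "\<And>m n. m *s w = n *s v \<Longrightarrow> m = 0 \<and> n = 0"
  shows "pb k v dvd d"
proof -
  have E: "Es k v d a = tpow l * Es k v d (a + w)" for a
  proof -
    have "Es k v (pb l w * d) a = 0" using assms(2) unfolding pb_dvd_iff[OF assms(1)] ..
    then show ?thesis unfolding Es_pb_mult[OF assms(1)] by (rule eq_iff_diff_eq_0[THEN iffD2])
  qed
  have EN: "Es k v d a = tpow (int N * l) * Es k v d (a + int N *s w)" for a N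
  proof (induction N)
    case (Suc N)
    have "a + int N *s w + w = a + int (Suc N) *s w" by (simp add: vec_eq_iff algebra_simps)
    then have "Es k v d (a + int N *s w) = tpow l * Es k v d (a + int (Suc N) *s w)"
      using E[of "a + int N *s w"] by (simp only:)
    then have "Es k v d a = tpow (int N * l) * tpow l * Es k v d (a + int (Suc N) *s w)"
      using Suc.IH by (simp only: mult.assoc)
    moreover have "tpow (int N * l) * tpow l = tpow (int (Suc N) * l)"
      by (simp add: algebra_simps flip: tpow_add)
    ultimately show ?case by (simp only:)
  qed simp
  have "Es k v d a = 0" for a
  proof (rule ccontr)
    assume nz: "Es k v d a \<noteq> 0"
    have "\<exists>n. lookup d (a + int N *s w + n *s v) \<noteq> 0" for N
    proof (rule ccontr)
      assume "\<not> ?thesis"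
      then have "Es k v d (a + int N *s w) = 0" by (simp add: Es_def)
      then show False using EN[of a N] nz by simp
    qed
    then obtain f where f: "\<And>N. lookup d (a + int N *s w + f N *s v) \<noteq> 0" by metis
    have "inj (\<lambda>N. a + int N *s w + f N *s v)"
    proof (rule injI)
      fix M N assume "a + int M *s w + f M *s v = a + int N *s w + f N *s v"
      then have "(int M - int N) *s w = (f N - f M) *s v"
        by (simp add: vec_eq_iff algebra_simps)
      then show "M = N" using indep by fastforce
    qed
    moreover have "range (\<lambda>N. a + int N *s w + f N *s v) \<subseteq> keys d"
      using f by (auto simp: in_keys_iff)
    ultimately show False using finite_subset[OF _ finite_keys[of d]] finite_imageD infinite_UNIV_nat by blast
  qed
  then show ?thesis by (simp add: pb_dvd_iff[OF assms(1)])
qed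

lemma tw_pb: "tw b (pb k v) = pb (k + idot b v) v"
  by (simp add: pb_def tpow_add mult.commute)

lemma tw_dvd: "x dvd y \<Longrightarrow> tw b x dvd tw b y"
  by (auto simp: dvd_def)

lemma ev_pb: "ev m (pb k v) = 1 - tpow (k + idot m v)"
proof -
  have "ev m 1 = 1" using ev_single[of m 0 1] by simp
  then show ?thesis by (simp add: pb_def tpow_add mult.commute)
qed

section \<open>The quantum Laurent phenomenon\<close>

context simply_laced
begin

subsection \<open>Laurent polynomials and the change of seed\<close>

inductive TT :: "'r qtser \<Rightarrow> bool" where
  TT_0: "TT 0"
| TT_step: "TT x \<Longrightarrow> TT (c \<star> X a b + x)"

lemma TT_X: "TT (c \<star> X a b)" "TT (X a b)"
  using TT_step[OF TT_0, of c a b] TT_step[OF TT_0, of 1 a b] by simp_all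

lemma TT_1: "TT 1"
  using TT_X(2)[of 0 0] by simp

lemma TT_add: "TT x \<Longrightarrow> TT y \<Longrightarrow> TT (x + y)"
  by (induction x rule: TT.induct) (simp_all add: add.assoc TT_step)

lemma TT_scl: "TT x \<Longrightarrow> TT (c \<star> x)"
  by (induction x rule: TT.induct) (simp_all add: scl_add_right TT_0 TT_step)

lemma TT_minus: "TT x \<Longrightarrow> TT (- x)"
  using TT_scl[of x "- 1"] by simp

lemma TT_diff: "TT x \<Longrightarrow> TT y \<Longrightarrow> TT (x - y)"
  using TT_add[of x "- y"] TT_minus by simp

lemma TT_mult: "TT x \<Longrightarrow> TT y \<Longrightarrow> TT (x * y)"
proof (induction x rule: TT.induct)
  case (TT_step x c a b)
  have "TT (c \<star> X a b * y)" using TT_step.prems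
    by (induction y rule: TT.induct)
      (simp_all add: TT_0 distrib_left scl_add_right X_mult TT.TT_step)
  then show ?case using TT_step by (simp add: distrib_right TT_add)
qed (simp add: TT_0)

lemma cf_X: "cf (X a b) (Lm b') = (if b' = b then q0 a else 0)"
  by (simp add: X_def cf_qmon Lm_inj)

lemma TT_lattice: "TT x \<Longrightarrow> cf x b' \<noteq> 0 \<Longrightarrow> \<exists>b. b' = Lm b"
proof (induction x arbitrary: b' rule: TT.induct)
  case (TT_step x c a b)
  then show ?case by (cases "b' = Lm b") (auto simp: X_def cf_qmon)
qed simp

lemma finite_TT: "TT x \<Longrightarrow> finite {b. cf x (Lm b) \<noteq> 0}"
proof (induction x rule: TT.induct)
  case (TT_step x c a b)
  have "{b'. cf (c \<star> X a b + x) (Lm b') \<noteq> 0} \<subseteq> insert b {b. cf x (Lm b) \<noteq> 0}"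
    by (auto simp: cf_X split: if_splits)
  then show ?case using TT_step.IH finite_subset by blast
qed simp

definition mY :: "nat \<Rightarrow> 'r lpoly \<Rightarrow> (int, 'r) vec \<Rightarrow> 'r qtser" where
  "mY i d b = (\<Sum>a\<in>keys d. lookup d a \<star> Xi i a b)"

lemma mY_superset:
  assumes "finite A" "keys d \<subseteq> A"
  shows "mY i d b = (\<Sum>a\<in>A. lookup d a \<star> Xi i a b)"
  unfolding mY_def using assms by (intro sum.mono_neutral_left) (auto simp: in_keys_iff)

lemma mY_add: "mY i (x + y) b = mY i x b + mY i y b"
proof -
  let ?A = "keys x \<union> keys y"
  have "mY i (x + y) b = (\<Sum>a\<in>?A. lookup (x + y) a \<star> Xi i a b)"
    by (rule mY_superset) (auto simp: keys_add)
  then show ?thesis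
    by (simp add: mY_superset[of ?A x] mY_superset[of ?A y] lookup_add scl_add_left sum.distrib)
qed

lemma mY_0 [simp]: "mY i 0 b = 0"
  by (simp add: mY_def)

lemma mY_single: "mY i (Poly_Mapping.single a c) b = c \<star> Xi i a b"
  by (cases "c = 0") (simp_all add: mY_def)

lemma mY_minus: "mY i (- x) b = - mY i x b"
  using mY_add[of i x "- x" b] by (simp add: eq_neg_iff_add_eq_0 add.commute)

text \<open>\<open>sg i\<close> is the homomorphism \<open>Q\<^sub>\<alpha>\<^sub>,\<^sub>0 \<mapsto> Q\<^sub>\<alpha>\<^sub>,\<^sub>i\<close>, \<open>Q\<^sub>\<alpha>\<^sub>,\<^sub>1 \<mapsto> Q\<^sub>\<alpha>\<^sub>,\<^sub>i\<^sub>+\<^sub>1\<close>.\<close>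

definition sg :: "nat \<Rightarrow> 'r qtser \<Rightarrow> 'r qtser" where
  "sg i x = (\<Sum>b | cf x (Lm b) \<noteq> 0. mY i (cf x (Lm b)) b)"

lemma sg_superset:
  assumes "finite B" "\<And>b. cf x (Lm b) \<noteq> 0 \<Longrightarrow> b \<in> B"
  shows "sg i x = (\<Sum>b\<in>B. mY i (cf x (Lm b)) b)"
  unfolding sg_def using assms by (intro sum.mono_neutral_left) auto

lemma sg_0: "sg i 0 = 0"
  by (simp add: sg_def)

lemma sg_add:
  assumes "TT x" "TT y"
  shows "sg i (x + y) = sg i x + sg i y"
proof -
  let ?B = "{b. cf x (Lm b) \<noteq> 0} \<union> {b. cf y (Lm b) \<noteq> 0}"
  have f: "finite ?B" using assms finite_TT by blast
  show ?thesis by (subst (1 2 3) sg_superset[OF f]) (auto simp: mY_add sum.distrib)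
qed

lemma sg_X: "sg i (c \<star> X a b) = c \<star> Xi i a b"
proof -
  have "sg i (c \<star> X a b) = (\<Sum>b'\<in>{b}. mY i (cf (c \<star> X a b) (Lm b')) b')"
    by (rule sg_superset) (auto simp: cf_X split: if_splits)
  then show ?thesis by (simp add: cf_X mult_single mY_single)
qed

lemma sg_step: "TT x \<Longrightarrow> sg i (c \<star> X a b + x) = c \<star> Xi i a b + sg i x"
  by (simp add: sg_add TT_X sg_X)

lemma sg_scl: "TT x \<Longrightarrow> sg i (c \<star> x) = c \<star> sg i x"
  by (induction x rule: TT.induct) (simp_all add: sg_0 scl_add_right sg_step TT_scl)

lemma sg_diff:
  assumes "TT x" "TT y"
  shows "sg i (x - y) = sg i x - sg i y"
proof -
  have "sg i (x + (- 1) \<star> y) = sg i x + (- 1) \<star> sg i y"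
    using assms by (simp only: sg_add TT_scl sg_scl)
  then show ?thesis by simp
qed

lemma sg_mult: "TT x \<Longrightarrow> TT y \<Longrightarrow> sg i (x * y) = sg i x * sg i y"
proof (induction x rule: TT.induct)
  case (TT_step x c a b)
  have "sg i (c \<star> X a b * y) = c \<star> Xi i a b * sg i y" using TT_step.prems
  proof (induction y rule: TT.induct)
    case (TT_step y d a' b')
    have t: "TT (c \<star> X a b * y)" using TT_step TT_X TT_mult by blast
    have "c \<star> X a b * (d \<star> X a' b' + y)
        = (c * d * tpow (- idot (Lm b) a')) \<star> X (a + a') (b + b') + c \<star> X a b * y"
      by (simp add: distrib_left scl_add_right X_mult mult_ac)
    then have "sg i (c \<star> X a b * (d \<star> X a' b' + y))
        = (c * d * tpow (- idot (Lm b) a')) \<star> Xi i (a + a') (b + b') + c \<star> Xi i a b * sg i y"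
      using t TT_step by (simp only: sg_step)
    then show ?case using TT_step.hyps by (simp add: sg_step distrib_left scl_add_right Xi_mult mult_ac)
  qed (simp add: sg_0)
  then show ?case using TT_step
    by (simp only: distrib_right sg_add TT_X TT_mult sg_X)
qed (simp add: sg_0)

subsection \<open>The subrings attached to the simple roots\<close>

definition pj :: "'r \<Rightarrow> int \<Rightarrow> 'r lpoly" where
  "pj \<alpha> j = pb (- j * dl) (vc \<alpha>)"

lemma vc_nz: "vc \<alpha> \<noteq> 0"
proof
  assume "vc \<alpha> = 0"
  then have "vc \<alpha> $ \<alpha> = 0" by simp
  then show False by (simp add: vc_nth)
qed

lemma tw_pj: "tw (Lm b) (pj \<alpha> j) = pj \<alpha> (j - b $ \<alpha>)"
  by (simp add: pj_def tw_pb algebra_simps)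

text \<open>For Laurent polynomials: the negative powers of Q_{\<alpha>,1} carry enough factors to
  be rewritten in positive powers of Q_{\<alpha>,-1}, that is, Laurentness after exchanging
  Q_{\<alpha>,1}. Divisibility is required factor by factor, so no products have to be handled;
  infinite series are allowed because inverses will be needed.\<close>

definition U :: "'r \<Rightarrow> 'r qtser \<Rightarrow> bool" where
  "U \<alpha> x \<longleftrightarrow> (\<forall>b'. cf x b' \<noteq> 0 \<longrightarrow> (\<exists>b. b' = Lm b)) \<and>
     (\<forall>b j. 1 \<le> j \<longrightarrow> j \<le> - b $ \<alpha> \<longrightarrow> pj \<alpha> j dvd cf x (Lm b))"

text \<open>Split b = c + c'. Either j is in the range of the first factor, or j + c_\<alpha> is in
  the range of the second, and commuting past Q_1^c brings index j + c_\<alpha> back to j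
  (\<open>tw_pj\<close>).\<close>

lemma U_mult:
  assumes "U \<alpha> x" "U \<alpha> y"
  shows "U \<alpha> (x * y)"
  unfolding U_def
proof (intro conjI allI impI)
  fix b' assume "cf (x * y) b' \<noteq> 0"
  then obtain b1 b2 where "cf x b1 \<noteq> 0" "cf y b2 \<noteq> 0" "b' = b1 + b2" by (rule cf_mult_nonzero)
  then obtain c1 c2 where "b' = Lm c1 + Lm c2" using assms unfolding U_def by blast
  then show "\<exists>b. b' = Lm b" by (metis Lm_add)
next
  fix b :: "(int, 'r) vec" and j assume j: "1 \<le> j" "j \<le> - b $ \<alpha>"
  show "pj \<alpha> j dvd cf (x * y) (Lm b)"
    unfolding cf_mult_raw
  proof (rule dvd_sum)
    fix b1 assume "b1 \<in> {b1. cf x b1 \<noteq> 0 \<and> cf y (Lm b - b1) \<noteq> 0}"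
    then obtain c where c: "b1 = Lm c" using assms(1) unfolding U_def by blast
    show "pj \<alpha> j dvd cf x b1 * tw b1 (cf y (Lm b - b1))"
    proof (cases "j \<le> - c $ \<alpha>")
      case True
      then have "pj \<alpha> j dvd cf x b1" using assms(1) j(1) unfolding U_def c by blast
      then show ?thesis by (rule dvd_mult2)
    next
      case False
      then have "1 \<le> j + c $ \<alpha>" "j + c $ \<alpha> \<le> - (b - c) $ \<alpha>" using j by auto
      then have "pj \<alpha> (j + c $ \<alpha>) dvd cf y (Lm (b - c))" using assms(2) unfolding U_def by blast
      then have "tw (Lm c) (pj \<alpha> (j + c $ \<alpha>)) dvd tw (Lm c) (cf y (Lm (b - c)))" by (rule tw_dvd)
      then show ?thesis by (simp add: tw_pj c Lm_diff)
    qed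
  qed
qed

lemma U_add: "U \<alpha> x \<Longrightarrow> U \<alpha> y \<Longrightarrow> U \<alpha> (x + y)"
  unfolding U_def by (auto intro: dvd_add) (metis add.right_neutral)

lemma U_scl:
  assumes "U \<alpha> x"
  shows "U \<alpha> (c \<star> x)"
  unfolding U_def
proof (intro conjI allI impI)
  fix b' assume "cf (c \<star> x) b' \<noteq> 0"
  then have "cf x b' \<noteq> 0" by auto
  then show "\<exists>b. b' = Lm b" using assms unfolding U_def by blast
next
  fix b :: "(int, 'r) vec" and j assume "1 \<le> j" "j \<le> - b $ \<alpha>"
  then have "pj \<alpha> j dvd cf x (Lm b)" using assms unfolding U_def by blast
  then show "pj \<alpha> j dvd cf (c \<star> x) (Lm b)" by simp
qed

lemma U_diff: "U \<alpha> x \<Longrightarrow> U \<alpha> y \<Longrightarrow> U \<alpha> (x - y)"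
  using U_add[OF _ U_scl, of \<alpha> x y "- 1"] by simp

lemma U_X: "b $ \<alpha> \<ge> 0 \<Longrightarrow> U \<alpha> (X a b)"
  unfolding U_def by (auto simp: X_def cf_qmon Lm_inj)

lemma limclosed_U: "limclosed (U \<alpha>)"
proof -
  have "U \<alpha> u" if h: "\<And>d. \<exists>v. U \<alpha> v \<and> cf u d = cf v d" for u
    unfolding U_def using h unfolding U_def by metis
  then show ?thesis
    unfolding limclosed_def using U_X[of 0 \<alpha> 0] U_mult U_add U_scl by auto
qed

definition TU :: "'r qtser \<Rightarrow> bool" where
  "TU x \<longleftrightarrow> TT x \<and> (\<forall>\<alpha>. U \<alpha> x)"

lemma TU_mult: "TU x \<Longrightarrow> TU y \<Longrightarrow> TU (x * y)" by (simp add: TU_def TT_mult U_mult)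
lemma TU_add: "TU x \<Longrightarrow> TU y \<Longrightarrow> TU (x + y)" by (simp add: TU_def TT_add U_add)
lemma TU_diff: "TU x \<Longrightarrow> TU y \<Longrightarrow> TU (x - y)" by (simp add: TU_def TT_diff U_diff)
lemma TU_scl: "TU x \<Longrightarrow> TU (c \<star> x)" by (simp add: TU_def TT_scl U_scl)
lemma TU_X: "(\<And>i. b $ i \<ge> 0) \<Longrightarrow> TU (X a b)" by (simp add: TU_def TT_X U_X)

subsection \<open>The Q-system relation between consecutive seeds\<close>

lemma nonneg_vec_induct [consumes 1, case_names zero step]:
  fixes c :: "(int, 'r) vec"
  assumes "\<And>i. c $ i \<ge> 0"
    and "P 0" and "\<And>c \<beta>. (\<And>i. c $ i \<ge> 0) \<Longrightarrow> P c \<Longrightarrow> P (c + ax \<beta>)"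
  shows "P c"
  using assms(1)
proof (induction "nat (tot c)" arbitrary: c)
  case 0
  have "tot c = (\<Sum>i\<in>UNIV. c $ i)" by (simp add: tot_def)
  moreover have "tot c \<le> 0" using 0 by simp
  moreover have "c $ i \<le> tot c" for i unfolding tot_def by (rule member_le_sum) (use 0 in auto)
  ultimately have "c $ i = 0" for i using 0(2)[of i] by (smt (verit))
  then have "c = 0" by (simp add: vec_eq_iff)
  then show ?case using assms(2) by simp
next
  case (Suc n)
  have "\<exists>\<beta>. c $ \<beta> > 0"
  proof (rule ccontr)
    assume "\<not> ?thesis"
    then have "c $ i = 0" for i using Suc(3)[of i] by (metis order_le_less)
    then have "tot c = 0" by (simp add: tot_def)
    then show False using Suc(2) by simp
  qed
  then obtain \<beta> where \<beta>: "c $ \<beta> > 0" by blast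
  have nn: "(c - ax \<beta>) $ i \<ge> 0" for i using Suc(3)[of i] \<beta> by (auto simp: axis_def)
  have "tot (ax \<beta>) = 1" by (simp add: tot_def axis_def)
  then have "n = nat (tot (c - ax \<beta>))" using Suc(2) by simp
  then have "P (c - ax \<beta>)" using Suc(1) nn by blast
  then show ?case using assms(3)[of "c - ax \<beta>" \<beta>] nn by simp
qed

text \<open>The relation of \<open>Pn\<close> read backwards; it is checked after multiplying by
  Q_{\<alpha>,i+2} on the right. It trades one negative power of the newest variable, with its
  factor 1 - t^(-\<delta>) Q_{i+1}^(-C e_\<alpha>), for the monomial Q_{\<alpha>,i}
  Q_{\<alpha>,i+1}^-2 of the preceding seed.\<close>

lemma Xi_Suc_W:
  "Xi (Suc i) 0 (- ax \<alpha>) - tpow (- dl) \<star> Xi (Suc i) (- vc \<alpha>) (- ax \<alpha>)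
    = tpow (lam C $ \<alpha> $ \<alpha>) \<star> Xi i (ax \<alpha>) (- (2 *s ax \<alpha>))"
    (is "?L = ?R")
proof -
  have l: "Lm (ax \<alpha>) $ \<alpha> = lam C $ \<alpha> $ \<alpha>" by (simp add: Lm_axis)
  have s: "pc \<alpha> - 2 *s ax \<alpha> = - vc \<alpha>" by (simp add: pc_def)
  have "?R * Xi (Suc i) 0 (ax \<alpha>) = 1 - tpow (- dl) \<star> Xi i 0 (- vc \<alpha>)"
    by (simp add: Xi_Suc_ax Pn_def right_diff_distrib scl_diff_right Xi_mult Lm_minus Lm_scale l s
        flip: tpow_add)
  moreover have "?L * Xi (Suc i) 0 (ax \<alpha>) = 1 - tpow (- dl) \<star> Xi i 0 (- vc \<alpha>)"
    by (simp add: left_diff_distrib Xi_mult Xi_Suc_0)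
  moreover have "isu (Xi (Suc i) 0 (ax \<alpha>))" using led_Xi led_isu by blast
  ultimately show ?thesis using isu_cancel_right by metis
qed

text \<open>Each available factor \<open>pj \<alpha> 1\<close> removes one negative power of
  Q_{\<alpha>,i+2}. This is where divisibility pays for the substitution of a later seed.\<close>

lemma mY_pj:
  "mY (Suc i) (pj \<alpha> 1 * d) b
    = tpow (lam C $ \<alpha> $ \<alpha>) \<star> Xi i (ax \<alpha>) (- (2 *s ax \<alpha>)) * mY (Suc i) (tw (Lm (ax \<alpha>)) d) (b + ax \<alpha>)"
  unfolding Xi_Suc_W[symmetric]
proof (induction d rule: lpoly_induct)
  case (single a c)
  have s: "- ax \<alpha> + (b + ax \<alpha>) = b" "- vc \<alpha> + a = a - vc \<alpha>" by simp_all
  have "pj \<alpha> 1 * Poly_Mapping.single a c = Poly_Mapping.single a c + - Poly_Mapping.single (a - vc \<alpha>) (tpow (- dl) * c)"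
    by (simp add: pj_def pb_def left_diff_distrib mult_single)
  then have "mY (Suc i) (pj \<alpha> 1 * Poly_Mapping.single a c) b
      = c \<star> Xi (Suc i) a b - (tpow (- dl) * c) \<star> Xi (Suc i) (a - vc \<alpha>) b"
    by (simp only: mY_add mY_minus mY_single) simp
  moreover have "(Xi (Suc i) 0 (- ax \<alpha>) - tpow (- dl) \<star> Xi (Suc i) (- vc \<alpha>) (- ax \<alpha>)) *
      mY (Suc i) (tw (Lm (ax \<alpha>)) (Poly_Mapping.single a c)) (b + ax \<alpha>)
      = c \<star> Xi (Suc i) a b - (tpow (- dl) * c) \<star> Xi (Suc i) (a - vc \<alpha>) b"
    by (simp add: mY_single left_diff_distrib Xi_mult Lm_minus scl_diff_right s mult_ac flip: tpow_add)
  ultimately show ?case by simp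
qed (simp_all add: distrib_left mY_add)

definition Dcond :: "'r lpoly \<Rightarrow> (int, 'r) vec \<Rightarrow> bool" where
  "Dcond d b \<longleftrightarrow> (\<forall>\<alpha> j. 1 \<le> j \<and> j \<le> - b $ \<alpha> \<longrightarrow> pj \<alpha> j dvd d)"

text \<open>After spending the factor with index 1, the others still divide the quotient: those of
  the same root because the binomials differ by a unit multiple of a nonzero scalar, those of other
  roots because the directions are independent. Commuting past Q_1^(e_\<alpha>) renumbers j + 1 as
  j.\<close>

lemma Dcond_step:
  assumes "Dcond (pj \<alpha> 1 * d) b" "b $ \<alpha> < 0"
  shows "Dcond (tw (Lm (ax \<alpha>)) d) (b + ax \<alpha>)"
  unfolding Dcond_def
proof (intro allI impI)
  fix \<beta> j assume j: "1 \<le> j \<and> j \<le> - (b + ax \<alpha>) $ \<beta>"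
  show "pj \<beta> j dvd tw (Lm (ax \<alpha>)) d"
  proof (cases "\<beta> = \<alpha>")
    case True
    then have "1 \<le> j + 1 \<and> j + 1 \<le> - b $ \<alpha>" using j by simp
    then have "pj \<alpha> (j + 1) dvd pj \<alpha> 1 * d" using assms(1) unfolding Dcond_def by blast
    moreover have "- (j + 1) * dl \<noteq> - 1 * dl" using j det_pos unfolding mult_cancel_right by linarith
    ultimately have "pj \<alpha> (j + 1) dvd d"
      unfolding pj_def by (rule pb_dvd_pb_same[OF vc_nz])
    then have "tw (Lm (ax \<alpha>)) (pj \<alpha> (j + 1)) dvd tw (Lm (ax \<alpha>)) d" by (rule tw_dvd)
    then show ?thesis using True by (simp add: tw_pj)
  next
    case False
    then have a0: "ax \<alpha> $ \<beta> = 0" by (simp add: axis_def)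
    then have "1 \<le> j \<and> j \<le> - b $ \<beta>" using j by simp
    then have "pj \<beta> j dvd pj \<alpha> 1 * d" using assms(1) unfolding Dcond_def by blast
    then have "pj \<beta> j dvd d"
      unfolding pj_def by (rule pb_dvd_pb_indep[OF vc_nz]) (use vc_indep False in metis)
    then have "tw (Lm (ax \<alpha>)) (pj \<beta> j) dvd tw (Lm (ax \<alpha>)) d" by (rule tw_dvd)
    then show ?thesis by (simp add: tw_pj a0)
  qed
qed

text \<open>Induction on the total negative part of b. It describes the image of the substitution by
  its closure properties alone: monomials with nonnegative exponents of the newest variables, sums,
  and left multiplication by Q_{\<alpha>,k} Q_{\<alpha>,k+1}^-2.\<close>

lemma mY_gen:
  assumes P0: "P 0" and Padd: "\<And>x y. P x \<Longrightarrow> P y \<Longrightarrow> P (x + y)"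
    and PX: "\<And>c a b. (\<And>i. b $ i \<ge> 0) \<Longrightarrow> P (c \<star> Xi (Suc k) a b)"
    and PW: "\<And>\<alpha> y c. P y \<Longrightarrow> P (c \<star> Xi k (ax \<alpha>) (- (2 *s ax \<alpha>)) * y)"
  shows "Dcond d b \<Longrightarrow> P (mY (Suc k) d b)"
proof (induction "nat (\<Sum>\<alpha>\<in>UNIV. max 0 (- b $ \<alpha>))" arbitrary: d b)
  case 0
  have "max 0 (- b $ i) \<le> (\<Sum>\<alpha>\<in>UNIV. max 0 (- b $ \<alpha>))" for i
    by (rule member_le_sum[of i UNIV "\<lambda>\<alpha>. max 0 (- b $ \<alpha>)"]) auto
  then have nn: "b $ i \<ge> 0" for i using 0(1) by (smt (verit) nat_0_iff)
  have "P (\<Sum>a\<in>A. f a \<star> Xi (Suc k) a b)" if "finite A" for A f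
    using that by (induction A rule: finite_induct) (auto intro: P0 Padd PX nn)
  then show ?case unfolding mY_def by simp
next
  case (Suc n)
  have "\<exists>\<alpha>. b $ \<alpha> < 0"
  proof (rule ccontr)
    assume "\<not> ?thesis"
    then have "max 0 (- b $ i) = 0" for i by (simp add: not_less)
    then show False using Suc(2) by simp
  qed
  then obtain \<alpha> where \<alpha>: "b $ \<alpha> < 0" by blast
  then have "1 \<le> - b $ \<alpha>" by simp
  then have "pj \<alpha> 1 dvd d" using Suc(3) unfolding Dcond_def by simp
  then obtain e where e: "d = pj \<alpha> 1 * e" by (auto simp: dvd_def)
  have "(\<Sum>\<beta>\<in>UNIV. max 0 (- b $ \<beta>)) = (\<Sum>\<beta>\<in>UNIV. max 0 (- (b + ax \<alpha>) $ \<beta>) + ax \<alpha> $ \<beta>)"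
    using \<alpha> by (intro sum.cong refl) (auto simp: axis_def)
  also have "\<dots> = (\<Sum>\<beta>\<in>UNIV. max 0 (- (b + ax \<alpha>) $ \<beta>)) + 1"
    by (simp add: sum.distrib axis_def)
  finally have "n = nat (\<Sum>\<beta>\<in>UNIV. max 0 (- (b + ax \<alpha>) $ \<beta>))" using Suc(2) by linarith
  then have "P (mY (Suc k) (tw (Lm (ax \<alpha>)) e) (b + ax \<alpha>))"
    using Suc(1) Dcond_step Suc(3) \<alpha> e by blast
  then show ?case unfolding e mY_pj by (rule PW)
qed

lemma TU_Dcond: "TU x \<Longrightarrow> Dcond (cf x (Lm b)) b"
  unfolding TU_def U_def Dcond_def by blast

lemma sg_gen:
  assumes P0: "P 0" and Padd: "\<And>x y. P x \<Longrightarrow> P y \<Longrightarrow> P (x + y)"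
    and PX: "\<And>c a b. (\<And>i. b $ i \<ge> 0) \<Longrightarrow> P (c \<star> Xi (Suc k) a b)"
    and PW: "\<And>\<alpha> y c. P y \<Longrightarrow> P (c \<star> Xi k (ax \<alpha>) (- (2 *s ax \<alpha>)) * y)"
    and x: "TU x"
  shows "P (sg (Suc k) x)"
proof -
  have m: "P (mY (Suc k) (cf x (Lm b)) b)" for b
    by (rule mY_gen[of P, OF assms(1-4) TU_Dcond[OF x]])
  have "P (\<Sum>b\<in>B. mY (Suc k) (cf x (Lm b)) b)" if "finite B" for B
    using that by (induction B rule: finite_induct) (auto intro: P0 Padd m)
  then show ?thesis unfolding sg_def using finite_TT x by (simp add: TU_def)
qed

definition QS :: "'r \<Rightarrow> nat \<Rightarrow> 'r qtser" where
  "QS \<alpha> n = Xi n (ax \<alpha>) 0"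

lemma QS_Suc: "QS \<alpha> (Suc n) = Xi n 0 (ax \<alpha>)"
  by (simp add: QS_def Xi_Suc_0)

lemma Xi_add_right: "Xi m 0 (c + d) = Xi m 0 c * Xi m 0 d"
  by (simp add: Xi_mult)

lemma QS_rec: "QS \<alpha> (Suc (Suc m)) * QS \<alpha> m
    = tpow (- lam C $ \<alpha> $ \<alpha>) \<star> (Xi m 0 (2 *s ax \<alpha>) - Xi m 0 (pc \<alpha>))"
proof -
  have l: "Lm (ax \<alpha>) $ \<alpha> = lam C $ \<alpha> $ \<alpha>" by (simp add: Lm_axis)
  show ?thesis
    unfolding QS_Suc Xi_Suc_ax Pn_def unfolding QS_def
    by (simp add: left_diff_distrib scl_diff_right Xi_mult Lm_scale Lm_pc l flip: tpow_add)
qed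

lemma isu_QS: "isu (QS \<alpha> n)"
  unfolding QS_def using led_Xi led_isu by blast

lemma TT_sg_Xi:
  assumes "\<And>i. c $ i \<ge> 0" "\<And>\<beta>. TT (QS \<beta> (Suc m))" "\<And>\<beta>. sg i (QS \<beta> (Suc m)) = QS \<beta> (Suc (m + i))"
  shows "TT (Xi m 0 c) \<and> sg i (Xi m 0 c) = Xi (m + i) 0 c"
  using assms(1)
proof (induction c rule: nonneg_vec_induct)
  case zero
  show ?case using sg_X[of i 1 0 0] by (simp add: TT_1)
next
  case (step c \<beta>)
  then show ?case using assms(2,3)[of \<beta>]
    by (simp add: Xi_add_right TT_mult sg_mult QS_Suc)
qed

lemma pc_nonneg: "pc \<alpha> $ i \<ge> 0"
  using C_offdiag_le[of \<alpha> i] by (simp add: pc_nth)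

text \<open>The substitution respects the relation, and Q_{\<alpha>,k+i} can be cancelled on the
  right. Laurentness of all members up to n is assumed because \<open>sg\<close> is multiplicative
  only on Laurent polynomials.\<close>

lemma sg_QS:
  assumes "\<And>\<beta> m. m \<le> n \<Longrightarrow> TT (QS \<beta> m)"
  shows "m \<le> n \<Longrightarrow> sg i (QS \<alpha> m) = QS \<alpha> (m + i)"
proof (induction m arbitrary: \<alpha> rule: less_induct)
  case (less m)
  consider "m = 0" | "m = 1" | k where "m = Suc (Suc k)" by (metis One_nat_def not0_implies_Suc)
  then show ?case
  proof cases
    case 1
    then show ?thesis using sg_X[of i 1 "ax \<alpha>" 0] by (simp add: QS_def)
  next
    case 2
    then show ?thesis using sg_X[of i 1 0 "ax \<alpha>"] QS_Suc[of \<alpha> 0] by (simp add: QS_Suc)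
  next
    case 3
    have T: "TT (QS \<beta> (Suc k))" "TT (QS \<beta> k)" "TT (QS \<beta> m)" for \<beta> using assms less 3 by simp_all
    have s: "sg i (QS \<beta> (Suc k)) = QS \<beta> (Suc (k + i))" "sg i (QS \<beta> k) = QS \<beta> (k + i)" for \<beta>
      using less 3 by simp_all
    note X = TT_sg_Xi[OF _ T(1) s(1)]
    have X2: "TT (Xi k 0 (2 *s ax \<alpha>)) \<and> sg i (Xi k 0 (2 *s ax \<alpha>)) = Xi (k + i) 0 (2 *s ax \<alpha>)"
      by (rule X) (simp add: axis_def)
    have Xp: "TT (Xi k 0 (pc \<alpha>)) \<and> sg i (Xi k 0 (pc \<alpha>)) = Xi (k + i) 0 (pc \<alpha>)"
      by (rule X) (rule pc_nonneg)
    have "sg i (QS \<alpha> m) * QS \<alpha> (k + i) = sg i (QS \<alpha> m * QS \<alpha> k)"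
      using T s by (simp add: sg_mult)
    also have "\<dots> = QS \<alpha> (m + i) * QS \<alpha> (k + i)"
      using X2 Xp QS_rec[of \<alpha> "k + i"] by (simp add: 3 QS_rec sg_scl sg_diff TT_diff)
    finally show ?thesis using isu_QS by (simp add: isu_cancel_right)
  qed
qed

subsection \<open>Cancelling \<open>Q\<^sub>\<beta>\<^sub>,\<^sub>2\<close>\<close>

lemma ex_outside_TT:
  assumes "TT x" "s \<noteq> 0"
  shows "\<exists>n :: nat. cf x (Lm (c + (int n * s) *s vc \<beta>)) = 0"
proof (rule ccontr)
  assume "\<not> ?thesis"
  then have "range (\<lambda>n :: nat. c + (int n * s) *s vc \<beta>) \<subseteq> {b. cf x (Lm b) \<noteq> 0}" by auto
  moreover have "inj (\<lambda>n :: nat. c + (int n * s) *s vc \<beta>)"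
  proof (rule injI)
    fix m n assume "c + (int m * s) *s vc \<beta> = c + (int n * s) *s vc \<beta>"
    then have "((int m * s) *s vc \<beta>) $ \<beta> = ((int n * s) *s vc \<beta>) $ \<beta>" by simp
    then show "m = n" using assms(2) by (simp add: vc_nth)
  qed
  ultimately show False
    using finite_subset[OF _ finite_TT[OF assms(1)]] finite_imageD infinite_UNIV_nat by blast
qed

text \<open>Up to a unit Q_{\<beta>,2} is a difference of two monomials in the Q_1, so neighbouring
  coefficients of x along a line in direction \<open>vc \<beta>\<close> agree modulo
  \<open>pj \<alpha> j\<close>. As x has finite support, one end of the line is zero.\<close>

lemma U_cancel:
  assumes T: "TT x" and Ux: "U \<alpha> (x * QS \<beta> 2)"
  shows "U \<alpha> x"
proof -
  have "U \<alpha> (x * (QS \<beta> 2 * X (ax \<beta>) 0))"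
    using U_mult[OF Ux U_X[of 0 \<alpha> "ax \<beta>"]] by (simp add: mult.assoc)
  moreover have "QS \<beta> 2 * X (ax \<beta>) 0 = tpow (- lam C $ \<beta> $ \<beta>) \<star> (X 0 (2 *s ax \<beta>) - X 0 (pc \<beta>))"
    using QS_rec[of \<beta> 0] by (simp add: QS_def numeral_2_eq_2)
  ultimately have "U \<alpha> (tpow (lam C $ \<beta> $ \<beta>) \<star> (x * (tpow (- lam C $ \<beta> $ \<beta>) \<star> (X 0 (2 *s ax \<beta>) - X 0 (pc \<beta>)))))"
    by (metis U_scl)
  then have Ux': "U \<alpha> (x * (X 0 (2 *s ax \<beta>) - X 0 (pc \<beta>)))"
    by (simp flip: tpow_add)
  have d: "pj \<alpha> j dvd cf x (Lm (b - 2 *s ax \<beta>)) - cf x (Lm (b - pc \<beta>))"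
    if "1 \<le> j" "j \<le> - b $ \<alpha>" for b j
  proof -
    have "cf (x * (X 0 (2 *s ax \<beta>) - X 0 (pc \<beta>))) (Lm b) = cf x (Lm (b - 2 *s ax \<beta>)) - cf x (Lm (b - pc \<beta>))"
      by (simp add: right_diff_distrib X_def cf_mult_qmon Lm_diff)
    then show ?thesis using Ux' that unfolding U_def by metis
  qed
  have pos: "pj \<alpha> j dvd cf x (Lm b)" if j: "1 \<le> j" "j \<le> - b $ \<alpha>" for b j
  proof (cases "\<beta> = \<alpha>")
    case True
    \<comment> \<open>The direction must keep the \<alpha>-exponent at most -j: here it drops by 2
      at each step along -\<open>vc \<alpha>\<close>, while for \<beta> \<noteq> \<alpha> one moves
      along +\<open>vc \<beta>\<close>, using C_{\<beta>\<alpha>} \<le> 0.\<close>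
    have step: "pj \<alpha> j dvd cf x (Lm (b + (int n * - 1) *s vc \<alpha>)) - cf x (Lm b)" for n
    proof (induction n)
      case (Suc n)
      define b' where "b' = b + (int n * - 1) *s vc \<alpha> + pc \<alpha>"
      have "j \<le> - b' $ \<alpha>" using j by (simp add: b'_def pc_nth vc_nth)
      then have "pj \<alpha> j dvd cf x (Lm (b' - 2 *s ax \<alpha>)) - cf x (Lm (b' - pc \<alpha>))" using d j True by blast
      moreover have "b' - 2 *s ax \<alpha> = b + (int (Suc n) * - 1) *s vc \<alpha>"
        by (simp add: b'_def pc_def vec_eq_iff algebra_simps)
      moreover have "b' - pc \<alpha> = b + (int n * - 1) *s vc \<alpha>" by (simp add: b'_def)
      ultimately have "pj \<alpha> j dvd (cf x (Lm (b + (int (Suc n) * - 1) *s vc \<alpha>)) - cf x (Lm (b + (int n * - 1) *s vc \<alpha>)))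
          + (cf x (Lm (b + (int n * - 1) *s vc \<alpha>)) - cf x (Lm b))"
        using Suc by (intro dvd_add) simp_all
      then show ?case by simp
    qed simp
    obtain n where "cf x (Lm (b + (int n * - 1) *s vc \<alpha>)) = 0" using ex_outside_TT[OF T, of "- 1" b \<alpha>] by auto
    then show ?thesis using step[of n] by simp
  next
    case False
    have step: "pj \<alpha> j dvd cf x (Lm b) - cf x (Lm (b + (int n * 1) *s vc \<beta>))" for n
    proof (induction n)
      case (Suc n)
      define b' where "b' = b + (int n * 1) *s vc \<beta> + 2 *s ax \<beta>"
      have "int n * C $ \<beta> $ \<alpha> \<le> 0" using C_offdiag_le[OF False] by (simp add: mult_nonneg_nonpos)
      then have "j \<le> - b' $ \<alpha>" using j False by (simp add: b'_def vc_nth axis_def)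
      then have "pj \<alpha> j dvd cf x (Lm (b' - 2 *s ax \<beta>)) - cf x (Lm (b' - pc \<beta>))" using d j by blast
      moreover have "b' - pc \<beta> = b + (int (Suc n) * 1) *s vc \<beta>"
        by (simp add: b'_def pc_def vec_eq_iff algebra_simps)
      moreover have "b' - 2 *s ax \<beta> = b + (int n * 1) *s vc \<beta>" by (simp add: b'_def)
      ultimately have "pj \<alpha> j dvd (cf x (Lm b) - cf x (Lm (b + (int n * 1) *s vc \<beta>)))
          + (cf x (Lm (b + (int n * 1) *s vc \<beta>)) - cf x (Lm (b + (int (Suc n) * 1) *s vc \<beta>)))"
        using Suc by (intro dvd_add) simp_all
      then show ?case by simp
    qed simp
    obtain n where "cf x (Lm (b + (int n * 1) *s vc \<beta>)) = 0" using ex_outside_TT[OF T, of 1 b \<beta>] by auto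
    then show ?thesis using step[of n] by simp
  qed
  show ?thesis unfolding U_def using pos TT_lattice[OF T] by blast
qed

lemma TU_Xi1_ax: "TU (Xi 1 0 (ax \<beta>))"
  using Xi_Suc_ax[of 0 \<beta>] unfolding Pn_def One_nat_def Xi.simps(1)
  by (simp, intro TU_scl TU_diff TU_X) (simp_all add: pc_nonneg axis_def)

lemma TU_Xi1:
  assumes "\<And>i. c $ i \<ge> 0"
  shows "TU (Xi 1 0 c)"
  using assms
proof (induction c rule: nonneg_vec_induct)
  case zero
  show ?case using TU_X[of 0 0] by simp
next
  case (step c \<beta>)
  then show ?case using TU_Xi1_ax by (simp only: Xi_add_right TU_mult)
qed

lemma U_cancel_Xi1:
  assumes "\<And>i. c $ i \<ge> 0"
  shows "TT x \<Longrightarrow> U \<alpha> (x * Xi 1 0 c) \<Longrightarrow> U \<alpha> x"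
  using assms
proof (induction c arbitrary: x rule: nonneg_vec_induct)
  case (step c \<beta>)
  have "TT (x * Xi 1 0 c)" using step TU_Xi1[of c] by (simp add: TT_mult TU_def)
  moreover have "U \<alpha> ((x * Xi 1 0 c) * QS \<beta> 2)"
    using step.prems(2) by (simp add: Xi_add_right mult.assoc QS_Suc numeral_2_eq_2)
  ultimately have "U \<alpha> (x * Xi 1 0 c)" by (rule U_cancel)
  then show ?case using step by blast
qed simp

subsection \<open>\<open>Q\<^sub>\<alpha>\<^sub>,\<^sub>3\<close>\<close>

text \<open>With \<open>LE\<close> this expresses "lowest part in the grading m . b" without
  defining it: \<open>NN\<close> bounds the support below by d, and \<open>LE\<close> asks for
  agreement up to degree d. It is used with m = e_\<alpha> here and with m = \<open>kap\<close> for
  lowest monomials.\<close>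

definition NN :: "(int, 'r) vec \<Rightarrow> int \<Rightarrow> 'r qtser \<Rightarrow> bool" where
  "NN m d x \<longleftrightarrow> (\<forall>b'. cf x b' \<noteq> 0 \<longrightarrow> (\<exists>b. b' = Lm b \<and> idot m b \<ge> d))"

definition LE :: "(int, 'r) vec \<Rightarrow> int \<Rightarrow> 'r qtser \<Rightarrow> 'r qtser \<Rightarrow> bool" where
  "LE m d x y \<longleftrightarrow> (\<forall>b. idot m b \<le> d \<longrightarrow> cf x (Lm b) = cf y (Lm b))"

lemma NN_nonneg: "NN m d x \<Longrightarrow> cf x (Lm b) \<noteq> 0 \<Longrightarrow> idot m b \<ge> d"
  unfolding NN_def using Lm_inj by metis

lemma NN_mult:
  assumes "NN m d x" "NN m e y"
  shows "NN m (d + e) (x * y)"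
  unfolding NN_def
proof (intro allI impI)
  fix b' assume "cf (x * y) b' \<noteq> 0"
  then obtain b1 b2 where "cf x b1 \<noteq> 0" "cf y b2 \<noteq> 0" "b' = b1 + b2" by (rule cf_mult_nonzero)
  then obtain c1 c2 where "b' = Lm (c1 + c2)" "idot m c1 \<ge> d" "idot m c2 \<ge> e"
    using assms unfolding NN_def by (metis Lm_add)
  then show "\<exists>b. b' = Lm b \<and> idot m b \<ge> d + e" by (intro exI[of _ "c1 + c2"]) (simp add: idot_add_right)
qed

lemma NN_mono: "NN m d x \<Longrightarrow> e \<le> d \<Longrightarrow> NN m e x"
  unfolding NN_def by (meson order_trans)

lemma NN_add: "NN m d x \<Longrightarrow> NN m d y \<Longrightarrow> NN m d (x + y)"
  unfolding NN_def by (metis add.right_neutral cf_add)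

lemma NN_scl: "NN m d x \<Longrightarrow> NN m d (c \<star> x)"
  unfolding NN_def cf_scl by (metis mult_zero_right)

lemma NN_diff: "NN m d x \<Longrightarrow> NN m d y \<Longrightarrow> NN m d (x - y)"
  using NN_add[OF _ NN_scl, of m d x y "- 1"] by simp

lemma NN_X: "idot m b \<ge> d \<Longrightarrow> NN m d (X a b)"
  by (auto simp: NN_def X_def cf_qmon)

lemma LE_diff: "LE m d x x' \<Longrightarrow> LE m d y y' \<Longrightarrow> LE m d (x - y) (x' - y')"
  by (simp add: LE_def)

lemma LE_scl: "LE m d x x' \<Longrightarrow> LE m d (c \<star> x) (c \<star> x')"
  by (simp add: LE_def)

lemma LE_refl: "LE m d x x"
  by (simp add: LE_def)

lemma LE_mult:
  assumes "NN m d x" "NN m e y" "NN m d x'" "NN m e y'" "LE m d x x'" "LE m e y y'"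
  shows "LE m (d + e) (x * y) (x' * y')"
  unfolding LE_def
proof (intro allI impI)
  fix b :: "(int, 'r) vec" assume b: "idot m b \<le> d + e"
  have zero: "idot m c = d \<and> idot m (b - c) = e"
    if "NN m d u" "NN m e v" "cf u (Lm c) \<noteq> 0" "cf v (Lm b - Lm c) \<noteq> 0" for u v c
    using NN_nonneg[OF that(1,3)] NN_nonneg[OF that(2), of "b - c"] that(4) b by (simp add: Lm_diff idot_diff_right)
  have lat: "\<exists>c. b1 = Lm c" if "NN m d u" "cf u b1 \<noteq> 0" for u b1 using that unfolding NN_def by blast
  have e: "cf x (Lm c) = cf x' (Lm c)" if "idot m c = d" for c
    using assms(5) that unfolding LE_def by simp
  have e': "cf y (Lm c) = cf y' (Lm c)" if "idot m c = e" for c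
    using assms(6) that unfolding LE_def by simp
  have "{b1. cf x b1 \<noteq> 0 \<and> cf y (Lm b - b1) \<noteq> 0} = {b1. cf x' b1 \<noteq> 0 \<and> cf y' (Lm b - b1) \<noteq> 0}"
  proof (intro equalityI subsetI CollectI; clarify)
    fix b1 assume h: "cf x b1 \<noteq> 0" "cf y (Lm b - b1) \<noteq> 0"
    then obtain c where c: "b1 = Lm c" using lat assms(1) by blast
    then show "cf x' b1 \<noteq> 0 \<and> cf y' (Lm b - b1) \<noteq> 0"
      using zero[OF assms(1,2)] h e[of c] e'[of "b - c"] by (simp add: Lm_diff)
  next
    fix b1 assume h: "cf x' b1 \<noteq> 0" "cf y' (Lm b - b1) \<noteq> 0"
    then obtain c where c: "b1 = Lm c" using lat assms(3) by blast
    then show "cf x b1 \<noteq> 0 \<and> cf y (Lm b - b1) \<noteq> 0"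
      using zero[OF assms(3,4)] h e[of c] e'[of "b - c"] by (simp add: Lm_diff)
  qed
  moreover have "cf x b1 * tw b1 (cf y (Lm b - b1)) = cf x' b1 * tw b1 (cf y' (Lm b - b1))"
    if h: "cf x b1 \<noteq> 0" "cf y (Lm b - b1) \<noteq> 0" for b1
  proof -
    obtain c where c: "b1 = Lm c" using lat assms(1) h by blast
    then show ?thesis using zero[OF assms(1,2)] h e[of c] e'[of "b - c"] by (simp add: Lm_diff)
  qed
  ultimately show "cf (x * y) (Lm b) = cf (x' * y') (Lm b)"
    unfolding cf_mult_raw by (intro sum.cong) auto
qed

text \<open>The lowest part of Q_2^c in the e_\<alpha>-grading when c is supported on neighbours
  \<beta> of \<alpha>: the other term of Q_{\<beta>,2} contains Q_{\<alpha>,1} once. The quadratic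
  exponent of t absorbs reordering and makes \<open>Zs\<close> multiplicative.\<close>

definition Zs :: "(int, 'r) vec \<Rightarrow> 'r qtser" where
  "Zs c = tpow (idot (Lm c) c) \<star> X (- c) (2 *s c)"

lemma Zs_add: "Zs (c + d) = Zs c * Zs d"
proof -
  have "idot (Lm (c + d)) (c + d) = idot (Lm c) c + idot (Lm d) d + 2 * idot (Lm c) d"
    by (simp add: Lm_add idot_add_left idot_add_right Lm_sym[of d c])
  then show ?thesis
    by (simp add: Zs_def X_mult Lm_scale tpow_add mult_ac vec.scale_right_distrib)
qed

lemma low_Xi1:
  assumes "\<And>i. c $ i \<ge> 0"
  shows "(\<forall>\<beta>. c $ \<beta> \<noteq> 0 \<longrightarrow> C $ \<alpha> $ \<beta> = - 1) \<longrightarrow> NN (ax \<alpha>) 0 (Xi 1 0 c) \<and> LE (ax \<alpha>) 0 (Xi 1 0 c) (Zs c) \<and> NN (ax \<alpha>) 0 (Zs c)"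
  using assms
proof (induction c rule: nonneg_vec_induct)
  case zero
  show ?case using NN_X[of 0 "ax \<alpha>" 0 0] by (simp add: Zs_def LE_def)
next
  case (step c \<beta>)
  show ?case
  proof
    assume h: "\<forall>\<gamma>. (c + ax \<beta>) $ \<gamma> \<noteq> 0 \<longrightarrow> C $ \<alpha> $ \<gamma> = - 1"
    have "(c + ax \<beta>) $ \<beta> > 0" using step(1)[of \<beta>] by simp
    then have C: "C $ \<alpha> $ \<beta> = - 1" using h by (metis less_irrefl)
    then have ne: "\<beta> \<noteq> \<alpha>" by auto
    have "C $ \<alpha> $ \<gamma> = - 1" if "c $ \<gamma> \<noteq> 0" for \<gamma>
    proof -
      have "(c + ax \<beta>) $ \<gamma> > 0" using step(1)[of \<gamma>] step(1)[of \<beta>] that by (simp add: axis_def)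
      then show ?thesis using h by (metis less_irrefl)
    qed
    then have c: "NN (ax \<alpha>) 0 (Xi 1 0 c)" "LE (ax \<alpha>) 0 (Xi 1 0 c) (Zs c)" "NN (ax \<alpha>) 0 (Zs c)" using step(2) by auto
    have p1: "pc \<beta> $ \<alpha> = 1" using C ne by (simp add: pc_nth C_sym[of \<beta>])
    have a0: "ax \<beta> $ \<alpha> = 0" "ax \<alpha> $ \<beta> = 0" using ne by (simp_all add: axis_def)
    have Q: "Xi 1 0 (ax \<beta>) = tpow (lam C $ \<beta> $ \<beta>) \<star> (X (- ax \<beta>) (2 *s ax \<beta>) - tpow (- dl) \<star> X (- ax \<beta>) (pc \<beta>))"
      using Xi_Suc_ax[of 0 \<beta>] by (simp add: Pn_def)
    have N: "NN (ax \<alpha>) 0 (Xi 1 0 (ax \<beta>))" unfolding Q by (intro NN_scl NN_diff NN_X) (simp_all add: p1 a0)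
    have Z: "Zs (ax \<beta>) = tpow (lam C $ \<beta> $ \<beta>) \<star> X (- ax \<beta>) (2 *s ax \<beta>)"
      by (simp add: Zs_def Lm_axis)
    have L: "LE (ax \<alpha>) 0 (Xi 1 0 (ax \<beta>)) (Zs (ax \<beta>))"
      unfolding Q Z LE_def using p1 by (auto simp: cf_X right_diff_distrib)
    have NZ: "NN (ax \<alpha>) 0 (Zs (ax \<beta>))" unfolding Z by (intro NN_scl NN_X) (simp add: a0)
    show "NN (ax \<alpha>) 0 (Xi 1 0 (c + ax \<beta>)) \<and> LE (ax \<alpha>) 0 (Xi 1 0 (c + ax \<beta>)) (Zs (c + ax \<beta>)) \<and> NN (ax \<alpha>) 0 (Zs (c + ax \<beta>))"
      unfolding Xi_add_right Zs_add
      using c N L NZ NN_mult[of "ax \<alpha>" 0 _ 0] LE_mult[of "ax \<alpha>" 0 _ 0] by simp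
  qed
qed

text \<open>Dividing by Q_{\<alpha>,1} leaves \<alpha>-exponents at least -1, so only the part of
  the numerator of e_\<alpha>-degree 0 matters. There the square and the product are single
  monomials with the same Q_1-exponent, and their difference contains \<open>pj \<alpha> 0\<close>;
  the division renumbers it as \<open>pj \<alpha> 1\<close>.\<close>

lemma U_Q3_diag:
  "U \<alpha> (X 0 (- ax \<alpha>) * (Xi 1 0 (2 *s ax \<alpha>) - tpow (- dl) \<star> Xi 1 0 (pc \<alpha>)))"
proof -
  define N where "N = Xi 1 0 (2 *s ax \<alpha>) - tpow (- dl) \<star> Xi 1 0 (pc \<alpha>)"
  let ?l = "lam C $ \<alpha> $ \<alpha>"
  have la: "Lm (ax \<alpha>) $ \<alpha> = ?l" by (simp add: Lm_axis)
  have Q: "Xi 1 0 (ax \<alpha>) = tpow ?l \<star> (X (- ax \<alpha>) (2 *s ax \<alpha>) - tpow (- dl) \<star> X (- ax \<alpha>) (pc \<alpha>))"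
    using Xi_Suc_ax[of 0 \<alpha>] by (simp add: Pn_def)
  have p0: "pc \<alpha> $ \<alpha> = 0" by (simp add: pc_nth)
  define w where "w = (- tpow (?l - dl)) \<star> X (- ax \<alpha>) (pc \<alpha>)"
  have Q1: "NN (ax \<alpha>) 0 (Xi 1 0 (ax \<alpha>))" unfolding Q by (intro NN_scl NN_diff NN_X) (simp_all add: p0)
  have w1: "NN (ax \<alpha>) 0 w" unfolding w_def by (intro NN_scl NN_X) (simp add: p0)
  have Lw: "LE (ax \<alpha>) 0 (Xi 1 0 (ax \<alpha>)) w"
    unfolding LE_def Q w_def
  proof (intro allI impI)
    fix b :: "(int, 'r) vec" assume "idot (ax \<alpha>) b \<le> 0"
    then have "b \<noteq> 2 *s ax \<alpha>" by auto
    then show "cf (tpow ?l \<star> (X (- ax \<alpha>) (2 *s ax \<alpha>) - tpow (- dl) \<star> X (- ax \<alpha>) (pc \<alpha>))) (Lm b)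
        = cf (- tpow (?l - dl) \<star> X (- ax \<alpha>) (pc \<alpha>)) (Lm b)"
      by (simp add: cf_X mult_single flip: tpow_add)
  qed
  have pca: "idot (Lm (pc \<alpha>)) (ax \<alpha>) = 2 * ?l - dl" by (simp add: Lm_pc idot_diff_left la)
  have pcp: "idot (Lm (pc \<alpha>)) (pc \<alpha>) = 4 * ?l - 2 * dl"
  proof -
    have "idot (Lm (pc \<alpha>)) (pc \<alpha>) = 2 * idot (Lm (ax \<alpha>)) (pc \<alpha>)"
      using p0 by (simp add: Lm_pc idot_diff_left)
    then show ?thesis using pca by (simp add: Lm_sym[of "ax \<alpha>"])
  qed
  have 2: "Xi 1 0 (2 *s ax \<alpha>) = Xi 1 0 (ax \<alpha>) * Xi 1 0 (ax \<alpha>)"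
  proof -
    have "2 *s ax \<alpha> = ax \<alpha> + ax \<alpha>" by (simp add: vec_eq_iff)
    then show ?thesis by (simp only: Xi_add_right)
  qed
  have ww: "w * w = tpow (4 * ?l - 3 * dl) \<star> X (- (2 *s ax \<alpha>)) (2 *s pc \<alpha>)"
  proof -
    have v: "- ax \<alpha> + - ax \<alpha> = - (2 *s ax \<alpha>)" "pc \<alpha> + pc \<alpha> = 2 *s pc \<alpha>" by (simp_all add: vec_eq_iff)
    have "w * w = (tpow (?l - dl) * tpow (?l - dl) * tpow (2 * ?l - dl)) \<star> X (- ax \<alpha> + - ax \<alpha>) (pc \<alpha> + pc \<alpha>)"
      using pca by (simp add: w_def X_mult mult.assoc)
    then show ?thesis unfolding v by (simp flip: tpow_add)
  qed
  have p: "NN (ax \<alpha>) 0 (Xi 1 0 (pc \<alpha>))" "LE (ax \<alpha>) 0 (Xi 1 0 (pc \<alpha>)) (Zs (pc \<alpha>))"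
  proof -
    have "\<forall>\<beta>. pc \<alpha> $ \<beta> \<noteq> 0 \<longrightarrow> C $ \<alpha> $ \<beta> = - 1" using C_offdiag by (auto simp: pc_nth)
    then show "NN (ax \<alpha>) 0 (Xi 1 0 (pc \<alpha>))" "LE (ax \<alpha>) 0 (Xi 1 0 (pc \<alpha>)) (Zs (pc \<alpha>))"
      using low_Xi1[of "pc \<alpha>" \<alpha>] pc_nonneg by blast+
  qed
  have NN: "NN (ax \<alpha>) 0 N" unfolding N_def 2 using NN_mult[OF Q1 Q1] by (intro NN_diff NN_scl p) simp
  \<comment> \<open>In degree 0 both parts sit at the exponent 2 \<open>pc \<alpha>\<close>. Their
    Q_0-exponents -2 e_\<alpha> and -\<open>pc \<alpha>\<close> differ by
    \<open>vc \<alpha>\<close>, and the powers of t coincide.\<close>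
  have d0: "pj \<alpha> 0 dvd cf N (Lm b)" if "b $ \<alpha> \<le> 0" for b
  proof -
    have "cf (Xi 1 0 (2 *s ax \<alpha>)) (Lm b) = cf (w * w) (Lm b)"
      using LE_mult[OF Q1 Q1 w1 w1 Lw Lw] that unfolding 2 LE_def by simp
    moreover have "cf (Xi 1 0 (pc \<alpha>)) (Lm b) = cf (Zs (pc \<alpha>)) (Lm b)"
      using p(2) that unfolding LE_def by simp
    ultimately have "cf N (Lm b) = cf (w * w) (Lm b) - sD (tpow (- dl)) * cf (Zs (pc \<alpha>)) (Lm b)"
      by (simp add: N_def)
    also have "\<dots> = (if b = 2 *s pc \<alpha> then Poly_Mapping.single (- (2 *s ax \<alpha>)) (tpow (4 * ?l - 3 * dl))
        - Poly_Mapping.single (- pc \<alpha>) (tpow (4 * ?l - 3 * dl)) else 0)"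
      by (simp add: ww Zs_def cf_X pcp mult_single flip: tpow_add)
    also have "Poly_Mapping.single (- (2 *s ax \<alpha>)) (tpow (4 * ?l - 3 * dl))
        - Poly_Mapping.single (- pc \<alpha>) (tpow (4 * ?l - 3 * dl))
        = pj \<alpha> 0 * (- Poly_Mapping.single (- pc \<alpha>) (tpow (4 * ?l - 3 * dl)))"
    proof -
      have "- vc \<alpha> + - pc \<alpha> = - (2 *s ax \<alpha>)" by (simp add: pc_def)
      then show ?thesis unfolding pj_def pb_def left_diff_distrib mult_minus_right mult_single by simp
    qed
    finally show ?thesis by simp
  qed
  have "U \<alpha> (X 0 (- ax \<alpha>) * N)"
    unfolding U_def
  proof (intro conjI allI impI)
    fix b' assume "cf (X 0 (- ax \<alpha>) * N) b' \<noteq> 0"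
    then obtain b1 b2 where "cf (X 0 (- ax \<alpha>)) b1 \<noteq> 0" "cf N b2 \<noteq> 0" "b' = b1 + b2" by (rule cf_mult_nonzero)
    moreover have "b1 = Lm (- ax \<alpha>)" using calculation(1) by (simp add: X_def cf_qmon split: if_splits)
    moreover obtain c where "b2 = Lm c" using calculation(2) NN unfolding NN_def by blast
    ultimately show "\<exists>b. b' = Lm b" by (metis Lm_add)
  next
    fix b :: "(int, 'r) vec" and j assume j: "1 \<le> j" "j \<le> - b $ \<alpha>"
    have e: "cf (X 0 (- ax \<alpha>) * N) (Lm b) = tw (Lm (- ax \<alpha>)) (cf N (Lm (b + ax \<alpha>)))"
      by (simp add: X_def cf_qmon_mult Lm_add Lm_minus)
    show "pj \<alpha> j dvd cf (X 0 (- ax \<alpha>) * N) (Lm b)"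
    proof (cases "(b + ax \<alpha>) $ \<alpha> < 0")
      case True
      then have "cf N (Lm (b + ax \<alpha>)) = 0" using NN_nonneg[OF NN, of "b + ax \<alpha>"] by fastforce
      then show ?thesis by (simp add: e)
    next
      case False
      then have b: "j = 1" "(b + ax \<alpha>) $ \<alpha> \<le> 0" using j by auto
      have "tw (Lm (- ax \<alpha>)) (pj \<alpha> 0) dvd tw (Lm (- ax \<alpha>)) (cf N (Lm (b + ax \<alpha>)))"
        by (rule tw_dvd[OF d0[OF b(2)]])
      then show ?thesis by (simp add: e tw_pj b)
    qed
  qed
  then show ?thesis by (simp add: N_def)
qed

lemma Xi1_split: "Xi 1 a b = X 0 a * Xi 1 0 b"
  using Xi_mult[of 1 a 0 0 b] Xi_Suc_0[of 0 a] by simp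

lemma U_Q3: "U \<alpha> (QS \<gamma> 3)"
proof -
  have Q: "QS \<gamma> 3 = tpow (lam C $ \<gamma> $ \<gamma>) \<star>
      (X 0 (- ax \<gamma>) * (Xi 1 0 (2 *s ax \<gamma>) - tpow (- dl) \<star> Xi 1 0 (pc \<gamma>)))"
    using Xi_Suc_ax[of 1 \<gamma>] Xi1_split[of "- ax \<gamma>"]
    by (simp add: QS_Suc numeral_3_eq_3 Pn_def right_diff_distrib)
  show ?thesis
  proof (cases "\<alpha> = \<gamma>")
    case True
    then show ?thesis unfolding Q by (simp only: U_scl U_Q3_diag)
  next
    case False
    then have "U \<alpha> (X 0 (- ax \<gamma>))" by (intro U_X) (simp add: axis_def)
    moreover have "U \<alpha> (Xi 1 0 (2 *s ax \<gamma>))" "U \<alpha> (Xi 1 0 (pc \<gamma>))"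
      using TU_Xi1[of "2 *s ax \<gamma>"] TU_Xi1[of "pc \<gamma>"] pc_nonneg by (simp_all add: TU_def axis_def)
    ultimately show ?thesis unfolding Q by (intro U_scl U_mult U_diff)
  qed
qed

subsection \<open>All \<open>Q\<^sub>\<alpha>\<^sub>,\<^sub>n\<close> are Laurent polynomials\<close>

lemma TT_sg1: "TU x \<Longrightarrow> TT (sg 1 x)"
proof -
  assume x: "TU x"
  have "TT (c \<star> Xi (Suc 0) a b)" if "\<And>i. b $ i \<ge> 0" for c a b
    using TU_Xi1[OF that] Xi1_split[of a b] by (simp add: TU_def TT_scl TT_mult TT_X)
  moreover have "TT (c \<star> Xi 0 (ax \<alpha>) (- (2 *s ax \<alpha>)) * y)" if "TT y" for \<alpha> y c
    using that by (simp add: TT_scl TT_mult TT_X)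
  ultimately show ?thesis using sg_gen[of TT 0, OF TT_0 TT_add _ _ x] by simp
qed

lemma Xi_pos:
  assumes "\<And>i. a $ i \<ge> 0" "\<And>i. b $ i \<ge> 0" "\<And>\<beta>. P (QS \<beta> m)" "\<And>\<beta>. P (QS \<beta> (Suc m))"
    "P 1" "\<And>x y. P x \<Longrightarrow> P y \<Longrightarrow> P (x * y)"
  shows "P (Xi m a b)"
proof -
  have "P (Xi m 0 b)" using assms(2)
    by (induction b rule: nonneg_vec_induct) (simp_all add: assms Xi_add_right QS_Suc[symmetric])
  moreover have "P (Xi m a 0)" using assms(1)
  proof (induction a rule: nonneg_vec_induct)
    case (step c \<beta>)
    have "Xi m (c + ax \<beta>) 0 = Xi m c 0 * QS \<beta> m" by (simp add: QS_def Xi_mult)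
    then show ?case using step assms by simp
  qed (simp add: assms)
  moreover have "Xi m a b = Xi m a 0 * Xi m 0 b" by (simp add: Xi_mult)
  ultimately show ?thesis using assms by simp
qed

definition ones :: "nat \<Rightarrow> (int, 'r) vec" where "ones n = (\<chi> i. int n)"

text \<open>Denominators Q_{\<beta>,2} have to be cleared on the right, but left multiplication by
  Q_{\<alpha>,1} Q_{\<alpha>,2}^-2 creates them on the left. Asking for all K, with a fixed surplus
  N, is stable under this.\<close>

definition Pr :: "'r qtser \<Rightarrow> bool" where
  "Pr y \<longleftrightarrow> (\<exists>N. \<forall>K. TU (Xi 1 0 (- ones K) * y * Xi 1 0 (ones (K + N))))"

lemma ones_add: "ones (m + n) = ones m + ones n"
  by (simp add: ones_def vec_eq_iff)

lemma Pr_mono: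
  assumes "TU (Xi 1 0 c * y * Xi 1 0 (ones N))" "N \<le> N'"
  shows "TU (Xi 1 0 c * y * Xi 1 0 (ones N'))"
proof -
  have "ones N' = ones N + ones (N' - N)" using assms(2) by (simp add: ones_def vec_eq_iff)
  then have "Xi 1 0 c * y * Xi 1 0 (ones N') = Xi 1 0 c * y * Xi 1 0 (ones N) * Xi 1 0 (ones (N' - N))"
    by (simp add: Xi_add_right mult.assoc)
  moreover have "TU (Xi 1 0 (ones (N' - N)))" by (rule TU_Xi1) (simp add: ones_def)
  ultimately show ?thesis using assms(1) TU_mult by simp
qed

lemma Pr_sg2:
  assumes x: "TU x" and Q3: "\<And>\<beta>. TU (QS \<beta> 3)"
  shows "Pr (sg 2 x)"
proof -
  have Q2: "TU (QS \<beta> 2)" for \<beta> using TU_Xi1_ax by (simp add: QS_Suc numeral_2_eq_2)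
  have Q1: "TU (QS \<beta> 1)" for \<beta> using TU_X[of "ax \<beta>" 0] QS_Suc[of \<beta> 0] by (simp add: axis_def)
  have one: "TU 1" using TU_X[of 0 0] by simp
  have P2: "TU (Xi 2 a b)" if "\<And>i. a $ i \<ge> 0" "\<And>i. b $ i \<ge> 0" for a b
    by (rule Xi_pos[OF that Q2 _ one TU_mult]) (use Q3 in \<open>simp_all add: numeral_3_eq_3 numeral_2_eq_2\<close>)
  have P1: "TU (Xi 1 a b)" if "\<And>i. a $ i \<ge> 0" "\<And>i. b $ i \<ge> 0" for a b
    by (rule Xi_pos[OF that Q1 _ one TU_mult]) (use Q2 in \<open>simp_all add: numeral_2_eq_2\<close>)
  have X12: "Xi 1 0 a = Xi 2 a 0" for a using Xi_Suc_0[of 1 a] by (simp add: numeral_2_eq_2)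
  have 1: "Pr 0" unfolding Pr_def using TU_def TT_0 limclosed_U by (simp add: U_def)
  have 2: "Pr (y + z)" if "Pr y" "Pr z" for y z
  proof -
    obtain M N where M: "\<And>K. TU (Xi 1 0 (- ones K) * y * Xi 1 0 (ones (K + M)))"
      and N: "\<And>K. TU (Xi 1 0 (- ones K) * z * Xi 1 0 (ones (K + N)))"
      using \<open>Pr y\<close> \<open>Pr z\<close> unfolding Pr_def by blast
    have "TU (Xi 1 0 (- ones K) * (y + z) * Xi 1 0 (ones (K + (M + N))))" for K
      unfolding distrib_left distrib_right
      by (rule TU_add; rule Pr_mono) (use M N in auto)
    then show ?thesis unfolding Pr_def by blast
  qed
  have 3: "Pr (c \<star> Xi 2 a b)" if b: "\<And>i. b $ i \<ge> 0" for c a b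
  proof -
    define N where "N = nat (\<Sum>i\<in>UNIV. \<bar>a $ i\<bar>)"
    have N: "(a + ones N) $ i \<ge> 0" for i
    proof -
      have "\<bar>a $ i\<bar> \<le> (\<Sum>i\<in>UNIV. \<bar>a $ i\<bar>)" by (rule member_le_sum[of i UNIV "\<lambda>i. \<bar>a $ i\<bar>"]) auto
      then show ?thesis by (simp add: N_def ones_def)
    qed
    have "TU (Xi 1 0 (- ones K) * (c \<star> Xi 2 a b) * Xi 1 0 (ones (K + N)))" for K
    proof -
      have "Xi 1 0 (- ones K) * (c \<star> Xi 2 a b) * Xi 1 0 (ones (K + N))
          = (c * tpow (- idot (Lm b) (ones (K + N)))) \<star> Xi 2 (a + ones N) b"
        unfolding X12 by (simp add: Xi_mult ones_add)
      then show ?thesis using P2[OF N b] TU_scl by simp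
    qed
    then show ?thesis unfolding Pr_def by blast
  qed
  have 4: "Pr (c \<star> Xi 1 (ax \<alpha>) (- (2 *s ax \<alpha>)) * y)" if y: "Pr y" for \<alpha> y c
  proof -
    obtain N where N: "\<And>K. TU (Xi 1 0 (- ones K) * y * Xi 1 0 (ones (K + N)))"
      using y unfolding Pr_def by blast
    have "TU (Xi 1 0 (- ones K) * (c \<star> Xi 1 (ax \<alpha>) (- (2 *s ax \<alpha>)) * y) * Xi 1 0 (ones (K + (2 + N))))" for K
    proof -
      have "Xi 1 0 (- ones K) * Xi 1 (ax \<alpha>) (- (2 *s ax \<alpha>))
          = tpow (idot (Lm (ones K)) (ax \<alpha>)) \<star> Xi 1 (ax \<alpha>) (- ones K - 2 *s ax \<alpha>)"
        by (simp add: Xi_mult Lm_minus)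
      \<comment> \<open>Borrowing two powers of every Q_{\<beta>,2} makes the left factor a monomial
        with nonnegative exponents; the price is that the hypothesis on y is used with K +
        2.\<close>
      also have "Xi 1 (ax \<alpha>) (- ones K - 2 *s ax \<alpha>) = Xi 1 (ax \<alpha>) (ones 2 - 2 *s ax \<alpha>) * Xi 1 0 (- ones (K + 2))"
      proof -
        have "- ones K - 2 *s ax \<alpha> = (ones 2 - 2 *s ax \<alpha>) + - ones (K + 2)"
          unfolding ones_add by simp
        then show ?thesis by (simp only: Xi_mult Lm_0 idot_0_right minus_zero tpow_0 scl_1 add_0_right)
      qed
      finally have e: "Xi 1 0 (- ones K) * Xi 1 (ax \<alpha>) (- (2 *s ax \<alpha>))
          = tpow (idot (Lm (ones K)) (ax \<alpha>)) \<star> (Xi 1 (ax \<alpha>) (ones 2 - 2 *s ax \<alpha>) * Xi 1 0 (- ones (K + 2)))" .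
      have "Xi 1 0 (- ones K) * (c \<star> Xi 1 (ax \<alpha>) (- (2 *s ax \<alpha>)) * y) * Xi 1 0 (ones (K + (2 + N)))
          = c \<star> ((Xi 1 0 (- ones K) * Xi 1 (ax \<alpha>) (- (2 *s ax \<alpha>))) * (y * Xi 1 0 (ones (K + (2 + N)))))"
        by (simp add: mult.assoc)
      also have "\<dots> = c \<star> tpow (idot (Lm (ones K)) (ax \<alpha>)) \<star> (Xi 1 (ax \<alpha>) (ones 2 - 2 *s ax \<alpha>)
          * (Xi 1 0 (- ones (K + 2)) * y * Xi 1 0 (ones ((K + 2) + N))))"
        unfolding e by (simp add: mult.assoc add.assoc)
      finally have e2: "Xi 1 0 (- ones K) * (c \<star> Xi 1 (ax \<alpha>) (- (2 *s ax \<alpha>)) * y) * Xi 1 0 (ones (K + (2 + N)))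
          = c \<star> tpow (idot (Lm (ones K)) (ax \<alpha>)) \<star> (Xi 1 (ax \<alpha>) (ones 2 - 2 *s ax \<alpha>)
          * (Xi 1 0 (- ones (K + 2)) * y * Xi 1 0 (ones ((K + 2) + N))))" .
      have "TU (Xi 1 (ax \<alpha>) (ones 2 - 2 *s ax \<alpha>))" by (rule P1) (auto simp: ones_def axis_def)
      then show ?thesis unfolding e2 by (rule TU_scl[OF TU_scl[OF TU_mult[OF _ N]]])
    qed
    then show ?thesis unfolding Pr_def by blast
  qed
  show ?thesis using sg_gen[of Pr 1, OF 1 2 _ _ x] 3 4 by (simp add: numeral_2_eq_2)
qed

text \<open>Shifting Q_{n-1} by one seed gives Laurentness but not the divisibilities. Shifting
  Q_{n-2} by two seeds gives them after multiplication by powers of the Q_{\<beta>,2}, which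
  \<open>U_cancel_Xi1\<close> then cancels. That shift presupposes the Q_{\<beta>,3}, so n = 3 is
  settled directly.\<close>

theorem TU_QS: "TU (QS \<alpha> n)"
proof (induction n arbitrary: \<alpha> rule: less_induct)
  case (less n)
  consider "n = 0" | "n = 1" | "n = 2" | "n = 3" | k where "n = Suc (Suc (Suc (Suc k)))"
    by (metis One_nat_def not0_implies_Suc numeral_2_eq_2 numeral_3_eq_3)
  then show ?case
  proof cases
    case 1
    then show ?thesis using TU_X[of 0 "ax \<alpha>"] by (simp add: QS_def)
  next
    case 2
    then show ?thesis using TU_X[of "ax \<alpha>" 0] QS_Suc[of \<alpha> 0] by (simp add: axis_def)
  next
    case 3
    then show ?thesis using TU_Xi1_ax by (simp add: QS_Suc numeral_2_eq_2)
  next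
    case 4
    have "TT (QS \<beta> m)" if "m \<le> 2" for \<beta> m using less.IH[of m \<beta>] 4 that by (simp add: TU_def)
    then have "sg 1 (QS \<alpha> 2) = QS \<alpha> 3" using sg_QS[of 2 2 1 \<alpha>] by simp
    then have "TT (QS \<alpha> 3)" using TT_sg1[of "QS \<alpha> 2"] less.IH[of 2] 4 by simp
    then show ?thesis using U_Q3 4 by (simp add: TU_def)
  next
    case (5 k)
    have T: "TT (QS \<beta> m)" if "m < n" for \<beta> m using less.IH[of m \<beta>] that by (simp add: TU_def)
    have "sg 1 (QS \<alpha> (n - 1)) = QS \<alpha> n" using sg_QS[of "n - 1" "n - 1" 1 \<alpha>] T 5 by simp
    then have TT: "TT (QS \<alpha> n)" using TT_sg1[of "QS \<alpha> (n - 1)"] less.IH[of "n - 1"] 5 by simp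
    have "sg 2 (QS \<alpha> (n - 2)) = QS \<alpha> n" using sg_QS[of "n - 2" "n - 2" 2 \<alpha>] T 5 by simp
    moreover have "Pr (sg 2 (QS \<alpha> (n - 2)))" by (rule Pr_sg2) (use less.IH 5 in simp_all)
    ultimately obtain N where "\<And>K. TU (Xi 1 0 (- ones K) * QS \<alpha> n * Xi 1 0 (ones (K + N)))"
      unfolding Pr_def by metis
    from this[of 0] have "TU (QS \<alpha> n * Xi 1 0 (ones N))" by (simp add: ones_def flip: zero_vec_def)
    then have "U \<beta> (QS \<alpha> n)" for \<beta>
      using U_cancel_Xi1[of "ones N" "QS \<alpha> n" \<beta>] TT by (simp add: TU_def ones_def)
    then show ?thesis using TT by (simp add: TU_def)
  qed
qed

end

section \<open>Chebyshev recursion and lowest terms\<close>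

context simply_laced
begin

section \<open>Chebyshev polynomials in the adjacency matrix and their positivity\<close>

definition Nv :: "(int, 'r) vec \<Rightarrow> (int, 'r) vec" where "Nv u = 2 *s u - C *v u"

text \<open>\<open>av n\<close> is the Chebyshev polynomial of the second kind of index n - 1,
  evaluated at half the adjacency matrix 2 - C. It will give the Q_1-exponents of lowest
  monomials.\<close>

fun av :: "nat \<Rightarrow> (int, 'r) vec \<Rightarrow> (int, 'r) vec" where
  "av 0 u = 0"
| "av (Suc 0) u = u"
| "av (Suc (Suc n)) u = Nv (av (Suc n) u) - av n u"

lemma Nv_add: "Nv (u + w) = Nv u + Nv w"
  by (simp add: Nv_def matvec_int_add vec.scale_right_distrib)

lemma Nv_minus: "Nv (- u) = - Nv u"
  by (simp add: Nv_def matvec_int_minus vec_eq_iff)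

lemma Nv_diff: "Nv (u - w) = Nv u - Nv w"
  using Nv_add[of u "- w"] by (simp add: Nv_minus)

lemma Nv_0 [simp]: "Nv 0 = 0"
  by (simp add: Nv_def)

lemma Nv_scale: "Nv (k *s u) = k *s Nv u"
  by (simp add: Nv_def matvec_int_scale vec_eq_iff algebra_simps)

lemma Nv_ax: "Nv (ax \<alpha>) = pc \<alpha>"
  by (simp add: Nv_def pc_def vc_def)

lemma idot_C: "idot u (C *v w) = idot (C *v u) w"
  by (rule idot_matvec_sym) (rule C_sym)

lemma idot_Nv: "idot u (Nv w) = idot (Nv u) w"
  by (simp add: Nv_def idot_diff_left idot_diff_right idot_C)

lemma av_add: "av n (u + w) = av n u + av n w"
  by (induction n u rule: av.induct) (simp_all add: Nv_add)

lemma av_0 [simp]: "av n 0 = 0"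
  by (induction n "0 :: (int, 'r) vec" rule: av.induct) simp_all

lemma av_minus: "av n (- u) = - av n u"
  by (induction n u rule: av.induct) (simp_all add: Nv_minus)

lemma av_diff: "av n (u - w) = av n u - av n w"
  using av_add[of n u "- w"] by (simp add: av_minus)

lemma av_scale: "av n (k *s u) = k *s av n u"
  by (induction n u rule: av.induct) (simp_all add: Nv_scale vec.scale_right_diff_distrib)

lemma av_sum: "av n (\<Sum>x\<in>A. f x) = (\<Sum>x\<in>A. av n (f x))"
  by (induction A rule: infinite_finite_induct) (simp_all add: av_add)

lemma av_Nv: "av n (Nv u) = Nv (av n u)"
  by (induction n u rule: av.induct) (simp_all add: Nv_diff)

lemma av_C: "av n (C *v u) = C *v av n u"
proof -
  have "C *v w = 2 *s w - Nv w" for w by (simp add: Nv_def)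
  then show ?thesis by (simp add: av_diff av_scale av_Nv)
qed

lemma idot_av: "idot u (av n w) = idot (av n u) w"
proof (induction n w arbitrary: u rule: av.induct)
  case (3 n w)
  have "idot u (Nv (av (Suc n) w)) = idot (Nv (av (Suc n) u)) w"
    unfolding idot_Nv[of u] "3.IH"(1) av_Nv ..
  then show ?case by (simp add: idot_diff_left idot_diff_right "3.IH"(2))
qed simp_all

text \<open>The Tits form of the bipartite double of the Dynkin diagram. It is invariant under the
  Chebyshev recursion (\<open>Fq_av\<close>), so consecutive vectors started at e_\<alpha> always
  have the value 1, like roots.\<close>

definition Fq :: "(int, 'r) vec \<Rightarrow> (int, 'r) vec \<Rightarrow> int" where
  "Fq x y = idot x x + idot y y - idot x (Nv y)"

lemma Fq_av: "Fq (av n u) (av (Suc n) u) = idot u u"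
proof (induction n)
  case (Suc n)
  define x y z where "x = av n u" and "y = av (Suc n) u" and "z = av (Suc (Suc n)) u"
  have N: "Nv y = z + x" by (simp add: x_def y_def z_def)
  have "idot y (Nv z) = idot (z + x) z" unfolding idot_Nv N ..
  then have "Fq y z = idot y y - idot x z" by (simp add: Fq_def idot_add_left)
  moreover have "Fq x y = idot y y - idot x z" unfolding Fq_def N by (simp add: idot_add_right)
  ultimately show ?case using Suc by (simp add: x_def y_def z_def)
qed (simp add: Fq_def)

lemma Nv_nth: "Nv u $ i = (\<Sum>j\<in>UNIV. pc i $ j * u $ j)"
proof -
  have "Nv u $ i = idot (ax i) (Nv u)" by simp
  also have "\<dots> = idot (pc i) u" by (simp only: idot_Nv Nv_ax)
  finally show ?thesis by (simp add: idot_def)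
qed

lemma idot_Nv_mono: "idot u (Nv w) \<le> idot (\<chi> i. \<bar>u $ i\<bar>) (Nv (\<chi> i. \<bar>w $ i\<bar>))"
  unfolding idot_def Nv_nth
proof (rule sum_mono)
  fix i
  have "u $ i * (\<Sum>j\<in>UNIV. pc i $ j * w $ j) \<le> \<bar>u $ i\<bar> * \<bar>\<Sum>j\<in>UNIV. pc i $ j * w $ j\<bar>"
    by (metis abs_ge_self abs_mult)
  also have "\<dots> \<le> \<bar>u $ i\<bar> * (\<Sum>j\<in>UNIV. pc i $ j * \<bar>w $ j\<bar>)"
  proof (rule mult_left_mono)
    have "\<bar>\<Sum>j\<in>UNIV. pc i $ j * w $ j\<bar> \<le> (\<Sum>j\<in>UNIV. \<bar>pc i $ j * w $ j\<bar>)" by (rule sum_abs)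
    then show "\<bar>\<Sum>j\<in>UNIV. pc i $ j * w $ j\<bar> \<le> (\<Sum>j\<in>UNIV. pc i $ j * \<bar>w $ j\<bar>)"
      using pc_nonneg by (simp add: abs_mult)
  qed simp
  finally show "u $ i * (\<Sum>j\<in>UNIV. pc i $ j * w $ j)
      \<le> (\<chi> i. \<bar>u $ i\<bar>) $ i * (\<Sum>j\<in>UNIV. pc i $ j * (\<chi> i. \<bar>w $ i\<bar>) $ j)" by simp
qed

lemma idot_abs: "idot (\<chi> i. \<bar>u $ i\<bar>) (\<chi> i. \<bar>u $ i\<bar>) = idot u u"
  by (simp add: idot_def)

lemma Nv_lower: "2 * idot u u + idot u (Nv u) \<ge> 0"
proof -
  have "- idot u (Nv u) = idot (- u) (Nv u)" by simp
  also have "\<dots> \<le> idot (\<chi> i. \<bar>u $ i\<bar>) (Nv (\<chi> i. \<bar>u $ i\<bar>))" using idot_Nv_mono[of "- u" u] by simp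
  also have "\<dots> \<le> 2 * idot u u"
    using C_nonneg[of "\<chi> i. \<bar>u $ i\<bar>"] by (simp add: Nv_def idot_diff_right idot_abs)
  finally show ?thesis by linarith
qed

text \<open>Passing to absolute values only decreases the form. For nonnegative u, w, four times the
  form splits into (u+w) . C(u+w) and (u-w) . (2+N)(u-w) with N the adjacency matrix; the second is
  nonnegative because sign changes turn 2+N into a form bounded below by C.\<close>

lemma Fq_pos: "x \<noteq> 0 \<or> y \<noteq> 0 \<Longrightarrow> Fq x y > 0"
proof -
  define u where "u = (\<chi> i. \<bar>x $ i\<bar>)"
  define w where "w = (\<chi> i. \<bar>y $ i\<bar>)"
  have F: "Fq x y \<ge> Fq u w"
    using idot_Nv_mono[of x y] by (simp add: Fq_def u_def w_def idot_abs)
  have s: "idot w (Nv u) = idot u (Nv w)" by (metis idot_Nv idot_commute)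
  have c: "idot w u = idot u w" by (rule idot_commute)
  have 4: "4 * Fq u w = idot (u + w) (C *v (u + w)) + (2 * idot (u - w) (u - w) + idot (u - w) (Nv (u - w)))"
  proof -
    have "C *v (u + w) = 2 *s (u + w) - Nv (u + w)" by (simp add: Nv_def)
    then show ?thesis
      by (simp add: Fq_def Nv_add Nv_diff idot_add_left idot_add_right idot_diff_left idot_diff_right s c)
  qed
  assume "x \<noteq> 0 \<or> y \<noteq> 0"
  then obtain i where "x $ i \<noteq> 0 \<or> y $ i \<noteq> 0" by (auto simp: vec_eq_iff)
  then have "(u + w) $ i > 0" by (auto simp: u_def w_def)
  then have "u + w \<noteq> 0" by (metis less_irrefl zero_index)
  then show "Fq x y > 0" using F 4 C_posdef[of "u + w"] Nv_lower[of "u - w"] by linarith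
qed

text \<open>Real roots are positive or negative: separating positive and negative parts only
  discards nonnegative mixed terms, so two nonzero parts would already give the value 2.\<close>

lemma sign_coherent:
  assumes "Fq x y = 1"
  shows "(\<forall>i. x $ i \<ge> 0 \<and> y $ i \<ge> 0) \<or> (\<forall>i. x $ i \<le> 0 \<and> y $ i \<le> 0)"
proof -
  define xp xm yp ym where "xp = (\<chi> i. max 0 (x $ i))" and "xm = (\<chi> i. max 0 (- x $ i))"
    and "yp = (\<chi> i. max 0 (y $ i))" and "ym = (\<chi> i. max 0 (- y $ i))"
  have x: "x = xp - xm" and y: "y = yp - ym"
    by (simp_all add: vec_eq_iff xp_def xm_def yp_def ym_def max_def)
  have 0: "idot xp xm = 0" "idot yp ym = 0"
    by (simp_all add: idot_def xp_def xm_def yp_def ym_def max_def sum.neutral)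
  have nn: "idot u (Nv w) \<ge> 0" if "\<And>i. u $ i \<ge> 0" "\<And>i. w $ i \<ge> 0" for u w
    unfolding idot_def Nv_nth using that pc_nonneg by (intro sum_nonneg mult_nonneg_nonneg) auto
  have c: "idot xp (Nv ym) \<ge> 0" "idot xm (Nv yp) \<ge> 0"
    by (rule nn; simp add: xp_def xm_def yp_def ym_def)+
  have "Fq x y = Fq xp yp + Fq xm ym + idot xp (Nv ym) + idot xm (Nv yp)"
    unfolding x y Fq_def using 0
    by (simp add: Nv_diff idot_diff_left idot_diff_right idot_commute[of xm xp] idot_commute[of ym yp])
  then have "Fq xp yp + Fq xm ym \<le> 1" using assms c by linarith
  then have "Fq xp yp \<le> 0 \<or> Fq xm ym \<le> 0" by linarith
  then have "(xp = 0 \<and> yp = 0) \<or> (xm = 0 \<and> ym = 0)" using Fq_pos by (meson not_less)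
  then show ?thesis
  proof
    assume z: "xp = 0 \<and> yp = 0"
    have "x $ i \<le> 0 \<and> y $ i \<le> 0" for i
    proof -
      have "xp $ i = 0" "yp $ i = 0" using z by simp_all
      then show ?thesis by (simp add: xp_def yp_def max_def split: if_splits)
    qed
    then show ?thesis by blast
  next
    assume z: "xm = 0 \<and> ym = 0"
    have "x $ i \<ge> 0 \<and> y $ i \<ge> 0" for i
    proof -
      have "xm $ i = 0" "ym $ i = 0" using z by simp_all
      then show ?thesis by (simp add: xm_def ym_def max_def split: if_splits)
    qed
    then show ?thesis by blast
  qed
qed

definition good :: "nat \<Rightarrow> bool" where
  "good n \<longleftrightarrow> (\<forall>\<alpha>. (\<forall>i. av n (ax \<alpha>) $ i \<ge> 0) \<and> av n (ax \<alpha>) \<noteq> 0)"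

lemma ax_nz: "ax \<alpha> \<noteq> 0"
proof
  assume "ax \<alpha> = 0"
  then have "ax \<alpha> $ \<alpha> = 0" by simp
  then show False by simp
qed

lemma good_1: "good 1"
  using ax_nz by (simp add: good_def axis_def)

lemma tot_pos: "(\<And>i. u $ i \<ge> 0) \<Longrightarrow> u \<noteq> 0 \<Longrightarrow> tot u > 0" for u :: "(int, 'r) vec"
proof -
  assume u: "\<And>i. u $ i \<ge> 0" "u \<noteq> 0"
  then obtain i where "u $ i \<noteq> 0" by (auto simp: vec_eq_iff)
  then have "u $ i > 0" using u(1)[of i] by simp
  then show ?thesis unfolding tot_def using u by (intro sum_pos2[of _ i]) simp_all
qed

lemma kap_C: "idot kap (C *v u) = dl * tot u"
proof -
  have "idot kap (C *v u) = idot (dl *s 1) u" by (simp only: idot_C kap_def C_Lm)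
  then show ?thesis by (simp add: tot_def idot_def sum_distrib_left)
qed

text \<open>Otherwise n -> \<open>kap\<close> . \<open>av n\<close> would be a positive integer
  sequence with second differences at most -1, since \<open>kap\<close> . C u = \<delta>
  \<open>tot u\<close>.\<close>

lemma ex_not_good: "\<exists>n\<ge>1. \<not> good n"
proof (rule ccontr)
  assume "\<not> ?thesis"
  then have g: "good n" if "n \<ge> 1" for n using that by blast
  fix \<alpha> :: 'r
  define d where "d n = idot kap (av n (ax \<alpha>))" for n
  have rec: "d (Suc (Suc n)) = 2 * d (Suc n) - dl * tot (av (Suc n) (ax \<alpha>)) - d n" for n
    by (simp add: d_def Nv_def idot_diff_right kap_C)
  have step: "d (Suc (Suc n)) - d (Suc n) \<le> d (Suc n) - d n - 1" for n
  proof -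
    have "tot (av (Suc n) (ax \<alpha>)) > 0" using g[of "Suc n"] tot_pos unfolding good_def by simp
    then have "dl * tot (av (Suc n) (ax \<alpha>)) \<ge> 1" using det_pos by (simp add: int_one_le_iff_zero_less)
    then show ?thesis using rec[of n] by linarith
  qed
  have slope: "d (Suc n) - d n \<le> d 1 - int n" for n
  proof (induction n)
    case 0
    show ?case by (simp add: d_def)
  next
    case (Suc n)
    then show ?case using step[of n] by simp
  qed
  define M where "M = nat (d 1) + 1"
  have dec: "d (M + k) \<le> d M - int k" for k
  proof (induction k)
    case (Suc k)
    have "int M \<ge> d 1 + 1" unfolding M_def by linarith
    then have "d (Suc (M + k)) - d (M + k) \<le> - 1" using slope[of "M + k"] unfolding of_nat_add by linarith
    then show ?case using Suc by simp
  qed simp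
  have pos: "d n > 0" if "n \<ge> 1" for n
  proof -
    have "(\<forall>i. av n (ax \<alpha>) $ i \<ge> 0) \<and> av n (ax \<alpha>) \<noteq> 0" using g[OF that] unfolding good_def by blast
    then obtain i where i: "av n (ax \<alpha>) $ i > 0" "\<And>j. av n (ax \<alpha>) $ j \<ge> 0"
      by (metis order_le_less vec_eq_iff zero_index)
    show ?thesis unfolding d_def idot_def
      by (rule sum_pos2[of _ i]) (use i kap_pos in \<open>simp_all add: less_imp_le\<close>)
  qed
  show False using dec[of "nat (d M)"] pos[of "M + nat (d M)"] pos[of M] by (simp add: M_def)
qed

text \<open>The Coxeter number h: on an eigenvector with eigenvalue 2 cos(\<pi> m/h) of the
  adjacency matrix, \<open>av n\<close> acts by sin(n \<pi> m/h) / sin(\<pi> m/h).\<close>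

definition Nh :: nat where "Nh = (LEAST n. n \<ge> 1 \<and> \<not> good n)"

lemma Nh: "Nh \<ge> 2" "\<not> good Nh" "1 \<le> n \<Longrightarrow> n < Nh \<Longrightarrow> good n"
proof -
  have h: "Nh \<ge> 1 \<and> \<not> good Nh" unfolding Nh_def using ex_not_good LeastI_ex[of "\<lambda>n. n \<ge> 1 \<and> \<not> good n"] by blast
  then show "\<not> good Nh" by simp
  have "Nh \<noteq> 1" using h good_1 by auto
  then show "Nh \<ge> 2" using h by simp
  show "good n" if "1 \<le> n" "n < Nh" using not_less_Least[of n "\<lambda>n. n \<ge> 1 \<and> \<not> good n"] that unfolding Nh_def by blast
qed

lemma Fq_ax: "Fq (av n (ax \<alpha>)) (av (Suc n) (ax \<alpha>)) = 1"
  by (simp add: Fq_av)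

text \<open>Sign coherence with the nonzero nonnegative predecessors keeps all columns nonnegative,
  so failure of \<open>good\<close> means that some column is zero. A zero column at i makes a sum
  of the nonnegative columns at its neighbours zero, and connectedness spreads this to every
  node.\<close>

lemma av_Nh: "av Nh u = 0"
proof -
  define n where "n = Nh - 1"
  have n: "Nh = Suc n" "n \<ge> 1" "good n" using Nh by (auto simp: n_def)
  have nn: "av Nh (ax \<beta>) $ i \<ge> 0" for \<beta> i
  proof -
    have "\<not> (\<forall>i. av n (ax \<beta>) $ i \<le> 0)"
      using n(3) tot_pos[of "av n (ax \<beta>)"] unfolding good_def
      by (metis order_antisym vec_eq_iff zero_index)
    then show ?thesis using sign_coherent[OF Fq_ax[of n \<beta>]] n(1) by auto
  qed
  then obtain \<alpha> where \<alpha>: "av Nh (ax \<alpha>) = 0" using Nh(2) unfolding good_def by blast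
  define S where "S = {\<beta>. av Nh (ax \<beta>) = 0}"
  have "S = UNIV"
  proof (rule ccontr)
    assume "S \<noteq> UNIV"
    moreover have "S \<noteq> {}" using \<alpha> by (auto simp: S_def)
    ultimately obtain i j where ij: "i \<in> S" "j \<notin> S" "C $ i $ j \<noteq> 0" using C_connected by blast
    then have "i \<noteq> j" by blast
    then have p: "pc i $ j > 0" using ij(3) C_offdiag[of i j] by (simp add: pc_nth)
    have "0 = av Nh (pc i)" using ij(1) by (simp add: S_def av_Nv flip: Nv_ax)
    also have "pc i = (\<Sum>k\<in>UNIV. pc i $ k *s ax k)" by (simp add: vec_expand)
    finally have z: "(\<Sum>k\<in>UNIV. pc i $ k *s av Nh (ax k)) = 0" by (simp add: av_sum av_scale)
    have "av Nh (ax j) $ l = 0" for l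
    proof -
      have "(\<Sum>k\<in>UNIV. pc i $ k * av Nh (ax k) $ l) = (\<Sum>k\<in>UNIV. pc i $ k *s av Nh (ax k)) $ l" by simp
      then have "(\<Sum>k\<in>UNIV. pc i $ k * av Nh (ax k) $ l) = 0" unfolding z by simp
      then have "pc i $ j * av Nh (ax j) $ l = 0"
        using pc_nonneg nn by (subst (asm) sum_nonneg_eq_0_iff) auto
      then show ?thesis using p by simp
    qed
    then show False using ij(2) by (simp add: S_def vec_eq_iff)
  qed
  then have ax: "av Nh (ax \<beta>) = 0" for \<beta> by (auto simp: S_def)
  have "av Nh u = av Nh (\<Sum>k\<in>UNIV. u $ k *s ax k)" by (simp add: vec_expand)
  then show ?thesis by (simp add: av_sum av_scale ax)
qed

text \<open>With \<open>av Nh\<close> = 0 the invariant form reduces to the norm, so the columns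
  just before are nonnegative integer vectors of norm 1, hence unit vectors. Symmetry of the matrix
  makes the resulting map of nodes an involution.\<close>

lemma ex_star: "\<exists>\<alpha>. av (Nh - 1) (ax \<alpha>) = ax \<gamma>"
proof -
  define n where "n = Nh - 1"
  have n: "Nh = Suc n" "n \<ge> 1" "good n" using Nh by (auto simp: n_def)
  have unit: "\<exists>\<beta>. av n (ax \<alpha>) = ax \<beta>" for \<alpha>
  proof -
    let ?u = "av n (ax \<alpha>)"
    have u1: "(\<Sum>i\<in>UNIV. ?u $ i * ?u $ i) = 1"
      using Fq_ax[of n \<alpha>] av_Nh[of "ax \<alpha>"] n(1) by (simp add: Fq_def idot_def)
    have unn: "?u $ i \<ge> 0" for i using n(3) by (simp add: good_def)
    obtain i where i: "?u $ i > 0" using n(3) unn unfolding good_def by (metis order_le_less vec_eq_iff zero_index)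
    have "(\<Sum>i\<in>UNIV. ?u $ i * ?u $ i) = ?u $ i * ?u $ i + (\<Sum>j\<in>UNIV - {i}. ?u $ j * ?u $ j)"
      by (simp add: sum.remove)
    moreover have ge: "?u $ i * ?u $ i \<ge> ?u $ i" using i by (simp add: mult_le_cancel_left1)
    moreover have "(\<Sum>j\<in>UNIV - {i}. ?u $ j * ?u $ j) \<ge> 0" by (intro sum_nonneg) simp
    ultimately have "?u $ i = 1" and s0: "(\<Sum>j\<in>UNIV - {i}. ?u $ j * ?u $ j) = 0" using u1 i by linarith+
    have "?u $ j = 0" if "j \<noteq> i" for j
      using s0 that by (subst (asm) sum_nonneg_eq_0_iff) auto
    then have "?u = ax i" using \<open>?u $ i = 1\<close> by (auto simp: vec_eq_iff axis_def)
    then show ?thesis by blast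
  qed
  obtain \<beta> where \<beta>: "av n (ax \<gamma>) = ax \<beta>" using unit by blast
  obtain \<delta> where \<delta>: "av n (ax \<beta>) = ax \<delta>" using unit by blast
  have "idot (ax \<gamma>) (av n (ax \<beta>)) = 1" unfolding idot_av \<beta> by simp
  then have "ax \<gamma> $ \<delta> = 1" unfolding \<delta> by simp
  then have "\<delta> = \<gamma>" by (simp add: axis_def split: if_splits)
  then show ?thesis using \<delta> n_def by blast
qed

text \<open>The companion solution of the same recursion, starting with u and 0: the Q_0-exponents
  of lowest monomials.\<close>

fun am :: "nat \<Rightarrow> (int, 'r) vec \<Rightarrow> (int, 'r) vec" where
  "am 0 u = u"
| "am (Suc n) u = - av n u"

lemma am_rec: "am (Suc (Suc n)) u = Nv (am (Suc n) u) - am n u"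
  by (cases n) (simp_all add: Nv_minus)

lemma am_add: "am n (u + w) = am n u + am n w"
  by (cases n) (simp_all add: av_add)

lemma am_0 [simp]: "am n 0 = 0"
  by (cases n) simp_all

lemma am_Nv: "am n (Nv u) = Nv (am n u)"
  by (cases n) (simp_all add: av_Nv Nv_minus)

section \<open>Lowest monomials of the Q_{\<alpha>,n}\<close>

definition uni :: "laurent \<Rightarrow> bool" where
  "uni u \<longleftrightarrow> (\<exists>k. u = tpow k \<or> u = - tpow k)"

lemma uni_tpow: "uni (tpow k)"
  by (auto simp: uni_def)

lemma uni_1: "uni 1"
  using uni_tpow[of 0] by simp

lemma uni_mult: "uni u \<Longrightarrow> uni w \<Longrightarrow> uni (u * w)"
  unfolding uni_def by (metis minus_mult_left minus_mult_right minus_minus tpow_add)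

lemma uni_minus: "uni u \<Longrightarrow> uni (- u)"
  unfolding uni_def by (metis minus_minus)

lemma uni_inverse: "uni u \<Longrightarrow> \<exists>w. uni w \<and> u * w = 1"
proof -
  assume "uni u"
  then obtain k where "u = tpow k \<or> u = - tpow k" by (auto simp: uni_def)
  then show ?thesis
    by (elim disjE; intro exI[of _ "tpow (- k)"] exI[of _ "- tpow (- k)"])
      (auto simp: uni_def simp flip: tpow_add intro: exI[of _ "- k"])
qed

lemma uni_nonzero: "uni u \<Longrightarrow> u \<noteq> 0"
  by (auto simp: uni_def)

definition kd :: "(int, 'r) vec \<Rightarrow> int" where "kd b = idot kap b"

lemma kd_add: "kd (a + b) = kd a + kd b" by (simp add: kd_def idot_add_right)
lemma kd_diff: "kd (a - b) = kd a - kd b" by (simp add: kd_def idot_diff_right)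
lemma kd_minus: "kd (- a) = - kd a" by (simp add: kd_def)
lemma kd_0: "kd 0 = 0" by (simp add: kd_def)

text \<open>Lowest is meant for the \<open>kap\<close>-grading, because \<open>kap\<close> . C u =
  \<delta> \<open>tot u\<close> decides which term of the Q-system relation is lower.\<close>

definition lowm :: "'r qtser \<Rightarrow> (int, 'r) vec \<Rightarrow> (int, 'r) vec \<Rightarrow> bool" where
  "lowm x a b \<longleftrightarrow> (\<exists>u. uni u \<and> NN kap (kd b) x \<and> LE kap (kd b) x (u \<star> X a b))"

lemma lowm_X: "uni u \<Longrightarrow> lowm (u \<star> X a b) a b"
  unfolding lowm_def using LE_refl by (auto intro!: NN_scl NN_X simp: kd_def)

lemma lowm_scl: "uni w \<Longrightarrow> lowm x a b \<Longrightarrow> lowm (w \<star> x) a b"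
  unfolding lowm_def using LE_scl[of kap "kd b" x _ w] NN_scl uni_mult by (metis scl_scl)

lemma lowm_mult:
  assumes "lowm x a b" "lowm y a' b'"
  shows "lowm (x * y) (a + a') (b + b')"
proof -
  obtain u w where u: "uni u" "NN kap (kd b) x" "LE kap (kd b) x (u \<star> X a b)"
    and w: "uni w" "NN kap (kd b') y" "LE kap (kd b') y (w \<star> X a' b')"
    using assms unfolding lowm_def by blast
  have n: "NN kap (kd c) (z \<star> X d c)" for z c d by (intro NN_scl NN_X) (simp add: kd_def)
  have "LE kap (kd (b + b')) (x * y) ((u * w * tpow (- idot (Lm b) a')) \<star> X (a + a') (b + b'))"
    using LE_mult[OF u(2) w(2) n n u(3) w(3)] by (simp add: kd_add X_mult mult_ac)
  moreover have "uni (u * w * tpow (- idot (Lm b) a'))" by (intro uni_mult u w uni_tpow)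
  ultimately show ?thesis unfolding lowm_def using NN_mult[OF u(2) w(2)] by (auto simp: kd_add)
qed

lemma X_unit_inverse:
  assumes "uni u"
  shows "\<exists>w. uni w \<and> is_inv (u \<star> X a b) (w \<star> X (- a) (- b))"
proof -
  obtain v where v: "uni v" "u * v = 1" using uni_inverse[OF assms] by blast
  define x where "x = idot (Lm b) a"
  define s where "s = v * tpow (- x)"
  have "u * s * tpow x = u * v * (tpow (- x) * tpow x)" by (simp only: s_def mult_ac)
  also have "\<dots> = 1" using v(2) by (simp flip: tpow_add)
  finally have c: "u * s * tpow x = 1" .
  have X1: "X a b * X (- a) (- b) = tpow x \<star> 1" "X (- a) (- b) * X a b = tpow x \<star> 1"
    by (simp_all add: X_mult Lm_minus x_def)
  have "(u \<star> X a b) * (s \<star> X (- a) (- b)) = (u * s * tpow x) \<star> 1"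
    "(s \<star> X (- a) (- b)) * (u \<star> X a b) = (u * s * tpow x) \<star> 1"
    by (simp_all add: X1 mult_ac)
  then have "is_inv (u \<star> X a b) (s \<star> X (- a) (- b))" by (simp only: c is_inv_def scl_1)
  moreover have "uni s" unfolding s_def by (intro uni_mult v uni_tpow)
  ultimately show ?thesis by blast
qed

text \<open>The lowest component of x times the lowest monomial of y cannot cancel. A lowest
  component exists because x is a Laurent polynomial, and this is one of the uses of the Laurent
  phenomenon.\<close>

lemma NN_div:
  assumes x: "TT x" and y: "lowm y a b" and z: "NN kap d (x * y)"
  shows "NN kap (d - kd b) x"
proof (rule ccontr)
  assume n: "\<not> ?thesis"
  define B where "B = {c. cf x (Lm c) \<noteq> 0}"
  have fB: "finite B" unfolding B_def by (rule finite_TT[OF x])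
  obtain b' where b': "cf x b' \<noteq> 0" "\<not> (\<exists>c. b' = Lm c \<and> d - kd b \<le> idot kap c)"
    using n unfolding NN_def by blast
  obtain c0 where "b' = Lm c0" using TT_lattice[OF x b'(1)] by blast
  then have c0: "c0 \<in> B" "kd c0 < d - kd b" using b' by (auto simp: B_def kd_def not_le)
  define e where "e = Min (kd ` B)"
  have emin: "e \<le> kd c" if "c \<in> B" for c unfolding e_def using fB that by simp
  have "e \<in> kd ` B" unfolding e_def using fB c0(1) by (intro Min_in) auto
  then obtain c where c: "c \<in> B" "kd c = e" by blast
  have Nx: "NN kap e x" unfolding NN_def using TT_lattice[OF x] emin unfolding B_def kd_def by blast
  obtain u where u: "uni u" "NN kap (kd b) y" "LE kap (kd b) y (u \<star> X a b)" using y unfolding lowm_def by blast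
  have "LE kap (e + kd b) (x * y) (x * (u \<star> X a b))"
    by (rule LE_mult[OF Nx u(2) Nx _ LE_refl u(3)]) (intro NN_scl NN_X, simp add: kd_def)
  then have "cf (x * y) (Lm (c + b)) = cf (x * (u \<star> X a b)) (Lm (c + b))"
    unfolding LE_def using c(2) by (simp add: kd_add flip: kd_def)
  moreover have "cf (x * (u \<star> X a b)) (Lm (c + b)) \<noteq> 0"
  proof
    assume h: "cf (x * (u \<star> X a b)) (Lm (c + b)) = 0"
    obtain w where "is_inv (u \<star> X a b) (w \<star> X (- a) (- b))" using X_unit_inverse[OF u(1)] by blast
    then have "x = x * (u \<star> X a b) * (w \<star> X (- a) (- b))" by (simp only: is_inv_def mult.assoc mult_1_right)
    moreover have "cf (z * (w \<star> X (- a) (- b))) (Lm c) = 0" if "cf z (Lm (c + b)) = 0" for z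
      using that by (simp add: X_def cf_mult_qmon Lm_add Lm_minus)
    ultimately have "cf x (Lm c) = 0" using h by metis
    then show False using c by (simp add: B_def)
  qed
  ultimately have "kd (c + b) \<ge> d" using NN_nonneg[OF z] by (simp add: kd_def)
  then have "kd c \<ge> d - kd b" by (simp add: kd_add)
  then show False using emin[OF c0(1)] c0(2) c(2) by linarith
qed

lemma LE_div:
  assumes x: "TT x" and y: "lowm y a b" and z: "NN kap d (x * y)" "LE kap d (x * y) z'" "NN kap d z'"
  shows "\<exists>w. uni w \<and> LE kap (d - kd b) x (z' * (w \<star> X (- a) (- b)))"
proof -
  obtain u where u: "uni u" "NN kap (kd b) y" "LE kap (kd b) y (u \<star> X a b)" using y unfolding lowm_def by blast
  have Nx: "NN kap (d - kd b) x" by (rule NN_div[OF x y z(1)])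
  have nX: "NN kap (kd c) (v \<star> X e c)" for v e c by (intro NN_scl NN_X) (simp add: kd_def)
  have "LE kap (d - kd b + kd b) (x * (u \<star> X a b)) (x * y)"
    by (rule LE_mult[OF Nx nX Nx u(2) LE_refl]) (use u(3) in \<open>simp add: LE_def\<close>)
  then have 1: "LE kap d (x * (u \<star> X a b)) z'" using z(2) unfolding LE_def by simp
  have N1: "NN kap d (x * (u \<star> X a b))" using NN_mult[OF Nx nX[of b u a]] by simp
  obtain w where w: "uni w" "is_inv (u \<star> X a b) (w \<star> X (- a) (- b))" using X_unit_inverse[OF u(1)] by blast
  have "LE kap (d + kd (- b)) (x * (u \<star> X a b) * (w \<star> X (- a) (- b))) (z' * (w \<star> X (- a) (- b)))"
    by (rule LE_mult[OF N1 nX z(3) nX 1 LE_refl])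
  moreover have "x * (u \<star> X a b) * (w \<star> X (- a) (- b)) = x"
    using w(2) by (simp only: is_inv_def mult.assoc mult_1_right)
  ultimately show ?thesis using w(1) by (auto simp: kd_minus)
qed

lemma lowm_div:
  assumes "TT x" "lowm y a b" "lowm (x * y) a' b'"
  shows "lowm x (a' - a) (b' - b)"
proof -
  obtain u where u: "uni u" "NN kap (kd b') (x * y)" "LE kap (kd b') (x * y) (u \<star> X a' b')"
    using assms(3) unfolding lowm_def by blast
  have nX: "NN kap (kd b') (u \<star> X a' b')" by (intro NN_scl NN_X) (simp add: kd_def)
  obtain w where w: "uni w" "LE kap (kd b' - kd b) x (u \<star> X a' b' * (w \<star> X (- a) (- b)))"
    using LE_div[OF assms(1,2) u(2,3) nX] by blast
  have "uni (u * w * tpow (idot (Lm b') a))" by (intro uni_mult u w uni_tpow)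
  moreover have "u \<star> X a' b' * (w \<star> X (- a) (- b)) = (u * w * tpow (idot (Lm b') a)) \<star> X (a' - a) (b' - b)"
    by (simp add: X_mult mult_ac)
  ultimately show ?thesis unfolding lowm_def
    using w(2) NN_div[OF assms(1,2) u(2)] by (auto simp: kd_diff)
qed

lemma lowm_diff:
  assumes "lowm x a b" "lowm y a' b'" "kd b' < kd b"
  shows "lowm (x - y) a' b'"
proof -
  obtain u where u: "NN kap (kd b) x" using assms(1) unfolding lowm_def by blast
  obtain w where w: "uni w" "NN kap (kd b') y" "LE kap (kd b') y (w \<star> X a' b')" using assms(2) unfolding lowm_def by blast
  have "LE kap (kd b') x 0"
    unfolding LE_def using NN_nonneg[OF u] assms(3) by (metis cf_0 kd_def le_less_trans not_less)
  then have "LE kap (kd b') (x - y) (0 - w \<star> X a' b')" by (rule LE_diff[OF _ w(3)])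
  then have "LE kap (kd b') (x - y) ((- w) \<star> X a' b')" by simp
  moreover have "NN kap (kd b') (x - y)" using NN_mono[OF u] assms(3) w(2) by (intro NN_diff) simp_all
  ultimately show ?thesis unfolding lowm_def using uni_minus[OF w(1)] by blast
qed

lemma lowm_Xi:
  assumes "\<And>i. c $ i \<ge> 0" "\<And>\<beta>. lowm (QS \<beta> m) (am m (ax \<beta>)) (av m (ax \<beta>))"
  shows "lowm (Xi m c 0) (am m c) (av m c)"
  using assms(1)
proof (induction c rule: nonneg_vec_induct)
  case zero
  show ?case using lowm_X[OF uni_1, of 0 0] by simp
next
  case (step c \<beta>)
  have "Xi m (c + ax \<beta>) 0 = Xi m c 0 * QS \<beta> m" by (simp add: QS_def Xi_mult)
  then show ?case using lowm_mult[OF step(2) assms(2)[of \<beta>]] by (simp add: am_add av_add)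
qed

lemma kd_vc_pos:
  assumes "1 \<le> n" "n < Nh"
  shows "kd (av n (pc \<alpha>)) < kd (av n (2 *s ax \<alpha>))"
proof -
  have "kd (av n (2 *s ax \<alpha>)) - kd (av n (pc \<alpha>)) = kd (av n (vc \<alpha>))"
    by (simp add: pc_def av_diff kd_diff)
  also have "\<dots> = dl * tot (av n (ax \<alpha>))" by (simp add: kd_def vc_def av_C kap_C)
  also have "\<dots> > 0" using Nh(3)[OF assms] tot_pos det_pos unfolding good_def by simp
  finally show ?thesis by simp
qed

lemma QS_rec': "QS \<alpha> (Suc (Suc m)) * QS \<alpha> m
    = tpow (- lam C $ \<alpha> $ \<alpha>) \<star> (Xi (Suc m) (2 *s ax \<alpha>) 0 - Xi (Suc m) (pc \<alpha>) 0)"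
  by (simp add: QS_rec Xi_Suc_0)

text \<open>Before the Coxeter number the product term has strictly smaller degree than the square
  (\<open>kd_vc_pos\<close>), so it alone fixes the lowest monomial, and dividing by Q_{n-2} yields
  the linear recursion of \<open>am\<close> and \<open>av\<close>.\<close>

lemma lowm_QS: "n \<le> Nh \<Longrightarrow> lowm (QS \<alpha> n) (am n (ax \<alpha>)) (av n (ax \<alpha>))"
proof (induction n arbitrary: \<alpha> rule: less_induct)
  case (less n)
  consider "n = 0" | "n = 1" | m where "n = Suc (Suc m)" by (metis One_nat_def not0_implies_Suc)
  then show ?case
  proof cases
    case 1
    then show ?thesis using lowm_X[OF uni_1, of "ax \<alpha>" 0] by (simp add: QS_def)
  next
    case 2
    then show ?thesis using lowm_X[OF uni_1, of 0 "ax \<alpha>"] QS_Suc[of \<alpha> 0] by simp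
  next
    case (3 m)
    have L: "lowm (Xi (Suc m) c 0) (am (Suc m) c) (av (Suc m) c)" if "\<And>i. c $ i \<ge> 0" for c
      by (rule lowm_Xi[OF that less.IH]) (use less.prems 3 in simp_all)
    have "lowm (Xi (Suc m) (2 *s ax \<alpha>) 0 - Xi (Suc m) (pc \<alpha>) 0) (am (Suc m) (pc \<alpha>)) (av (Suc m) (pc \<alpha>))"
      by (rule lowm_diff[OF L[of "2 *s ax \<alpha>"] L[OF pc_nonneg] kd_vc_pos]) (use less.prems 3 in \<open>simp_all add: axis_def\<close>)
    then have "lowm (QS \<alpha> n * QS \<alpha> m) (am (Suc m) (pc \<alpha>)) (av (Suc m) (pc \<alpha>))"
      unfolding 3 QS_rec' by (intro lowm_scl uni_tpow)
    moreover have "TT (QS \<alpha> n)" using TU_QS by (simp add: TU_def)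
    moreover have "lowm (QS \<alpha> m) (am m (ax \<alpha>)) (av m (ax \<alpha>))" using less 3 by simp
    ultimately have "lowm (QS \<alpha> n) (am (Suc m) (pc \<alpha>) - am m (ax \<alpha>)) (av (Suc m) (pc \<alpha>) - av m (ax \<alpha>))"
      using lowm_div by blast
    then show ?thesis unfolding 3 am_rec av.simps by (simp only: am_Nv av_Nv flip: Nv_ax)
  qed
qed

text \<open>At n = \<open>Nh\<close> the Q_1-exponents of the square and of the product both become
  0, so both terms survive in the lowest part. Dividing by Q_{\<alpha>,Nh-1}, whose lowest monomial
  has Q_1-exponent e_\<gamma>, leaves a two-term coefficient at -e_\<gamma>.\<close>

theorem lowering_term:
  "\<exists>\<alpha> n a u w. uni u \<and> uni w \<and> n \<ge> 1 \<and>
     cf (QS \<alpha> n) (Lm (- ax \<gamma>)) = Poly_Mapping.single a u - Poly_Mapping.single (a + vc \<gamma>) w"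
proof -
  obtain \<alpha> where \<alpha>: "av (Nh - 1) (ax \<alpha>) = ax \<gamma>" using ex_star by blast
  obtain m where m: "Nh = Suc m" "m \<ge> 1" using Nh(1) by (cases Nh) auto
  have am: "am Nh c = - av m c" for c by (simp add: m)
  have a1: "am Nh (2 *s ax \<alpha>) = - (2 *s ax \<gamma>)" using \<alpha> by (simp add: am av_scale m)
  have a2: "am Nh (pc \<alpha>) = - (2 *s ax \<gamma>) + vc \<gamma>"
    using \<alpha> by (simp add: am av_scale m pc_def vc_def av_diff av_C)
  have L: "lowm (Xi Nh c 0) (am Nh c) 0" if "\<And>i. c $ i \<ge> 0" for c
    using lowm_Xi[OF that lowm_QS[OF order_refl]] by (simp add: av_Nh)
  have L': "\<exists>u. uni u \<and> NN kap 0 (Xi Nh c 0) \<and> LE kap 0 (Xi Nh c 0) (u \<star> X (am Nh c) 0)"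
    if "\<And>i. c $ i \<ge> 0" for c
    using L[OF that] unfolding lowm_def kd_0 .
  obtain u1 where u1: "uni u1" "NN kap 0 (Xi Nh (2 *s ax \<alpha>) 0)" "LE kap 0 (Xi Nh (2 *s ax \<alpha>) 0) (u1 \<star> X (- (2 *s ax \<gamma>)) 0)"
    using L'[of "2 *s ax \<alpha>"] unfolding a1 by (auto simp: axis_def)
  obtain u2 where u2: "uni u2" "NN kap 0 (Xi Nh (pc \<alpha>) 0)" "LE kap 0 (Xi Nh (pc \<alpha>) 0) (u2 \<star> X (- (2 *s ax \<gamma>) + vc \<gamma>) 0)"
    using L'[of "pc \<alpha>"] pc_nonneg unfolding a2 by blast
  define t where "t = tpow (- lam C $ \<alpha> $ \<alpha>)"
  define z where "z = t \<star> (u1 \<star> X (- (2 *s ax \<gamma>)) 0 - u2 \<star> X (- (2 *s ax \<gamma>) + vc \<gamma>) 0)"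
  have prod: "QS \<alpha> (Suc Nh) * QS \<alpha> m = t \<star> (Xi Nh (2 *s ax \<alpha>) 0 - Xi Nh (pc \<alpha>) 0)"
    unfolding m(1) t_def by (rule QS_rec')
  have N: "NN kap 0 (QS \<alpha> (Suc Nh) * QS \<alpha> m)" unfolding prod by (intro NN_scl NN_diff u1 u2)
  have Lz: "LE kap 0 (QS \<alpha> (Suc Nh) * QS \<alpha> m) z" unfolding prod z_def by (intro LE_scl LE_diff u1 u2)
  have Nz: "NN kap 0 z" unfolding z_def by (intro NN_scl NN_diff NN_X) simp_all
  have y: "lowm (QS \<alpha> m) (am m (ax \<alpha>)) (ax \<gamma>)"
    using lowm_QS[of m \<alpha>] \<alpha> m by simp
  have T: "TT (QS \<alpha> (Suc Nh))" using TU_QS by (simp add: TU_def)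
  obtain w where w: "uni w" "LE kap (0 - kd (ax \<gamma>)) (QS \<alpha> (Suc Nh)) (z * (w \<star> X (- am m (ax \<alpha>)) (- ax \<gamma>)))"
    using LE_div[OF T y N Lz Nz] by blast
  define a where "a = - (2 *s ax \<gamma>) - am m (ax \<alpha>)"
  have "cf (QS \<alpha> (Suc Nh)) (Lm (- ax \<gamma>)) = cf (z * (w \<star> X (- am m (ax \<alpha>)) (- ax \<gamma>))) (Lm (- ax \<gamma>))"
    using w(2) unfolding LE_def by (simp add: kd_def)
  also have "z * (w \<star> X (- am m (ax \<alpha>)) (- ax \<gamma>)) = (t * u1 * w) \<star> X a (- ax \<gamma>) - (t * u2 * w) \<star> X (a + vc \<gamma>) (- ax \<gamma>)"
  proof -
    have e: "vc \<gamma> - 2 *s ax \<gamma> - am m (ax \<alpha>) = a + vc \<gamma>" by (simp add: a_def)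
    show ?thesis
      by (simp add: z_def left_diff_distrib scl_diff_right X_mult e mult_ac flip: a_def)
  qed
  also have "cf \<dots> (Lm (- ax \<gamma>)) = Poly_Mapping.single a (t * u1 * w) - Poly_Mapping.single (a + vc \<gamma>) (t * u2 * w)"
    by (simp add: cf_X mult_single)
  finally show ?thesis
    using uni_mult[OF uni_mult[OF uni_tpow u1(1)] w(1)] uni_mult[OF uni_mult[OF uni_tpow u2(1)] w(1)]
    unfolding t_def by (intro exI[of _ \<alpha>] exI[of _ "Suc Nh"] exI conjI) auto
qed

text \<open>
  The vanishing at \<open>kap\<close>, which is part of the Laurent phenomenon, fixes the ratio of the two
  coefficients; no explicit power of \<open>t\<close> has to be computed.
\<close>

lemma lowering_ev:
  assumes "b $ \<gamma> \<noteq> 0"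
  shows "\<exists>\<alpha> n. n \<ge> 1 \<and> ev (Lm (1 + b)) (cf (QS \<alpha> n) (Lm (- ax \<gamma>))) \<noteq> 0"
proof -
  obtain \<alpha> n a u w where h: "uni u" "uni w" "n \<ge> 1"
    "cf (QS \<alpha> n) (Lm (- ax \<gamma>)) = Poly_Mapping.single a u - Poly_Mapping.single (a + vc \<gamma>) w"
    using lowering_term by blast
  have e: "ev (Lm c) (cf (QS \<alpha> n) (Lm (- ax \<gamma>))) = tpow (- idot (Lm c) a) * (u - tpow (- dl * c $ \<gamma>) * w)" for c
    by (simp add: h idot_add_right tpow_diff right_diff_distrib mult.assoc)
  have "pj \<gamma> 1 dvd cf (QS \<alpha> n) (Lm (- ax \<gamma>))"
    using TU_QS[of \<alpha> n] unfolding TU_def U_def by simp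
  then have "ev (Lm 1) (pj \<gamma> 1) dvd ev (Lm 1) (cf (QS \<alpha> n) (Lm (- ax \<gamma>)))" by (auto simp: dvd_def)
  then have "ev (Lm 1) (cf (QS \<alpha> n) (Lm (- ax \<gamma>))) = 0" by (simp add: pj_def ev_pb)
  then have u: "u = tpow (- dl) * w" unfolding e by simp
  have "u - tpow (- dl * (1 + b) $ \<gamma>) * w = (tpow (- dl) - tpow (- dl * (1 + b) $ \<gamma>)) * w"
    unfolding u left_diff_distrib ..
  moreover have "- dl \<noteq> - dl * (1 + b) $ \<gamma>" using assms det_pos by simp
  ultimately have "ev (Lm (1 + b)) (cf (QS \<alpha> n) (Lm (- ax \<gamma>))) \<noteq> 0"
    unfolding e using uni_nonzero[OF h(2)] by simp
  then show ?thesis using h(3) by blast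
qed

end

section \<open>Constant terms\<close>

lemma Sum_any_inj:
  assumes "inj f" "\<And>x. x \<notin> range f \<Longrightarrow> g x = 0"
  shows "Sum_any (\<lambda>x. g (f x)) = Sum_any g"
proof -
  have "{x. g x \<noteq> 0} = f ` {x. g (f x) \<noteq> 0}" (is "?A = ?B")
  proof
    show "?A \<subseteq> ?B"
    proof
      fix x assume "x \<in> ?A"
      then show "x \<in> ?B" using assms(2)[of x] by (cases "x \<in> range f") auto
    qed
  qed auto
  moreover have "sum g (f ` {x. g (f x) \<noteq> 0}) = (\<Sum>x\<in>{x. g (f x) \<noteq> 0}. g (f x))"
    using sum.reindex[OF inj_on_subset[OF assms(1) subset_UNIV]] unfolding o_def .
  ultimately show ?thesis by (simp only: Sum_any.expand_set)
qed

section \<open>q-binomial coefficients and their Pascal recursion\<close>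

lemma qbinom_fps:
  "qbinom C a (int b) = fps_nth (\<Prod>i\<in>{..b}. Abs_fps (\<lambda>k. qpow C (int i * int k))) a"
proof -
  have "(\<Prod>i\<in>{0..int b}. Abs_fps (\<lambda>k. qpow C (i * int k))) = (\<Prod>i\<in>{..b}. Abs_fps (\<lambda>k. qpow C (int i * int k)))"
    by (rule prod.reindex_bij_witness[of _ int nat]) auto
  then show ?thesis by (simp add: qbinom_def)
qed

lemma qpow_add: "qpow C (k + l) = qpow C k * qpow C l"
  unfolding qpow_def tpow_add[symmetric] by (simp add: algebra_simps)

lemma qpow_0 [simp]: "qpow C 0 = 1"
  by (simp add: qpow_def)

lemma fps_scale_prod:
  fixes f :: "'i \<Rightarrow> laurent fps"
  assumes "finite A"
  shows "fps_nth (\<Prod>i\<in>A. Abs_fps (\<lambda>k. qpow C (int k) * fps_nth (f i) k)) m = qpow C (int m) * fps_nth (\<Prod>i\<in>A. f i) m"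
  using assms
proof (induction A arbitrary: m rule: finite_induct)
  case (insert x A)
  show ?case
    unfolding prod.insert[OF insert.hyps] fps_mult_nth sum_distrib_left
  proof (rule sum.cong[OF refl])
    fix i assume "i \<in> {0..m}"
    then have "int m = int i + int (m - i)" by simp
    then have q: "qpow C (int m) = qpow C (int i) * qpow C (int (m - i))" by (simp only: qpow_add)
    show "fps_nth (Abs_fps (\<lambda>k. qpow C (int k) * fps_nth (f x) k)) i
        * fps_nth (\<Prod>i\<in>A. Abs_fps (\<lambda>k. qpow C (int k) * fps_nth (f i) k)) (m - i)
        = qpow C (int m) * (fps_nth (f x) i * fps_nth (\<Prod>i\<in>A. f i) (m - i))"
      unfolding insert.IH q by (simp add: mult_ac)
  qed
qed simp

text \<open>Substituting q x for x in the generating product removes its first factor, the geometric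
  series, and multiplication by that series is summation of coefficients.\<close>

lemma qbinom_pascal:
  "qbinom C (Suc m) (int (Suc b)) = qbinom C m (int (Suc b)) + qpow C (int (Suc m)) * qbinom C (Suc m) (int b)"
proof -
  define G where "G i = Abs_fps (\<lambda>k. qpow C (int i * int k))" for i
  define F where "F = (\<Prod>i\<in>{..b}. G (Suc i))"
  have "G (Suc i) = Abs_fps (\<lambda>k. qpow C (int k) * fps_nth (G i) k)" for i
    by (rule fps_ext) (simp add: G_def algebra_simps flip: qpow_add)
  then have F: "fps_nth F k = qpow C (int k) * qbinom C k (int b)" for k
    using fps_scale_prod[of "{..b}" C G k] by (simp add: F_def qbinom_fps G_def[symmetric])
  have "(\<Prod>i\<in>{..Suc b}. G i) = G 0 * F"
    unfolding F_def by (rule prod.atMost_Suc_shift)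
  then have Q: "qbinom C k (int (Suc b)) = (\<Sum>i=0..k. fps_nth F i)" for k
  proof -
    have "qbinom C k (int (Suc b)) = fps_nth (F * G 0) k"
      unfolding qbinom_fps G_def[symmetric] \<open>(\<Prod>i\<in>{..Suc b}. G i) = G 0 * F\<close> by (simp add: mult.commute)
    also have "\<dots> = (\<Sum>i=0..k. fps_nth F i)" by (simp add: fps_mult_nth G_def)
    finally show ?thesis .
  qed
  show ?thesis unfolding Q by (simp add: F)
qed

lemma qbinom_0 [simp]: "qbinom C 0 (int b) = 1"
proof -
  have "fps_nth (\<Prod>i\<in>A. Abs_fps (\<lambda>k. qpow C (int i * int k))) 0 = 1" if "finite A" for A :: "nat set"
    using that by (induction A rule: finite_induct) (simp_all add: fps_mult_nth)
  then show ?thesis by (simp add: qbinom_fps)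
qed

lemma qbinom_b0: "qbinom C a 0 = 1"
  using qbinom_fps[of C a 0] by simp

text \<open>Up to a power of \<open>q\<close>, this is \<open>[m + s - 1, m]\<^sub>q\<close>.\<close>

definition cq :: "int^'r::finite^'r \<Rightarrow> nat \<Rightarrow> nat \<Rightarrow> laurent" where
  "cq C s m = (case s of 0 \<Rightarrow> if m = 0 then 1 else 0 | Suc p \<Rightarrow> tpow (det C * int m * int p) * qbinom C m (int p))"

lemma cq_0: "cq C 0 m = (if m = 0 then 1 else 0)"
  by (simp add: cq_def)

lemma cq_Suc: "cq C (Suc p) m = tpow (det C * int m * int p) * qbinom C m (int p)"
  by (simp add: cq_def)

lemma cq_m0 [simp]: "cq C s 0 = 1"
  by (cases s) (simp_all add: cq_0 cq_Suc)

text \<open>This recursion dictates the normalisation of \<open>cq\<close>: t^(\<delta> s) is the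
  factor collected in \<open>one_step\<close> when the exponent a is lowered by
  \<open>vc \<alpha>\<close>.\<close>

lemma cq_rec: "cq C (Suc s) (Suc m) = cq C s (Suc m) + tpow (det C * int s) * cq C (Suc s) m"
proof (cases s)
  case 0
  then show ?thesis by (simp add: cq_0 cq_Suc qbinom_b0)
next
  case (Suc p)
  have e1: "tpow (det C * int (Suc m) * int s) = tpow (det C * int s) * tpow (det C * int m * int s)"
    by (simp add: algebra_simps flip: tpow_add)
  have e2: "tpow (det C * int (Suc m) * int s) * qpow C (int (Suc m)) = tpow (det C * int (Suc m) * int p)"
    by (simp add: qpow_def Suc algebra_simps flip: tpow_add)
  have "cq C (Suc s) (Suc m) = tpow (det C * int (Suc m) * int s) * (qbinom C m (int s) + qpow C (int (Suc m)) * qbinom C (Suc m) (int p))"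
    unfolding cq_Suc using qbinom_pascal[of C m p] by (simp only: Suc)
  also have "\<dots> = tpow (det C * int s) * (tpow (det C * int m * int s) * qbinom C m (int s))
      + tpow (det C * int (Suc m) * int p) * qbinom C (Suc m) (int p)"
  proof -
    have "tpow (det C * int (Suc m) * int s) * (qpow C (int (Suc m)) * qbinom C (Suc m) (int p))
        = tpow (det C * int (Suc m) * int p) * qbinom C (Suc m) (int p)"
      by (simp only: mult.assoc[symmetric] e2)
    moreover have "tpow (det C * int (Suc m) * int s) * qbinom C m (int s)
        = tpow (det C * int s) * (tpow (det C * int m * int s) * qbinom C m (int s))"
      by (simp only: mult.assoc[symmetric] e1)
    ultimately show ?thesis by (simp only: distrib_left)
  qed
  also have "\<dots> = cq C s (Suc m) + tpow (det C * int s) * cq C (Suc s) m"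
    unfolding Suc cq_Suc by (simp only: Suc add.commute)
  finally show ?thesis .
qed

context simply_laced
begin

section \<open>The functional and its zeros\<close>

definition Lam0 :: "'r qtser \<Rightarrow> laurent" where
  "Lam0 x = ev kap (cf x (- kap))"

lemma Lam0_add: "Lam0 (x + y) = Lam0 x + Lam0 y"
  by (simp add: Lam0_def)

lemma Lam0_diff: "Lam0 (x - y) = Lam0 x - Lam0 y"
  by (simp add: Lam0_def)

lemma Lam0_scl: "Lam0 (c \<star> x) = c * Lam0 x"
  by (simp add: Lam0_def)

text \<open>The coefficient of Q_1^-1 contains \<open>pj \<alpha> 1\<close>, and \<open>kap\<close>
  . \<open>vc \<alpha>\<close> = \<delta> makes this factor 1 - t^0 at the evaluation point.\<close>

lemma Lam0_U: "U \<alpha> x \<Longrightarrow> Lam0 x = 0"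
proof -
  assume "U \<alpha> x"
  then have "pj \<alpha> 1 dvd cf x (Lm (- 1))" unfolding U_def by simp
  then have "ev kap (pj \<alpha> 1) dvd Lam0 x" unfolding Lam0_def kap_def by (auto simp: dvd_def Lm_minus)
  then show ?thesis by (simp add: pj_def ev_pb)
qed

lemma Lam0_deep: "fl N x \<Longrightarrow> N > tot kap \<Longrightarrow> Lam0 x = 0"
  unfolding fl_def Lam0_def by (metis ev_0 neg_le_iff_le not_less tot_minus)

lemma led_fl: "led x b \<Longrightarrow> fl (- kd b) x"
  unfolding fl_def kd_def using led_incone incone_le tot_mono tot_Lm by (metis minus_minus)

text \<open>The bound depends on Y only, not on the seed. It makes the expansions finite and ends
  the recursion in \<open>one_step\<close>.\<close>

lemma Lam0_Xi_deep: "\<exists>N. \<forall>i a b. kd (int i *s a + int (Suc i) *s b) < N \<longrightarrow> Lam0 (Y * Xi i a b) = 0"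
proof -
  obtain M where M: "fl M Y" using fl_ex by blast
  have "Lam0 (Y * Xi i a b) = 0" if "kd (int i *s a + int (Suc i) *s b) < M - tot kap" for i a b
    by (rule Lam0_deep[OF fl_mult[OF M led_fl[OF led_Xi]]]) (use that in linarith)
  then show ?thesis by blast
qed

lemma U_QS: "U \<beta> (QS \<alpha> n)"
  using TU_QS by (simp add: TU_def)

text \<open>The inverse of a Q_{\<beta>,n} with \<beta> \<noteq> \<alpha> stays in
  \<open>U \<alpha>\<close>: its top monomial does not involve Q_{\<alpha>,1}, and
  \<open>limclosed_U\<close> transports the property along the geometric series.\<close>

lemma U_Xi_neg:
  assumes "\<And>i. c $ i \<ge> 0"
  shows "c $ \<alpha> = 0 \<longrightarrow> U \<alpha> (Xi i 0 (- c))"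
  using assms
proof (induction c rule: nonneg_vec_induct)
  case zero
  show ?case using U_X[of 0 \<alpha> 0] by simp
next
  case (step c \<beta>)
  show ?case
  proof
    assume z: "(c + ax \<beta>) $ \<alpha> = 0"
    have nn: "c $ \<alpha> \<ge> 0" "ax \<beta> $ \<alpha> \<ge> 0" using step(1)[of \<alpha>] by (simp_all add: axis_def)
    then have 0: "c $ \<alpha> = 0" "ax \<beta> $ \<alpha> = 0" using z by auto
    have "is_inv (QS \<beta> (Suc i)) (Xi i 0 (- ax \<beta>))" by (simp add: is_inv_def QS_Suc Xi_mult)
    then have "Xi i 0 (- ax \<beta>) = uinv (QS \<beta> (Suc i))" using uinvI by metis
    moreover have "led (QS \<beta> (Suc i)) (int (Suc i) *s ax \<beta>)"
      using led_Xi[of i 0 "ax \<beta>"] by (simp add: QS_Suc)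
    then have "U \<alpha> (uinv (QS \<beta> (Suc i)))"
      by (rule led_uinv_closed[OF _ limclosed_U _ U_QS]) (rule U_X, simp add: 0)
    moreover have "Xi i 0 (- (c + ax \<beta>)) = Xi i 0 (- c) * Xi i 0 (- ax \<beta>)" by (simp add: Xi_mult)
    ultimately show "U \<alpha> (Xi i 0 (- (c + ax \<beta>)))" using step(2) 0 U_mult by simp
  qed
qed

text \<open>If Q_{\<alpha>,i+1} does not occur to a negative power, every factor lies in
  \<open>U \<alpha>\<close>. With b = -(p + 1) the condition on b is p_\<alpha> < 0, so these are
  the terms absent from the sum defining the multiplicities.\<close>

lemma Lam0_vanish:
  assumes Y: "U \<alpha> Y" and a: "\<And>i. a $ i \<ge> 0" and b: "b $ \<alpha> \<ge> 0"
  shows "Lam0 (Y * Xi i a b) = 0"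
proof -
  have one: "U \<alpha> 1" using U_X[of 0 \<alpha> 0] by simp
  define bp where "bp = (\<chi> i. max 0 (b $ i))"
  define bm where "bm = (\<chi> i. max 0 (- b $ i))"
  have b': "b = bp + - bm" by (simp add: vec_eq_iff bp_def bm_def max_def)
  have "U \<alpha> (Xi i a bp)"
    by (rule Xi_pos[OF a _ U_QS U_QS one U_mult]) (simp add: bp_def)
  moreover have "U \<alpha> (Xi i 0 (- bm))"
    using U_Xi_neg[of bm \<alpha> i] b by (simp add: bm_def max_def)
  moreover have "Xi i a b = Xi i a bp * Xi i 0 (- bm)" unfolding b' Xi_mult by simp
  ultimately have "U \<alpha> (Y * Xi i a b)" using Y U_mult by simp
  then show ?thesis by (rule Lam0_U)
qed

section \<open>Expanding negative powers of a seed in the preceding one\<close>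

definition vm :: "('r \<Rightarrow> nat) \<Rightarrow> (int, 'r) vec" where
  "vm m = (\<chi> i. int (m i))"

lemma vm_nth [simp]: "vm m $ i = int (m i)"
  by (simp add: vm_def)

lemma kd_C_vm: "kd (C *v vm m) = dl * int (\<Sum>i\<in>UNIV. m i)"
  by (simp add: kd_def kap_C tot_def)

lemma finite_bounded_funs: "finite {m :: 'r \<Rightarrow> nat. (\<Sum>i\<in>UNIV. m i) \<le> M}"
proof -
  have "{m :: 'r \<Rightarrow> nat. (\<Sum>i\<in>UNIV. m i) \<le> M} \<subseteq> PiE UNIV (\<lambda>_. {..M})"
  proof
    fix m :: "'r \<Rightarrow> nat" assume "m \<in> {m. (\<Sum>i\<in>UNIV. m i) \<le> M}"
    moreover have "m i \<le> (\<Sum>i\<in>UNIV. m i)" for i by (rule member_le_sum) auto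
    ultimately show "m \<in> PiE UNIV (\<lambda>_. {..M})" by (auto intro: order_trans)
  qed
  then show ?thesis by (rule finite_subset) (intro finite_PiE; simp)
qed

lemma kd_scale: "kd (k *s a) = k * kd a"
  by (simp add: kd_def)

lemma finite_step_support:
  "finite {m :: 'r \<Rightarrow> nat. Lam0 (Y * Xi j s (a - C *v vm m)) \<noteq> 0}"
proof -
  obtain N where N: "\<And>i a b. kd (int i *s a + int (Suc i) *s b) < N \<Longrightarrow> Lam0 (Y * Xi i a b) = 0"
    using Lam0_Xi_deep by blast
  define M where "M = nat (kd (int j *s s + int (Suc j) *s a) - N)"
  have "(\<Sum>i\<in>UNIV. m i) \<le> M" if "Lam0 (Y * Xi j s (a - C *v vm m)) \<noteq> 0" for m
  proof -
    have "\<not> kd (int j *s s + int (Suc j) *s (a - C *v vm m)) < N" using N[of j s "a - C *v vm m"] that by argo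
    moreover have "kd (int j *s s + int (Suc j) *s (a - C *v vm m))
        = kd (int j *s s + int (Suc j) *s a) - int (Suc j) * (dl * int (\<Sum>i\<in>UNIV. m i))"
      by (simp only: kd_add kd_scale kd_diff kd_C_vm right_diff_distrib diff_add_eq add_diff_eq)
    ultimately have "int (Suc j) * (dl * int (\<Sum>i\<in>UNIV. m i)) \<le> kd (int j *s s + int (Suc j) *s a) - N"
      by linarith
    moreover have "int (\<Sum>i\<in>UNIV. m i) \<le> int (Suc j) * (dl * int (\<Sum>i\<in>UNIV. m i))"
    proof -
      have "1 * int (\<Sum>i\<in>UNIV. m i) \<le> (int (Suc j) * dl) * int (\<Sum>i\<in>UNIV. m i)"
      proof (rule mult_right_mono)
        have "0 < int (Suc j) * dl" using det_pos by (intro mult_pos_pos) auto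
        then show "1 \<le> int (Suc j) * dl" by linarith
      qed (rule of_nat_0_le_iff)
      then show ?thesis by (simp add: mult.assoc)
    qed
    ultimately show ?thesis unfolding M_def by linarith
  qed
  then show ?thesis by (intro finite_subset[OF _ finite_bounded_funs[of M]] subsetI CollectI) (erule CollectE)
qed

text \<open>\<open>Xi_Suc_W\<close> applied to one inverse Q_{\<alpha>,j+2}: either a is lowered by
  \<open>vc \<alpha>\<close>, or this inverse is traded for Q_{\<alpha>,j}
  Q_{\<alpha>,j+1}^-2.\<close>

lemma Xi_step:
  "Xi (Suc j) a (- s - ax \<alpha>) = tpow (- dl) \<star> Xi (Suc j) (a - vc \<alpha>) (- s - ax \<alpha>)
    + tpow (lam C $ \<alpha> $ \<alpha> - idot (Lm (ax \<alpha>)) a) \<star> (Xi j (ax \<alpha>) (- (2 *s ax \<alpha>)) * Xi (Suc j) a (- s))"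
proof -
  define x where "x = idot (Lm (ax \<alpha>)) a"
  have e: "- ax \<alpha> - s = - s - ax \<alpha>" by simp
  have "(Xi (Suc j) 0 (- ax \<alpha>) - tpow (- dl) \<star> Xi (Suc j) (- vc \<alpha>) (- ax \<alpha>)) * Xi (Suc j) a (- s)
      = tpow x \<star> (Xi (Suc j) a (- s - ax \<alpha>) - tpow (- dl) \<star> Xi (Suc j) (a - vc \<alpha>) (- s - ax \<alpha>))"
    by (simp add: left_diff_distrib Xi_mult Lm_minus scl_diff_right x_def e mult.commute)
  then have "tpow x \<star> (Xi (Suc j) a (- s - ax \<alpha>) - tpow (- dl) \<star> Xi (Suc j) (a - vc \<alpha>) (- s - ax \<alpha>))
      = tpow (lam C $ \<alpha> $ \<alpha>) \<star> (Xi j (ax \<alpha>) (- (2 *s ax \<alpha>)) * Xi (Suc j) a (- s))"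
    unfolding Xi_Suc_W by simp
  then have "tpow (- x) \<star> tpow x \<star> (Xi (Suc j) a (- s - ax \<alpha>) - tpow (- dl) \<star> Xi (Suc j) (a - vc \<alpha>) (- s - ax \<alpha>))
      = tpow (- x) \<star> tpow (lam C $ \<alpha> $ \<alpha>) \<star> (Xi j (ax \<alpha>) (- (2 *s ax \<alpha>)) * Xi (Suc j) a (- s))"
    by (simp only:)
  then have "Xi (Suc j) a (- s - ax \<alpha>) - tpow (- dl) \<star> Xi (Suc j) (a - vc \<alpha>) (- s - ax \<alpha>)
      = tpow (lam C $ \<alpha> $ \<alpha> - x) \<star> (Xi j (ax \<alpha>) (- (2 *s ax \<alpha>)) * Xi (Suc j) a (- s))"
    by (simp flip: tpow_add)
  then show ?thesis by (simp add: x_def algebra_simps)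
qed

definition vinc :: "'r \<Rightarrow> ('r \<Rightarrow> nat) \<Rightarrow> 'r \<Rightarrow> nat" where
  "vinc \<alpha> m = m(\<alpha> := Suc (m \<alpha>))"

lemma inj_vinc: "inj (vinc \<alpha>)"
proof (rule injI)
  fix m m' assume h: "vinc \<alpha> m = vinc \<alpha> m'"
  have "m \<beta> = m' \<beta>" for \<beta> using fun_cong[OF h, of \<beta>] by (simp add: vinc_def split: if_splits)
  then show "m = m'" by blast
qed

lemma range_vinc: "m \<in> range (vinc \<alpha>) \<longleftrightarrow> m \<alpha> \<noteq> 0"
proof
  assume "m \<alpha> \<noteq> 0"
  then have "m = vinc \<alpha> (m(\<alpha> := m \<alpha> - 1))" by (auto simp: vinc_def)
  then show "m \<in> range (vinc \<alpha>)" by blast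
qed (auto simp: vinc_def)

lemma vm_vinc: "vm (vinc \<alpha> m) = vm m + ax \<alpha>"
  by (simp add: vec_eq_iff vinc_def axis_def)

definition cqs :: "(int, 'r) vec \<Rightarrow> ('r \<Rightarrow> nat) \<Rightarrow> laurent" where
  "cqs s m = (\<Prod>\<alpha>\<in>UNIV. cq C (nat (s $ \<alpha>)) (m \<alpha>))"

lemma cqs_split: "cqs s m = cq C (nat (s $ \<alpha>)) (m \<alpha>) * (\<Prod>\<beta>\<in>UNIV - {\<alpha>}. cq C (nat (s $ \<beta>)) (m \<beta>))"
  unfolding cqs_def by (rule prod.remove) auto

lemma cqs_rec:
  assumes s: "\<And>i. s $ i \<ge> 0"
  shows "cqs (s + ax \<alpha>) (vinc \<alpha> m) = cqs s (vinc \<alpha> m) + tpow (dl * s $ \<alpha>) * cqs (s + ax \<alpha>) m"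
    and "m \<alpha> = 0 \<Longrightarrow> cqs (s + ax \<alpha>) m = cqs s m"
proof -
  define R where "R m' = (\<Prod>\<beta>\<in>UNIV - {\<alpha>}. cq C (nat (s $ \<beta>)) (m' \<beta>))" for m'
  have n: "nat ((s + ax \<alpha>) $ \<alpha>) = Suc (nat (s $ \<alpha>))" using s[of \<alpha>] by simp
  have R: "cqs s m' = cq C (nat (s $ \<alpha>)) (m' \<alpha>) * R m'"
    "cqs (s + ax \<alpha>) m' = cq C (Suc (nat (s $ \<alpha>))) (m' \<alpha>) * R m'" for m'
  proof -
    show "cqs s m' = cq C (nat (s $ \<alpha>)) (m' \<alpha>) * R m'" unfolding R_def by (rule cqs_split)
    have "(\<Prod>\<beta>\<in>UNIV - {\<alpha>}. cq C (nat ((s + ax \<alpha>) $ \<beta>)) (m' \<beta>)) = R m'"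
      unfolding R_def by (intro prod.cong refl) (simp add: axis_def)
    then show "cqs (s + ax \<alpha>) m' = cq C (Suc (nat (s $ \<alpha>))) (m' \<alpha>) * R m'"
      using cqs_split[of "s + ax \<alpha>" m' \<alpha>] n by simp
  qed
  have Rv: "R (vinc \<alpha> m) = R m" unfolding R_def by (intro prod.cong refl) (simp add: vinc_def)
  have v: "vinc \<alpha> m \<alpha> = Suc (m \<alpha>)" by (simp add: vinc_def)
  have ss: "int (nat (s $ \<alpha>)) = s $ \<alpha>" using s[of \<alpha>] by simp
  show "cqs (s + ax \<alpha>) (vinc \<alpha> m) = cqs s (vinc \<alpha> m) + tpow (dl * s $ \<alpha>) * cqs (s + ax \<alpha>) m"
    unfolding R Rv v cq_rec ss by (simp add: distrib_right mult.assoc)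
  show "cqs (s + ax \<alpha>) m = cqs s m" if "m \<alpha> = 0" unfolding R that by simp
qed

lemma cqs_0: "cqs 0 m = (if m = (\<lambda>_. 0) then 1 else 0)"
proof (cases "m = (\<lambda>_. 0)")
  case False
  then obtain \<alpha> where "m \<alpha> \<noteq> 0" by blast
  then show ?thesis using False by (auto simp: cqs_def cq_0 intro!: prod_zero)
qed (simp add: cqs_def)

lemma deep_shift:
  assumes "l \<noteq> 0"
  shows "\<exists>n :: nat. x - int (n * l) * dl < (N :: int)"
proof -
  define n where "n = nat (x - N) + 1"
  have "int (n * l) * dl \<ge> int n"
  proof -
    have "1 * 1 \<le> int l * dl" using assms det_pos by (intro mult_mono) auto
    then have "int n * 1 \<le> int n * (int l * dl)" by (intro mult_left_mono) auto
    then show ?thesis by (simp add: mult.assoc)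
  qed
  moreover have "int n > x - N" unfolding n_def by linarith
  ultimately have "x - int (n * l) * dl < N" by linarith
  then show ?thesis ..
qed

lemma kd_vc: "kd (vc \<alpha>) = dl"
  by (simp add: kd_def)

text \<open>The expansion of Q_{j+2}^-s under the functional, without forming the infinite series:
  both sides obey the same recursion from a to a - \<open>vc \<alpha>\<close>, and far along it both
  vanish because the degree becomes too low.\<close>

theorem one_step:
  assumes "\<And>i. s $ i \<ge> 0"
  shows "Lam0 (Y * Xi (Suc j) a (- s)) = tpow (idot (Lm s) s - idot (Lm s) a) *
    Sum_any (\<lambda>m. cqs s m * Lam0 (Y * Xi j s (a - 2 *s s - C *v vm m)))"
  using assms
proof (induction s arbitrary: Y a rule: nonneg_vec_induct)
  case zero
  have v: "vm (\<lambda>_. 0) = 0" by (simp add: vec_eq_iff)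
  have "Sum_any (\<lambda>m. cqs 0 m * Lam0 (Y * Xi j 0 (a - 2 *s 0 - C *v vm m)))
      = Sum_any (\<lambda>m :: 'r \<Rightarrow> nat. Lam0 (Y * Xi j 0 a) when m = (\<lambda>_. 0))"
  proof (intro arg_cong[where f = Sum_any] ext)
    fix m
    have z: "2 *s (0 :: (int, 'r) vec) = 0" by (simp add: vec_eq_iff)
    show "cqs 0 m * Lam0 (Y * Xi j 0 (a - 2 *s 0 - C *v vm m)) = (Lam0 (Y * Xi j 0 a) when m = (\<lambda>_. 0))"
      unfolding z using v by (cases "m = (\<lambda>_. 0)") (simp_all add: cqs_0)
  qed
  then show ?case by (simp add: Xi_Suc_0)
next
  case (step s \<alpha>)
  define e where "e = ax \<alpha>"
  define L where "L a = Lam0 (Y * Xi (Suc j) a (- (s + e)))" for a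
  define H where "H d = Lam0 (Y * Xi j (s + e) d)" for d
  define T where "T a = tpow (idot (Lm (s + e)) (s + e) - idot (Lm (s + e)) a)" for a
  define base where "base a = a - 2 *s (s + e)" for a
  define R where "R a = T a * Sum_any (\<lambda>m. cqs (s + e) m * H (base a - C *v vm m))" for a
  have finH: "finite {m. f m * H (a - C *v vm m) \<noteq> 0}" for f a
    using finite_step_support[of Y j "s + e" a] unfolding H_def
    by (rule rev_finite_subset) auto
  have Lrec: "L a = tpow (- dl) * L (a - vc \<alpha>) + T a * Sum_any (\<lambda>m. cqs s m * H (base a - C *v vm m))" for a
  proof -
    let ?Z = "Xi j e (- (2 *s e))"
    have "Lam0 (Y * ?Z * Xi (Suc j) a (- s)) = tpow (idot (Lm s) s - idot (Lm s) a) *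
        Sum_any (\<lambda>m. cqs s m * Lam0 (Y * ?Z * Xi j s (a - 2 *s s - C *v vm m)))"
      by (rule step.IH)
    also have "(\<lambda>m. cqs s m * Lam0 (Y * ?Z * Xi j s (a - 2 *s s - C *v vm m)))
        = (\<lambda>m. tpow (2 * idot (Lm e) s) * (cqs s m * H (base a - C *v vm m)))"
    proof (rule ext)
      fix m
      have "- (2 *s e) + (a - 2 *s s - C *v vm m) = base a - C *v vm m"
        by (simp add: base_def vec.scale_right_distrib)
      then have "?Z * Xi j s (a - 2 *s s - C *v vm m) = tpow (2 * idot (Lm e) s) \<star> Xi j (s + e) (base a - C *v vm m)"
        by (simp only: Xi_mult Lm_minus Lm_scale idot_minus_left idot_scale_left minus_minus add.commute[of e s])
      then show "cqs s m * Lam0 (Y * ?Z * Xi j s (a - 2 *s s - C *v vm m))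
          = tpow (2 * idot (Lm e) s) * (cqs s m * H (base a - C *v vm m))"
        by (simp add: mult.assoc Lam0_scl H_def mult.left_commute)
    qed
    also have "Sum_any (\<lambda>m. tpow (2 * idot (Lm e) s) * (cqs s m * H (base a - C *v vm m)))
        = tpow (2 * idot (Lm e) s) * Sum_any (\<lambda>m. cqs s m * H (base a - C *v vm m))"
      by (rule Sum_any_right_distrib[symmetric]) (rule finH)
    finally have IH: "Lam0 (Y * (?Z * Xi (Suc j) a (- s))) = tpow (idot (Lm s) s - idot (Lm s) a) *
        (tpow (2 * idot (Lm e) s) * Sum_any (\<lambda>m. cqs s m * H (base a - C *v vm m)))"
      by (simp only: mult.assoc)
    have t: "tpow (lam C $ \<alpha> $ \<alpha> - idot (Lm e) a) * (tpow (idot (Lm s) s - idot (Lm s) a) * tpow (2 * idot (Lm e) s)) = T a"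
    proof -
      have "idot (Lm e) e = lam C $ \<alpha> $ \<alpha>" by (simp add: e_def Lm_axis)
      then show ?thesis
        by (simp add: T_def Lm_add idot_add_left idot_add_right Lm_sym[of s e] algebra_simps flip: tpow_add)
    qed
    have v: "- (s + e) = - s - ax \<alpha>" by (simp add: e_def)
    have "L a = tpow (- dl) * L (a - vc \<alpha>) + tpow (lam C $ \<alpha> $ \<alpha> - idot (Lm e) a) * Lam0 (Y * (?Z * Xi (Suc j) a (- s)))"
      unfolding L_def v
      by (subst Xi_step) (simp add: distrib_left Lam0_add Lam0_scl e_def)
    then show ?thesis unfolding IH t[symmetric] by (simp only: mult.assoc)
  qed
  have Rrec: "R a = tpow (- dl) * R (a - vc \<alpha>) + T a * Sum_any (\<lambda>m. cqs s m * H (base a - C *v vm m))" for a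
  proof -
    \<comment> \<open>The difference between the coefficients for s + e_\<alpha> and for s. By
      \<open>cqs_rec\<close> it vanishes when m_\<alpha> = 0 and is otherwise t^(\<delta>
      s_\<alpha>) times the coefficient with m_\<alpha> lowered by one, so reindexing by
      \<open>vinc \<alpha>\<close> gives the shifted sum.\<close>
    define g where "g m = (if m \<alpha> = 0 then 0 else (cqs (s + e) m - cqs s m) * H (base a - C *v vm m))" for m
    have T: "tpow (- dl) * T (a - vc \<alpha>) = T a * tpow (dl * s $ \<alpha>)"
      by (simp add: T_def idot_diff_right e_def algebra_simps flip: tpow_add)
    have vm: "base (a - vc \<alpha>) - C *v vm m = base a - C *v vm (vinc \<alpha> m)" for m
      by (simp add: base_def vm_vinc matvec_int_add vc_def)
    have "tpow (- dl) * R (a - vc \<alpha>) = T a * (tpow (dl * s $ \<alpha>) * Sum_any (\<lambda>m. cqs (s + e) m * H (base (a - vc \<alpha>) - C *v vm m)))"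
      unfolding R_def mult.assoc[symmetric] T ..
    also have "tpow (dl * s $ \<alpha>) * Sum_any (\<lambda>m. cqs (s + e) m * H (base (a - vc \<alpha>) - C *v vm m))
        = Sum_any (\<lambda>m. tpow (dl * s $ \<alpha>) * (cqs (s + e) m * H (base (a - vc \<alpha>) - C *v vm m)))"
      by (rule Sum_any_right_distrib) (rule finH)
    also have "\<dots> = Sum_any (\<lambda>m. g (vinc \<alpha> m))"
    proof (rule arg_cong[of _ _ Sum_any], rule ext)
      fix m
      have "vinc \<alpha> m \<alpha> \<noteq> 0" by (simp add: vinc_def)
      then show "tpow (dl * s $ \<alpha>) * (cqs (s + e) m * H (base (a - vc \<alpha>) - C *v vm m)) = g (vinc \<alpha> m)"
        unfolding g_def vm e_def using cqs_rec(1)[OF step(1), of \<alpha> m] by (simp add: mult.assoc)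
    qed
    also have "\<dots> = Sum_any g"
      by (rule Sum_any_inj[OF inj_vinc[of \<alpha>]]) (auto simp: range_vinc g_def)
    finally have "tpow (- dl) * R (a - vc \<alpha>) = T a * Sum_any g" .
    moreover have "Sum_any (\<lambda>m. cqs (s + e) m * H (base a - C *v vm m)) = Sum_any (\<lambda>m. g m + cqs s m * H (base a - C *v vm m))"
      by (rule arg_cong[of _ _ Sum_any], rule ext)
        (use cqs_rec(2)[OF step(1)] in \<open>auto simp: g_def e_def algebra_simps\<close>)
    moreover have "finite {m. g m \<noteq> 0}"
      by (rule rev_finite_subset[OF finH[of "\<lambda>m. cqs (s + e) m - cqs s m" "base a"]]) (auto simp: g_def)
    ultimately show ?thesis
      unfolding R_def using Sum_any.distrib[OF _ finH[of "cqs s" "base a"], of g] by (simp add: distrib_left)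
  qed
  \<comment> \<open>The inhomogeneous terms of \<open>Lrec\<close> and \<open>Rrec\<close> are
    equal, so the difference satisfies the homogeneous recursion.\<close>
  have Dn: "L a - R a = tpow (- dl * int n) * (L (a - int n *s vc \<alpha>) - R (a - int n *s vc \<alpha>))" for a n
  proof (induction n)
    case (Suc n)
    define b where "b = a - int n *s vc \<alpha>"
    have b: "a - int (Suc n) *s vc \<alpha> = b - vc \<alpha>" by (simp add: b_def vec_eq_iff algebra_simps)
    have "L b - R b = tpow (- dl) * (L (b - vc \<alpha>) - R (b - vc \<alpha>))"
      unfolding Lrec[of b] Rrec[of b] by (simp add: algebra_simps)
    moreover have "tpow (- dl * int n) * tpow (- dl) = tpow (- dl * int (Suc n))"
      by (simp add: algebra_simps flip: tpow_add)
    ultimately show ?case using Suc unfolding b b_def[symmetric] by (metis mult.assoc)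
  qed simp
  obtain N where N: "\<And>i a b. kd (int i *s a + int (Suc i) *s b) < N \<Longrightarrow> Lam0 (Y * Xi i a b) = 0"
    using Lam0_Xi_deep by blast
  have "L a = R a" for a
  proof -
    obtain n1 where n1: "kd (int (Suc j) *s a + int (Suc (Suc j)) *s (- (s + e))) - int (n1 * Suc j) * dl < N"
      using deep_shift[of "Suc j"] by blast
    obtain n2 where n2: "kd (int j *s (s + e) + int (Suc j) *s base a) - int (n2 * Suc j) * dl < N"
      using deep_shift[of "Suc j"] by blast
    define n where "n = n1 + n2"
    have nm: "int (n1 * Suc j) * dl \<le> int (n * Suc j) * dl" "int (n2 * Suc j) * dl \<le> int (n * Suc j) * dl"
      using det_pos by (intro mult_right_mono of_nat_mono mult_le_mono1; simp add: n_def)+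
    have "L (a - int n *s vc \<alpha>) = 0"
      unfolding L_def
    proof (rule N)
      show "kd (int (Suc j) *s (a - int n *s vc \<alpha>) + int (Suc (Suc j)) *s (- (s + e))) < N"
        using n1 nm(1) by (simp add: kd_add kd_diff kd_scale kd_vc algebra_simps)
    qed
    moreover have "R (a - int n *s vc \<alpha>) = 0"
    proof -
      have "H (base (a - int n *s vc \<alpha>) - C *v vm m) = 0" for m
        unfolding H_def
      proof (rule N)
        have "0 \<le> int (Suc j) * (dl * int (\<Sum>i\<in>UNIV. m i))" using det_pos by (intro mult_nonneg_nonneg) (auto intro: sum_nonneg)
        moreover have "kd (int j *s (s + e) + int (Suc j) *s (base (a - int n *s vc \<alpha>) - C *v vm m))
            = kd (int j *s (s + e) + int (Suc j) *s base a) - int (n * Suc j) * dl - int (Suc j) * (dl * int (\<Sum>i\<in>UNIV. m i))"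
          by (simp add: base_def kd_add kd_diff kd_scale kd_vc kd_C_vm algebra_simps del: of_nat_sum)
        ultimately show "kd (int j *s (s + e) + int (Suc j) *s (base (a - int n *s vc \<alpha>) - C *v vm m)) < N"
          using n2 nm(2) by linarith
      qed
      then show ?thesis by (simp add: R_def)
    qed
    ultimately show ?thesis using Dn[of a n] by simp
  qed
  then show ?case unfolding L_def R_def T_def H_def base_def e_def .
qed

end

section \<open>Graded multiplicities as constant terms\<close>

context simply_laced
begin

definition nv :: "('r \<Rightarrow> nat \<Rightarrow> nat) \<Rightarrow> nat \<Rightarrow> (int, 'r) vec" where
  "nv n i = vm (\<lambda>\<alpha>. n \<alpha> i)"

lemma nv_nth [simp]: "nv n i $ \<alpha> = int (n \<alpha> i)"
  by (simp add: nv_def)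

fun Ypre :: "('r \<Rightarrow> nat \<Rightarrow> nat) \<Rightarrow> nat \<Rightarrow> 'r qtser" where
  "Ypre n 0 = 1"
| "Ypre n (Suc j) = Ypre n j * Xi (Suc j) (nv n (Suc j)) 0"

lemma U_Ypre: "U \<alpha> (Ypre n j)"
proof (induction j)
  case 0
  then show ?case using U_X[of 0 \<alpha> 0] by simp
next
  case (Suc j)
  have one: "U \<alpha> 1" using U_X[of 0 \<alpha> 0] by simp
  have "U \<alpha> (Xi (Suc j) (nv n (Suc j)) 0)"
    by (rule Xi_pos[OF _ _ U_QS U_QS one U_mult]) simp_all
  then show ?case using Suc U_mult by simp
qed

text \<open>Here p and p' play the roles of the consecutive values P_j and P_{j+1} of a sequence
  running over the seeds. The shift by 1 is that of the exponent \<ell> + 1 of z.\<close>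

definition GL :: "('r \<Rightarrow> nat \<Rightarrow> nat) \<Rightarrow> nat \<Rightarrow> (int, 'r) vec \<Rightarrow> (int, 'r) vec \<Rightarrow> laurent" where
  "GL n j p p' = Lam0 (Ypre n j * Xi j (p' + 1) (- (p + 1)))"

lemma GL_0: "GL n 0 p p' = (if p = 0 then tpow (- idot kap (p' + 1)) else 0)"
proof -
  have "- kap = Lm (- 1)" by (simp add: kap_def Lm_minus)
  then have "cf (X (p' + 1) (- (p + 1))) (- kap) = (if - 1 = - (p + 1) then q0 (p' + 1) else 0)"
    by (simp only: cf_X)
  moreover have "(- 1 :: (int, 'r) vec) = - (p + 1) \<longleftrightarrow> p = 0" by auto
  ultimately show ?thesis by (simp add: GL_def Lam0_def)
qed

lemma GL_vanish:
  assumes "\<And>i. p $ i \<ge> 0" and "p'' $ \<alpha> < 0"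
  shows "GL n j p'' p = 0"
  unfolding GL_def by (rule Lam0_vanish[OF U_Ypre, where \<alpha> = \<alpha>]) (use assms in \<open>auto simp: add_nonneg_nonneg\<close>)

abbreviation (input) pdown :: "('r \<Rightarrow> nat \<Rightarrow> nat) \<Rightarrow> nat \<Rightarrow> (int, 'r) vec \<Rightarrow> (int, 'r) vec \<Rightarrow> ('r \<Rightarrow> nat) \<Rightarrow> (int, 'r) vec" where
  "pdown n j p p' y \<equiv> 2 *s p - p' - nv n (Suc j) + C *v vm y"

definition qbp :: "(int, 'r) vec \<Rightarrow> ('r \<Rightarrow> nat) \<Rightarrow> laurent" where
  "qbp p m = (\<Prod>\<alpha>\<in>UNIV. qbinom C (m \<alpha>) (p $ \<alpha>))"

lemma cqs_qbp:
  assumes "\<And>i. p $ i \<ge> 0"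
  shows "cqs (p + 1) m = tpow (dl * idot (vm m) p) * qbp p m"
proof -
  have "cq C (nat ((p + 1) $ \<alpha>)) (m \<alpha>) = tpow (dl * int (m \<alpha>) * p $ \<alpha>) * qbinom C (m \<alpha>) (p $ \<alpha>)" for \<alpha>
  proof -
    have "nat ((p + 1) $ \<alpha>) = Suc (nat (p $ \<alpha>))" "int (nat (p $ \<alpha>)) = p $ \<alpha>" using assms[of \<alpha>] by simp_all
    then show ?thesis by (simp add: cq_Suc)
  qed
  moreover have "(\<Prod>\<alpha>\<in>A. tpow (f \<alpha>)) = tpow (\<Sum>\<alpha>\<in>A. f \<alpha>)" if "finite A" for f and A :: "'r set"
    using that by (induction A rule: finite_induct) (simp_all add: tpow_add)
  ultimately show ?thesis
    by (simp add: cqs_def qbp_def prod.distrib idot_def sum_distrib_left mult.assoc)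
qed

text \<open>\<open>one_step\<close> read as a second order difference equation: y is the column
  m_{j+1} and \<open>pdown\<close> the predecessor P_j determined by P_{j+1} = p and P_{j+2} =
  p'.\<close>

lemma GL_Suc:
  assumes p: "\<And>i. p $ i \<ge> 0"
  shows "GL n (Suc j) p p' = Sum_any (\<lambda>y.
    tpow (idot (Lm (p + 1)) (p - p' - nv n (Suc j)) + dl * idot (vm y) p) * qbp p y * GL n j (pdown n j p p' y) p)"
    and "finite {y. GL n j (pdown n j p p' y) p \<noteq> 0}"
proof -
  define s where "s = p + 1"
  define a where "a = nv n (Suc j) + (p' + 1)"
  have s: "\<And>i. s $ i \<ge> 0" using p by (simp add: s_def add_nonneg_nonneg)
  have G: "Lam0 (Ypre n j * Xi j s (a - 2 *s s - C *v vm y)) = GL n j (pdown n j p p' y) p" for y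
  proof -
    have "a - 2 *s s - C *v vm y = - (pdown n j p p' y + 1)"
      by (simp add: a_def s_def vec_eq_iff algebra_simps)
    then show ?thesis unfolding GL_def s_def[symmetric] by (simp only:)
  qed
  show fin: "finite {y. GL n j (pdown n j p p' y) p \<noteq> 0}"
    using finite_step_support[of "Ypre n j" j s "a - 2 *s s"] unfolding G .
  have "GL n (Suc j) p p' = Lam0 (Ypre n j * Xi (Suc j) a (- s))"
    by (simp add: GL_def a_def s_def Xi_mult mult.assoc)
  also have "\<dots> = tpow (idot (Lm s) s - idot (Lm s) a) * Sum_any (\<lambda>y. cqs s y * GL n j (pdown n j p p' y) p)"
    unfolding G[symmetric] by (rule one_step) (rule s)
  also have "\<dots> = Sum_any (\<lambda>y. tpow (idot (Lm s) s - idot (Lm s) a) * (cqs s y * GL n j (pdown n j p p' y) p))"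
    by (rule Sum_any_right_distrib) (rule rev_finite_subset[OF fin], auto)
  also have "(\<lambda>y. tpow (idot (Lm s) s - idot (Lm s) a) * (cqs s y * GL n j (pdown n j p p' y) p))
     = (\<lambda>y. tpow (idot (Lm (p + 1)) (p - p' - nv n (Suc j)) + dl * idot (vm y) p) * qbp p y * GL n j (pdown n j p p' y) p)"
  proof (rule ext)
    fix y
    have "idot (Lm s) s - idot (Lm s) a = idot (Lm (p + 1)) (p - p' - nv n (Suc j))"
      unfolding idot_diff_right[symmetric] s_def a_def by (rule arg_cong[of _ _ "idot _"]) simp
    then show "tpow (idot (Lm s) s - idot (Lm s) a) * (cqs s y * GL n j (pdown n j p p' y) p)
      = tpow (idot (Lm (p + 1)) (p - p' - nv n (Suc j)) + dl * idot (vm y) p) * qbp p y * GL n j (pdown n j p p' y) p"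
      unfolding s_def cqs_qbp[OF p] tpow_add by (simp only: mult.assoc)
  qed
  finally show "GL n (Suc j) p p' = Sum_any (\<lambda>y.
    tpow (idot (Lm (p + 1)) (p - p' - nv n (Suc j)) + dl * idot (vm y) p) * qbp p y * GL n j (pdown n j p p' y) p)" .
qed

section \<open>Solving the recursion by a sum over m\<close>

definition cv :: "('r \<Rightarrow> nat \<Rightarrow> nat) \<Rightarrow> ('r \<Rightarrow> nat \<Rightarrow> nat) \<Rightarrow> nat \<Rightarrow> (int, 'r) vec" where
  "cv n m k = nv n k - C *v nv m k"

text \<open>The solution of \<open>P\<^sub>i\<^sub>+\<^sub>1 - 2 P\<^sub>i + P\<^sub>i\<^sub>-\<^sub>1 = C m\<^sub>i - n\<^sub>i\<close> for \<open>1 \<le> i \<le> j\<close> with \<open>P\<^sub>0 = 0\<close> and \<open>P\<^sub>j\<^sub>+\<^sub>1 - P\<^sub>j = s\<close>.\<close>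

definition PP :: "('r \<Rightarrow> nat \<Rightarrow> nat) \<Rightarrow> ('r \<Rightarrow> nat \<Rightarrow> nat) \<Rightarrow> nat \<Rightarrow> (int, 'r) vec \<Rightarrow> nat \<Rightarrow> (int, 'r) vec" where
  "PP n m j s i = (\<Sum>k=1..j. int (min i k) *s cv n m k) + int i *s s"

lemma PP_0 [simp]: "PP n m j s 0 = 0"
  by (simp add: PP_def)

lemma PP_Suc: "i \<le> Suc j \<Longrightarrow> PP n m (Suc j) s i = PP n m j (s + cv n m (Suc j)) i"
  by (simp add: PP_def min_def vec_eq_iff algebra_simps)

lemma PP_top: "PP n m j s (Suc j) = PP n m j s j + s"
proof -
  have "(\<Sum>k=1..j. int (min (Suc j) k) *s cv n m k) = (\<Sum>k=1..j. int (min j k) *s cv n m k)"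
    by (rule sum.cong) (auto simp: min_def)
  then show ?thesis by (simp add: PP_def vec_eq_iff algebra_simps)
qed

lemma PP_cong: "(\<And>\<alpha> k. k \<in> {1..j} \<Longrightarrow> m \<alpha> k = m' \<alpha> k) \<Longrightarrow> PP n m j s i = PP n m' j s i"
proof -
  assume h: "\<And>\<alpha> k. k \<in> {1..j} \<Longrightarrow> m \<alpha> k = m' \<alpha> k"
  have "nv m k = nv m' k" if "k \<in> {1..j}" for k using h[OF that] by (simp add: vec_eq_iff)
  then show ?thesis unfolding PP_def cv_def by (intro arg_cong2[of _ _ _ _ "(+)"] sum.cong refl) simp
qed

definition Adm :: "('r \<Rightarrow> nat \<Rightarrow> nat) \<Rightarrow> nat \<Rightarrow> (int, 'r) vec \<Rightarrow> (int, 'r) vec \<Rightarrow> ('r \<Rightarrow> nat \<Rightarrow> nat) set" where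
  "Adm n j p p' = {m. (\<forall>\<alpha> i. i \<notin> {1..j} \<longrightarrow> m \<alpha> i = 0) \<and> PP n m j (p' - p) j = p \<and>
     (\<forall>\<alpha>. \<forall>i\<in>{1..j}. PP n m j (p' - p) i $ \<alpha> \<ge> 0)}"

text \<open>The exponents collected by \<open>GL_Suc\<close> at each level; the term outside the sum
  is the value left at seed 0 by \<open>GL_0\<close>.\<close>

definition EE :: "('r \<Rightarrow> nat \<Rightarrow> nat) \<Rightarrow> ('r \<Rightarrow> nat \<Rightarrow> nat) \<Rightarrow> nat \<Rightarrow> (nat \<Rightarrow> (int, 'r) vec) \<Rightarrow> int" where
  "EE n m j P = (\<Sum>i=1..j. idot (Lm (P i + 1)) (P i - P (Suc i) - nv n i) + dl * idot (nv m i) (P i)) - idot kap (P 1 + 1)"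

definition WW :: "('r \<Rightarrow> nat \<Rightarrow> nat) \<Rightarrow> ('r \<Rightarrow> nat \<Rightarrow> nat) \<Rightarrow> nat \<Rightarrow> (nat \<Rightarrow> (int, 'r) vec) \<Rightarrow> laurent" where
  "WW n m j P = tpow (EE n m j P) * (\<Prod>i=1..j. qbp (P i) (\<lambda>\<alpha>. m \<alpha> i))"

lemma WW_cong:
  assumes "\<And>\<alpha> k. k \<in> {1..j} \<Longrightarrow> m \<alpha> k = m' \<alpha> k" "\<And>i. i \<le> Suc j \<Longrightarrow> P i = P' i"
  shows "WW n m j P = WW n m' j P'"
proof -
  have m: "nv m k = nv m' k" "(\<lambda>\<alpha>. m \<alpha> k) = (\<lambda>\<alpha>. m' \<alpha> k)" if "k \<in> {1..j}" for k
    using assms(1)[OF that] by (simp_all add: vec_eq_iff)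
  have "(\<Prod>i=1..j. qbp (P i) (\<lambda>\<alpha>. m \<alpha> i)) = (\<Prod>i=1..j. qbp (P' i) (\<lambda>\<alpha>. m' \<alpha> i))"
    by (rule prod.cong) (simp_all add: m assms(2))
  moreover have "(\<Sum>i=1..j. idot (Lm (P i + 1)) (P i - P (Suc i) - nv n i) + dl * idot (nv m i) (P i))
      = (\<Sum>i=1..j. idot (Lm (P' i + 1)) (P' i - P' (Suc i) - nv n i) + dl * idot (nv m' i) (P' i))"
    by (rule sum.cong) (simp_all add: m assms(2))
  ultimately show ?thesis using assms(2)[of 1] by (simp add: WW_def EE_def)
qed

lemma WW_Suc:
  "WW n m (Suc j) P = tpow (idot (Lm (P (Suc j) + 1)) (P (Suc j) - P (Suc (Suc j)) - nv n (Suc j)) + dl * idot (nv m (Suc j)) (P (Suc j)))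
     * qbp (P (Suc j)) (\<lambda>\<alpha>. m \<alpha> (Suc j)) * WW n m j P"
proof -
  have "EE n m (Suc j) P = idot (Lm (P (Suc j) + 1)) (P (Suc j) - P (Suc (Suc j)) - nv n (Suc j)) + dl * idot (nv m (Suc j)) (P (Suc j)) + EE n m j P"
    by (simp add: EE_def)
  then show ?thesis by (simp only: WW_def prod.atLeast_Suc_atMost_Suc_shift tpow_add) (simp add: mult_ac tpow_add)
qed

lemma kd_sum: "kd (sum f A) = (\<Sum>x\<in>A. kd (f x))"
  by (simp add: kd_def idot_sum_right)

lemma finite_Adm: "finite (Adm n j p p')"
proof -
  define R where "R = (\<Sum>k=1..j. int k * kd (nv n k)) + int j * kd (p' - p) - kd p"
  define S where "S = {f :: nat \<Rightarrow> nat. \<forall>i. (i \<in> {1..j} \<longrightarrow> f i \<in> {..nat R}) \<and> (i \<notin> {1..j} \<longrightarrow> f i = 0)}"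
  have "finite S" unfolding S_def by (rule finite_set_of_finite_funs) auto
  then have "finite {m :: 'r \<Rightarrow> nat \<Rightarrow> nat. \<forall>\<alpha>. (\<alpha> \<in> UNIV \<longrightarrow> m \<alpha> \<in> S) \<and> (\<alpha> \<notin> UNIV \<longrightarrow> m \<alpha> = (\<lambda>_. 0))}"
    by (intro finite_set_of_finite_funs) auto
  moreover have "m \<alpha> \<in> S" if m: "m \<in> Adm n j p p'" for m \<alpha>
  proof -
    have "kd (PP n m j (p' - p) j) = kd p" using m by (simp add: Adm_def)
    moreover have "(\<Sum>k=1..j. int (min j k) *s cv n m k) = (\<Sum>k=1..j. int k *s cv n m k)"
      by (rule sum.cong) auto
    ultimately have "(\<Sum>k=1..j. int k * kd (cv n m k)) + int j * kd (p' - p) = kd p"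
      by (simp only: PP_def kd_add kd_scale kd_sum)
    moreover have cv: "kd (cv n m k) = kd (nv n k) - dl * int (\<Sum>\<beta>\<in>UNIV. m \<beta> k)" for k
      by (simp only: cv_def kd_diff nv_def kd_C_vm)
    ultimately have R: "(\<Sum>k=1..j. int k * (dl * int (\<Sum>\<beta>\<in>UNIV. m \<beta> k))) = R"
      unfolding R_def cv by (simp only: right_diff_distrib sum_subtractf)
    have "m \<alpha> k \<in> {..nat R}" if k: "k \<in> {1..j}" for k
    proof -
      have "m \<alpha> k \<le> (\<Sum>\<beta>\<in>UNIV. m \<beta> k)" by (rule member_le_sum) auto
      then have "int (m \<alpha> k) \<le> 1 * int (\<Sum>\<beta>\<in>UNIV. m \<beta> k)" by linarith
      also have "1 * int (\<Sum>\<beta>\<in>UNIV. m \<beta> k) \<le> (int k * dl) * int (\<Sum>\<beta>\<in>UNIV. m \<beta> k)"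
      proof (rule mult_right_mono)
        have "0 < int k * dl" using det_pos k by (intro mult_pos_pos) auto
        then show "1 \<le> int k * dl" by linarith
      qed (rule of_nat_0_le_iff)
      also have "\<dots> = int k * (dl * int (\<Sum>\<beta>\<in>UNIV. m \<beta> k))" by (simp only: mult.assoc)
      also have "\<dots> \<le> R"
        unfolding R[symmetric]
      proof (rule member_le_sum[OF k])
        fix x
        show "0 \<le> int x * (dl * int (\<Sum>\<beta>\<in>UNIV. m \<beta> x))"
          using det_pos by (intro mult_nonneg_nonneg) (auto intro: sum_nonneg)
      qed simp
      finally show ?thesis by simp
    qed
    moreover have "m \<alpha> k = 0" if "k \<notin> {1..j}" for k using m that by (simp add: Adm_def)
    ultimately show ?thesis by (simp add: S_def)
  qed
  ultimately show ?thesis by (elim rev_finite_subset) auto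
qed

lemma PP_drop:
  assumes "y = (\<lambda>\<alpha>. m \<alpha> (Suc j))" and "i \<le> Suc j"
  shows "PP n m (Suc j) (p' - p) i = PP n (\<lambda>\<alpha>. (m \<alpha>)(Suc j := 0)) j (p - pdown n j p p' y) i"
proof -
  have "p' - p + cv n m (Suc j) = p - pdown n j p p' y"
    by (simp add: cv_def nv_def assms(1) vec_eq_iff)
  moreover have "PP n m j s i = PP n (\<lambda>\<alpha>. (m \<alpha>)(Suc j := 0)) j s i" for s
    by (rule PP_cong) simp
  ultimately show ?thesis using PP_Suc[OF assms(2), of n m "p' - p"] by (simp only:)
qed

lemma Adm_drop:
  assumes p: "\<And>i. p $ i \<ge> 0" and y: "y = (\<lambda>\<alpha>. m \<alpha> (Suc j))"
  shows "m \<in> Adm n (Suc j) p p' \<longleftrightarrow> (\<lambda>\<alpha>. (m \<alpha>)(Suc j := 0)) \<in> Adm n j (pdown n j p p' y) p"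
proof -
  define m0 where "m0 = (\<lambda>\<alpha>. (m \<alpha>)(Suc j := 0))"
  define d where "d = pdown n j p p' y"
  have P: "PP n m (Suc j) (p' - p) i = PP n m0 j (p - d) i" if "i \<le> Suc j" for i
    using PP_drop[where y = y and m = m and j = j, OF y that] by (simp only: m0_def d_def)
  have "PP n m (Suc j) (p' - p) (Suc j) = p \<longleftrightarrow> PP n m0 j (p - d) j = d"
    using P[of "Suc j"] by (auto simp: PP_top algebra_simps)
  moreover have "(\<forall>\<alpha> i. i \<notin> {1..Suc j} \<longrightarrow> m \<alpha> i = 0) \<longleftrightarrow> (\<forall>\<alpha> i. i \<notin> {1..j} \<longrightarrow> m0 \<alpha> i = 0)"
    by (auto simp: m0_def le_Suc_eq)
  moreover have "(\<forall>\<alpha>. \<forall>i\<in>{1..Suc j}. PP n m (Suc j) (p' - p) i $ \<alpha> \<ge> 0)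
      \<longleftrightarrow> (\<forall>\<alpha>. \<forall>i\<in>{1..j}. PP n m0 j (p - d) i $ \<alpha> \<ge> 0)" if "PP n m (Suc j) (p' - p) (Suc j) = p"
  proof -
    have "{1..Suc j} = insert (Suc j) {1..j}" by auto
    then show ?thesis using p that P by simp
  qed
  ultimately show ?thesis unfolding Adm_def m0_def[symmetric] d_def[symmetric] mem_Collect_eq by blast
qed

text \<open>Induction on the number of seeds, grouping the admissible m by their last column. A
  column leading to a predecessor with a negative entry contributes zero by
  \<open>GL_vanish\<close>, and no admissible m has such a column: this is how the conditions
  p_{\<alpha>,i} \<ge> 0 arise.\<close>

theorem GL_eq:
  assumes "\<And>i. p $ i \<ge> 0"
  shows "GL n j p p' = (\<Sum>m\<in>Adm n j p p'. WW n m j (PP n m j (p' - p)))"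
  using assms
proof (induction j arbitrary: p p')
  case 0
  have "Adm n 0 p p' = (if p = 0 then {\<lambda>_ _. 0} else {})"
    by (auto simp: Adm_def)
  then show ?case by (simp add: GL_0 WW_def EE_def PP_def)
next
  case (Suc j)
  define g :: "('r \<Rightarrow> nat \<Rightarrow> nat) \<Rightarrow> 'r \<Rightarrow> nat" where "g m = (\<lambda>\<alpha>. m \<alpha> (Suc j))" for m
  define d where "d y = pdown n j p p' y" for y
  define c where "c y = tpow (idot (Lm (p + 1)) (p - p' - nv n (Suc j)) + dl * idot (vm y) p) * qbp p y" for y
  define W where "W m = WW n m (Suc j) (PP n m (Suc j) (p' - p))" for m
  define A where "A = Adm n (Suc j) p p'"
  define T where "T = g ` A \<union> {y. GL n j (d y) p \<noteq> 0}"
  have fT: "finite T" unfolding T_def d_def A_def using finite_Adm GL_Suc(2)[OF Suc.prems] by simp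
  have key: "c y * GL n j (d y) p = (\<Sum>m | m \<in> A \<and> g m = y. W m)" for y
  proof (cases "\<forall>i. d y $ i \<ge> 0")
    case False
    then obtain \<alpha> where "d y $ \<alpha> < 0" by (auto simp: not_le)
    then have "GL n j (d y) p = 0" by (rule GL_vanish[OF Suc.prems])
    moreover have "{m. m \<in> A \<and> g m = y} = {}"
    proof -
      have "\<forall>i. d y $ i \<ge> 0" if m: "m \<in> A" and y: "g m = y" for m
      proof -
        have "(\<lambda>\<alpha>. (m \<alpha>)(Suc j := 0)) \<in> Adm n j (d y) p"
          using m y Adm_drop[OF Suc.prems, of y m j n p'] by (simp add: A_def d_def g_def)
        then have "PP n (\<lambda>\<alpha>. (m \<alpha>)(Suc j := 0)) j (p - d y) j = d y"
          "\<forall>\<alpha>. \<forall>i\<in>{1..j}. PP n (\<lambda>\<alpha>. (m \<alpha>)(Suc j := 0)) j (p - d y) i $ \<alpha> \<ge> 0"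
          unfolding Adm_def by blast+
        \<comment> \<open>For j = 0 the admissibility inequalities are empty, but then the
          predecessor is P_0 = 0.\<close>
        then show ?thesis by (cases "j = 0") (auto dest!: bspec[of _ _ j])
      qed
      then show ?thesis using False by blast
    qed
    ultimately show ?thesis by (simp only: sum.empty mult_zero_right)
  next
    case True
    have "c y * GL n j (d y) p = (\<Sum>m\<in>Adm n j (d y) p. c y * WW n m j (PP n m j (p - d y)))"
      using Suc.IH[of "d y" p] True by (simp add: sum_distrib_left)
    also have "\<dots> = (\<Sum>m | m \<in> A \<and> g m = y. W m)"
    proof (rule sum.reindex_bij_witness[where i = "\<lambda>m \<alpha>. (m \<alpha>)(Suc j := 0)" and j = "\<lambda>m \<alpha>. (m \<alpha>)(Suc j := y \<alpha>)"])
      fix m assume m: "m \<in> Adm n j (d y) p"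
      let ?m = "\<lambda>\<alpha>. (m \<alpha>)(Suc j := y \<alpha>)"
      have m0: "m \<alpha> (Suc j) = 0" for \<alpha> using m by (simp add: Adm_def)
      then show bck: "(\<lambda>\<alpha>. (?m \<alpha>)(Suc j := 0)) = m" by (auto simp: fun_eq_iff)
      have gm: "y = (\<lambda>\<alpha>. ?m \<alpha> (Suc j))" by simp
      have mA: "?m \<in> A" using Adm_drop[where m = ?m and j = j and y = y, OF Suc.prems gm, of n p'] m unfolding A_def d_def bck by simp
      then show "?m \<in> {m. m \<in> A \<and> g m = y}" by (simp add: g_def)
      have P: "PP n ?m (Suc j) (p' - p) i = PP n m j (p - d y) i" if "i \<le> Suc j" for i
        using PP_drop[where y = y and j = j and m = ?m, OF gm that, of n p' p] unfolding bck d_def .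
      have P1: "PP n ?m (Suc j) (p' - p) (Suc j) = p" using mA by (simp add: A_def Adm_def)
      then have P2: "PP n ?m (Suc j) (p' - p) (Suc (Suc j)) = p'" by (simp add: PP_top)
      have W: "WW n ?m j (PP n ?m (Suc j) (p' - p)) = WW n m j (PP n m j (p - d y))"
        by (rule WW_cong) (use P in auto)
      have ym: "nv ?m (Suc j) = vm y" by (simp add: vec_eq_iff)
      show "W ?m = c y * WW n m j (PP n m j (p - d y))"
        unfolding W_def WW_Suc W P1 P2 c_def ym by simp
    next
      fix m assume "m \<in> {m. m \<in> A \<and> g m = y}"
      then have m: "m \<in> A" and y: "y = (\<lambda>\<alpha>. m \<alpha> (Suc j))" by (auto simp: g_def)
      show "(\<lambda>\<alpha>. ((m \<alpha>)(Suc j := 0))(Suc j := y \<alpha>)) = m" unfolding y by (auto simp: fun_eq_iff)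
      show "(\<lambda>\<alpha>. (m \<alpha>)(Suc j := 0)) \<in> Adm n j (d y) p"
        using m Adm_drop[where m = m and j = j and y = y, OF Suc.prems y, of n p'] by (simp add: A_def d_def)
    qed
    finally show ?thesis .
  qed
  have "GL n (Suc j) p p' = (\<Sum>y\<in>T. c y * GL n j (d y) p)"
    unfolding GL_Suc(1)[OF Suc.prems] c_def d_def
    by (rule Sum_any.expand_superset) (use fT in \<open>auto simp: T_def d_def\<close>)
  also have "\<dots> = (\<Sum>y\<in>T. \<Sum>m | m \<in> A \<and> g m = y. W m)" by (simp only: key)
  also have "\<dots> = (\<Sum>m\<in>A. W m)"
    by (rule sum.group) (use fT finite_Adm in \<open>auto simp: T_def A_def\<close>)
  finally show ?case unfolding A_def W_def .
qed

section \<open>Comparison with the exponents of the graded multiplicities\<close>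

definition vi :: "(nat, 'r) vec \<Rightarrow> (int, 'r) vec" where
  "vi l = (\<chi> \<alpha>. int (l $ \<alpha>))"

lemma vi_nth [simp]: "vi l $ \<alpha> = int (l $ \<alpha>)"
  by (simp add: vi_def)

lemma PP_pvec: "PP n m K 0 i $ \<alpha> = pvec C K n m \<alpha> i"
proof -
  have "PP n m K 0 i $ \<alpha> = (\<Sum>k=1..K. int (min i k) * int (n \<alpha> k) - (\<Sum>\<beta>\<in>UNIV. C $ \<alpha> $ \<beta> * (int (min i k) * int (m \<beta> k))))"
  proof -
    have "(int (min i k) *s cv n m k) $ \<alpha> = int (min i k) * int (n \<alpha> k) - (\<Sum>\<beta>\<in>UNIV. C $ \<alpha> $ \<beta> * (int (min i k) * int (m \<beta> k)))" for k
    proof -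
      have "int (min i k) * (\<Sum>\<beta>\<in>UNIV. C $ \<alpha> $ \<beta> * int (m \<beta> k)) = (\<Sum>\<beta>\<in>UNIV. C $ \<alpha> $ \<beta> * (int (min i k) * int (m \<beta> k)))"
        unfolding sum_distrib_left by (rule sum.cong) (simp_all only: mult.left_commute)
      then show ?thesis
        by (simp only: vector_smult_component cv_def vector_minus_component matvec_int_nth nv_nth right_diff_distrib)
    qed
    then show ?thesis by (simp add: PP_def sum_component)
  qed
  also have "\<dots> = (\<Sum>k=1..K. int (min i k) * int (n \<alpha> k)) - (\<Sum>k=1..K. \<Sum>\<beta>\<in>UNIV. C $ \<alpha> $ \<beta> * (int (min i k) * int (m \<beta> k)))"
    by (rule sum_subtractf)
  also have "(\<Sum>k=1..K. \<Sum>\<beta>\<in>UNIV. C $ \<alpha> $ \<beta> * (int (min i k) * int (m \<beta> k)))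
      = (\<Sum>\<beta>\<in>UNIV. \<Sum>k=1..K. C $ \<alpha> $ \<beta> * (int (min i k) * int (m \<beta> k)))"
    by (rule sum.swap)
  also have "\<dots> = (\<Sum>\<beta>\<in>UNIV. C $ \<alpha> $ \<beta> * An K m \<beta> i)"
    by (simp only: An_def sum_distrib_left)
  finally show ?thesis by (simp only: pvec_def An_def)
qed

lemma admissible_Adm: "admissible C K l n = Adm n K (vi l) (vi l)"
proof -
  have "(\<forall>\<alpha>. int (l $ \<alpha>) - pvec C K n m \<alpha> K = 0) \<longleftrightarrow> PP n m K 0 K = vi l" for m
    unfolding vec_eq_iff PP_pvec vi_nth by auto
  then show ?thesis by (simp add: admissible_def Adm_def PP_pvec)
qed

lemma PP_diff2:
  assumes "i \<in> {1..j}"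
  shows "PP n m j s (Suc i) = 2 *s PP n m j s i - PP n m j s (i - 1) - cv n m i"
proof -
  have "int (min (Suc i) k) = 2 * int (min i k) - int (min (i - 1) k) - (if k = i then 1 else 0)" for k
    using assms by auto
  then have "(\<Sum>k=1..j. int (min (Suc i) k) *s cv n m k)
      = (\<Sum>k=1..j. 2 *s (int (min i k) *s cv n m k) - int (min (i - 1) k) *s cv n m k - (if k = i then cv n m k else 0))"
    by (intro sum.cong) (auto simp: vec_eq_iff left_diff_distrib)
  also have "\<dots> = (\<Sum>k=1..j. 2 *s (int (min i k) *s cv n m k)) - (\<Sum>k=1..j. int (min (i - 1) k) *s cv n m k) - cv n m i"
    using assms by (simp add: sum_subtractf)
  also have "(\<Sum>k=1..j. 2 *s (int (min i k) *s cv n m k)) = 2 *s (\<Sum>k=1..j. int (min i k) *s cv n m k)"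
    by (simp add: vec_eq_iff sum_component sum_distrib_left mult.assoc)
  finally have e: "(\<Sum>k=1..j. int (min (Suc i) k) *s cv n m k) = 2 *s (\<Sum>k=1..j. int (min i k) *s cv n m k)
      - (\<Sum>k=1..j. int (min (i - 1) k) *s cv n m k) - cv n m i" .
  have i: "int (i - 1) = int i - 1" using assms by (simp add: of_nat_diff)
  show ?thesis unfolding PP_def e i by (simp add: vec_eq_iff algebra_simps)
qed

text \<open>A discrete Green identity: the quadratic part of the exponent telescopes.\<close>

lemma discrete_green:
  fixes P N c n :: "nat \<Rightarrow> (int, 'r) vec"
  assumes "P 0 = 0" "N 0 = 0"
    and c: "\<And>i. i \<in> {1..K} \<Longrightarrow> c i = P (Suc i) - 2 *s P i + P (i - 1) + n i"
    and n: "\<And>i. i \<in> {1..K} \<Longrightarrow> n i = 2 *s N i - N (Suc i) - N (i - 1)"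
  shows "(\<Sum>i=1..K. 2 * idot (Lm (P i)) (P i - P (Suc i) - n i) + 2 * idot (Lm (c i)) (P i)
      - idot (Lm (c i)) (P i + N i) + idot (Lm (n i)) (N i))
    = - idot (Lm (P K)) (P (Suc K)) - idot (Lm (P (Suc K))) (N K) + idot (Lm (N (Suc K))) (P K)"
  using c n
proof (induction K)
  case 0
  then show ?case by (simp add: assms(1,2))
next
  case (Suc K)
  define S where "S = (\<Sum>i=1..K. 2 * idot (Lm (P i)) (P i - P (Suc i) - n i) + 2 * idot (Lm (c i)) (P i)
      - idot (Lm (c i)) (P i + N i) + idot (Lm (n i)) (N i))"
  have IH: "S = - idot (Lm (P K)) (P (Suc K)) - idot (Lm (P (Suc K))) (N K) + idot (Lm (N (Suc K))) (P K)"
    unfolding S_def by (rule Suc.IH) (use Suc.prems in auto)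
  define x y z where "x = P K" and "y = P (Suc K)" and "z = P (Suc (Suc K))"
  define u v w where "u = N K" and "v = N (Suc K)" and "w = N (Suc (Suc K))"
  have c': "c (Suc K) = z - 2 *s y + x + n (Suc K)" and n': "n (Suc K) = 2 *s v - w - u"
    using Suc.prems(1)[of "Suc K"] Suc.prems(2)[of "Suc K"] by (simp_all add: x_def y_def z_def u_def v_def w_def)
  have "S + (2 * idot (Lm y) (y - z - n (Suc K)) + 2 * idot (Lm (c (Suc K))) y
      - idot (Lm (c (Suc K))) (y + v) + idot (Lm (n (Suc K))) v)
    = - idot (Lm y) z - idot (Lm z) v + idot (Lm w) y"
    unfolding IH c' n' x_def[symmetric] y_def[symmetric] u_def[symmetric] v_def[symmetric]
    using Lm_sym[of x y] Lm_sym[of x z] Lm_sym[of y z] Lm_sym[of u y] Lm_sym[of v y] Lm_sym[of w y]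
      Lm_sym[of u x] Lm_sym[of v x] Lm_sym[of w x] Lm_sym[of u z] Lm_sym[of v z] Lm_sym[of w z]
      Lm_sym[of u v] Lm_sym[of u w] Lm_sym[of v w]
    by (simp add: Lm_add Lm_diff Lm_scale idot_add_left idot_add_right idot_diff_left idot_diff_right)
  then show ?case by (simp add: S_def x_def y_def z_def u_def v_def w_def)
qed

text \<open>The right-hand side does not involve m: as q = t^(-\<delta>), the collected power of t
  is a common factor times q^Q. The quadratic part is \<open>discrete_green\<close>, the part linear
  in \<open>kap\<close> telescopes, and everything is doubled to avoid halves.\<close>

lemma cc_identity:
  assumes m: "m \<in> Adm n K p p"
  shows "2 * EE n m K (PP n m K 0) + 2 * dl * Qform C K n m
    = - 2 * idot kap (p + 1) - 2 * (\<Sum>i=1..K. idot kap (nv n i)) - idot (Lm p) p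
      - (\<Sum>i=1..K. idot (Lm (nv n i)) (PP n (\<lambda>_ _. 0) K 0 i))"
proof -
  define P where "P = PP n m K 0"
  define N where "N = PP n (\<lambda>_ _. 0) K 0"
  define c where "c i = C *v nv m i" for i
  have PK: "P K = p" "P (Suc K) = p" using m by (simp_all add: P_def Adm_def PP_top)
  have NK: "N (Suc K) = N K" by (simp add: N_def PP_top)
  have z: "nv (\<lambda>_ _. 0) i = 0" for i by (simp add: vec_eq_iff)
  have g: "(\<Sum>i=1..K. 2 * idot (Lm (P i)) (P i - P (Suc i) - nv n i) + 2 * idot (Lm (c i)) (P i)
      - idot (Lm (c i)) (P i + N i) + idot (Lm (nv n i)) (N i))
    = - idot (Lm (P K)) (P (Suc K)) - idot (Lm (P (Suc K))) (N K) + idot (Lm (N (Suc K))) (P K)"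
  proof (rule discrete_green)
    fix i assume i: "i \<in> {1..K}"
    show "c i = P (Suc i) - 2 *s P i + P (i - 1) + nv n i"
      using PP_diff2[OF i, of n m 0] by (simp add: P_def c_def cv_def)
    show "nv n i = 2 *s N i - N (Suc i) - N (i - 1)"
      using PP_diff2[OF i, of n "\<lambda>_ _. 0" 0] by (simp add: N_def cv_def z)
  qed (simp_all add: P_def N_def)
  have dm: "dl * idot (nv m i) x = idot (Lm (c i)) x" for i x by (simp add: c_def Lm_C)
  have "2 * Qform C K n m = - (\<Sum>i=1..K. idot (nv m i) (P i + N i))"
  proof -
    have "(\<Sum>\<alpha>\<in>UNIV. \<Sum>i=1..K. int (m \<alpha> i) * (pvec C K n m \<alpha> i + An K n \<alpha> i)) = (\<Sum>i=1..K. idot (nv m i) (P i + N i))"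
      by (subst sum.swap) (simp add: idot_def P_def N_def PP_pvec pvec_def An_def)
    then show ?thesis using Qform_exact[OF slc, of K n m] by simp
  qed
  then have "dl * (2 * Qform C K n m) = - (\<Sum>i=1..K. idot (Lm (c i)) (P i + N i))"
    by (simp only: mult_minus_right sum_distrib_left dm)
  then have Q: "2 * dl * Qform C K n m = - (\<Sum>i=1..K. idot (Lm (c i)) (P i + N i))" by simp
  have tel: "(\<Sum>i=1..K. idot kap (P i - P (Suc i))) = idot kap (P 1) - idot kap p"
  proof -
    have "(\<Sum>i=1..k. idot kap (P i - P (Suc i))) = idot kap (P 1) - idot kap (P (Suc k))" for k
      by (induction k) (simp_all add: idot_diff_right)
    then show ?thesis using PK by simp
  qed
  have "(\<Sum>i=1..K. idot (Lm (P i + 1)) (P i - P (Suc i) - nv n i))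
      = (\<Sum>i=1..K. idot (Lm (P i)) (P i - P (Suc i) - nv n i)) + (\<Sum>i=1..K. idot kap (P i - P (Suc i))) - (\<Sum>i=1..K. idot kap (nv n i))"
    by (simp add: Lm_add kap_def[symmetric] idot_add_left sum.distrib idot_diff_right sum_subtractf)
  then have E: "EE n m K P = (\<Sum>i=1..K. idot (Lm (P i)) (P i - P (Suc i) - nv n i)) + (\<Sum>i=1..K. idot (Lm (c i)) (P i))
      - idot kap (p + 1) - (\<Sum>i=1..K. idot kap (nv n i))"
    unfolding EE_def sum.distrib dm tel by (simp add: idot_add_right)
  have "2 * (\<Sum>i=1..K. idot (Lm (P i)) (P i - P (Suc i) - nv n i)) + 2 * (\<Sum>i=1..K. idot (Lm (c i)) (P i))
      - (\<Sum>i=1..K. idot (Lm (c i)) (P i + N i)) + (\<Sum>i=1..K. idot (Lm (nv n i)) (N i)) = - idot (Lm p) p"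
    using g unfolding PK NK sum.distrib sum_subtractf sum_distrib_left[symmetric]
    by (simp add: Lm_sym[of p "N K"])
  moreover have "2 * (a + b - u - v) + - q = - 2 * u - 2 * v - s - r" if "2 * a + 2 * b - q + r = - s" for a b q r s u v :: int
    using that by simp
  ultimately show ?thesis
    unfolding P_def[symmetric] N_def[symmetric] Q E by blast
qed

text \<open>The hypothesis on e is conditional because its right-hand side is known to be even only
  when an admissible m exists; without one both sides are zero.\<close>

lemma GL_MultK:
  assumes "admissible C K l n \<noteq> {} \<Longrightarrow> 2 * e = - 2 * idot kap (vi l + 1) - 2 * (\<Sum>i=1..K. idot kap (nv n i)) - idot (Lm (vi l)) (vi l)
      - (\<Sum>i=1..K. idot (Lm (nv n i)) (PP n (\<lambda>_ _. 0) K 0 i))"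
  shows "GL n K (vi l) (vi l) = tpow e * MultK C K l n"
proof -
  have "GL n K (vi l) (vi l) = (\<Sum>m\<in>admissible C K l n. WW n m K (PP n m K 0))"
    using GL_eq[of "vi l" n K "vi l"] by (simp add: admissible_Adm)
  also have "\<dots> = (\<Sum>m\<in>admissible C K l n. tpow e * (qpow C (Qform C K n m)
      * (\<Prod>\<alpha>\<in>UNIV. \<Prod>i=1..K. qbinom C (m \<alpha> i) (pvec C K n m \<alpha> i))))"
  proof (rule sum.cong[OF refl])
    fix m assume m: "m \<in> admissible C K l n"
    then have "2 * e = 2 * EE n m K (PP n m K 0) + 2 * dl * Qform C K n m"
      using assms cc_identity[of m n K "vi l"] unfolding admissible_Adm by (metis empty_iff)
    then have "EE n m K (PP n m K 0) = e + - dl * Qform C K n m" by simp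
    then have 1: "tpow (EE n m K (PP n m K 0)) = tpow e * qpow C (Qform C K n m)"
      unfolding qpow_def tpow_add[symmetric] by (simp only:)
    have 2: "(\<Prod>i=1..K. qbp (PP n m K 0 i) (\<lambda>\<alpha>. m \<alpha> i)) = (\<Prod>\<alpha>\<in>UNIV. \<Prod>i=1..K. qbinom C (m \<alpha> i) (pvec C K n m \<alpha> i))"
      unfolding qbp_def PP_pvec by (rule prod.swap)
    show "WW n m K (PP n m K 0) = tpow e * (qpow C (Qform C K n m)
      * (\<Prod>\<alpha>\<in>UNIV. \<Prod>i=1..K. qbinom C (m \<alpha> i) (pvec C K n m \<alpha> i)))"
      unfolding WW_def 1 2 by (simp only: mult.assoc)
  qed
  finally show ?thesis by (simp only: MultK_def sum_distrib_left)
qed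

end

section \<open>The completed quantum torus as a subring of the twisted Laurent series\<close>

lemma lookup_times_superset:
  fixes d e :: "'r::finite lpoly"
  assumes "finite A" "keys d \<subseteq> A"
  shows "lookup (d * e) a = (\<Sum>a1\<in>A. lookup d a1 * lookup e (a - a1))"
proof -
  have s: "lookup (Poly_Mapping.single a1 c * e) a = c * lookup e (a - a1)" for a1 c
  proof (induction e rule: lpoly_induct)
    case (single b c')
    show ?case by (auto simp: mult_single lookup_single when_def algebra_simps)
  qed (simp_all add: distrib_left lookup_add)
  have sm: "lookup (sum f B) a = (\<Sum>x\<in>B. lookup (f x) a)" for f :: "(int, 'r) vec \<Rightarrow> 'r lpoly" and B
    by (induction B rule: infinite_finite_induct) (simp_all add: lookup_add)
  have "lookup (d * e) a = lookup ((\<Sum>a1\<in>keys d. Poly_Mapping.single a1 (lookup d a1)) * e) a"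
    using lpoly_sum_single[of d] by (simp only:)
  also have "\<dots> = (\<Sum>a1\<in>keys d. lookup d a1 * lookup e (a - a1))"
    unfolding sum_distrib_right sm s ..
  also have "\<dots> = (\<Sum>a1\<in>A. lookup d a1 * lookup e (a - a1))"
    using assms by (intro sum.mono_neutral_left) (auto simp: in_keys_iff)
  finally show ?thesis .
qed

context simply_laced
begin

definition Ser :: "'r qtser \<Rightarrow> bool" where
  "Ser x \<longleftrightarrow> (\<exists>B. finite B \<and> (\<forall>b. cf x b \<noteq> 0 \<longrightarrow> (\<exists>b0\<in>B. incone b0 b)))"

text \<open>Return from \<lambda>b to b. Coefficients off the lattice of the \<lambda>b are
  forgotten, which is harmless on \<open>Ser\<close>, where the support lies in cones inside that
  lattice.\<close>

definition Ph :: "'r qtser \<Rightarrow> 'r qseries" where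
  "Ph x = (\<lambda>a b. lookup (cf x (Lm b)) a)"

lemma Ser_led: "led x b \<Longrightarrow> Ser x"
  unfolding Ser_def using led_incone by (intro exI[of _ "{b}"]) auto

lemma Ser_0: "Ser 0"
  unfolding Ser_def by (intro exI[of _ "{}"]) auto

lemma Ser_1: "Ser 1"
  using Ser_led led_1 by blast

lemma Ser_add: "Ser x \<Longrightarrow> Ser y \<Longrightarrow> Ser (x + y)"
proof -
  assume "Ser x" "Ser y"
  then obtain B B' where B: "finite B" "\<And>b. cf x b \<noteq> 0 \<Longrightarrow> \<exists>b0\<in>B. incone b0 b"
    and B': "finite B'" "\<And>b. cf y b \<noteq> 0 \<Longrightarrow> \<exists>b0\<in>B'. incone b0 b"
    unfolding Ser_def by blast
  have "\<exists>b0\<in>B \<union> B'. incone b0 b" if "cf (x + y) b \<noteq> 0" for b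
  proof -
    have "cf x b \<noteq> 0 \<or> cf y b \<noteq> 0" using that by auto
    then show ?thesis using B(2)[of b] B'(2)[of b] by blast
  qed
  then show ?thesis unfolding Ser_def using B(1) B'(1) by (intro exI[of _ "B \<union> B'"]) auto
qed

lemma Ser_minus: "Ser x \<Longrightarrow> Ser (- x)"
  by (simp add: Ser_def)

lemma Ser_diff: "Ser x \<Longrightarrow> Ser y \<Longrightarrow> Ser (x - y)"
  using Ser_add[of x "- y"] Ser_minus by simp

lemma Ser_mult: "Ser x \<Longrightarrow> Ser y \<Longrightarrow> Ser (x * y)"
proof -
  assume "Ser x" "Ser y"
  then obtain B B' where B: "finite B" "\<And>b. cf x b \<noteq> 0 \<Longrightarrow> \<exists>b0\<in>B. incone b0 b"
    and B': "finite B'" "\<And>b. cf y b \<noteq> 0 \<Longrightarrow> \<exists>b0\<in>B'. incone b0 b"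
    unfolding Ser_def by blast
  have "\<exists>c\<in>(\<lambda>(b0, b1). b0 + b1) ` (B \<times> B'). incone c b" if nz: "cf (x * y) b \<noteq> 0" for b
  proof -
    obtain b1 b2 where b: "cf x b1 \<noteq> 0" "cf y b2 \<noteq> 0" "b = b1 + b2" by (rule cf_mult_nonzero[OF nz])
    obtain c1 c2 where "c1 \<in> B" "c2 \<in> B'" "incone c1 b1" "incone c2 b2" using B(2) B'(2) b by blast
    then show ?thesis unfolding b(3) using incone_add by force
  qed
  then show ?thesis unfolding Ser_def using B(1) B'(1) by (intro exI[of _ "(\<lambda>(b0, b1). b0 + b1) ` (B \<times> B')"]) auto
qed

lemma Ser_scl: "Ser x \<Longrightarrow> Ser (c \<star> x)"
  unfolding Ser_def by (metis cf_scl mult_zero_right)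

lemma Ser_X: "Ser (X a b)"
  using Ser_led led_X by blast

lemma Ser_lattice: "Ser x \<Longrightarrow> cf x b \<noteq> 0 \<Longrightarrow> \<exists>c. b = Lm c"
  unfolding Ser_def using incone_lattice by blast

lemma Ph_inject:
  assumes "Ser x" "Ser y" "Ph x = Ph y"
  shows "x = y"
proof (rule qtser_eqI)
  fix b
  show "cf x b = cf y b"
  proof (cases "\<exists>c. b = Lm c")
    case True
    then obtain c where c: "b = Lm c" by blast
    have "lookup (cf x b) a = lookup (cf y b) a" for a
      using fun_cong[OF fun_cong[OF assms(3), of a], of c] by (simp add: Ph_def c)
    then show ?thesis by (rule poly_mapping_eqI)
  next
    case False
    then have "cf x b = 0" "cf y b = 0" using Ser_lattice assms(1,2) by blast+
    then show ?thesis by simp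
  qed
qed

lemma incone_Lm: "incone b0 (Lm b) \<longleftrightarrow> (\<exists>k :: (nat, 'r) vec. b = b0 - C *v (\<chi> \<beta>. int (k $ \<beta>)))"
proof
  assume "incone b0 (Lm b)"
  then obtain n :: "'r \<Rightarrow> nat" where "Lm b = Lm b0 - dl *s (\<chi> i. int (n i))" unfolding incone_def by blast
  then have "Lm b = Lm (b0 - C *v (\<chi> i. int (n i)))" by (simp add: Lm_diff Lm_C)
  then have "b = b0 - C *v (\<chi> \<beta>. int ((\<chi> i. n i) $ \<beta>))" by (simp add: Lm_inj)
  then show "\<exists>k :: (nat, 'r) vec. b = b0 - C *v (\<chi> \<beta>. int (k $ \<beta>))" by blast
next
  assume "\<exists>k :: (nat, 'r) vec. b = b0 - C *v (\<chi> \<beta>. int (k $ \<beta>))"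
  then obtain k :: "(nat, 'r) vec" where "b = b0 - C *v (\<chi> \<beta>. int (k $ \<beta>))" by blast
  then show "incone b0 (Lm b)" unfolding incone_def by (intro exI[of _ "\<lambda>i. k $ i"]) (simp add: Lm_diff Lm_C)
qed

lemma Ph_carrier: "Ser x \<Longrightarrow> Ph x \<in> qseries_carrier C"
proof -
  assume "Ser x"
  then obtain B where B: "finite B" "\<And>b. cf x b \<noteq> 0 \<Longrightarrow> \<exists>b0\<in>B. incone b0 b"
    unfolding Ser_def by blast
  have "\<exists>b0\<in>B. \<exists>k :: (nat, 'r) vec. b = b0 - C *v (\<chi> \<beta>. int (k $ \<beta>))" if "Ph x a b \<noteq> 0" for a b
  proof -
    have "cf x (Lm b) \<noteq> 0" using that by (auto simp: Ph_def)
    then show ?thesis using B(2) incone_Lm by blast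
  qed
  moreover have "finite {a. Ph x a b \<noteq> 0}" for b by (simp add: Ph_def)
  ultimately show ?thesis unfolding qseries_carrier_def using B(1) by blast
qed

lemma Ph_surj:
  assumes "f \<in> qseries_carrier C"
  shows "\<exists>x. Ser x \<and> Ph x = f"
proof -
  obtain B where B: "finite B" "\<And>a b. f a b \<noteq> 0 \<Longrightarrow> \<exists>b0\<in>B. \<exists>k :: (nat, 'r) vec. b = b0 - C *v (\<chi> \<beta>. int (k $ \<beta>))"
    and fin: "\<And>b. finite {a. f a b \<noteq> 0}"
    using assms unfolding qseries_carrier_def by blast
  define g where "g b' = (if b' \<in> range Lm then Poly_Mapping.Abs_poly_mapping (\<lambda>a. f a (inv_into UNIV Lm b')) else 0)" for b'
  have il: "inv_into UNIV Lm (Lm b) = b" for b by (rule inv_into_f_f) (simp_all add: inj_def Lm_inj)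
  have lg: "lookup (g (Lm b)) a = f a b" for a b
    using fin[of b] by (simp add: g_def il)
  have gc: "\<exists>b0\<in>B. incone b0 b'" if nz: "g b' \<noteq> 0" for b'
  proof -
    obtain b where b: "b' = Lm b" using nz by (auto simp: g_def split: if_splits)
    then have "lookup (g (Lm b)) \<noteq> lookup 0" using nz by (metis lookup_inject)
    then obtain a where "lookup (g (Lm b)) a \<noteq> 0" by (auto simp: fun_eq_iff)
    then show ?thesis using B(2)[of a b] by (simp add: lg b incone_Lm)
  qed
  have "\<exists>u. \<forall>b0\<in>B'. Lm b0 \<le> u" if "finite B'" for B'
    using that
  proof (induction B' rule: finite_induct)
    case (insert b F)
    then obtain u where u: "\<forall>b0\<in>F. Lm b0 \<le> u" by blast
    obtain v where "u \<le> v" "Lm b \<le> v" using vec_ub by blast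
    then show ?case using u by (intro exI[of _ v]) (auto intro: order_trans)
  qed simp
  then obtain u where u: "\<And>b0. b0 \<in> B \<Longrightarrow> Lm b0 \<le> u" using B(1) by blast
  have c: "cf (mkser g) = g"
    by (rule cf_mkser[of _ u]) (use gc u incone_le order_trans in blast)
  have "Ser (mkser g)" unfolding Ser_def c using gc B(1) by blast
  moreover have "Ph (mkser g) = f" by (intro ext) (simp add: Ph_def c lg)
  ultimately show ?thesis by blast
qed

lemma carrier_qring: "carrier (qring C) = Ph ` {x. Ser x}"
proof
  show "carrier (qring C) \<subseteq> Ph ` {x. Ser x}"
  proof
    fix f assume "f \<in> carrier (qring C)"
    then have "f \<in> qseries_carrier C" by (simp add: qring_def)
    then show "f \<in> Ph ` {x. Ser x}" using Ph_surj by blast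
  qed
  show "Ph ` {x. Ser x} \<subseteq> carrier (qring C)" using Ph_carrier by (auto simp: qring_def)
qed

lemma Ph_add: "Ph x \<oplus>\<^bsub>qring C\<^esub> Ph y = Ph (x + y)"
  by (intro ext) (simp add: qring_def Ph_def lookup_add)

lemma Ph_0: "\<zero>\<^bsub>qring C\<^esub> = Ph 0"
  by (intro ext) (simp add: qring_def Ph_def)

lemma Ph_qmonom: "qmonom c a b = Ph (c \<star> X a b)"
  by (intro ext) (auto simp: qmonom_def Ph_def cf_X lookup_single when_def)

lemma Ph_1: "\<one>\<^bsub>qring C\<^esub> = Ph 1"
  using Ph_qmonom[of 1 0 0] by (simp add: qring_def)

lemma Ph_mult:
  assumes "Ser x" "Ser y"
  shows "Ph x \<otimes>\<^bsub>qring C\<^esub> Ph y = Ph (x * y)"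
proof (intro ext)
  fix a b
  define B where "B = {b1. cf x (Lm b1) \<noteq> 0 \<and> cf y (Lm b - Lm b1) \<noteq> 0}"
  have injB: "inj_on Lm B" by (simp add: inj_on_def Lm_inj)
  have fB: "finite B"
    by (rule inj_on_finite[OF injB _ finite_conv_support[of x y "Lm b"]]) (auto simp: B_def)
  define T where "T = (\<lambda>(b1, a1). (a1, b1)) ` (SIGMA b1:B. keys (cf x (Lm b1)))"
  have i: "inj_on (\<lambda>(b1, a1). (a1, b1)) (SIGMA b1:B. keys (cf x (Lm b1)))" by (auto simp: inj_on_def)
  let ?F = "\<lambda>a1 b1. tpow (- idot (Lm b1) (a - a1)) * Ph x a1 b1 * Ph y (a - a1) (b - b1)"
  have e: "(\<Sum>\<alpha>\<in>UNIV. \<Sum>\<beta>\<in>UNIV. b1 $ \<alpha> * lam C $ \<alpha> $ \<beta> * c $ \<beta>) = idot (Lm b1) c" for b1 c :: "(int, 'r) vec"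
    using idot_matvec[of b1 "lam C" c] Lm_sym[of b1 c] by (simp add: Lm_def idot_commute)
  have "(Ph x \<otimes>\<^bsub>qring C\<^esub> Ph y) a b = Sum_any (\<lambda>(a1, b1). ?F a1 b1)"
    by (simp add: qring_def qmult_def e del: vector_minus_component)
  also have "\<dots> = (\<Sum>(a1, b1)\<in>T. ?F a1 b1)"
  proof (rule Sum_any.expand_superset)
    show "finite T" unfolding T_def using fB by (intro finite_imageI finite_SigmaI) auto
    show "{p. (case p of (a1, b1) \<Rightarrow> ?F a1 b1) \<noteq> 0} \<subseteq> T"
    proof clarify
      fix a1 b1 assume nz: "?F a1 b1 \<noteq> 0"
      then have "a1 \<in> keys (cf x (Lm b1))" by (auto simp: Ph_def in_keys_iff)
      moreover have "cf x (Lm b1) \<noteq> 0" "cf y (Lm b - Lm b1) \<noteq> 0"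
        using nz by (auto simp: Ph_def Lm_diff)
      ultimately show "(a1, b1) \<in> T" unfolding T_def B_def by (intro image_eqI[of _ _ "(b1, a1)"]) auto
    qed
  qed
  also have "\<dots> = (\<Sum>(b1, a1)\<in>(SIGMA b1:B. keys (cf x (Lm b1))). ?F a1 b1)"
    unfolding T_def by (subst sum.reindex[OF i]) (auto simp: o_def intro!: sum.cong)
  also have "\<dots> = (\<Sum>b1\<in>B. \<Sum>a1\<in>keys (cf x (Lm b1)). ?F a1 b1)"
    by (rule sum.Sigma[symmetric]) (simp_all add: fB)
  also have "\<dots> = (\<Sum>b1\<in>B. lookup (cf x (Lm b1) * tw (Lm b1) (cf y (Lm b - Lm b1))) a)"
  proof (rule sum.cong[OF refl])
    fix b1
    show "(\<Sum>a1\<in>keys (cf x (Lm b1)). ?F a1 b1) = lookup (cf x (Lm b1) * tw (Lm b1) (cf y (Lm b - Lm b1))) a"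
      unfolding lookup_times_superset[OF finite_keys order_refl] lookup_tw Ph_def Lm_diff
      by (rule sum.cong[OF refl]) (simp only: mult.assoc mult.left_commute)
  qed
  also have "\<dots> = lookup (\<Sum>b1\<in>B. cf x (Lm b1) * tw (Lm b1) (cf y (Lm b - Lm b1))) a"
    using fB by (induction B rule: finite_induct) (simp_all add: lookup_add)
  also have "(\<Sum>b1\<in>B. cf x (Lm b1) * tw (Lm b1) (cf y (Lm b - Lm b1)))
      = (\<Sum>b1\<in>Lm ` B. cf x b1 * tw b1 (cf y (Lm b - b1)))"
    by (simp add: sum.reindex[OF injB] o_def)
  also have "\<dots> = cf (x * y) (Lm b)"
  proof (rule cf_mult_superset[symmetric])
    show "b1 \<in> Lm ` B" if "cf x b1 \<noteq> 0" "cf y (Lm b - b1) \<noteq> 0" for b1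
      using Ser_lattice[OF assms(1) that(1)] that by (auto simp: B_def)
  qed (use fB in simp)
  finally show "(Ph x \<otimes>\<^bsub>qring C\<^esub> Ph y) a b = Ph (x * y) a b" by (simp add: Ph_def)
qed

lemma qring_ring: "ring (qring C)"
proof -
  have ex: "\<exists>x. Ser x \<and> f = Ph x" if "f \<in> carrier (qring C)" for f
    using that unfolding carrier_qring by blast
  have cl: "Ph x \<in> carrier (qring C)" if "Ser x" for x
    using that unfolding carrier_qring by blast
  show ?thesis
  proof (rule ringI)
    show "abelian_group (qring C)"
    proof (rule abelian_groupI)
      show "f \<oplus>\<^bsub>qring C\<^esub> g \<in> carrier (qring C)" if "f \<in> carrier (qring C)" "g \<in> carrier (qring C)" for f g
        using ex[OF that(1)] ex[OF that(2)] Ph_add cl Ser_add by metis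
      show "\<zero>\<^bsub>qring C\<^esub> \<in> carrier (qring C)" unfolding Ph_0 by (rule cl[OF Ser_0])
      show "f \<oplus>\<^bsub>qring C\<^esub> g \<oplus>\<^bsub>qring C\<^esub> h = f \<oplus>\<^bsub>qring C\<^esub> (g \<oplus>\<^bsub>qring C\<^esub> h)" for f g h
        by (simp add: qring_def add.assoc)
      show "f \<oplus>\<^bsub>qring C\<^esub> g = g \<oplus>\<^bsub>qring C\<^esub> f" for f g by (simp add: qring_def add.commute)
      show "\<zero>\<^bsub>qring C\<^esub> \<oplus>\<^bsub>qring C\<^esub> f = f" for f by (simp add: qring_def)
      fix f assume "f \<in> carrier (qring C)"
      then obtain x where x: "Ser x" "f = Ph x" using ex by blast
      have "Ph (- x) \<oplus>\<^bsub>qring C\<^esub> f = \<zero>\<^bsub>qring C\<^esub>" unfolding x Ph_add Ph_0 by simp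
      then show "\<exists>g\<in>carrier (qring C). g \<oplus>\<^bsub>qring C\<^esub> f = \<zero>\<^bsub>qring C\<^esub>" using cl[OF Ser_minus[OF x(1)]] by blast
    qed
    show "monoid (qring C)"
    proof (rule monoidI)
      show "f \<otimes>\<^bsub>qring C\<^esub> g \<in> carrier (qring C)" if "f \<in> carrier (qring C)" "g \<in> carrier (qring C)" for f g
        using ex[OF that(1)] ex[OF that(2)] Ph_mult cl Ser_mult by metis
      show "\<one>\<^bsub>qring C\<^esub> \<in> carrier (qring C)" unfolding Ph_1 by (rule cl[OF Ser_1])
      show "f \<otimes>\<^bsub>qring C\<^esub> g \<otimes>\<^bsub>qring C\<^esub> h = f \<otimes>\<^bsub>qring C\<^esub> (g \<otimes>\<^bsub>qring C\<^esub> h)"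
        if h: "f \<in> carrier (qring C)" "g \<in> carrier (qring C)" "h \<in> carrier (qring C)" for f g h
      proof -
        obtain x y z where "Ser x" "f = Ph x" "Ser y" "g = Ph y" "Ser z" "h = Ph z"
          using ex[OF h(1)] ex[OF h(2)] ex[OF h(3)] by (elim exE conjE)
        then show ?thesis by (simp add: Ph_mult Ser_mult mult.assoc)
      qed
      fix f assume "f \<in> carrier (qring C)"
      then obtain x where x: "Ser x" "f = Ph x" using ex by blast
      then show "\<one>\<^bsub>qring C\<^esub> \<otimes>\<^bsub>qring C\<^esub> f = f" "f \<otimes>\<^bsub>qring C\<^esub> \<one>\<^bsub>qring C\<^esub> = f"
        by (simp_all add: Ph_1 Ph_mult Ser_1)
    qed
    fix f g h assume h: "f \<in> carrier (qring C)" "g \<in> carrier (qring C)" "h \<in> carrier (qring C)"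
    obtain x y z where "Ser x" "f = Ph x" "Ser y" "g = Ph y" "Ser z" "h = Ph z"
      using ex[OF h(1)] ex[OF h(2)] ex[OF h(3)] by (elim exE conjE)
    then show "(f \<oplus>\<^bsub>qring C\<^esub> g) \<otimes>\<^bsub>qring C\<^esub> h = f \<otimes>\<^bsub>qring C\<^esub> h \<oplus>\<^bsub>qring C\<^esub> g \<otimes>\<^bsub>qring C\<^esub> h"
      "h \<otimes>\<^bsub>qring C\<^esub> (f \<oplus>\<^bsub>qring C\<^esub> g) = h \<otimes>\<^bsub>qring C\<^esub> f \<oplus>\<^bsub>qring C\<^esub> h \<otimes>\<^bsub>qring C\<^esub> g"
      by (simp_all add: Ph_mult Ph_add Ser_add distrib_left distrib_right)
  qed
qed

section \<open>Ring operations and the Q-system under this identification\<close>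

interpretation R: ring "qring C"
  by (rule qring_ring)

lemma Ph_in [simp]: "Ser x \<Longrightarrow> Ph x \<in> carrier (qring C)"
  unfolding carrier_qring by blast

lemma Ph_minus: "Ser x \<Longrightarrow> \<ominus>\<^bsub>qring C\<^esub> Ph x = Ph (- x)"
  by (rule R.minus_equality) (simp_all add: Ph_add Ph_0 Ser_minus)

lemma Ph_diff: "Ser x \<Longrightarrow> Ser y \<Longrightarrow> Ph x \<ominus>\<^bsub>qring C\<^esub> Ph y = Ph (x - y)"
  by (simp add: a_minus_def Ph_minus Ph_add)

lemma Ph_inv:
  assumes "Ser x" "Ser (uinv x)" "isu x"
  shows "inv\<^bsub>qring C\<^esub> Ph x = Ph (uinv x)"
proof -
  have 1: "Ph x \<otimes>\<^bsub>qring C\<^esub> Ph (uinv x) = \<one>\<^bsub>qring C\<^esub>" and 2: "Ph (uinv x) \<otimes>\<^bsub>qring C\<^esub> Ph x = \<one>\<^bsub>qring C\<^esub>"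
    using assms by (simp_all add: Ph_mult Ph_1)
  show ?thesis unfolding m_inv_def
  proof (rule the_equality)
    fix y assume y: "y \<in> carrier (qring C) \<and> Ph x \<otimes>\<^bsub>qring C\<^esub> y = \<one>\<^bsub>qring C\<^esub> \<and> y \<otimes>\<^bsub>qring C\<^esub> Ph x = \<one>\<^bsub>qring C\<^esub>"
    show "y = Ph (uinv x)"
      by (rule R.inv_unique[of y "Ph x" "Ph (uinv x)"]) (use y 1 assms in simp_all)
  qed (use 1 2 assms in simp)
qed

lemma Ph_inv_led: "led x b \<Longrightarrow> inv\<^bsub>qring C\<^esub> Ph x = Ph (uinv x)"
  using Ph_inv Ser_led led_uinv led_isu by blast

lemma Ser_power: "Ser x \<Longrightarrow> Ser (x ^ n)"
  by (induction n) (simp_all add: Ser_1 Ser_mult)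

lemma Ph_power: "Ser x \<Longrightarrow> Ph x [^]\<^bsub>qring C\<^esub> n = Ph (x ^ n)"
proof (induction n)
  case 0
  then show ?case by (simp only: R.nat_pow_0 Ph_1 power_0)
next
  case (Suc n)
  then show ?case by (simp only: R.nat_pow_Suc Ph_mult Ser_power power_Suc2)
qed

lemma Ph_int_power: "Ser x \<Longrightarrow> k \<ge> 0 \<Longrightarrow> Ph x [^]\<^bsub>qring C\<^esub> (k :: int) = Ph (pw x k)"
proof -
  assume x: "Ser x" and k: "k \<ge> 0"
  have "Ph x [^]\<^bsub>qring C\<^esub> k = Ph x [^]\<^bsub>qring C\<^esub> nat k" unfolding int_pow_def2 by (rule if_not_P) (use k in linarith)
  then show "Ph x [^]\<^bsub>qring C\<^esub> k = Ph (pw x k)" using Ph_power[OF x] k by (simp only: pw_def if_True)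
qed

lemma Ser_prod_list: "(\<And>i. i \<in> set is \<Longrightarrow> Ser (f i)) \<Longrightarrow> Ser (prod_list (map f is))"
  by (induction "is") (simp_all add: Ser_1 Ser_mult)

lemma Ph_ordprod:
  assumes "\<And>i. i \<in> set is \<Longrightarrow> Ser (f i) \<and> g i = Ph (f i)"
  shows "ordprod (qring C) g is = Ph (prod_list (map f is))"
  using assms by (induction "is") (simp_all add: ordprod_def Ph_1 Ph_mult Ser_prod_list)

lemma Ser_QS: "Ser (QS \<alpha> n)"
  unfolding QS_def using Ser_led led_Xi by blast

lemma Xi_power: "Xi i 0 u ^ n = Xi i 0 (int n *s u)" and Xi_power': "Xi i u 0 ^ n = Xi i (int n *s u) 0"
proof -
  have s: "int (Suc n) *s u = u + int n *s u" for n by (simp add: vec_eq_iff algebra_simps)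
  show "Xi i 0 u ^ n = Xi i 0 (int n *s u)"
    by (induction n) (simp_all only: power_Suc s Xi_add_right, simp)
  show "Xi i u 0 ^ n = Xi i (int n *s u) 0"
  proof (induction n)
    case (Suc n)
    then show ?case unfolding power_Suc s by (simp add: Xi_mult)
  qed simp
qed

lemma uinv_Xi: "uinv (Xi i 0 u) = Xi i 0 (- u)" "uinv (Xi i u 0) = Xi i (- u) 0"
  by (rule uinvI, simp add: is_inv_def Xi_mult)+

lemma pw_Xi: "pw (Xi i 0 u) k = Xi i 0 (k *s u)"
proof (cases "k \<ge> 0")
  case True
  then show ?thesis by (simp add: pw_def Xi_power)
next
  case False
  have "int (nat (- k)) *s (- u) = k *s u" using False by (simp add: vec_eq_iff)
  then show ?thesis using False by (simp add: pw_def uinv_Xi Xi_power)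
qed

lemma prod_list_Xi: "prod_list (map (\<lambda>\<alpha>. Xi i 0 (g \<alpha>)) l) = Xi i 0 (sum_list (map g l))"
  "prod_list (map (\<lambda>\<alpha>. Xi i (g \<alpha>) 0) l) = Xi i (sum_list (map g l)) 0"
  by (induction l) (simp_all add: Xi_mult)

lemma Xi_prod: "Xi i 0 b = prod_list (map (\<lambda>\<alpha>. pw (Xi i 0 (ax \<alpha>)) (b $ \<alpha>)) idx)"
  unfolding pw_Xi prod_list_Xi sum_list_idx vec_expand ..

text \<open>The division in the recursion of \<open>qQ\<close> is genuine because Q_{\<alpha>,n-2}
  has a monomial leading term, so \<open>Ph_inv_led\<close> computes its inverse; what remains is
  \<open>QS_rec\<close> divided on the right.\<close>

theorem Ph_QS: "qQ C \<alpha> n = Ph (QS \<alpha> n)"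
proof (induction n arbitrary: \<alpha> rule: less_induct)
  case (less n)
  consider "n = 0" | "n = Suc 0" | k where "n = Suc (Suc k)" by (metis not0_implies_Suc)
  then show ?case
  proof cases
    case 1
    then show ?thesis by (simp add: Ph_qmonom QS_def)
  next
    case 2
    then show ?thesis by (simp add: Ph_qmonom QS_Suc)
  next
    case (3 m)
    have IH: "qQ C \<beta> (Suc m) = Ph (QS \<beta> (Suc m))" "qQ C \<beta> m = Ph (QS \<beta> m)" for \<beta>
      using less.IH 3 by simp_all
    define js where "js = filter (\<lambda>\<beta>. \<beta> \<noteq> \<alpha>) (idx :: 'r list)"
    have ld: "led (QS \<beta> k) (int k *s ax \<beta>)" for \<beta> k using led_Xi[of k "ax \<beta>" 0] by (simp add: QS_def)
    have "ordprod (qring C) (\<lambda>\<beta>. qQ C \<beta> (Suc m) [^]\<^bsub>qring C\<^esub> (- C $ \<alpha> $ \<beta>)) js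
        = Ph (prod_list (map (\<lambda>\<beta>. pw (QS \<beta> (Suc m)) (- C $ \<alpha> $ \<beta>)) js))"
    proof (rule Ph_ordprod)
      fix \<beta> assume "\<beta> \<in> set js"
      then have "- C $ \<alpha> $ \<beta> \<ge> 0" using C_offdiag_le[of \<alpha> \<beta>] by (auto simp: js_def)
      then show "Ser (pw (QS \<beta> (Suc m)) (- C $ \<alpha> $ \<beta>)) \<and> qQ C \<beta> (Suc m) [^]\<^bsub>qring C\<^esub> (- C $ \<alpha> $ \<beta>) = Ph (pw (QS \<beta> (Suc m)) (- C $ \<alpha> $ \<beta>))"
        using IH(1) Ph_int_power[OF Ser_QS] Ser_led[OF led_pw[OF ld]] by simp
    qed
    also have "prod_list (map (\<lambda>\<beta>. pw (QS \<beta> (Suc m)) (- C $ \<alpha> $ \<beta>)) js) = Xi m 0 (pc \<alpha>)"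
    proof -
      have "prod_list (map (\<lambda>\<beta>. pw (Xi m 0 (ax \<beta>)) (- C $ \<alpha> $ \<beta>)) (filter (\<lambda>\<beta>. \<beta> \<noteq> \<alpha>) ks))
          = prod_list (map (\<lambda>\<beta>. pw (Xi m 0 (ax \<beta>)) (pc \<alpha> $ \<beta>)) ks)" for ks
        by (induction ks) (auto simp: pc_nth)
      then show ?thesis by (simp add: Xi_prod[of m "pc \<alpha>"] js_def QS_Suc)
    qed
    finally have P: "ordprod (qring C) (\<lambda>\<beta>. qQ C \<beta> (Suc m) [^]\<^bsub>qring C\<^esub> (- C $ \<alpha> $ \<beta>)) js = Ph (Xi m 0 (pc \<alpha>))" .
    have S: "Ser (Xi m 0 b)" for b using Ser_led led_Xi by blast
    have sq: "QS \<alpha> (Suc m) ^ 2 = Xi m 0 (2 *s ax \<alpha>)"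
      by (simp add: QS_Suc power2_eq_square Xi_mult vec_eq_iff) (simp add: vec_eq_iff arg_cong[of _ _ "Xi m 0"])
    have d: "QS \<alpha> n = tpow (- lam C $ \<alpha> $ \<alpha>) \<star> (Xi m 0 (2 *s ax \<alpha>) - Xi m 0 (pc \<alpha>)) * uinv (QS \<alpha> m)"
      using QS_rec[of \<alpha> m] isu_QS[of \<alpha> m] 3 by (metis mult.assoc mult_1_right uinv_right)
    have q: "qmonom (tpow (- lam C $ \<alpha> $ \<alpha>)) 0 0 = Ph (tpow (- lam C $ \<alpha> $ \<alpha>) \<star> 1)"
      by (simp add: Ph_qmonom)
    have "qQ C \<alpha> n = Ph (tpow (- lam C $ \<alpha> $ \<alpha>) \<star> 1) \<otimes>\<^bsub>qring C\<^esub> (Ph (QS \<alpha> (Suc m)) [^]\<^bsub>qring C\<^esub> (2::nat)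
        \<ominus>\<^bsub>qring C\<^esub> Ph (Xi m 0 (pc \<alpha>))) \<otimes>\<^bsub>qring C\<^esub> inv\<^bsub>qring C\<^esub> Ph (QS \<alpha> m)"
      unfolding 3 qQ.simps(3) q IH js_def[symmetric] P[unfolded IH] ..
    also have "\<dots> = Ph (tpow (- lam C $ \<alpha> $ \<alpha>) \<star> 1 * (Xi m 0 (2 *s ax \<alpha>) - Xi m 0 (pc \<alpha>)) * uinv (QS \<alpha> m))"
      using Ser_led[OF led_uinv[OF ld, of \<alpha> m]]
      by (simp only: Ph_inv_led[OF ld] Ph_power[OF Ser_QS] sq Ph_diff S Ph_mult Ser_diff Ser_scl Ser_1 Ser_mult)
    finally show ?thesis unfolding d by simp
  qed
qed

end

section \<open>The functionals as constant terms\<close>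

context simply_laced
begin

section \<open>The limits z_\<beta>\<close>

definition Zk :: "nat \<Rightarrow> 'r \<Rightarrow> 'r qtser" where
  "Zk k \<beta> = Xi k (ax \<beta>) (- ax \<beta>)"

lemma led_Zk: "led (Zk k \<beta>) (- ax \<beta>)"
proof -
  have "int k *s ax \<beta> + int (Suc k) *s (- ax \<beta>) = - ax \<beta>" by (simp add: vec_eq_iff algebra_simps)
  then show ?thesis using led_Xi[of k "ax \<beta>" "- ax \<beta>"] by (simp only: Zk_def)
qed

text \<open>Consecutive quotients differ by a power of t times a monomial of seed k + 1, of top
  degree -\<open>kap\<close>_\<beta> - (k+1) \<delta>. Hence every coefficient is eventually
  constant.\<close>

lemma Zk_Suc: "Zk (Suc k) \<beta> = Zk k \<beta> + tpow (- dl) \<star> Xi (Suc k) (ax \<beta> - vc \<beta>) (- ax \<beta>)"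
proof -
  have l: "Lm (ax \<beta>) $ \<beta> = lam C $ \<beta> $ \<beta>" by (simp add: Lm_axis)
  have "Xi (Suc k) (ax \<beta>) 0 * (Xi (Suc k) 0 (- ax \<beta>) - tpow (- dl) \<star> Xi (Suc k) (- vc \<beta>) (- ax \<beta>))
      = Xi (Suc k) (ax \<beta>) 0 * (tpow (lam C $ \<beta> $ \<beta>) \<star> Xi k (ax \<beta>) (- (2 *s ax \<beta>)))"
    unfolding Xi_Suc_W ..
  moreover have "Xi (Suc k) (ax \<beta>) 0 * (tpow (lam C $ \<beta> $ \<beta>) \<star> Xi k (ax \<beta>) (- (2 *s ax \<beta>))) = Zk k \<beta>"
  proof -
    have v: "ax \<beta> - 2 *s ax \<beta> = - ax \<beta>" by (simp add: vec_eq_iff)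
    show ?thesis by (simp add: Xi_Suc_0 Xi_mult l v Zk_def flip: tpow_add)
  qed
  ultimately show ?thesis by (simp add: right_diff_distrib Xi_mult Zk_def algebra_simps)
qed

lemma Zk_stable: "nat (- tot b) \<le> k \<Longrightarrow> cf (Zk k \<beta>) b = cf (Zk (nat (- tot b)) \<beta>) b"
proof (induction k rule: dec_induct)
  case (step k)
  have "cf (Xi (Suc k) (ax \<beta> - vc \<beta>) (- ax \<beta>)) b = 0"
  proof (rule ccontr)
    assume "cf (Xi (Suc k) (ax \<beta> - vc \<beta>) (- ax \<beta>)) b \<noteq> 0"
    moreover have "fl (- kd (int (Suc k) *s (ax \<beta> - vc \<beta>) + int (Suc (Suc k)) *s (- ax \<beta>))) (Xi (Suc k) (ax \<beta> - vc \<beta>) (- ax \<beta>))"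
      by (rule led_fl[OF led_Xi])
    ultimately have "tot b \<le> kd (int (Suc k) *s (ax \<beta> - vc \<beta>) + int (Suc (Suc k)) *s (- ax \<beta>))"
      unfolding fl_def by fastforce
    also have "\<dots> = - kd (ax \<beta>) - int (Suc k) * dl"
      by (simp add: kd_add kd_scale kd_diff kd_minus kd_vc algebra_simps)
    also have "\<dots> \<le> - int (Suc k)"
    proof -
      have "y \<le> z \<Longrightarrow> 0 \<le> x \<Longrightarrow> - x - z \<le> - y" for x y z :: int by simp
      moreover have "int (Suc k) \<le> int (Suc k) * dl"
        using det_pos mult_left_mono[of 1 dl "int (Suc k)"] by simp
      moreover have "kd (ax \<beta>) \<ge> 0" using kap_pos[of \<beta>] by (simp add: kd_def)
      ultimately show ?thesis by blast
    qed
    finally show False using step by linarith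
  qed
  then show ?case using step by (simp add: Zk_Suc)
qed simp

definition zl :: "'r \<Rightarrow> 'r qtser" where
  "zl \<beta> = mkser (\<lambda>b. cf (Zk (nat (- tot b)) \<beta>) b)"

lemma cf_zl: "nat (- tot b) \<le> k \<Longrightarrow> cf (zl \<beta>) b = cf (Zk k \<beta>) b"
proof -
  assume k: "nat (- tot b) \<le> k"
  have "cf (zl \<beta>) = (\<lambda>b. cf (Zk (nat (- tot b)) \<beta>) b)"
    unfolding zl_def by (rule cf_mkser[of _ "Lm (- ax \<beta>)"]) (use led_incone[OF led_Zk] incone_le in blast)
  then show ?thesis using Zk_stable[OF k] by simp
qed

lemma led_zl: "led (zl \<beta>) (- ax \<beta>)"
proof -
  have "\<exists>k a. cf (zl \<beta>) (Lm (- ax \<beta>)) = Poly_Mapping.single a (tpow k)"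
    using led_Zk[of "nat (- tot (Lm (- ax \<beta>)))" \<beta>] by (simp add: led_def cf_zl[OF order_refl])
  moreover have "incone (- ax \<beta>) b" if "cf (zl \<beta>) b \<noteq> 0" for b
    using that led_incone[OF led_Zk] cf_zl[OF order_refl] by metis
  ultimately show ?thesis by (simp add: led_def)
qed

lemma fl_zl_diff: "fl (int k) (zl \<beta> - Zk k \<beta>)"
  unfolding fl_def
proof (intro allI impI)
  fix b assume "cf (zl \<beta> - Zk k \<beta>) b \<noteq> 0"
  then have "\<not> nat (- tot b) \<le> k" using cf_zl[of b k] by auto
  then show "tot b \<le> - int k" by linarith
qed

lemma Ph_Zk: "qQ C \<beta> k \<otimes>\<^bsub>qring C\<^esub> inv\<^bsub>qring C\<^esub> (qQ C \<beta> (k + 1)) = Ph (Zk k \<beta>)"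
proof -
  have ld: "led (QS \<beta> k) (int k *s ax \<beta>)" for k using led_Xi[of k "ax \<beta>" 0] by (simp add: QS_def)
  have "qQ C \<beta> k \<otimes>\<^bsub>qring C\<^esub> inv\<^bsub>qring C\<^esub> (qQ C \<beta> (k + 1)) = Ph (QS \<beta> k) \<otimes>\<^bsub>qring C\<^esub> Ph (uinv (QS \<beta> (Suc k)))"
    using Ph_inv_led[OF ld, of "Suc k"] by (simp add: Ph_QS)
  also have "\<dots> = Ph (QS \<beta> k * uinv (QS \<beta> (Suc k)))"
    by (rule Ph_mult) (use Ser_QS Ser_led[OF led_uinv[OF ld]] in blast)+
  also have "QS \<beta> k * uinv (QS \<beta> (Suc k)) = Zk k \<beta>"
    unfolding QS_Suc uinv_Xi by (simp add: QS_def Xi_mult Zk_def)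
  finally show ?thesis .
qed

theorem zlim_zl: "zlim C \<beta> = Ph (zl \<beta>)"
  unfolding zlim_def Ph_Zk
proof (rule the_equality)
  have ev: "\<forall>\<^sub>F k in sequentially. \<forall>a. Ph (Zk k \<beta>) a b = Ph (zl \<beta>) a b" for b
    unfolding eventually_sequentially
    by (intro exI[of _ "nat (- tot (Lm b))"]) (simp add: Ph_def cf_zl)
  then show "Ph (zl \<beta>) \<in> carrier (qring C) \<and> (\<forall>b. \<forall>\<^sub>F k in sequentially. \<forall>a. Ph (Zk k \<beta>) a b = Ph (zl \<beta>) a b)"
    using Ser_led[OF led_zl] by simp
  fix z assume z: "z \<in> carrier (qring C) \<and> (\<forall>b. \<forall>\<^sub>F k in sequentially. \<forall>a. Ph (Zk k \<beta>) a b = z a b)"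
  show "z = Ph (zl \<beta>)"
  proof (intro ext)
    fix a b
    have "\<forall>\<^sub>F k in sequentially. \<forall>a. Ph (Zk k \<beta>) a b = z a b" using z by blast
    then have "\<forall>\<^sub>F k in sequentially. z a b = Ph (zl \<beta>) a b"
      using ev[of b] by eventually_elim metis
    then show "z a b = Ph (zl \<beta>) a b" by simp
  qed
qed

section \<open>Normal ordering of the prefactor and of the powers of z\<close>

definition pz :: "(nat, 'r) vec \<Rightarrow> 'r qtser" where
  "pz l = prod_list (map (\<lambda>\<beta>. zl \<beta> ^ (l $ \<beta> + 1)) idx)"

text \<open>
  The exponents are carried doubled, since their integrality is only visible for the products.
\<close>

definition halfp :: "((int, 'r) vec \<Rightarrow> 'r qtser) \<Rightarrow> 'r qtser \<Rightarrow> (int, 'r) vec \<Rightarrow> int \<Rightarrow> bool" where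
  "halfp D x a S \<longleftrightarrow> (\<exists>e. x = tpow e \<star> D a \<and> 2 * e = idot (Lm a) a - S)"

lemma halfp_mult:
  assumes "\<And>a b. D a * D b = tpow (idot (Lm a) b) \<star> D (a + b)" "halfp D x a S" "halfp D y b T"
  shows "halfp D (x * y) (a + b) (S + T)"
proof -
  obtain e f where e: "x = tpow e \<star> D a" "2 * e = idot (Lm a) a - S" and f: "y = tpow f \<star> D b" "2 * f = idot (Lm b) b - T"
    using assms unfolding halfp_def by blast
  have "x * y = tpow (e + f + idot (Lm a) b) \<star> D (a + b)"
    by (simp add: e f assms(1) tpow_add mult_ac)
  moreover have "2 * (e + f + idot (Lm a) b) = idot (Lm (a + b)) (a + b) - (S + T)"
    using e f Lm_sym[of a b] by (simp add: Lm_add idot_add_left idot_add_right)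
  ultimately show ?thesis unfolding halfp_def by blast
qed

lemma halfp_power:
  assumes "\<And>a b. D a * D b = tpow (idot (Lm a) b) \<star> D (a + b)" "D 0 = 1" "halfp D x a S"
  shows "halfp D (x ^ n) (int n *s a) (int n * S)"
proof (induction n)
  case 0
  then show ?case using assms(2) by (auto simp: halfp_def)
next
  case (Suc n)
  have "int (Suc n) *s a = a + int n *s a" "int (Suc n) * S = S + int n * S" by (simp_all add: vec_eq_iff algebra_simps)
  then show ?case using halfp_mult[OF assms(1,3) Suc] by (simp only: power_Suc)
qed

lemma halfp_prod_list:
  assumes "\<And>a b. D a * D b = tpow (idot (Lm a) b) \<star> D (a + b)" "D 0 = 1" "\<And>i. halfp D (x i) (a i) (S i)"
  shows "halfp D (prod_list (map x js)) (sum_list (map a js)) (sum_list (map S js))"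
proof (induction js)
  case Nil
  then show ?case using assms(2) by (auto simp: halfp_def)
next
  case (Cons i js)
  then show ?case using halfp_mult[OF assms(1,3) Cons] by simp
qed

lemma fl0_led: "led x (- ax \<beta>) \<Longrightarrow> fl 0 x"
  using led_fl[of x "- ax \<beta>"] kap_pos[of \<beta>] fl_mono[of "kap $ \<beta>" x 0] by (simp add: kd_def)

lemma fl_diff_mult:
  assumes "fl 0 x" "fl 0 y'" "fl N (x - x')" "fl N (y - y')" 
  shows "fl N (x * y - x' * y')"
proof -
  have "x * y - x' * y' = x * (y - y') + (x - x') * y'" by (simp add: algebra_simps)
  then show ?thesis using fl_add fl_mult[OF assms(1,4)] fl_mult[OF assms(3,2)] by simp
qed

lemma fl_1: "fl 0 1"
  by (simp add: fl_def cf_1)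

lemma fl_power: "fl 0 x \<Longrightarrow> fl 0 (x ^ n)"
  by (induction n) (use fl_1 fl_mult[of 0 _ 0] in auto)

lemma fl_prod_list: "(\<And>i. fl 0 (f i)) \<Longrightarrow> fl 0 (prod_list (map f js))"
  by (induction js) (use fl_1 fl_mult[of 0 _ 0] in auto)

lemma fl_0: "fl N 0"
  by (simp add: fl_def)

lemma fl_diff_power: "fl 0 x \<Longrightarrow> fl 0 x' \<Longrightarrow> fl N (x - x') \<Longrightarrow> fl N (x ^ n - x' ^ n)"
  by (induction n) (simp_all add: fl_0 fl_diff_mult fl_power)

lemma fl_diff_prod_list:
  "(\<And>i. fl 0 (f i)) \<Longrightarrow> (\<And>i. fl 0 (g i)) \<Longrightarrow> (\<And>i. fl N (f i - g i)) \<Longrightarrow> fl N (prod_list (map f js) - prod_list (map g js))"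
  by (induction js) (simp_all add: fl_0 fl_diff_mult fl_prod_list)

lemma fl_pz_diff: "fl (int k) (pz l - prod_list (map (\<lambda>\<beta>. Zk k \<beta> ^ (l $ \<beta> + 1)) idx))"
  unfolding pz_def
  by (intro fl_diff_prod_list fl_diff_power fl_power fl0_led[OF led_zl] fl0_led[OF led_Zk] fl_zl_diff)

definition trl :: "(int, 'r) vec \<Rightarrow> int" where
  "trl a = (\<Sum>\<alpha>\<in>UNIV. a $ \<alpha> * lam C $ \<alpha> $ \<alpha>)"

lemma idot_Lm_ax: "idot (Lm (ax \<alpha>)) (ax \<alpha>) = lam C $ \<alpha> $ \<alpha>"
  by (simp add: Lm_axis)

lemma prod_Zk: "halfp (\<lambda>a. Xi k a (- a)) (prod_list (map (\<lambda>\<beta>. Zk k \<beta> ^ (l $ \<beta> + 1)) idx)) (vi l + 1) (trl (vi l + 1))"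
proof -
  let ?D = "\<lambda>a. Xi k a (- a)"
  have D: "?D a * ?D b = tpow (idot (Lm a) b) \<star> ?D (a + b)" for a b
    by (simp add: Xi_mult Lm_minus)
  have "halfp ?D (Zk k \<beta>) (ax \<beta>) (lam C $ \<beta> $ \<beta>)" for \<beta>
    unfolding halfp_def Zk_def by (intro exI[of _ 0]) (simp only: tpow_0 scl_1 idot_Lm_ax, simp)
  then have "halfp ?D (Zk k \<beta> ^ (l $ \<beta> + 1)) (int (l $ \<beta> + 1) *s ax \<beta>) (int (l $ \<beta> + 1) * lam C $ \<beta> $ \<beta>)" for \<beta>
    by (intro halfp_power[OF D]) simp_all
  then have "halfp ?D (prod_list (map (\<lambda>\<beta>. Zk k \<beta> ^ (l $ \<beta> + 1)) idx)) (sum_list (map (\<lambda>\<beta>. int (l $ \<beta> + 1) *s ax \<beta>) idx))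
      (sum_list (map (\<lambda>\<beta>. int (l $ \<beta> + 1) * lam C $ \<beta> $ \<beta>) idx))"
    by (intro halfp_prod_list[OF D]) simp_all
  moreover have "sum_list (map (\<lambda>\<beta>. int (l $ \<beta> + 1) *s ax \<beta>) idx) = vi l + 1"
    using vec_expand[of "vi l + 1"] by (simp add: sum_list_idx add.commute)
  moreover have "sum_list (map (\<lambda>\<beta>. int (l $ \<beta> + 1) * lam C $ \<beta> $ \<beta>) idx) = trl (vi l + 1)"
    by (simp add: sum_list_idx trl_def add.commute)
  ultimately show ?thesis by simp
qed

lemma prefactor: "halfp (\<lambda>a. X (- a) a) (prod_list (map (\<lambda>\<alpha>. QS \<alpha> 1 * uinv (QS \<alpha> 0)) idx)) 1 (- trl 1)"
proof -
  let ?D = "\<lambda>a. X (- a) a"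
  have D: "?D a * ?D b = tpow (idot (Lm a) b) \<star> ?D (a + b)" for a b
    by (simp add: X_mult)
  have "halfp ?D (QS \<alpha> 1 * uinv (QS \<alpha> 0)) (ax \<alpha>) (- lam C $ \<alpha> $ \<alpha>)" for \<alpha>
  proof -
    have "QS \<alpha> 1 = X 0 (ax \<alpha>)" using QS_Suc[of \<alpha> 0] by simp
    moreover have "uinv (QS \<alpha> 0) = X (- ax \<alpha>) 0" unfolding QS_def uinv_Xi by simp
    ultimately have "QS \<alpha> 1 * uinv (QS \<alpha> 0) = tpow (idot (Lm (ax \<alpha>)) (ax \<alpha>)) \<star> ?D (ax \<alpha>)"
      by (simp only: X_mult) simp
    then show ?thesis unfolding halfp_def idot_Lm_ax by (intro exI[of _ "lam C $ \<alpha> $ \<alpha>"]) simp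
  qed
  then have "halfp ?D (prod_list (map (\<lambda>\<alpha>. QS \<alpha> 1 * uinv (QS \<alpha> 0)) idx)) (sum_list (map ax idx))
      (sum_list (map (\<lambda>\<alpha>. - lam C $ \<alpha> $ \<alpha>) idx))"
    by (intro halfp_prod_list[OF D]) simp_all
  moreover have "sum_list (map ax idx) = 1"
    using vec_expand[of 1] by (simp add: sum_list_idx)
  moreover have "sum_list (map (\<lambda>\<alpha>. - lam C $ \<alpha> $ \<alpha>) idx) = - trl 1"
    by (simp add: sum_list_idx trl_def sum_negf)
  ultimately show ?thesis by simp
qed

lemma CT1_Ph: "CT1 (Ph x) = ev 0 (cf x 0)"
proof -
  have "CT1 (Ph x) = (\<Sum>a\<in>keys (cf x 0). lookup (cf x 0) a)"
    unfolding CT1_def Ph_def Lm_0 by (rule Sum_any.expand_superset) (auto simp: in_keys_iff)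
  then show ?thesis by (simp add: ev_def)
qed

text \<open>The prefactor is t^c Q_0^-1 Q_1 after reordering. Its Q_1 selects the coefficient of
  Q_1^-1 in the rest and, by \<open>ev_tw\<close>, moves evaluation from Q_0 = 1 to
  \<open>kap\<close>. One c serves all \<ell> and all p, which gives linearity of
  \<open>mu\<close>.\<close>

theorem mu_Lam0: "\<exists>c. 2 * c = idot (Lm 1) 1 + trl 1 \<and> (\<forall>l p. Ser p \<longrightarrow> mu C l (Ph p) = tpow c * Lam0 (p * pz l))"
proof -
  obtain c where c: "prod_list (map (\<lambda>\<alpha>. QS \<alpha> 1 * uinv (QS \<alpha> 0)) idx) = tpow c \<star> X (- 1) 1"
    "2 * c = idot (Lm 1) 1 - - trl 1"
    using prefactor unfolding halfp_def by blast
  have ld: "led (QS \<beta> k) (int k *s ax \<beta>)" for \<beta> k using led_Xi[of k "ax \<beta>" 0] by (simp add: QS_def)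
  have "mu C l (Ph p) = tpow c * Lam0 (p * pz l)" if p: "Ser p" for l p
  proof -
    have S: "Ser (QS \<alpha> 1 * uinv (QS \<alpha> 0))" for \<alpha>
      using Ser_mult Ser_QS Ser_led[OF led_uinv[OF ld]] by blast
    have "ordprod (qring C) (\<lambda>\<alpha>. qQ C \<alpha> 1 \<otimes>\<^bsub>qring C\<^esub> inv\<^bsub>qring C\<^esub> (qQ C \<alpha> 0)) idx
        = Ph (prod_list (map (\<lambda>\<alpha>. QS \<alpha> 1 * uinv (QS \<alpha> 0)) idx))"
      by (rule Ph_ordprod) (simp only: Ph_QS Ph_inv_led[OF ld] S Ph_mult Ser_QS Ser_led[OF led_uinv[OF ld]])
    moreover have "ordprod (qring C) (\<lambda>\<beta>. zlim C \<beta> [^]\<^bsub>qring C\<^esub> (l $ \<beta> + 1)) idx = Ph (pz l)"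
      unfolding pz_def by (rule Ph_ordprod) (simp only: zlim_zl Ph_power[OF Ser_led[OF led_zl]] Ser_power[OF Ser_led[OF led_zl]])
    moreover have "Ser (pz l)"
      unfolding pz_def by (intro Ser_prod_list Ser_power Ser_led[OF led_zl])
    ultimately have "mu C l (Ph p) = CT1 (Ph (tpow c \<star> X (- 1) 1 * p * pz l))"
      unfolding mu_def by (simp only: c Ph_mult Ser_mult Ser_scl Ser_X p)
    also have "\<dots> = tpow c * Lam0 (p * pz l)"
      by (simp add: CT1_Ph X_def cf_qmon_mult mult.assoc Lam0_def kap_def ev_tw)
    finally show ?thesis .
  qed
  then show ?thesis using c(2) by (intro exI[of _ c]) auto
qed

text \<open>Replacing z by the quotients at k changes terms of degree at most -k only; for late k
  these do not reach the coefficient of Q_1^-1. The starting index may depend on p, but c does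
  not.\<close>

theorem mu_seed: "\<exists>c. 2 * c = idot (Lm 1) 1 + trl 1 + idot (Lm (vi l + 1)) (vi l + 1) - trl (vi l + 1)
    \<and> (\<forall>p. Ser p \<longrightarrow> (\<exists>K0. \<forall>k\<ge>K0. mu C l (Ph p) = tpow c * Lam0 (p * Xi k (vi l + 1) (- (vi l + 1)))))"
proof -
  obtain c where c: "2 * c = idot (Lm 1) 1 + trl 1" "\<And>l p. Ser p \<Longrightarrow> mu C l (Ph p) = tpow c * Lam0 (p * pz l)"
    using mu_Lam0 by blast
  define L where "L = vi l + 1"
  obtain e where e: "2 * e = idot (Lm L) L - trl L" using prod_Zk[of 0 l] unfolding halfp_def L_def by blast
  have Z: "prod_list (map (\<lambda>\<beta>. Zk k \<beta> ^ (l $ \<beta> + 1)) idx) = tpow e \<star> Xi k L (- L)" for k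
  proof -
    obtain e' where "prod_list (map (\<lambda>\<beta>. Zk k \<beta> ^ (l $ \<beta> + 1)) idx) = tpow e' \<star> Xi k L (- L)" "2 * e' = idot (Lm L) L - trl L"
      using prod_Zk[of k l] unfolding halfp_def L_def by blast
    moreover from this have "e' = e" using e by simp
    ultimately show ?thesis by (simp only:)
  qed
  have "\<exists>K0. \<forall>k\<ge>K0. mu C l (Ph p) = tpow (c + e) * Lam0 (p * Xi k L (- L))" if p: "Ser p" for p
  proof -
    obtain M where M: "fl M p" using fl_ex by blast
    have "mu C l (Ph p) = tpow (c + e) * Lam0 (p * Xi k L (- L))" if k: "k \<ge> nat (tot kap - M + 1)" for k
    proof -
      have "fl (M + int k) (p * (pz l - tpow e \<star> Xi k L (- L)))"
        using fl_mult[OF M fl_pz_diff[of k l]] unfolding Z .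
      then have "Lam0 (p * (pz l - tpow e \<star> Xi k L (- L))) = 0"
        by (rule Lam0_deep) (use k in linarith)
      then have "Lam0 (p * pz l) = tpow e * Lam0 (p * Xi k L (- L))"
        by (simp add: right_diff_distrib Lam0_diff Lam0_scl)
      then show ?thesis by (simp add: c(2)[OF p] tpow_add mult.assoc)
    qed
    then show ?thesis by blast
  qed
  then show ?thesis using c(1) e unfolding L_def by (intro exI[of _ "c + e"]) auto
qed

section \<open>The products in the defining equations\<close>

lemma sum_delta_n:
  assumes "m $ \<beta> \<le> K"
  shows "(\<Sum>i=1..K. int (delta_n m \<beta> i) * f i) = (if m $ \<beta> = 0 then 0 else f (m $ \<beta>))"
proof -
  have "(\<Sum>i=1..K. int (delta_n m \<beta> i) * f i) = (\<Sum>i=1..K. if i = m $ \<beta> then f i else 0)"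
    by (rule sum.cong) (auto simp: delta_n_def)
  then show ?thesis using assms by auto
qed

lemma PP_delta:
  assumes "\<And>\<alpha>. m $ \<alpha> \<le> K"
  shows "PP (delta_n m) (\<lambda>_ _. 0) K 0 i $ \<alpha> = int (min i (m $ \<alpha>))"
proof -
  have "PP (delta_n m) (\<lambda>_ _. 0) K 0 i $ \<alpha> = (\<Sum>j=1..K. int (delta_n m \<alpha> j) * int (min i j))"
    unfolding PP_pvec by (simp add: pvec_def An_def mult.commute)
  then show ?thesis using sum_delta_n[OF assms, of \<alpha> "\<lambda>j. int (min i j)"] by auto
qed

lemma Lm_nth: "Lm a $ \<alpha> = (\<Sum>\<beta>\<in>UNIV. lam C $ \<alpha> $ \<beta> * a $ \<beta>)"
  by (simp add: Lm_def matvec_int_nth)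

lemma exponent_linear:
  assumes "\<And>\<alpha>. m $ \<alpha> \<le> K"
  shows "(\<Sum>i=1..K. idot kap (nv (delta_n m) i))
    = (\<Sum>\<alpha>\<in>UNIV. \<Sum>\<beta>\<in>UNIV. \<Sum>i=1..m $ \<alpha>. int (delta_n m \<alpha> i) * lam C $ \<alpha> $ \<beta>)"
proof -
  have "(\<Sum>i=1..K. idot kap (nv (delta_n m) i)) = (\<Sum>\<alpha>\<in>UNIV. \<Sum>i=1..K. int (delta_n m \<alpha> i) * kap $ \<alpha>)"
    unfolding idot_def by (subst sum.swap) (simp add: mult.commute)
  also have "\<dots> = (\<Sum>\<alpha>\<in>UNIV. \<Sum>i=1..m $ \<alpha>. int (delta_n m \<alpha> i) * kap $ \<alpha>)"
    by (rule sum.cong[OF refl]) (simp only: sum_delta_n[OF assms] sum_delta_n[OF order_refl])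
  also have "\<dots> = (\<Sum>\<alpha>\<in>UNIV. \<Sum>i=1..m $ \<alpha>. \<Sum>\<beta>\<in>UNIV. int (delta_n m \<alpha> i) * lam C $ \<alpha> $ \<beta>)"
    by (simp add: kap_def Lm_nth sum_distrib_left)
  also have "\<dots> = (\<Sum>\<alpha>\<in>UNIV. \<Sum>\<beta>\<in>UNIV. \<Sum>i=1..m $ \<alpha>. int (delta_n m \<alpha> i) * lam C $ \<alpha> $ \<beta>)"
    by (rule sum.cong[OF refl]) (rule sum.swap)
  finally show ?thesis .
qed

lemma exponent_quadratic:
  assumes "\<And>\<alpha>. m $ \<alpha> \<le> K"
  shows "(\<Sum>i=1..K. idot (Lm (nv (delta_n m) i)) (PP (delta_n m) (\<lambda>_ _. 0) K 0 i))
    = (\<Sum>\<alpha>\<in>UNIV. \<Sum>\<beta>\<in>UNIV. int (min (m $ \<alpha>) (m $ \<beta>)) * lam C $ \<alpha> $ \<beta>)"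
proof -
  have "(\<Sum>i=1..K. idot (Lm (nv (delta_n m) i)) (PP (delta_n m) (\<lambda>_ _. 0) K 0 i))
      = (\<Sum>i=1..K. \<Sum>\<alpha>\<in>UNIV. \<Sum>\<beta>\<in>UNIV. int (delta_n m \<beta> i) * (int (min i (m $ \<alpha>)) * lam C $ \<alpha> $ \<beta>))"
    unfolding idot_def PP_delta[OF assms] Lm_nth sum_distrib_right nv_nth
    by (intro sum.cong refl) (simp only: mult_ac)
  also have "\<dots> = (\<Sum>\<alpha>\<in>UNIV. \<Sum>i=1..K. \<Sum>\<beta>\<in>UNIV. int (delta_n m \<beta> i) * (int (min i (m $ \<alpha>)) * lam C $ \<alpha> $ \<beta>))"
    by (rule sum.swap)
  also have "\<dots> = (\<Sum>\<alpha>\<in>UNIV. \<Sum>\<beta>\<in>UNIV. \<Sum>i=1..K. int (delta_n m \<beta> i) * (int (min i (m $ \<alpha>)) * lam C $ \<alpha> $ \<beta>))"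
    by (rule sum.cong[OF refl]) (rule sum.swap)
  also have "\<dots> = (\<Sum>\<alpha>\<in>UNIV. \<Sum>\<beta>\<in>UNIV. int (min (m $ \<alpha>) (m $ \<beta>)) * lam C $ \<alpha> $ \<beta>)"
    unfolding sum_delta_n[OF assms] by (intro sum.cong refl) (auto simp: min.commute)
  finally show ?thesis .
qed

lemma Ypre_stable:
  assumes "\<And>\<alpha> i. i > M \<Longrightarrow> n \<alpha> i = 0" and "M \<le> K"
  shows "Ypre n K = Ypre n M"
  using assms(2)
proof (induction K rule: dec_induct)
  case (step k)
  have "nv n (Suc k) = 0" using assms(1) step by (simp add: vec_eq_iff)
  then show ?case using step by simp
qed simp

lemma Ser_Ypre: "Ser (Ypre n j)"
proof (induction j)
  case (Suc j)
  then show ?case using Ser_mult Ser_led[OF led_Xi] by simp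
qed (simp add: Ser_1)

definition Qm :: "(nat, 'r) vec \<Rightarrow> 'r qtser" where
  "Qm m = Ypre (delta_n m) (MAX \<alpha>. m $ \<alpha>)"

lemma le_MAX: "m $ \<alpha> \<le> (MAX \<alpha>. m $ \<alpha>)" for m :: "(nat, 'r) vec"
  by (rule Max_ge) auto

lemma mu_MultK: "\<exists>K0. \<forall>K\<ge>K0. mu C l (Ph (Qm m)) = tpow (rep_exponent C m l) * MultK C K l (delta_n m)"
proof -
  define M where "M = (MAX \<alpha>. m $ \<alpha>)"
  obtain c where c: "2 * c = idot (Lm 1) 1 + trl 1 + idot (Lm (vi l + 1)) (vi l + 1) - trl (vi l + 1)"
    and "\<exists>K0. \<forall>k\<ge>K0. mu C l (Ph (Qm m)) = tpow c * Lam0 (Qm m * Xi k (vi l + 1) (- (vi l + 1)))"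
    using mu_seed[of l] Ser_Ypre unfolding Qm_def by blast
  then obtain K0 where K0: "\<And>k. k \<ge> K0 \<Longrightarrow> mu C l (Ph (Qm m)) = tpow c * Lam0 (Qm m * Xi k (vi l + 1) (- (vi l + 1)))"
    by blast
  have "mu C l (Ph (Qm m)) = tpow (rep_exponent C m l) * MultK C K l (delta_n m)" if K: "K \<ge> max K0 M" for K
  proof -
    have mK: "m $ \<alpha> \<le> K" for \<alpha> using le_MAX[of m \<alpha>] K by (simp add: M_def)
    have "Qm m = Ypre (delta_n m) K"
      unfolding Qm_def M_def[symmetric]
      by (rule Ypre_stable[symmetric]) (use K le_MAX[of m] in \<open>auto simp: delta_n_def M_def not_less\<close>)
    then have mu: "mu C l (Ph (Qm m)) = tpow c * GL (delta_n m) K (vi l) (vi l)"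
      using K0[of K] K by (simp add: GL_def)
    define A where "A = (\<Sum>\<alpha>\<in>UNIV. \<Sum>\<beta>\<in>UNIV. \<Sum>i=1..m $ \<alpha>. int (delta_n m \<alpha> i) * lam C $ \<alpha> $ \<beta>)"
    define B where "B = (\<Sum>\<alpha>\<in>UNIV. \<Sum>\<beta>\<in>UNIV. int (min (m $ \<alpha>) (m $ \<beta>)) * lam C $ \<alpha> $ \<beta>)"
    have rep: "rep_exponent C m l = - A - (trl (vi l) + B) div 2"
      by (simp add: rep_exponent_def A_def B_def trl_def)
    have c': "2 * c = 2 * idot kap (vi l + 1) + idot (Lm (vi l)) (vi l) - trl (vi l)"
    proof -
      have "trl (vi l + 1) = trl (vi l) + trl 1" by (simp add: trl_def sum.distrib distrib_right)
      moreover have "idot (Lm (vi l + 1)) (vi l + 1) = idot (Lm (vi l)) (vi l) + 2 * idot (Lm 1) (vi l) + idot (Lm 1) 1"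
        using Lm_sym[of "vi l" 1] by (simp add: Lm_add idot_add_left idot_add_right)
      ultimately show ?thesis using c by (simp add: kap_def idot_add_right)
    qed
    have "GL (delta_n m) K (vi l) (vi l) = tpow (rep_exponent C m l - c) * MultK C K l (delta_n m)"
    proof (rule GL_MultK)
      assume "admissible C K l (delta_n m) \<noteq> {}"
      then obtain k where "k \<in> Adm (delta_n m) K (vi l) (vi l)" unfolding admissible_Adm by blast
      from cc_identity[OF this]
      have cc: "2 * EE (delta_n m) k K (PP (delta_n m) k K 0) + 2 * dl * Qform C K (delta_n m) k
          = - 2 * idot kap (vi l + 1) - 2 * A - idot (Lm (vi l)) (vi l) - B"
        unfolding exponent_linear[OF mK] exponent_quadratic[OF mK] A_def B_def .
      define e where "e = EE (delta_n m) k K (PP (delta_n m) k K 0) + dl * Qform C K (delta_n m) k"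
      have "2 * e = - 2 * idot kap (vi l + 1) - 2 * A - idot (Lm (vi l)) (vi l) - B"
        unfolding e_def using cc by simp
      \<comment> \<open>The integer e from an admissible k supplies the parity that makes the
        division by 2 in \<open>rep_exponent\<close> exact.\<close>
      then have "2 * (rep_exponent C m l - c) = - 2 * idot kap (vi l + 1) - 2 * A - idot (Lm (vi l)) (vi l) - B"
        using c' rep by presburger
      then show "2 * (rep_exponent C m l - c) = - 2 * idot kap (vi l + 1) - 2 * (\<Sum>i=1..K. idot kap (nv (delta_n m) i))
          - idot (Lm (vi l)) (vi l) - (\<Sum>i=1..K. idot (Lm (nv (delta_n m) i)) (PP (delta_n m) (\<lambda>_ _. 0) K 0 i))"
        unfolding exponent_linear[OF mK] exponent_quadratic[OF mK] A_def B_def .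
    qed
    then show ?thesis unfolding mu by (simp flip: mult.assoc tpow_add)
  qed
  then show ?thesis by blast
qed

text \<open>The multiplicities stabilise in K because, by \<open>mu_MultK\<close>, they equal up to
  a fixed power of t a value of \<open>mu\<close>, in which K does not occur.\<close>

lemma Mult_eq: "\<exists>K0. \<forall>K\<ge>K0. Mult C l (delta_n m) = MultK C K l (delta_n m)"
proof -
  obtain K0 where K0: "\<And>K. K \<ge> K0 \<Longrightarrow> mu C l (Ph (Qm m)) = tpow (rep_exponent C m l) * MultK C K l (delta_n m)"
    using mu_MultK by blast
  have c: "MultK C K l (delta_n m) = MultK C K0 l (delta_n m)" if "K \<ge> K0" for K
    using K0[OF that] K0[of K0] by simp
  have "Mult C l (delta_n m) = MultK C K0 l (delta_n m)"
    unfolding Mult_def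
  proof (rule the_equality)
    show "\<forall>\<^sub>F K in sequentially. MultK C K l (delta_n m) = MultK C K0 l (delta_n m)"
      using c unfolding eventually_sequentially by blast
    fix d assume "\<forall>\<^sub>F K in sequentially. MultK C K l (delta_n m) = d"
    then obtain N where "\<And>K. K \<ge> N \<Longrightarrow> MultK C K l (delta_n m) = d" unfolding eventually_sequentially by blast
    then show "d = MultK C K0 l (delta_n m)" using c[of "max K0 N"] by simp
  qed
  then show ?thesis using c by metis
qed

theorem mu_Q: "mu C l (Ph (Qm m)) = tpow (rep_exponent C m l) * Mult C l (delta_n m)"
proof -
  obtain K0 K1 where "\<And>K. K \<ge> K0 \<Longrightarrow> mu C l (Ph (Qm m)) = tpow (rep_exponent C m l) * MultK C K l (delta_n m)"
    "\<And>K. K \<ge> K1 \<Longrightarrow> Mult C l (delta_n m) = MultK C K l (delta_n m)"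
    using mu_MultK Mult_eq by meson
  from this(1)[of "max K0 K1"] this(2)[of "max K0 K1"] show ?thesis by simp
qed

section \<open>Unitriangularity of the multiplicities\<close>

lemma sum_delta_vec:
  assumes "\<And>\<alpha>. m $ \<alpha> \<le> K"
  shows "(\<Sum>i=1..K. int i *s nv (delta_n m) i) = vi m"
proof -
  have "(\<Sum>i=1..K. int i *s nv (delta_n m) i) $ \<alpha> = int (m $ \<alpha>)" for \<alpha>
  proof -
    have "(\<Sum>i=1..K. int i *s nv (delta_n m) i) $ \<alpha> = (\<Sum>i=1..K. int (delta_n m \<alpha> i) * int i)"
      unfolding sum_component vector_smult_component nv_nth by (rule sum.cong[OF refl]) (rule mult.commute)
    then show ?thesis unfolding sum_delta_n[OF assms] by simp
  qed
  then show ?thesis unfolding vec_eq_iff vi_nth by blast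
qed

lemma matvec_int_sum: "C *v (\<Sum>i\<in>I. f i) = (\<Sum>i\<in>I. C *v (f i :: (int, 'r) vec))"
  by (induction I rule: infinite_finite_induct) (simp_all add: matvec_int_add)

lemma PP_slope_0: "PP n k K 0 K = (\<Sum>i=1..K. int i *s nv n i) - C *v (\<Sum>i=1..K. int i *s nv k i)"
proof -
  have "PP n k K 0 K = (\<Sum>i=1..K. int (min K i) *s cv n k i)"
  proof -
    have "int K *s (0 :: (int, 'r) vec) = 0" by (simp add: vec_eq_iff)
    then show ?thesis by (simp only: PP_def add_0_right)
  qed
  also have "\<dots> = (\<Sum>i=1..K. int i *s nv n i - C *v (int i *s nv k i))"
  proof (rule sum.cong[OF refl])
    fix i assume "i \<in> {1..K}"
    then have "min K i = i" by simp
    moreover have "int i *s (x - y) = int i *s x - int i *s y" for x y :: "(int, 'r) vec"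
      by (simp add: vec_eq_iff right_diff_distrib)
    ultimately show "int (min K i) *s cv n k i = int i *s nv n i - C *v (int i *s nv k i)"
      by (simp only: cv_def matvec_int_scale)
  qed
  also have "\<dots> = (\<Sum>i=1..K. int i *s nv n i) - (\<Sum>i=1..K. C *v (int i *s nv k i))"
    by (rule sum_subtractf)
  finally show ?thesis by (simp only: matvec_int_sum)
qed

lemma Adm_delta:
  assumes "k \<in> admissible C K l (delta_n m)" "\<And>\<alpha>. m $ \<alpha> \<le> K"
  shows "vi l = vi m - C *v (\<Sum>i=1..K. int i *s nv k i)"
proof -
  have "PP (delta_n m) k K (vi l - vi l) K = vi l" using assms(1) unfolding admissible_Adm Adm_def by blast
  then show ?thesis by (simp only: diff_self PP_slope_0 sum_delta_vec[OF assms(2)])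
qed

text \<open>An admissible m-array gives \<ell> = m - C w with w \<ge> 0, and \<open>kap\<close> . C
  w = \<delta> \<open>tot w\<close> is positive unless w = 0.\<close>

lemma Mult_triangular:
  assumes "Mult C l (delta_n m) \<noteq> 0"
  shows "l = m \<or> kd (vi l) < kd (vi m)"
proof -
  obtain K0 where K0: "\<And>K. K \<ge> K0 \<Longrightarrow> Mult C l (delta_n m) = MultK C K l (delta_n m)"
    using Mult_eq by blast
  define K where "K = max K0 (MAX \<alpha>. m $ \<alpha>)"
  have mK: "m $ \<alpha> \<le> K" for \<alpha> unfolding K_def by (rule max.coboundedI2[OF le_MAX])
  have "MultK C K l (delta_n m) \<noteq> 0" using K0[of K] assms by (simp add: K_def)
  then have "admissible C K l (delta_n m) \<noteq> {}" by (auto simp: MultK_def)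
  then obtain k where k: "k \<in> admissible C K l (delta_n m)" by blast
  define w where "w = (\<Sum>i=1..K. int i *s nv k i)"
  have w: "vi l = vi m - C *v w" unfolding w_def by (rule Adm_delta[OF k mK])
  have w0: "w $ \<alpha> \<ge> 0" for \<alpha> unfolding w_def sum_component by (rule sum_nonneg) simp
  have kd: "kd (C *v w) = dl * tot w" by (simp add: kd_def kap_C tot_def)
  show ?thesis
  proof (cases "w = 0")
    case True
    then have "vi l = vi m" using w by simp
    then show ?thesis by (simp add: vec_eq_iff)
  next
    case False
    then obtain \<alpha> where "w $ \<alpha> \<noteq> 0" by (auto simp: vec_eq_iff)
    then have "0 < w $ \<alpha>" using w0[of \<alpha>] by simp
    also have "w $ \<alpha> \<le> tot w" unfolding tot_def by (rule member_le_sum) (use w0 in auto)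
    finally have "kd (C *v w) > 0" unfolding kd using det_pos by simp
    then show ?thesis by (simp add: w kd_diff)
  qed
qed

lemma Mult_diag: "Mult C m (delta_n m) = 1"
proof -
  obtain K0 where K0: "\<And>K. K \<ge> K0 \<Longrightarrow> Mult C m (delta_n m) = MultK C K m (delta_n m)"
    using Mult_eq by blast
  define K where "K = max K0 (MAX \<alpha>. m $ \<alpha>)"
  have mK: "m $ \<alpha> \<le> K" for \<alpha> unfolding K_def by (rule max.coboundedI2[OF le_MAX])
  have P: "pvec C K (delta_n m) (\<lambda>_ _. 0) \<alpha> i = int (min i (m $ \<alpha>))" for \<alpha> i
    using PP_delta[OF mK, of i \<alpha>] by (simp only: PP_pvec)
  have "admissible C K m (delta_n m) = {\<lambda>_ _. 0}"
  proof
    show "admissible C K m (delta_n m) \<subseteq> {\<lambda>_ _. 0}"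
    proof
      fix k assume k: "k \<in> admissible C K m (delta_n m)"
      define w where "w = (\<Sum>i=1..K. int i *s nv k i)"
      have "vi m = vi m - C *v w" unfolding w_def by (rule Adm_delta[OF k mK])
      then have "C *v w = C *v 0" by simp
      then have w0: "w = 0" by (rule C_inj)
      have "k \<alpha> i = 0" for \<alpha> i
      proof (cases "i \<in> {1..K}")
        case True
        have "(\<Sum>i=1..K. int i * int (k \<alpha> i)) = w $ \<alpha>" by (simp add: w_def sum_component)
        then have "int i * int (k \<alpha> i) = 0" using True sum_nonneg_eq_0_iff[of "{1..K}" "\<lambda>i. int i * int (k \<alpha> i)"] w0 by simp
        then show ?thesis using True by simp
      next
        case False
        then show ?thesis using k unfolding admissible_def by blast
      qed
      then show "k \<in> {\<lambda>_ _. 0}" by blast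
    qed
    show "{\<lambda>_ _. 0} \<subseteq> admissible C K m (delta_n m)"
      using mK by (simp add: admissible_def P min_absorb2)
  qed
  moreover have "Qform C K (delta_n m) (\<lambda>_ _. 0) = 0" by (simp add: Qform_def)
  ultimately have "MultK C K m (delta_n m) = 1"
    by (simp add: MultK_def P qpow_def del: of_nat_min)
  then show ?thesis using K0[of K] by (simp add: K_def)
qed

lemma finite_Mult_support: "finite {p. Mult C p (delta_n m) \<noteq> 0}"
proof -
  define N where "N = nat (kd (vi m))"
  have "{p. Mult C p (delta_n m) \<noteq> 0} \<subseteq> (\<lambda>f. \<chi> i. f i) ` (PiE UNIV (\<lambda>_. {..N}))"
  proof
    fix p assume "p \<in> {p. Mult C p (delta_n m) \<noteq> 0}"
    then have le: "kd (vi p) \<le> kd (vi m)" using Mult_triangular[of p m] by auto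
    have "p $ i \<le> N" for i
    proof -
      have "1 * vi p $ i \<le> kap $ i * vi p $ i" using kap_pos[of i] by (intro mult_right_mono) auto
      also have "\<dots> \<le> kd (vi p)" unfolding kd_def idot_def
        by (rule member_le_sum) (use kap_pos in \<open>auto intro!: mult_nonneg_nonneg simp: less_imp_le\<close>)
      finally show ?thesis using le unfolding N_def by simp
    qed
    then show "p \<in> (\<lambda>f. \<chi> i. f i) ` (PiE UNIV (\<lambda>_. {..N}))"
      by (intro image_eqI[of _ _ "\<lambda>i. p $ i"]) auto
  qed
  then show ?thesis by (rule finite_subset) (intro finite_imageI finite_PiE; simp)
qed

lemma Ph_Qm: "ordprod (qring C) (\<lambda>i. ordprod (qring C) (\<lambda>\<alpha>. qQ C \<alpha> i [^]\<^bsub>qring C\<^esub> delta_n m \<alpha> i) idx)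
    [1..<Suc (MAX \<alpha>. m $ \<alpha>)] = Ph (Qm m)"
proof -
  have "ordprod (qring C) (\<lambda>\<alpha>. qQ C \<alpha> i [^]\<^bsub>qring C\<^esub> delta_n m \<alpha> i) idx = Ph (Xi i (nv (delta_n m) i) 0)" for i
  proof -
    have "ordprod (qring C) (\<lambda>\<alpha>. qQ C \<alpha> i [^]\<^bsub>qring C\<^esub> delta_n m \<alpha> i) idx = Ph (prod_list (map (\<lambda>\<alpha>. QS \<alpha> i ^ delta_n m \<alpha> i) idx))"
      by (rule Ph_ordprod) (simp only: Ph_QS Ph_power[OF Ser_QS] Ser_power[OF Ser_QS])
    also have "prod_list (map (\<lambda>\<alpha>. QS \<alpha> i ^ delta_n m \<alpha> i) idx) = Xi i (\<Sum>\<alpha>\<in>UNIV. int (delta_n m \<alpha> i) *s ax \<alpha>) 0"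
      unfolding QS_def Xi_power' prod_list_Xi sum_list_idx ..
    also have "(\<Sum>\<alpha>\<in>UNIV. int (delta_n m \<alpha> i) *s ax \<alpha>) = nv (delta_n m) i"
      using vec_expand[of "nv (delta_n m) i"] by (simp only: nv_nth)
    finally show ?thesis .
  qed
  then have "ordprod (qring C) (\<lambda>i. ordprod (qring C) (\<lambda>\<alpha>. qQ C \<alpha> i [^]\<^bsub>qring C\<^esub> delta_n m \<alpha> i) idx)
    [1..<Suc (MAX \<alpha>. m $ \<alpha>)] = Ph (prod_list (map (\<lambda>i. Xi i (nv (delta_n m) i) 0) [1..<Suc (MAX \<alpha>. m $ \<alpha>)]))"
    using Ser_led[OF led_Xi] by (intro Ph_ordprod) blast
  moreover have "prod_list (map (\<lambda>i. Xi i (nv n i) 0) [1..<Suc k]) = Ypre n k" for n k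
    by (induction k) simp_all
  ultimately show ?thesis by (simp only: Qm_def)
qed

end

section \<open>The algebra \<open>\<A>\<^sub>+\<close>\<close>

context simply_laced
begin

interpretation R: ring "qring C"
  by (rule qring_ring)

definition AA :: "'r qtser \<Rightarrow> bool" where
  "AA x \<longleftrightarrow> Ser x \<and> Ph x \<in> Aplus C"

lemma Ph_X_inv: "inv\<^bsub>qring C\<^esub> (qQ C \<alpha> 0) = Ph (X (- ax \<alpha>) 0)"
proof -
  have "led (QS \<alpha> 0) 0" using led_X[of "ax \<alpha>" 0] by (simp add: QS_def)
  then have "inv\<^bsub>qring C\<^esub> (qQ C \<alpha> 0) = Ph (uinv (QS \<alpha> 0))" unfolding Ph_QS by (rule Ph_inv_led)
  also have "uinv (QS \<alpha> 0) = X (- ax \<alpha>) 0" unfolding QS_def uinv_Xi by simp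
  finally show ?thesis .
qed

lemma Aplus_generator:
  assumes "h \<in> range (\<lambda>c. qmonom c 0 0) \<union> range (\<lambda>\<alpha>. qQ C \<alpha> 0) \<union> range (\<lambda>\<alpha>. inv\<^bsub>qring C\<^esub> (qQ C \<alpha> 0))
      \<union> {qQ C \<alpha> m | \<alpha> m. m \<ge> 1}"
  shows "\<exists>x. Ser x \<and> TU x \<and> Ph x = h"
proof -
  have "\<exists>x. Ser x \<and> TU x \<and> Ph x = qmonom c 0 0" for c
  proof (intro exI conjI)
    show "Ser (c \<star> X 0 0)" by (rule Ser_scl[OF Ser_X])
    show "TU (c \<star> X 0 0)" by (intro TU_scl TU_X) simp
    show "Ph (c \<star> X 0 0) = qmonom c 0 0" by (rule Ph_qmonom[symmetric])
  qed
  moreover have "\<exists>x. Ser x \<and> TU x \<and> Ph x = qQ C \<alpha> n" for \<alpha> n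
    by (intro exI conjI) (rule Ser_QS, rule TU_QS, rule Ph_QS[symmetric])
  moreover have "\<exists>x. Ser x \<and> TU x \<and> Ph x = inv\<^bsub>qring C\<^esub> (qQ C \<alpha> 0)" for \<alpha>
  proof (intro exI conjI)
    show "TU (X (- ax \<alpha>) 0)" by (rule TU_X) simp
  qed (rule Ser_X, rule Ph_X_inv[symmetric])
  ultimately show ?thesis using assms by (elim UnE rangeE CollectE exE conjE) (simp_all only:)
qed

text \<open>All generators are Laurent polynomials with the divisibilities, the Q_{\<alpha>,n} by
  \<open>TU_QS\<close>, and such elements form a ring. Thus every element of the algebra has finite
  support.\<close>

lemma Aplus_cases:
  assumes "p \<in> Aplus C"
  shows "\<exists>x. Ser x \<and> TU x \<and> Ph x = p"
  using assms unfolding Aplus_def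
proof (induction p rule: generate_ring.induct)
  case one
  show ?case
  proof (intro exI conjI)
    show "TU 1" using TU_X[of 0 0] by simp
  qed (rule Ser_1, rule Ph_1[symmetric])
next
  case (incl h)
  then show ?case by (rule Aplus_generator)
next
  case (a_inv h)
  then obtain x where x: "Ser x" "TU x" "Ph x = h" by (elim exE conjE)
  show ?case
  proof (intro exI conjI)
    show "Ser (- x)" by (rule Ser_minus[OF x(1)])
    show "TU (- x)" using TU_scl[OF x(2), of "- 1"] by simp
    show "Ph (- x) = \<ominus>\<^bsub>qring C\<^esub> h" unfolding x(3)[symmetric] by (rule Ph_minus[OF x(1), symmetric])
  qed
next
  case (eng_add h1 h2)
  obtain x y where x: "Ser x" "TU x" "Ph x = h1" and y: "Ser y" "TU y" "Ph y = h2"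
    using eng_add.IH by (elim exE conjE)
  show ?case
  proof (intro exI conjI)
    show "Ser (x + y)" "TU (x + y)" by (rule Ser_add[OF x(1) y(1)], rule TU_add[OF x(2) y(2)])
    show "Ph (x + y) = h1 \<oplus>\<^bsub>qring C\<^esub> h2" unfolding x(3)[symmetric] y(3)[symmetric] by (rule Ph_add[symmetric])
  qed
next
  case (eng_mult h1 h2)
  obtain x y where x: "Ser x" "TU x" "Ph x = h1" and y: "Ser y" "TU y" "Ph y = h2"
    using eng_mult.IH by (elim exE conjE)
  show ?case
  proof (intro exI conjI)
    show "Ser (x * y)" "TU (x * y)" by (rule Ser_mult[OF x(1) y(1)], rule TU_mult[OF x(2) y(2)])
    show "Ph (x * y) = h1 \<otimes>\<^bsub>qring C\<^esub> h2" unfolding x(3)[symmetric] y(3)[symmetric]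
      by (rule Ph_mult[OF x(1) y(1), symmetric])
  qed
qed

lemma AA_TU: "AA x \<Longrightarrow> TU x"
proof -
  assume x: "AA x"
  then obtain x' where "Ser x'" "TU x'" "Ph x' = Ph x" using Aplus_cases unfolding AA_def by blast
  then show "TU x" using Ph_inject[of x' x] x unfolding AA_def by blast
qed

lemma AA_add: "AA x \<Longrightarrow> AA y \<Longrightarrow> AA (x + y)"
proof -
  assume h: "AA x" "AA y"
  then have "Ph x \<oplus>\<^bsub>qring C\<^esub> Ph y \<in> Aplus C" unfolding AA_def Aplus_def by (intro generate_ring.eng_add) simp_all
  then show "AA (x + y)" using h Ser_add by (simp only: AA_def Ph_add)
qed

lemma AA_mult: "AA x \<Longrightarrow> AA y \<Longrightarrow> AA (x * y)"
proof -
  assume h: "AA x" "AA y"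
  then have "Ph x \<otimes>\<^bsub>qring C\<^esub> Ph y \<in> Aplus C" unfolding AA_def Aplus_def by (intro generate_ring.eng_mult) simp_all
  then show "AA (x * y)" using h Ser_mult Ph_mult[of x y] by (simp add: AA_def)
qed

lemma AA_scalar: "AA (c \<star> 1)"
proof -
  have "qmonom c 0 0 \<in> Aplus C" unfolding Aplus_def by (rule generate_ring.incl) blast
  then show ?thesis using Ser_scl[OF Ser_1] by (simp add: AA_def Ph_qmonom)
qed

lemma AA_scl: "AA x \<Longrightarrow> AA (c \<star> x)"
  using AA_mult[OF AA_scalar, of x c] by simp

lemma AA_diff: "AA x \<Longrightarrow> AA y \<Longrightarrow> AA (x - y)"
  using AA_add[of x "(- 1) \<star> y"] AA_scl[of y "- 1"] by simp

lemma AA_1: "AA 1"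
  using AA_scalar[of 1] by simp

lemma AA_0: "AA 0"
  using AA_scalar[of 0] by simp

lemma AA_QS: "AA (QS \<alpha> n)"
proof -
  have "qQ C \<alpha> n \<in> Aplus C"
    unfolding Aplus_def 
  proof (rule generate_ring.incl)
    show "qQ C \<alpha> n \<in> range (\<lambda>c. qmonom c 0 0) \<union> range (\<lambda>\<alpha>. qQ C \<alpha> 0) \<union> range (\<lambda>\<alpha>. inv\<^bsub>qring C\<^esub> (qQ C \<alpha> 0))
      \<union> {qQ C \<alpha> m | \<alpha> m. m \<ge> 1}"
    proof (cases "n = 0")
      case True
      then show ?thesis by blast
    next
      case False
      then have "n \<ge> 1" by simp
      then show ?thesis by blast
    qed
  qed
  then show ?thesis by (simp add: AA_def Ser_QS Ph_QS)
qed

lemma vec_generated: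
  assumes "P 0" "\<And>a b. P a \<Longrightarrow> P b \<Longrightarrow> P (a + b)" "\<And>\<alpha>. P (ax \<alpha>)" "\<And>\<alpha>. P (- ax \<alpha>)"
  shows "P (a :: (int, 'r) vec)"
proof -
  have s: "P (k *s ax \<alpha>)" for k \<alpha>
  proof (induction k rule: int_induct[where k = 0])
    case base
    then show ?case using assms(1) by simp
  next
    case (step1 i)
    moreover have "(i + 1) *s ax \<alpha> = i *s ax \<alpha> + ax \<alpha>" by (simp add: vec_eq_iff algebra_simps)
    ultimately show ?case using assms(2,3) by simp
  next
    case (step2 i)
    moreover have "(i - 1) *s ax \<alpha> = i *s ax \<alpha> + - ax \<alpha>" by (simp add: vec_eq_iff algebra_simps)
    ultimately show ?case using assms(2)[OF _ assms(4)] by simp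
  qed
  have "P (\<Sum>i\<in>I. a $ i *s ax i)" if "finite I" for I
    using that by (induction I rule: finite_induct) (use assms(1,2) s in auto)
  then have "P (\<Sum>i\<in>UNIV. a $ i *s ax i)" by simp
  then show ?thesis unfolding vec_expand .
qed

lemma AA_Q0: "AA (X a 0)"
proof (rule vec_generated[where P = "\<lambda>a. AA (X a 0)"])
  show "AA (X (a + b) 0)" if "AA (X a 0)" "AA (X b 0)" for a b
    using AA_mult[OF that] by (simp add: X_mult)
  show "AA (X (ax \<alpha>) 0)" for \<alpha> using AA_QS[of \<alpha> 0] by (simp add: QS_def)
  show "AA (X (- ax \<alpha>) 0)" for \<alpha>
  proof -
    have "inv\<^bsub>qring C\<^esub> (qQ C \<alpha> 0) \<in> Aplus C" unfolding Aplus_def by (rule generate_ring.incl) blast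
    then show ?thesis by (simp only: AA_def Ph_X_inv Ser_X)
  qed
qed (simp add: AA_1)

lemma X_split: "X a b = X a 0 * X 0 b"
  by (simp add: X_mult)

lemma AA_X: "(\<And>i. b $ i \<ge> 0) \<Longrightarrow> AA (X a b)"
proof -
  assume b: "\<And>i. b $ i \<ge> 0"
  have "AA (X 0 b)" using b
  proof (induction b rule: nonneg_vec_induct)
    case (step c \<beta>)
    have "X 0 c * X 0 (ax \<beta>) = X 0 (c + ax \<beta>)" by (simp add: X_mult)
    moreover have "AA (X 0 (ax \<beta>))" using AA_QS[of \<beta> "Suc 0"] by (simp add: QS_Suc)
    ultimately show ?case using AA_mult[OF step(2), of "X 0 (ax \<beta>)"] by simp
  qed (simp add: AA_1)
  then show ?thesis unfolding X_split[of a b] by (rule AA_mult[OF AA_Q0])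
qed

lemma Lm_separates:
  assumes "b \<noteq> b0"
  shows "\<exists>a. idot (Lm b) a \<noteq> idot (Lm b0) a"
proof (rule ccontr)
  assume "\<nexists>a. idot (Lm b) a \<noteq> idot (Lm b0) a"
  then have "idot (Lm b) (ax i) = idot (Lm b0) (ax i)" for i by blast
  then have "Lm b $ i = Lm b0 $ i" for i by simp
  then have "Lm b = Lm b0" by (simp add: vec_eq_iff)
  then show False using assms Lm_inj by blast
qed

text \<open>Conjugation by \<open>Q\<^sub>0\<close> separates the \<open>Q\<^sub>1\<close>-degrees.\<close>

lemma AA_component:
  assumes "AA x"
  shows "\<exists>c. c \<noteq> 0 \<and> AA (qmon (sD c * cf x (Lm b0)) (Lm b0))"
proof -
  have claim: "\<exists>y c. c \<noteq> 0 \<and> AA y \<and> cf y (Lm b0) = sD c * cf x (Lm b0) \<and> (\<forall>b\<in>F. cf y (Lm b) = 0)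
      \<and> (\<forall>b. cf x b = 0 \<longrightarrow> cf y b = 0)" if "finite F" "b0 \<notin> F" for F
    using that
  proof (induction F rule: finite_induct)
    case empty
    then show ?case using assms by (intro exI[of _ x] exI[of _ 1]) simp
  next
    case (insert b F)
    have "b0 \<notin> F" using insert.prems by simp
    from insert.IH[OF this] obtain y c where y: "c \<noteq> 0" "AA y" "cf y (Lm b0) = sD c * cf x (Lm b0)"
      "\<forall>b\<in>F. cf y (Lm b) = 0" "\<forall>b. cf x b = 0 \<longrightarrow> cf y b = 0" by (elim exE conjE)
    obtain a where a: "idot (Lm b) a \<noteq> idot (Lm b0) a" using Lm_separates[of b b0] insert.prems by auto
    \<comment> \<open>This kills degree b and multiplies degree b0 by a nonzero difference of powers
      of t. That difference need not be a unit, so the component is obtained only up to a nonzero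
      scalar.\<close>
    define y' where "y' = X a 0 * y * X (- a) 0 - tpow (idot (Lm b) a) \<star> y"
    have cy: "cf y' b' = sD (tpow (idot b' a) - tpow (idot (Lm b) a)) * cf y b'" for b'
    proof -
      have "cf (X a 0 * y * X (- a) 0) b' = q0 a * cf y b' * q0 (- a) * sD (tpow (idot b' a))"
        by (simp add: X_def cf_mult_qmon cf_qmon_mult mult_single mult.assoc)
      also have "\<dots> = sD (tpow (idot b' a)) * cf y b'"
      proof -
        have "q0 a * cf y b' * q0 (- a) * sD (tpow (idot b' a)) = (q0 a * q0 (- a)) * (sD (tpow (idot b' a)) * cf y b')"
          by (simp only: mult_ac)
        then show ?thesis by (simp add: mult_single)
      qed
      finally show ?thesis by (simp add: y'_def single_diff left_diff_distrib)
    qed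
    define c' where "c' = (tpow (idot (Lm b0) a) - tpow (idot (Lm b) a)) * c"
    have "c' \<noteq> 0" unfolding c'_def using y(1) a by simp
    moreover have "AA y'" unfolding y'_def by (intro AA_diff AA_mult AA_scl AA_Q0 y(2))
    moreover have "cf y' (Lm b0) = sD c' * cf x (Lm b0)" unfolding cy y(3) c'_def by (simp add: mult_single flip: mult.assoc)
    moreover have "\<forall>b'\<in>insert b F. cf y' (Lm b') = 0" using y(4) by (auto simp: cy)
    moreover have "\<forall>b. cf x b = 0 \<longrightarrow> cf y' b = 0" using y(5) by (simp add: cy)
    ultimately show ?case by (intro exI[of _ y'] exI[of _ c'] conjI)
  qed
  have "finite ({b. cf x (Lm b) \<noteq> 0} - {b0})" using finite_TT AA_TU[OF assms] by (simp add: TU_def)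
  moreover have "b0 \<notin> {b. cf x (Lm b) \<noteq> 0} - {b0}" by simp
  ultimately have "\<exists>y c. c \<noteq> 0 \<and> AA y \<and> cf y (Lm b0) = sD c * cf x (Lm b0)
      \<and> (\<forall>b\<in>{b. cf x (Lm b) \<noteq> 0} - {b0}. cf y (Lm b) = 0) \<and> (\<forall>b. cf x b = 0 \<longrightarrow> cf y b = 0)"
    by (rule claim)
  then obtain y c where y: "c \<noteq> 0" "AA y" "cf y (Lm b0) = sD c * cf x (Lm b0)"
    "\<forall>b\<in>{b. cf x (Lm b) \<noteq> 0} - {b0}. cf y (Lm b) = 0" "\<forall>b. cf x b = 0 \<longrightarrow> cf y b = 0"
    by (elim exE conjE)
  have "y = qmon (sD c * cf x (Lm b0)) (Lm b0)"
  proof (rule qtser_eqI)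
    fix b
    show "cf y b = cf (qmon (sD c * cf x (Lm b0)) (Lm b0)) b"
    proof (cases "cf x b = 0")
      case True
      then show ?thesis using y(5) by (auto simp: cf_qmon)
    next
      case False
      then obtain b' where b': "b = Lm b'" using TT_lattice AA_TU[OF assms] unfolding TU_def by blast
      then show ?thesis using y(3,4) False by (cases "b' = b0") (auto simp: cf_qmon Lm_inj)
    qed
  qed
  then show ?thesis using y(1,2) by blast
qed

lemma AA_Qm: "AA (Qm m)"
proof -
  have X1: "AA (Xi i (nv n i) 0)" for n i
    by (rule Xi_pos[OF _ _ AA_QS AA_QS AA_1 AA_mult]) simp_all
  have "AA (Ypre n k)" for n k
  proof (induction k)
    case (Suc k)
    then show ?case using AA_mult[OF _ X1] by simp
  qed (simp add: AA_1)
  then show ?thesis by (simp add: Qm_def)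
qed

lemma AA_finite: "AA x \<Longrightarrow> finite {b. cf x (Lm b) \<noteq> 0}"
  using finite_TT AA_TU by (simp add: TU_def)

lemma AA_lattice: "AA x \<Longrightarrow> cf x b' \<noteq> 0 \<Longrightarrow> \<exists>b. b' = Lm b"
  using TT_lattice AA_TU unfolding TU_def by blast

end

section \<open>The representation\<close>

locale simply_laced_rep = simply_laced C + cyclic_rep smul C act bra
  for C :: "((int, 'r::{finite,linorder}) vec, 'r) vec" and smul :: "laurent \<Rightarrow> 'v::ab_group_add \<Rightarrow> 'v"
    and act :: "'v \<Rightarrow> 'r qseries \<Rightarrow> 'v" and bra :: "(nat, 'r) vec \<Rightarrow> 'v" +
  fixes ket :: "(nat, 'r) vec \<Rightarrow> 'v \<Rightarrow> laurent"
  assumes dual: "dual_basis smul bra ket"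
begin

section \<open>The module axioms in the working ring\<close>

abbreviation ap :: "'v \<Rightarrow> 'r qtser \<Rightarrow> 'v" where
  "ap v x \<equiv> act v (Ph x)"

lemma ket_hom: "Modules.module_hom smul (*) (ket l)"
  using dual by (simp add: dual_basis_def)

lemma ket_bra: "ket l (bra m) = (if m = l then 1 else 0)"
proof -
  have "ket l (bra m) = (\<Prod>\<alpha>\<in>UNIV. if m $ \<alpha> = l $ \<alpha> then 1 else 0)"
    using dual by (simp add: dual_basis_def)
  then show ?thesis by (simp add: prod_zero_iff vec_eq_iff)
qed

lemma ket_add: "ket l (v + w) = ket l v + ket l w"
  by (rule module_hom.add[OF ket_hom])

lemma ket_scale: "ket l (smul c v) = c * ket l v"
  by (rule module_hom.scale[OF ket_hom])

lemma ket_0: "ket l 0 = 0"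
  by (rule module_hom.zero[OF ket_hom])

lemma ket_sum: "ket l (sum f A) = (\<Sum>x\<in>A. ket l (f x))"
  by (rule module_hom.sum[OF ket_hom])

lemma ket_zero:
  assumes "\<And>l. ket l v = 0"
  shows "v = 0"
proof -
  have "v \<in> span (range bra)" by (simp add: bra_span)
  then obtain t r where v: "v = (\<Sum>a\<in>t. smul (r a) a)" and t: "finite t" "t \<subseteq> range bra"
    unfolding span_explicit by blast
  have "smul (r a) a = 0" if a: "a \<in> t" for a
  proof -
    obtain q where q: "a = bra q" using a t by blast
    have "ket q v = (\<Sum>b\<in>t. if b = a then r b else 0)"
      unfolding v ket_sum
    proof (rule sum.cong[OF refl])
      fix b assume "b \<in> t"
      then obtain p where p: "b = bra p" using t by blast
      have "b = a \<longleftrightarrow> p = q" unfolding p q using bra_inj by (rule inj_eq)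
      then show "ket q (smul (r b) b) = (if b = a then r b else 0)"
        by (simp add: ket_scale p ket_bra)
    qed
    then have "r a = 0" using a t(1) assms by simp
    then show ?thesis by simp
  qed
  then show ?thesis using v by simp
qed

lemma smul_eq_0: "smul c v = 0 \<longleftrightarrow> c = 0 \<or> v = 0"
proof
  assume h: "smul c v = 0"
  show "c = 0 \<or> v = 0"
  proof (rule disjCI)
    assume "v \<noteq> 0"
    then obtain l where "ket l v \<noteq> 0" using ket_zero by blast
    moreover have "c * ket l v = 0" using h ket_scale ket_0 by metis
    ultimately show "c = 0" by simp
  qed
qed auto

lemma ap_add: "AA x \<Longrightarrow> AA y \<Longrightarrow> ap v (x + y) = ap v x + ap v y"
  using act_add[of "Ph x" "Ph y" v] by (simp add: AA_def Ph_add)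

lemma ap_mult: "AA x \<Longrightarrow> AA y \<Longrightarrow> ap v (x * y) = ap (ap v x) y"
  using act_mult[of "Ph x" "Ph y" v] by (simp add: AA_def Ph_mult)

lemma ap_scalar: "ap v (c \<star> 1) = smul c v"
  using act_scalar[of v c] Ph_qmonom[of c 0 0] by simp

lemma ap_add_left: "AA x \<Longrightarrow> ap (v + w) x = ap v x + ap w x"
  using act_add_left by (simp add: AA_def)

lemma ap_scale_left: "AA x \<Longrightarrow> ap (smul c v) x = smul c (ap v x)"
  using act_scale_left by (simp add: AA_def)

lemma ap_scl: "AA x \<Longrightarrow> ap v (c \<star> x) = smul c (ap v x)"
  using ap_mult[OF AA_scalar, of x v c] by (simp add: ap_scalar ap_scale_left)

lemma ap_1: "ap v 1 = v"
  using ap_scalar[of v 1] by simp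

lemma ap_0: "ap v 0 = 0"
  using ap_scalar[of v 0] by simp

lemma ap_0_left: "AA x \<Longrightarrow> ap 0 x = 0"
  using ap_scale_left[of x 0 0] by simp

lemma ap_diff: "AA x \<Longrightarrow> AA y \<Longrightarrow> ap v (x - y) = ap v x - ap v y"
  using ap_add[of "x - y" y v] AA_diff by (simp add: algebra_simps)

lemma ap_Q0: "ap (bra 0) (X a 0) = smul (tpow (- idot kap a)) (bra 0)"
proof (rule vec_generated[where P = "\<lambda>a. ap (bra 0) (X a 0) = smul (tpow (- idot kap a)) (bra 0)"])
  show "ap (bra 0) (X 0 0) = smul (tpow (- idot kap 0)) (bra 0)" by (simp add: ap_1)
  have mult: "ap (bra 0) (X (a + b) 0) = ap (ap (bra 0) (X a 0)) (X b 0)" for a b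
    using ap_mult[OF AA_Q0 AA_Q0, of "bra 0" a b] by (simp add: X_mult)
  show "ap (bra 0) (X (a + b) 0) = smul (tpow (- idot kap (a + b))) (bra 0)"
    if "ap (bra 0) (X a 0) = smul (tpow (- idot kap a)) (bra 0)" "ap (bra 0) (X b 0) = smul (tpow (- idot kap b)) (bra 0)" for a b
    unfolding mult that(1) ap_scale_left[OF AA_Q0] that(2) by (simp add: idot_add_right flip: tpow_add)
  have k: "(\<Sum>\<beta>\<in>UNIV. lam C $ \<alpha> $ \<beta>) = idot kap (ax \<alpha>)" for \<alpha>
    by (simp add: kap_def Lm_nth)
  show ax: "ap (bra 0) (X (ax \<alpha>) 0) = smul (tpow (- idot kap (ax \<alpha>))) (bra 0)" for \<alpha>
    using bra_Q0[of \<alpha>] unfolding Ph_QS k by (simp add: QS_def)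
  show "ap (bra 0) (X (- ax \<alpha>) 0) = smul (tpow (- idot kap (- ax \<alpha>))) (bra 0)" for \<alpha>
  proof -
    have "bra 0 = smul (tpow (- idot kap (ax \<alpha>))) (ap (bra 0) (X (- ax \<alpha>) 0))"
      using mult[of "ax \<alpha>" "- ax \<alpha>"] unfolding ax ap_scale_left[OF AA_Q0] by (simp add: ap_1)
    then have "smul (tpow (idot kap (ax \<alpha>))) (bra 0)
        = smul (tpow (idot kap (ax \<alpha>))) (smul (tpow (- idot kap (ax \<alpha>))) (ap (bra 0) (X (- ax \<alpha>) 0)))"
      by (rule arg_cong)
    then show ?thesis by (simp flip: tpow_add)
  qed
qed

section \<open>Weight vectors for the Q_{\<alpha>,0}\<close>

definition wv :: "(int, 'r) vec \<Rightarrow> 'v" where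
  "wv b = ap (bra 0) (X 0 b)"

lemma ap_X: "(\<And>i. b $ i \<ge> 0) \<Longrightarrow> ap (bra 0) (X a b) = smul (tpow (- idot kap a)) (wv b)"
proof -
  assume b: "\<And>i. b $ i \<ge> 0"
  have "ap (bra 0) (X a b) = ap (ap (bra 0) (X a 0)) (X 0 b)"
    unfolding X_split[of a b] by (rule ap_mult[OF AA_Q0 AA_X[OF b]])
  then show ?thesis unfolding ap_Q0 ap_scale_left[OF AA_X[OF b]] wv_def .
qed

lemma wv_weight:
  assumes b: "\<And>i. b $ i \<ge> 0"
  shows "ap (wv b) (X a 0) = smul (tpow (- idot (Lm b) a - idot kap a)) (wv b)"
proof -
  have "ap (wv b) (X a 0) = ap (bra 0) (X 0 b * X a 0)"
    unfolding wv_def by (rule ap_mult[OF AA_X[OF b] AA_Q0, symmetric])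
  also have "X 0 b * X a 0 = tpow (- idot (Lm b) a) \<star> X a b" by (simp add: X_mult)
  also have "ap (bra 0) \<dots> = smul (tpow (- idot (Lm b) a)) (smul (tpow (- idot kap a)) (wv b))"
    unfolding ap_scl[OF AA_X[OF b]] ap_X[OF b] ..
  finally show ?thesis by (simp flip: tpow_add)
qed

lemma ap_qmon:
  assumes b: "\<And>i. b $ i \<ge> 0"
  shows "AA (qmon d (Lm b)) \<and> ap (bra 0) (qmon d (Lm b)) = smul (ev kap d) (wv b)"
proof (induction d rule: lpoly_induct)
  case zero
  then show ?case by (simp add: AA_0 ap_0)
next
  case (single a c)
  have "qmon (Poly_Mapping.single a c) (Lm b) = c \<star> X a b"
    by (simp add: X_def mult_single)
  then show ?case using AA_scl[OF AA_X[OF b]] ap_scl[OF AA_X[OF b]] ap_X[OF b] by (simp add: mult.commute)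
next
  case (add x y)
  then show ?case by (simp add: qmon_add AA_add ap_add scale_left_distrib)
qed

text \<open>The lowering element maps the vector at b + e_\<gamma> to a multiple of the one at b,
  and not conversely: nonvanishing is thus pulled back along the induction. Commuting it past Q_1^(b
  + e_\<gamma>) moves \<open>kap\<close> to a point where its coefficient is nonzero by
  \<open>lowering_ev\<close>, since b_\<gamma> + 1 \<noteq> 0.\<close>

lemma wv_nonzero:
  assumes "\<And>i. b $ i \<ge> 0"
  shows "wv b \<noteq> 0"
  using assms
proof (induction b rule: nonneg_vec_induct)
  case zero
  have "ket 0 (bra 0) = 1" by (simp add: ket_bra)
  then have "bra 0 \<noteq> 0" using ket_0[of 0] by auto
  then show ?case by (simp add: wv_def ap_1)
next
  case (step b \<gamma>)
  define b' where "b' = b + ax \<gamma>"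
  have nn: "b' $ i \<ge> 0" for i using step(1)[of i] by (simp add: b'_def axis_def)
  have "b' $ \<gamma> \<noteq> 0" using step(1)[of \<gamma>] by (simp add: b'_def)
  then obtain \<alpha> n where e: "ev (Lm (1 + b')) (cf (QS \<alpha> n) (Lm (- ax \<gamma>))) \<noteq> 0"
    using lowering_ev by blast
  define d where "d = cf (QS \<alpha> n) (Lm (- ax \<gamma>))"
  obtain c where c: "c \<noteq> 0" "AA (qmon (sD c * d) (Lm (- ax \<gamma>)))"
    using AA_component[OF AA_QS, of \<alpha> n "- ax \<gamma>"] unfolding d_def by blast
  have "X 0 b' * qmon (sD c * d) (Lm (- ax \<gamma>)) = qmon (tw (Lm b') (sD c * d)) (Lm b)"
    unfolding X_def qmon_mult by (simp add: b'_def Lm_add Lm_minus)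
  then have "ap (wv b') (qmon (sD c * d) (Lm (- ax \<gamma>))) = ap (bra 0) (qmon (tw (Lm b') (sD c * d)) (Lm b))"
    unfolding wv_def using ap_mult[OF AA_X[OF nn] c(2), of "bra 0" 0] by simp
  also have "\<dots> = smul (ev kap (tw (Lm b') (sD c * d))) (wv b)"
    using ap_qmon[OF step(1)] by blast
  also have "ev kap (tw (Lm b') (sD c * d)) = c * ev (Lm (1 + b')) d"
    by (simp add: ev_tw Lm_add kap_def)
  finally have "ap (wv b') (qmon (sD c * d) (Lm (- ax \<gamma>))) \<noteq> 0"
    using c(1) e step(2) by (simp add: smul_eq_0 d_def)
  then show ?case unfolding b'_def[symmetric] using ap_0_left[OF c(2)] by auto
qed

text \<open>The usual argument for vectors of different weights: apply some Q_0^a and subtract a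
  multiple of the relation to eliminate one vector. The differences of weights are nonzero and
  cancel because the scalars form a domain.\<close>

lemma wv_independent:
  assumes "finite B" "\<And>b i. b \<in> B \<Longrightarrow> b $ i \<ge> 0" "(\<Sum>b\<in>B. smul (d b) (wv b)) = 0" "b \<in> B"
  shows "d b = 0"
  using assms
proof (induction B arbitrary: d b rule: finite_induct)
  case (insert b0 B)
  have nn: "b' $ i \<ge> 0" if "b' \<in> insert b0 B" for b' i using insert.prems(1) that by blast
  define w where "w b' a = tpow (- idot (Lm b') a - idot kap a)" for b' a
  have ap_sum: "ap (\<Sum>b'\<in>S. smul (d b') (wv b')) (X a 0) = (\<Sum>b'\<in>S. smul (w b' a * d b') (wv b'))"
    if "finite S" "S \<subseteq> insert b0 B" for S a
    using that
  proof (induction S rule: finite_induct)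
    case empty
    then show ?case by (simp add: ap_0_left AA_Q0)
  next
    case (insert x S)
    have "x \<in> insert b0 B" using insert.prems by blast
    then have "ap (wv x) (X a 0) = smul (w x a) (wv x)" unfolding w_def by (rule wv_weight[OF nn])
    then have "ap (smul (d x) (wv x)) (X a 0) = smul (w x a * d x) (wv x)"
      by (simp only: ap_scale_left[OF AA_Q0] scale_scale mult.commute)
    moreover have "ap (\<Sum>b'\<in>S. smul (d b') (wv b')) (X a 0) = (\<Sum>b'\<in>S. smul (w b' a * d b') (wv b'))"
      using insert.IH insert.prems by blast
    ultimately show ?case unfolding sum.insert[OF insert.hyps] ap_add_left[OF AA_Q0] by (simp only:)
  qed
  have z: "(\<Sum>b'\<in>B. smul ((w b' a - w b0 a) * d b') (wv b')) = 0" for a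
  proof -
    have "(\<Sum>b'\<in>insert b0 B. smul (w b' a * d b') (wv b')) = 0"
    proof -
      have "finite (insert b0 B)" using insert.hyps(1) by blast
      from ap_sum[OF this order_refl, of a] show ?thesis
        unfolding insert.prems(2) ap_0_left[OF AA_Q0] by (rule sym)
    qed
    moreover have "smul (w b0 a) (\<Sum>b'\<in>insert b0 B. smul (d b') (wv b')) = 0"
      unfolding insert.prems(2) by (rule scale_zero_right)
    ultimately have "(\<Sum>b'\<in>insert b0 B. smul (w b' a * d b') (wv b') - smul (w b0 a * d b') (wv b')) = 0"
      unfolding sum_subtractf scale_sum_right scale_scale by (simp only: diff_self)
    moreover have "smul (w b' a * d b') (wv b') - smul (w b0 a * d b') (wv b') = smul ((w b' a - w b0 a) * d b') (wv b')" for b'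
      by (simp only: left_diff_distrib scale_left_diff_distrib)
    ultimately show ?thesis
      by (simp only: sum.insert[OF insert.hyps] diff_self mult_zero_left scale_zero_left add_0_left)
  qed
  have dB: "d b' = 0" if b': "b' \<in> B" for b'
  proof -
    have "b' \<noteq> b0" using b' insert.hyps by blast
    then obtain a where a: "idot (Lm b') a \<noteq> idot (Lm b0) a" using Lm_separates by blast
    have "(w b' a - w b0 a) * d b' = 0"
      by (rule insert.IH[OF _ z b']) (use nn in blast)
    moreover have "w b' a \<noteq> w b0 a" unfolding w_def tpow_eq_iff using a by simp
    ultimately show ?thesis by simp
  qed
  then have "(\<Sum>b'\<in>B. smul (d b') (wv b')) = 0" by (intro sum.neutral) simp
  then have "smul (d b0) (wv b0) = 0" using insert.prems(2) unfolding sum.insert[OF insert.hyps] by simp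
  moreover have "wv b0 \<noteq> 0" by (rule wv_nonzero) (rule nn, blast)
  ultimately have "d b0 = 0" using smul_eq_0 by blast
  then show ?case using dB insert.prems(3) by (elim insertE) simp_all
qed blast

lemma ap_kernel:
  assumes y: "AA y" and f: "ap (bra 0) y = 0"
  shows "ev kap (cf y b) = 0"
proof (cases "cf y b = 0")
  case False
  define S where "S = {b. cf y (Lm b) \<noteq> 0}"
  have fS: "finite S" unfolding S_def by (rule AA_finite[OF y])
  \<comment> \<open>Large enough that y Q_1^s has only nonnegative Q_1-exponents: each coordinate
    dominates all absolute values in the support of y.\<close>
  define s where "s = (\<chi> i. \<Sum>b\<in>S. \<bar>b $ i\<bar>)"
  have s0: "s $ i \<ge> 0" for i by (simp add: s_def sum_nonneg)
  have sb: "(b + s) $ i \<ge> 0" if "b \<in> S" for b i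
  proof -
    have "\<bar>b $ i\<bar> \<le> s $ i" unfolding s_def vec_lambda_beta by (rule member_le_sum) (use that fS in auto)
    then show ?thesis by simp
  qed
  define T where "T = (\<lambda>b. b + s) ` S"
  define z where "z = y * X 0 s"
  have cz: "cf z b' = cf y (b' - Lm s)" for b' by (simp add: z_def X_def cf_mult_qmon)
  have zsum: "z = (\<Sum>b\<in>T. qmon (cf z (Lm b)) (Lm b))"
  proof (rule qtser_eqI)
    fix b'
    show "cf z b' = cf (\<Sum>b\<in>T. qmon (cf z (Lm b)) (Lm b)) b'"
    proof (cases "\<exists>b\<in>T. b' = Lm b")
      case True
      then obtain b where b: "b \<in> T" "b' = Lm b" by blast
      have "cf (\<Sum>b\<in>T. qmon (cf z (Lm b)) (Lm b)) b' = (\<Sum>c\<in>T. if c = b then cf z (Lm b) else 0)"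
        unfolding cf_sum cf_qmon b(2) Lm_inj by (rule sum.cong) auto
      then show ?thesis using b fS by (simp add: T_def)
    next
      case False
      then have "cf (\<Sum>b\<in>T. qmon (cf z (Lm b)) (Lm b)) b' = 0"
        unfolding cf_sum cf_qmon by (intro sum.neutral) auto
      moreover have "cf z b' = 0"
      proof (rule ccontr)
        assume nz: "cf z b' \<noteq> 0"
        then obtain c where c: "b' - Lm s = Lm c" using AA_lattice[OF y] unfolding cz by blast
        then have "c + s \<in> T" using nz unfolding cz T_def S_def by auto
        moreover have "b' = Lm (c + s)" using c by (simp add: Lm_add algebra_simps)
        ultimately show False using False by blast
      qed
      ultimately show ?thesis by simp
    qed
  qed
  have Tn: "b $ i \<ge> 0" if "b \<in> T" for b i using that sb unfolding T_def by blast
  have sums: "AA (\<Sum>b\<in>F. qmon (cf z (Lm b)) (Lm b)) \<and> ap (bra 0) (\<Sum>b\<in>F. qmon (cf z (Lm b)) (Lm b)) = (\<Sum>b\<in>F. smul (ev kap (cf z (Lm b))) (wv b))"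
    if "finite F" "F \<subseteq> T" for F
    using that
  proof (induction F rule: finite_induct)
    case (insert b F)
    have q: "AA (qmon (cf z (Lm b)) (Lm b))" "ap (bra 0) (qmon (cf z (Lm b)) (Lm b)) = smul (ev kap (cf z (Lm b))) (wv b)"
    proof -
      have "b \<in> T" using insert.prems by blast
      from ap_qmon[OF Tn[OF this], of "cf z (Lm b)"]
      show "AA (qmon (cf z (Lm b)) (Lm b))" "ap (bra 0) (qmon (cf z (Lm b)) (Lm b)) = smul (ev kap (cf z (Lm b))) (wv b)"
        by (rule conjunct1, rule conjunct2)
    qed
    have IH: "AA (\<Sum>b\<in>F. qmon (cf z (Lm b)) (Lm b))"
      "ap (bra 0) (\<Sum>b\<in>F. qmon (cf z (Lm b)) (Lm b)) = (\<Sum>b\<in>F. smul (ev kap (cf z (Lm b))) (wv b))"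
      using insert.IH insert.prems by blast+
    show ?case unfolding sum.insert[OF insert.hyps] ap_add[OF q(1) IH(1)] q(2) IH(2) using AA_add[OF q(1) IH(1)] by blast
  qed (simp add: AA_0 ap_0)
  have fT: "finite T" unfolding T_def using fS by simp
  have "ap (bra 0) z = (\<Sum>b\<in>T. smul (ev kap (cf z (Lm b))) (wv b))"
    using sums[OF fT order_refl] unfolding zsum[symmetric] by (rule conjunct2)
  moreover have "ap (bra 0) z = 0" unfolding z_def ap_mult[OF y AA_X[OF s0]] f by (rule ap_0_left[OF AA_X[OF s0]])
  ultimately have sum0: "(\<Sum>b\<in>T. smul (ev kap (cf z (Lm b))) (wv b)) = 0" by simp
  obtain c where c: "b = Lm c" using AA_lattice[OF y False] by blast
  then have cT: "c + s \<in> T" using False by (auto simp: T_def S_def)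
  have "ev kap (cf z (Lm (c + s))) = 0"
    by (rule wv_independent[OF fT Tn sum0 cT])
  then show ?thesis by (simp add: cz Lm_add c)
qed simp

section \<open>Comparison of the functionals with the dual basis\<close>

lemma mu_kernel:
  assumes y: "AA y" and f: "ap (bra 0) y = 0"
  shows "mu C l (Ph y) = 0"
proof -
  \<comment> \<open>In the product formula the coefficients of y stand on the left, untwisted, so
    every summand carries a factor evaluated at \<open>kap\<close>; hence arbitrary series w are
    allowed, in particular \<open>pz l\<close>.\<close>
  have "Lam0 (y * w) = 0" for w
    unfolding Lam0_def cf_mult_raw ev_sum ev_mult by (simp add: ap_kernel[OF y f])
  moreover obtain c where "mu C l (Ph y) = tpow c * Lam0 (y * pz l)"
    using mu_Lam0 y unfolding AA_def by blast
  ultimately show ?thesis by simp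
qed

lemma mu_add: "Ser x \<Longrightarrow> Ser y \<Longrightarrow> mu C l (Ph (x + y)) = mu C l (Ph x) + mu C l (Ph y)"
proof -
  assume h: "Ser x" "Ser y"
  obtain c where "\<And>p. Ser p \<Longrightarrow> mu C l (Ph p) = tpow c * Lam0 (p * pz l)"
    using mu_Lam0 by blast
  then show ?thesis using h Ser_add by (simp add: distrib_right Lam0_add distrib_left)
qed

lemma mu_scl: "Ser x \<Longrightarrow> mu C l (Ph (k \<star> x)) = k * mu C l (Ph x)"
proof -
  assume h: "Ser x"
  obtain c where "\<And>p. Ser p \<Longrightarrow> mu C l (Ph p) = tpow c * Lam0 (p * pz l)"
    using mu_Lam0 by blast
  then show ?thesis using h Ser_scl by (simp add: Lam0_scl mult.left_commute)
qed

lemma ap_Qm: "ap (bra 0) (Qm m) = (\<Sum>p | Mult C p (delta_n m) \<noteq> 0. smul (tpow (rep_exponent C m p) * Mult C p (delta_n m)) (bra p))"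
  unfolding Ph_Qm[symmetric] bra_Q
  by (rule Sum_any.expand_superset) (use finite_Mult_support in auto)

lemma ket_Qm: "ket l (ap (bra 0) (Qm m)) = mu C l (Ph (Qm m))"
proof -
  have "ket l (ap (bra 0) (Qm m)) = (\<Sum>p | Mult C p (delta_n m) \<noteq> 0. if p = l then tpow (rep_exponent C m l) * Mult C l (delta_n m) else 0)"
    unfolding ap_Qm ket_sum by (rule sum.cong) (auto simp: ket_scale ket_bra)
  then show ?thesis unfolding mu_Q by (simp add: finite_Mult_support)
qed

text \<open>Inversion of the unitriangular system: all other basis vectors in the defining equation
  for m have smaller \<open>kap\<close>-degree, and the coefficient of \<open>bra m\<close> is a
  power of t.\<close>

lemma bra_in_span: "bra m \<in> span (range (\<lambda>m. ap (bra 0) (Qm m)))"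
proof (induction "nat (kd (vi m))" arbitrary: m rule: less_induct)
  case less
  define S where "S = {p. Mult C p (delta_n m) \<noteq> 0}"
  define k where "k p = tpow (rep_exponent C m p) * Mult C p (delta_n m)" for p
  have mS: "m \<in> S" by (simp add: S_def Mult_diag)
  have "finite S" unfolding S_def by (rule finite_Mult_support)
  then have "ap (bra 0) (Qm m) = smul (k m) (bra m) + (\<Sum>p\<in>S - {m}. smul (k p) (bra p))"
    unfolding ap_Qm S_def[symmetric] k_def using sum.remove[OF _ mS] by blast
  then have e: "smul (k m) (bra m) = ap (bra 0) (Qm m) - (\<Sum>p\<in>S - {m}. smul (k p) (bra p))" by simp
  have kd0: "kd (vi p) \<ge> 0" for p
    unfolding kd_def idot_def using kap_pos by (intro sum_nonneg mult_nonneg_nonneg) (auto simp: less_imp_le)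
  have "bra p \<in> span (range (\<lambda>m. ap (bra 0) (Qm m)))" if "p \<in> S - {m}" for p
  proof (rule less)
    have "kd (vi p) < kd (vi m)" using that Mult_triangular[of p m] by (auto simp: S_def)
    then show "nat (kd (vi p)) < nat (kd (vi m))" using kd0[of p] by linarith
  qed
  then have "(\<Sum>p\<in>S - {m}. smul (k p) (bra p)) \<in> span (range (\<lambda>m. ap (bra 0) (Qm m)))"
    by (intro span_sum span_scale)
  then have "smul (k m) (bra m) \<in> span (range (\<lambda>m. ap (bra 0) (Qm m)))"
    unfolding e by (intro span_diff[OF span_base[OF rangeI]])
  then have "smul (tpow (- rep_exponent C m m)) (smul (k m) (bra m)) \<in> span (range (\<lambda>m. ap (bra 0) (Qm m)))"
    by (rule span_scale)
  then show ?case by (simp add: k_def Mult_diag flip: tpow_add)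
qed

lemma span_Qm: "span (range (\<lambda>m. ap (bra 0) (Qm m))) = UNIV"
proof -
  have "span (range bra) \<subseteq> span (range (\<lambda>m. ap (bra 0) (Qm m)))"
    by (rule span_minimal) (use bra_in_span in auto)
  then show ?thesis using bra_span by auto
qed

text \<open>One preimage with the right value suffices: by \<open>mu_kernel\<close>,
  \<open>mu\<close> depends on an element of the algebra only through its action on
  \<open>bra 0\<close>.\<close>

lemma mu_representative: "\<exists>y. AA y \<and> ap (bra 0) y = v \<and> (\<forall>l. mu C l (Ph y) = ket l v)"
proof -
  have "v \<in> span (range (\<lambda>m. ap (bra 0) (Qm m)))" by (simp add: span_Qm)
  then show ?thesis
  proof (induction rule: span_induct_alt)
    case base
    have "mu C l (Ph 0) = 0" for l by (rule mu_kernel[OF AA_0 ap_0])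
    then show ?case using AA_0 ap_0 ket_0 by (intro exI[of _ 0]) simp
  next
    case (step c x y)
    obtain m where x: "x = ap (bra 0) (Qm m)" using step(1) by blast
    obtain u where u: "AA u" "ap (bra 0) u = y" "\<And>l. mu C l (Ph u) = ket l y" using step(2) by blast
    have Q: "AA (c \<star> Qm m)" by (rule AA_scl[OF AA_Qm])
    show ?case
    proof (intro exI conjI allI)
      show "AA (c \<star> Qm m + u)" by (rule AA_add[OF Q u(1)])
      show "ap (bra 0) (c \<star> Qm m + u) = smul c x + y"
        unfolding ap_add[OF Q u(1)] ap_scl[OF AA_Qm] u(2) x ..
      show "mu C l (Ph (c \<star> Qm m + u)) = ket l (smul c x + y)" for l
        using mu_add[of "c \<star> Qm m" u l] mu_scl[of "Qm m" l c] Q u(1) AA_Qm[of m]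
        by (simp add: AA_def ket_add ket_scale x ket_Qm u(3))
    qed
  qed
qed

theorem mu_eq_ket:
  assumes "p \<in> Aplus C"
  shows "mu C l p = ket l (act (bra 0) p)"
proof -
  obtain x where x: "Ser x" "Ph x = p" using Aplus_cases[OF assms] by blast
  then have A: "AA x" using assms by (simp add: AA_def)
  obtain y where y: "AA y" "ap (bra 0) y = ap (bra 0) x" "mu C l (Ph y) = ket l (ap (bra 0) x)"
    using mu_representative by blast
  have "mu C l (Ph (x - y)) = 0"
    by (rule mu_kernel) (simp_all add: AA_diff A y ap_diff)
  moreover have "mu C l (Ph ((x - y) + y)) = mu C l (Ph (x - y)) + mu C l (Ph y)"
    by (rule mu_add) (use AA_diff[OF A y(1)] y(1) in \<open>simp_all add: AA_def\<close>)
  ultimately show ?thesis using y(3) x(2) by simp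
qed

end

theorem theorem5p25:
  fixes C :: "int^'r::{finite,linorder}^'r::{finite,linorder}"
    and smul :: "laurent \<Rightarrow> 'v::ab_group_add \<Rightarrow> 'v"
    and act :: "'v \<Rightarrow> 'r qseries \<Rightarrow> 'v"
    and bra :: "nat^'r::{finite,linorder} \<Rightarrow> 'v"
    and ket :: "nat^'r::{finite,linorder} \<Rightarrow> 'v \<Rightarrow> laurent"
    and p :: "'r qseries"
    and l :: "nat^'r::{finite,linorder}"
  assumes "simply_laced_cartan C"
    and "cyclic_rep smul C act bra"
    and "dual_basis smul bra ket"
    and "p \<in> Aplus C"
  shows "mu C l p = ket l (act (bra 0) p)"
proof -
  have "simply_laced_rep C smul act bra ket"
    using assms(1-3) by (intro simply_laced_rep.intro simply_laced.intro simply_laced_rep_axioms.intro)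
  then show ?thesis using assms(4) by (rule simply_laced_rep.mu_eq_ket)
qed

end
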